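(* Let $R$ be a ring, $M$ an $R$-module, $L\subseteq M$ an $R$-submodule, and $\mathrm{cl}$ a glueable preclosure operation on submodules over $\operatorname{Spec}R$. The following are equivalent: (a) For every $f\in R$, $(L_f)^{\mathrm{cl}}_{M_f}=(L^{\mathrm{cl}}_M)_f$. (b) The sheaf $\tilde L^{\mathrm{cl}}_{\tilde M}$ over $\operatorname{Spec}R$ is quasi-coherent.
   Context: All rings are commutative with $1$; $\tilde M$ is the quasi-coherent sheaf on $\operatorname{Spec}R$ associated to an $R$-module $M$. A preclosure operation on a poset is an extensive ($s\le s^{\mathrm{cl}}$) and order-preserving self-map. A preclosure operation $\mathrm{cl}$ on (sub)modules over a scheme $X$ gives, for every affine open $U\subseteq X$ and every module $N$ over $S=\mathcal{O}_X(U)$, a preclosure operation $K\mapsto K^{\mathrm{cl}}_N$ on the $S$-submodules of $N$. Canonically isomorphic modules are identified, so the operation is understood to be compatible with module isomorphisms. Openly persistent over $X$: for all affine opens $V\subseteq U\subseteq X$, with $A=\mathcal{O}_X(U)$, $B=\mathcal{O}_X(V)$, all $A$-modules $K\subseteq N$ and all $x\in K^{\mathrm{cl}}_N$, we have $x\otimes1\in(KB)^{\mathrm{cl}}_{N\otimes_AB}$, where $KB$ is the image of $K\otimes_AB\to N\otimes_AB$. Glueable over $X$: $\mathrm{cl}$ is openly persistent over $X$ and for every affine open $\operatorname{Spec}A\subseteq X$: whenever $I$ is an ideal of $A$ with generating set $(f_\alpha)_{\alpha\in\Lambda}$, $g\in\sqrt I$, $K\subseteq N$ are $A$-modules, and $z\in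 N$ satisfies $z/1\in(K_{f_\alpha})^{\mathrm{cl}}_{N_{f_\alpha}}$ for all $\alpha\in\Lambda$, it follows that $z/1\in(K_g)^{\mathrm{cl}}_{N_g}$. For a quasi-coherent $\mathcal{O}_X$-module $\mathcal{M}$ and a sheaf of submodules $\mathcal{L}\subseteq\mathcal{M}$, $\mathcal{L}^{\mathrm{cl}}_{\mathcal{M}}$ is the sheaf of submodules of $\mathcal{M}$ whose sections over an open $U\subseteq X$ are those $s\in\mathcal{M}(U)$ such that every $x\in U$ has an affine open neighborhood $V\subseteq U$ with $s|_V\in\mathcal{L}(V)^{\mathrm{cl}}_{\mathcal{M}(V)}$. *)

theory Defs
  imports "HOL-Analysis.Abstract_Topology" "HOL-Algebra.Module" "HOL-Algebra.QuotRing"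
    "HOL-Algebra.Free_Abelian_Groups"
begin

section \<open>Localization of modules\<close>

definition regular_module :: "('r, 'c) ring_scheme \<Rightarrow> ('r, 'r) module" where
  "regular_module R = \<lparr>carrier = carrier R, monoid.mult = (\<otimes>\<^bsub>R\<^esub>), one = \<one>\<^bsub>R\<^esub>,
     ring.zero = \<zero>\<^bsub>R\<^esub>, add = (\<oplus>\<^bsub>R\<^esub>), smult = (\<otimes>\<^bsub>R\<^esub>)\<rparr>"

text \<open>The fraction m/s, as an equivalence class of pairs.\<close>

definition frac :: "('r, 'c) ring_scheme \<Rightarrow> 'r set \<Rightarrow> ('r, 'm, 'd) module_scheme \<Rightarrow> 'm \<Rightarrow> 'r \<Rightarrow> ('m \<times> 'r) set"
  where "frac R S M m s =
    {(m', s'). m' \<in> carrier M \<and> s' \<in> S \<and>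
       (\<exists>t\<in>S. t \<odot>\<^bsub>M\<^esub> (s' \<odot>\<^bsub>M\<^esub> m) = t \<odot>\<^bsub>M\<^esub> (s \<odot>\<^bsub>M\<^esub> m'))}"

text \<open>The unions below run over all representatives; they pick out the common value.
  The locale \<^locale>\<open>module\<close> ignores the multiplicative fields of a module record.  They are
  carried along here (and in \<open>tilde\<close> below) because, for \<open>M = regular_module R\<close>, the result
  is then the localized ring itself: the ring of fractions of \<open>R\<close> with denominators in \<open>S\<close>
  is \<open>localization R S (regular_module R)\<close>.\<close>

definition localization ::
    "('r, 'c) ring_scheme \<Rightarrow> 'r set \<Rightarrow> ('r, 'm, 'd) module_scheme
      \<Rightarrow> (('r \<times> 'r) set, ('m \<times> 'r) set) module"
  where "localization R S M =
    \<lparr>carrier = {frac R S M m s | m s. m \<in> carrier M \<and> s \<in> S},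
     monoid.mult = (\<lambda>x y. \<Union>(m, s)\<in>x. \<Union>(n, t)\<in>y. frac R S M (m \<otimes>\<^bsub>M\<^esub> n) (s \<otimes>\<^bsub>R\<^esub> t)),
     one = frac R S M \<one>\<^bsub>M\<^esub> \<one>\<^bsub>R\<^esub>,
     ring.zero = frac R S M \<zero>\<^bsub>M\<^esub> \<one>\<^bsub>R\<^esub>,
     add = (\<lambda>x y. \<Union>(m, s)\<in>x. \<Union>(n, t)\<in>y.
              frac R S M (t \<odot>\<^bsub>M\<^esub> m \<oplus>\<^bsub>M\<^esub> s \<odot>\<^bsub>M\<^esub> n) (s \<otimes>\<^bsub>R\<^esub> t)),
     smult = (\<lambda>x y. \<Union>(a, s)\<in>x. \<Union>(n, t)\<in>y. frac R S M (a \<odot>\<^bsub>M\<^esub> n) (s \<otimes>\<^bsub>R\<^esub> t))\<rparr>"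

text \<open>The localization of a submodule, as a submodule of the localized module.\<close>

definition localized_submodule ::
    "('r, 'c) ring_scheme \<Rightarrow> 'r set \<Rightarrow> ('r, 'm, 'd) module_scheme \<Rightarrow> 'm set \<Rightarrow> ('m \<times> 'r) set set"
  where "localized_submodule R S M K = {frac R S M m s | m s. m \<in> K \<and> s \<in> S}"

definition powers :: "('r, 'c) ring_scheme \<Rightarrow> 'r \<Rightarrow> 'r set" where
  "powers R f = {f [^]\<^bsub>R\<^esub> (n::nat) | n. True}"

text \<open>The extension to the localization of \<open>A\<close> at \<open>f\<close> of a ring homomorphism \<open>\<rho>\<close> from \<open>A\<close> to \<open>B\<close>
  for which \<open>\<rho> f\<close> is a unit.\<close>

definition localization_lift ::
    "('a, 'c) ring_scheme \<Rightarrow> 'a \<Rightarrow> ('b, 'd) ring_scheme \<Rightarrow> ('a \<Rightarrow> 'b) \<Rightarrow> ('a \<times> 'a) set \<Rightarrow> 'b"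
  where "localization_lift A f B \<rho> q =
    (THE y. y \<in> carrier B \<and>
       (\<exists>a\<in>carrier A. \<exists>n::nat. q = frac A (powers A f) (regular_module A) a (f [^]\<^bsub>A\<^esub> n) \<and>
          y \<otimes>\<^bsub>B\<^esub> (\<rho> f [^]\<^bsub>B\<^esub> n) = \<rho> a))"


section \<open>Extension of scalars\<close>

definition tensor_relations ::
    "('a, 'c) ring_scheme \<Rightarrow> ('a \<Rightarrow> 'b) \<Rightarrow> ('b, 'd) ring_scheme \<Rightarrow> ('a, 'n, 'e) module_scheme
      \<Rightarrow> ('n \<times> 'b \<Rightarrow>\<^sub>0 int) set"
  where "tensor_relations A \<rho> B N = generate (free_Abelian_group (carrier N \<times> carrier B))
    ({frag_of (m \<oplus>\<^bsub>N\<^esub> n, b) - frag_of (m, b) - frag_of (n, b) | m n b.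
        m \<in> carrier N \<and> n \<in> carrier N \<and> b \<in> carrier B} \<union>
     {frag_of (n, b \<oplus>\<^bsub>B\<^esub> c) - frag_of (n, b) - frag_of (n, c) | n b c.
        n \<in> carrier N \<and> b \<in> carrier B \<and> c \<in> carrier B} \<union>
     {frag_of (a \<odot>\<^bsub>N\<^esub> n, b) - frag_of (n, \<rho> a \<otimes>\<^bsub>B\<^esub> b) | a n b.
        a \<in> carrier A \<and> n \<in> carrier N \<and> b \<in> carrier B})"

definition tensor_class ::
    "('a, 'c) ring_scheme \<Rightarrow> ('a \<Rightarrow> 'b) \<Rightarrow> ('b, 'd) ring_scheme \<Rightarrow> ('a, 'n, 'e) module_scheme
      \<Rightarrow> ('n \<times> 'b \<Rightarrow>\<^sub>0 int) \<Rightarrow> ('n \<times> 'b \<Rightarrow>\<^sub>0 int) set"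
  where "tensor_class A \<rho> B N x =
    tensor_relations A \<rho> B N #>\<^bsub>free_Abelian_group (carrier N \<times> carrier B)\<^esub> x"

text \<open>The tensor product of \<open>N\<close> and \<open>B\<close> over \<open>A\<close>, where \<open>B\<close> is an \<open>A\<close>-algebra via \<open>\<rho>\<close>,
  as a \<open>B\<close>-module.\<close>

definition base_change ::
    "('a, 'c) ring_scheme \<Rightarrow> ('a \<Rightarrow> 'b) \<Rightarrow> ('b, 'd) ring_scheme \<Rightarrow> ('a, 'n, 'e) module_scheme
      \<Rightarrow> ('b, ('n \<times> 'b \<Rightarrow>\<^sub>0 int) set) module"
  where "base_change A \<rho> B N =
    (let T = free_Abelian_group (carrier N \<times> carrier B) Mod tensor_relations A \<rho> B N in
    \<lparr>carrier = carrier T, monoid.mult = undefined, one = undefined,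
     ring.zero = \<one>\<^bsub>T\<^esub>, add = (\<otimes>\<^bsub>T\<^esub>),
     smult = (\<lambda>b X. \<Union>x\<in>X. tensor_class A \<rho> B N
                (frag_extend (\<lambda>(n, c). frag_of (n, b \<otimes>\<^bsub>B\<^esub> c)) x))\<rparr>)"

text \<open>The image of the base change of the submodule \<open>K\<close> in the base change of \<open>N\<close>.\<close>

definition extended_submodule ::
    "('a, 'c) ring_scheme \<Rightarrow> ('a \<Rightarrow> 'b) \<Rightarrow> ('b, 'd) ring_scheme \<Rightarrow> ('a, 'n, 'e) module_scheme
      \<Rightarrow> 'n set \<Rightarrow> ('n \<times> 'b \<Rightarrow>\<^sub>0 int) set set"
  where "extended_submodule A \<rho> B N K =
    tensor_class A \<rho> B N ` carrier (free_Abelian_group (K \<times> carrier B))"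


section \<open>The spectrum and its structure sheaf\<close>

definition spec :: "('r, 'c) ring_scheme \<Rightarrow> 'r set set" where
  "spec R = {p. primeideal p R}"

definition zariski_open :: "('r, 'c) ring_scheme \<Rightarrow> 'r set set \<Rightarrow> bool" where
  "zariski_open R U \<longleftrightarrow> (\<exists>E\<subseteq>carrier R. U = {p \<in> spec R. \<not> E \<subseteq> p})"

definition zariski :: "('r, 'c) ring_scheme \<Rightarrow> 'r set topology" where
  "zariski R = topology (zariski_open R)"

lemma istopology_zariski_open: "istopology (zariski_open R)"
  unfolding istopology_def
proof (intro conjI allI impI)
  fix U V assume "zariski_open R U" "zariski_open R V"
  then obtain E F where E: "E \<subseteq> carrier R" "U = {p \<in> spec R. \<not> E \<subseteq> p}"
    and F: "F \<subseteq> carrier R" "V = {p \<in> spec R. \<not> F \<subseteq> p}"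
    unfolding zariski_open_def by blast
  let ?G = "{e \<otimes>\<^bsub>R\<^esub> f | e f. e \<in> E \<and> f \<in> F}"
  have "(\<not> ?G \<subseteq> p) = (\<not> E \<subseteq> p \<and> \<not> F \<subseteq> p)" if "p \<in> spec R" for p
  proof -
    interpret primeideal p R using that by (simp add: spec_def)
    show ?thesis
    proof
      assume "\<not> ?G \<subseteq> p"
      then obtain e f where ef: "e \<in> E" "f \<in> F" "e \<otimes>\<^bsub>R\<^esub> f \<notin> p" by blast
      then have "e \<in> carrier R" "f \<in> carrier R" using E(1) F(1) by auto
      then have "e \<notin> p" "f \<notin> p" using ef(3) I_l_closed I_r_closed by blast+
      then show "\<not> E \<subseteq> p \<and> \<not> F \<subseteq> p" using ef by blast
    next
      assume "\<not> E \<subseteq> p \<and> \<not> F \<subseteq> p"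
      then obtain e f where "e \<in> E" "f \<in> F" "e \<notin> p" "f \<notin> p" by blast
      moreover from this have "e \<otimes>\<^bsub>R\<^esub> f \<notin> p" using I_prime E(1) F(1) by blast
      ultimately show "\<not> ?G \<subseteq> p" by blast
    qed
  qed
  then have "U \<inter> V = {p \<in> spec R. \<not> ?G \<subseteq> p}" using E(2) F(2) by blast
  moreover have "?G \<subseteq> carrier R" if "spec R \<noteq> {}"
  proof -
    from that obtain p where "primeideal p R" by (auto simp: spec_def)
    then interpret primeideal p R .
    show ?thesis using E(1) F(1) by blast
  qed
  ultimately show "zariski_open R (U \<inter> V)"
    using E unfolding zariski_open_def by (cases "spec R = {}") blast+
next
  fix \<U> assume "\<forall>U\<in>\<U>. zariski_open R U"
  then obtain E where E: "\<And>U. U \<in> \<U> \<Longrightarrow> E U \<subseteq> carrier R \<and> U = {p \<in> spec R. \<not> E U \<subseteq> p}"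
    unfolding zariski_open_def by metis
  have "\<Union>\<U> = {p \<in> spec R. \<not> (\<Union>U\<in>\<U>. E U) \<subseteq> p}" using E by blast
  moreover have "(\<Union>U\<in>\<U>. E U) \<subseteq> carrier R" using E by blast
  ultimately show "zariski_open R (\<Union>\<U>)" unfolding zariski_open_def by blast
qed

lemma openin_zariski: "openin (zariski R) U \<longleftrightarrow> zariski_open R U"
  by (simp add: zariski_def istopology_zariski_open)

definition stalk_at ::
    "('r, 'c) ring_scheme \<Rightarrow> ('r, 'm, 'd) module_scheme \<Rightarrow> 'r set
      \<Rightarrow> (('r \<times> 'r) set, ('m \<times> 'r) set) module"
  where "stalk_at R M p = localization R (carrier R - p) M"

type_synonym ('r, 'm) sections = "'r set \<Rightarrow> ('m \<times> 'r) set"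

text \<open>Sections over \<open>U\<close> are the functions on \<open>U\<close> (undefined outside \<open>U\<close>) assigning to each \<open>p\<close> an
  element of the stalk at \<open>p\<close>, which are locally of the form m/f.  The restriction of a
  section to \<open>V\<close> is the restriction of the function to \<open>V\<close>.\<close>

definition tilde ::
    "('r, 'c) ring_scheme \<Rightarrow> ('r, 'm, 'd) module_scheme \<Rightarrow> 'r set set
      \<Rightarrow> (('r, 'r) sections, ('r, 'm) sections) module"
  where "tilde R M U =
    \<lparr>carrier = {s \<in> (\<Pi>\<^sub>E p\<in>U. carrier (stalk_at R M p)).
        \<forall>p\<in>U. \<exists>V m f. openin (zariski R) V \<and> p \<in> V \<and> V \<subseteq> U \<and> m \<in> carrier M \<and> f \<in> carrier R \<and>
          (\<forall>q\<in>V. f \<notin> q \<and> s q = frac R (carrier R - q) M m f)},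
     monoid.mult = (\<lambda>s t. \<lambda>p\<in>U. s p \<otimes>\<^bsub>stalk_at R M p\<^esub> t p),
     one = (\<lambda>p\<in>U. \<one>\<^bsub>stalk_at R M p\<^esub>),
     ring.zero = (\<lambda>p\<in>U. \<zero>\<^bsub>stalk_at R M p\<^esub>),
     add = (\<lambda>s t. \<lambda>p\<in>U. s p \<oplus>\<^bsub>stalk_at R M p\<^esub> t p),
     smult = (\<lambda>a s. \<lambda>p\<in>U. a p \<odot>\<^bsub>stalk_at R M p\<^esub> s p)\<rparr>"

definition structure_sheaf ::
    "('r, 'c) ring_scheme \<Rightarrow> 'r set set \<Rightarrow> (('r, 'r) sections, ('r, 'r) sections) module"
    (\<open>\<O>\<close>)
  where "\<O> R = tilde R (regular_module R)"

text \<open>For a submodule \<open>L\<close> of \<open>M\<close>: the image in \<open>tilde R M\<close> of the sheaf associated to the module \<open>L\<close>.\<close>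

definition tilde_sub ::
    "('r, 'c) ring_scheme \<Rightarrow> ('r, 'm, 'd) module_scheme \<Rightarrow> 'm set \<Rightarrow> 'r set set \<Rightarrow> ('r, 'm) sections set"
  where "tilde_sub R M L U =
    (\<lambda>t. \<lambda>p\<in>U. \<Union>(l, f)\<in>t p. frac R (carrier R - p) M l f) ` carrier (tilde R (M\<lparr>carrier := L\<rparr>) U)"

definition to_sections :: "('r, 'c) ring_scheme \<Rightarrow> 'r set set \<Rightarrow> 'r \<Rightarrow> ('r, 'r) sections" where
  "to_sections R U r = (\<lambda>p\<in>U. frac R (carrier R - p) (regular_module R) r \<one>\<^bsub>R\<^esub>)"

definition basic_open :: "('r, 'c) ring_scheme \<Rightarrow> 'r \<Rightarrow> 'r set set" where
  "basic_open R f = {p \<in> spec R. f \<notin> p}"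

text \<open>The locus in \<open>U\<close> where the section \<open>f\<close> of the structure sheaf is invertible; if \<open>U\<close> is
  affine with coordinate ring \<open>A\<close>, this is the distinguished open subset of \<open>Spec A\<close> given by \<open>f\<close>.\<close>

definition invertibility_locus ::
    "('r, 'c) ring_scheme \<Rightarrow> 'r set set \<Rightarrow> ('r, 'r) sections \<Rightarrow> 'r set set"
  where "invertibility_locus R U f = {p \<in> U. f p \<in> Units (stalk_at R (regular_module R) p)}"


section \<open>Affine opens and quasi-coherent sheaves on the spectrum\<close>

text \<open>An isomorphism of ringed spaces from an open subset \<open>U\<close> of \<open>Spec R\<close> onto \<open>Spec A\<close>; it is
  automatically an isomorphism of locally ringed spaces.\<close>

definition ringed_iso ::
    "('r, 'c) ring_scheme \<Rightarrow> 'r set set \<Rightarrow> ('a, 'd) ring_scheme \<Rightarrow> ('r set \<Rightarrow> 'a set)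
      \<Rightarrow> ('a set set \<Rightarrow> ('a, 'a) sections \<Rightarrow> ('r, 'r) sections) \<Rightarrow> bool"
  where "ringed_iso R U A \<psi> \<theta> \<longleftrightarrow>
    homeomorphic_map (subtopology (zariski R) U) (zariski A) \<psi> \<and>
    (\<forall>W. openin (zariski A) W \<longrightarrow> \<theta> W \<in> ring_iso (\<O> A W) (\<O> R (U \<inter> \<psi> -` W))) \<and>
    (\<forall>W W'. openin (zariski A) W \<longrightarrow> openin (zariski A) W' \<longrightarrow> W' \<subseteq> W \<longrightarrow>
       (\<forall>s\<in>carrier (\<O> A W). \<theta> W' (restrict s W') = restrict (\<theta> W s) (U \<inter> \<psi> -` W')))"

text \<open>The ring \<open>A\<close> below is necessarily isomorphic to \<open>\<O> R U\<close>, hence nothing is lost by fixing its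
  type.\<close>

definition affine_open :: "('r, 'c) ring_scheme \<Rightarrow> 'r set set \<Rightarrow> bool" where
  "affine_open R U \<longleftrightarrow> openin (zariski R) U \<and>
    (\<exists>(A :: ('r, 'r) sections ring) \<psi> \<theta>. cring A \<and> ringed_iso R U A \<psi> \<theta>)"

text \<open>Isomorphisms from the \<open>A\<close>-module \<open>N\<close> to \<open>N'\<close> over an isomorphism \<open>\<theta>\<close> of the rings of scalars.\<close>

definition semilinear_iso ::
    "('a, 'c) ring_scheme \<Rightarrow> ('a \<Rightarrow> 'b) \<Rightarrow> ('a, 'n, 'd) module_scheme \<Rightarrow> ('b, 'm, 'e) module_scheme
      \<Rightarrow> ('n \<Rightarrow> 'm) \<Rightarrow> bool"
  where "semilinear_iso A \<theta> N N' \<phi> \<longleftrightarrow>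
    bij_betw \<phi> (carrier N) (carrier N') \<and>
    (\<forall>x\<in>carrier N. \<forall>y\<in>carrier N. \<phi> (x \<oplus>\<^bsub>N\<^esub> y) = \<phi> x \<oplus>\<^bsub>N'\<^esub> \<phi> y) \<and>
    (\<forall>a\<in>carrier A. \<forall>x\<in>carrier N. \<phi> (a \<odot>\<^bsub>N\<^esub> x) = \<theta> a \<odot>\<^bsub>N'\<^esub> \<phi> x)"

text \<open>Sheaves of modules over the structure sheaf, in the form of sheaves of functions on the
  points (with arbitrary values) whose restriction maps are the restrictions of functions.\<close>

definition sheaf_of_modules ::
    "('r, 'c) ring_scheme \<Rightarrow> ('r set set \<Rightarrow> (('r, 'r) sections, 'r set \<Rightarrow> 'x) module) \<Rightarrow> bool"
  where "sheaf_of_modules R F \<longleftrightarrow>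
    (\<forall>U. openin (zariski R) U \<longrightarrow> module (\<O> R U) (F U) \<and> carrier (F U) \<subseteq> extensional U) \<and>
    (\<forall>U V. openin (zariski R) U \<longrightarrow> openin (zariski R) V \<longrightarrow> V \<subseteq> U \<longrightarrow>
      (\<forall>s\<in>carrier (F U). restrict s V \<in> carrier (F V)) \<and>
      (\<forall>s\<in>carrier (F U). \<forall>t\<in>carrier (F U).
         restrict (s \<oplus>\<^bsub>F U\<^esub> t) V = restrict s V \<oplus>\<^bsub>F V\<^esub> restrict t V) \<and>
      (\<forall>a\<in>carrier (\<O> R U). \<forall>s\<in>carrier (F U).
         restrict (a \<odot>\<^bsub>F U\<^esub> s) V = restrict a V \<odot>\<^bsub>F V\<^esub> restrict s V)) \<and>
    (\<forall>\<U>. (\<forall>U\<in>\<U>. openin (zariski R) U) \<longrightarrow>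
      (\<forall>s\<in>extensional (\<Union>\<U>). (\<forall>U\<in>\<U>. restrict s U \<in> carrier (F U)) \<longrightarrow> s \<in> carrier (F (\<Union>\<U>))))"

text \<open>\<open>Spec R\<close> is covered by affine opens \<open>U\<close> on which \<open>F\<close> is isomorphic to the sheaf associated to
  a module \<open>P\<close> over \<open>A\<close>, where \<open>U\<close> is identified with \<open>Spec A\<close>.  Again \<open>A\<close> and \<open>P\<close> are necessarily
  isomorphic to \<open>\<O> R U\<close> and \<open>F U\<close>.\<close>

definition quasi_coherent ::
    "('r, 'c) ring_scheme \<Rightarrow> ('r set set \<Rightarrow> (('r, 'r) sections, 'r set \<Rightarrow> 'x) module) \<Rightarrow> bool"
  where "quasi_coherent R F \<longleftrightarrow> sheaf_of_modules R F \<and>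
    (\<forall>p\<in>spec R. \<exists>U (A :: ('r, 'r) sections ring) \<psi> \<theta> (P :: (('r, 'r) sections, 'r set \<Rightarrow> 'x) module) \<eta>.
       p \<in> U \<and> openin (zariski R) U \<and> cring A \<and> ringed_iso R U A \<psi> \<theta> \<and> module A P \<and>
       (\<forall>W. openin (zariski A) W \<longrightarrow>
          semilinear_iso (\<O> A W) (\<theta> W) (tilde A P W) (F (U \<inter> \<psi> -` W)) (\<eta> W)) \<and>
       (\<forall>W W'. openin (zariski A) W \<longrightarrow> openin (zariski A) W' \<longrightarrow> W' \<subseteq> W \<longrightarrow>
          (\<forall>s\<in>carrier (tilde A P W). \<eta> W' (restrict s W') = restrict (\<eta> W s) (U \<inter> \<psi> -` W'))))"


section \<open>Preclosure operations\<close>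

text \<open>A family of operations on submodules over \<open>Spec R\<close> assigns to every affine open \<open>U\<close>,
  every \<open>\<O> R U\<close>-module \<open>N\<close> and every submodule \<open>K\<close> of \<open>N\<close> the closure of \<open>K\<close> in \<open>N\<close>.  The modules
  range over those with elements in a type \<open>'u\<close>, which plays the role of a universe: if \<open>'u\<close>
  is infinite and at least as large as \<open>R\<close>, it contains with each module, up to isomorphism,
  all the localizations, extensions of scalars and modules of sections used below.\<close>

type_synonym ('r, 'u) operation =
  "'r set set \<Rightarrow> (('r, 'r) sections, 'u) module \<Rightarrow> 'u set \<Rightarrow> 'u set"

definition preclosure_operation :: "('r, 'c) ring_scheme \<Rightarrow> ('r, 'u) operation \<Rightarrow> bool" where
  "preclosure_operation R cl \<longleftrightarrow>
    (\<forall>U N. affine_open R U \<longrightarrow> module (\<O> R U) N \<longrightarrow>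
      (\<forall>K. submodule K (\<O> R U) N \<longrightarrow> submodule (cl U N K) (\<O> R U) N \<and> K \<subseteq> cl U N K) \<and>
      (\<forall>K K'. submodule K (\<O> R U) N \<longrightarrow> submodule K' (\<O> R U) N \<longrightarrow> K \<subseteq> K' \<longrightarrow>
         cl U N K \<subseteq> cl U N K') \<and>
      (\<forall>N' \<phi> K. module (\<O> R U) N' \<longrightarrow> semilinear_iso (\<O> R U) id N N' \<phi> \<longrightarrow>
         submodule K (\<O> R U) N \<longrightarrow> cl U N' (\<phi> ` K) = \<phi> ` cl U N K))"

text \<open>The closure of \<open>K\<close> in an \<open>A\<close>-module \<open>N\<close> with elements in an arbitrary type, where the ring \<open>A\<close> is
  identified with \<open>\<O> R U\<close> by means of the isomorphism \<open>\<theta>\<close>: it is transported from an isomorphic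
  module with elements in \<open>'u\<close>.  By the isomorphism invariance required above, the choice of
  the latter is irrelevant.\<close>

definition closure_in ::
    "('r, 'c) ring_scheme \<Rightarrow> ('r, 'u) operation \<Rightarrow> 'r set set
      \<Rightarrow> ('a, 'd) ring_scheme \<Rightarrow> ('a \<Rightarrow> ('r, 'r) sections) \<Rightarrow> ('a, 'n, 'e) module_scheme \<Rightarrow> 'n set \<Rightarrow> 'n set"
  where "closure_in R cl U A \<theta> N K =
    {x \<in> carrier N. \<exists>N' \<phi>. module (\<O> R U) N' \<and> semilinear_iso A \<theta> N N' \<phi> \<and> \<phi> x \<in> cl U N' (\<phi> ` K)}"

text \<open>The closure of the localization of \<open>K\<close> at \<open>f\<close> in that of \<open>N\<close>, for an \<open>A\<close>-module \<open>N\<close>, where the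
  localization of \<open>A\<close> at \<open>f\<close> is identified with \<open>\<O> R U\<close> by the canonical map extending \<open>\<rho>\<close>.\<close>

definition localized_closure ::
    "('r, 'c) ring_scheme \<Rightarrow> ('r, 'u) operation \<Rightarrow> 'r set set
      \<Rightarrow> ('a, 'd) ring_scheme \<Rightarrow> ('a \<Rightarrow> ('r, 'r) sections) \<Rightarrow> 'a
      \<Rightarrow> ('a, 'n, 'e) module_scheme \<Rightarrow> 'n set \<Rightarrow> ('n \<times> 'a) set set"
  where "localized_closure R cl U A \<rho> f N K =
    closure_in R cl U (localization A (powers A f) (regular_module A))
      (localization_lift A f (\<O> R U) \<rho>)
      (localization A (powers A f) N) (localized_submodule A (powers A f) N K)"

definition openly_persistent :: "('r, 'c) ring_scheme \<Rightarrow> ('r, 'u) operation \<Rightarrow> bool" where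
  "openly_persistent R cl \<longleftrightarrow>
    (\<forall>U V N K. affine_open R U \<longrightarrow> affine_open R V \<longrightarrow> V \<subseteq> U \<longrightarrow>
       module (\<O> R U) N \<longrightarrow> submodule K (\<O> R U) N \<longrightarrow>
       (let A = \<O> R U; B = \<O> R V; \<rho> = (\<lambda>s. restrict s V) in
         \<forall>x\<in>cl U N K. tensor_class A \<rho> B N (frag_of (x, \<one>\<^bsub>B\<^esub>))
           \<in> closure_in R cl V B id (base_change A \<rho> B N) (extended_submodule A \<rho> B N K)))"

definition glueable :: "('r, 'c) ring_scheme \<Rightarrow> ('r, 'u) operation \<Rightarrow> bool" where
  "glueable R cl \<longleftrightarrow> openly_persistent R cl \<and>
    (\<forall>U F g (N :: (('r, 'r) sections, 'u) module) K z. affine_open R U \<longrightarrow>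
       (let A = \<O> R U; X = invertibility_locus R U; \<rho> = (\<lambda>V s. restrict s V) in
         F \<subseteq> carrier A \<longrightarrow> g \<in> carrier A \<longrightarrow> (\<exists>n::nat. g [^]\<^bsub>A\<^esub> n \<in> Idl\<^bsub>A\<^esub> F) \<longrightarrow>
         module A N \<longrightarrow> submodule K A N \<longrightarrow> z \<in> carrier N \<longrightarrow>
         (\<forall>f\<in>F. frac A (powers A f) N z \<one>\<^bsub>A\<^esub> \<in> localized_closure R cl (X f) A (\<rho> (X f)) f N K) \<longrightarrow>
         frac A (powers A g) N z \<one>\<^bsub>A\<^esub> \<in> localized_closure R cl (X g) A (\<rho> (X g)) g N K))"

definition sheaf_closure ::
    "('r, 'c) ring_scheme \<Rightarrow> ('r, 'u) operation
      \<Rightarrow> ('r set set \<Rightarrow> (('r, 'r) sections, 'r set \<Rightarrow> 'x) module) \<Rightarrow> ('r set set \<Rightarrow> ('r set \<Rightarrow> 'x) set)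
      \<Rightarrow> 'r set set \<Rightarrow> (('r, 'r) sections, 'r set \<Rightarrow> 'x) module"
  where "sheaf_closure R cl F G U = (F U)\<lparr>carrier :=
    {s \<in> carrier (F U). \<forall>x\<in>U. \<exists>V. affine_open R V \<and> x \<in> V \<and> V \<subseteq> U \<and>
       restrict s V \<in> closure_in R cl V (\<O> R V) id (F V) (G V)}\<rparr>"

end

theory Submission
  imports Defs
begin

text \<open>Over a basic open subset \<open>D(f)\<close>, the sections of the closure \<open>F\<close> of the sheaf of \<open>L\<close> are exactly
  \<open>(L\<^sub>f)\<^sup>c\<^sup>l\<close> inside \<open>M\<^sub>f\<close>.  One inclusion is trivial.  For the other one, open persistence shrinks
  the affine neighbourhoods occurring in the definition of \<open>F\<close> to basic open ones, because the
  extension of scalars of \<open>M(V)\<close> from \<open>V\<close> to \<open>D(h) \<subseteq> V\<close> is \<open>M\<^sub>h\<close>; then glueability, applied to the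
  \<open>R\<close>-module \<open>M\<close> itself and the elements \<open>h\<close> with \<open>g = f\<close>, puts the local conditions together.
  Hence (a) says that \<open>F(D(f))\<close> is the localization of \<open>F(Spec R)\<close> for all \<open>f\<close>.  If this holds, \<open>F\<close> is
  the sheaf associated to the submodule \<open>F(Spec R)\<close> of \<open>M\<close>.  Conversely, if \<open>F\<close> is quasi-coherent and
  \<open>s\<close> is a section of \<open>F\<close> over \<open>D(f)\<close>, then some \<open>f\<^sup>n s\<close> extends to the members of a finite cover by
  basic open subsets, and after increasing \<open>n\<close> the extensions agree on the overlaps.\<close>

section \<open>Modules of fractions\<close>

text \<open>An operation acts only on modules over some \<open>\<O> R U\<close> with elements in
  \<open>'u\<close>, whereas modules of sections and tensor products have elements in other types.
  \<open>closure_in\<close> therefore quantifies over copies in \<open>'u\<close>, and it is empty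
  for a module that has no such copy. For M(D(f)) a copy exists, because its elements are m/f^n with
  m in M and \<open>'u\<close> is infinite. For a general affine V none is constructed, so the
  closures are shown to be submodules over basic open sets. The obstacle is open persistence for
  D(h) inside an affine V. The ring of V need not be a localization of R, nor M(V) one of M, so the
  base change of M(V) to D(h) cannot be computed by transitivity of localization. It is computed
  directly: every tensor is x \<otimes> 1/h^n, and if x restricts to 0 on D(h), then a power of h
  kills x, because V is quasi-compact. The same torsion statement makes the extensions agree on
  overlaps when quasi-coherence is assumed.\<close>

lemma regular_module_simps [simp]:
  "carrier (regular_module R) = carrier R" "monoid.mult (regular_module R) = (\<otimes>\<^bsub>R\<^esub>)"
  "one (regular_module R) = \<one>\<^bsub>R\<^esub>" "ring.zero (regular_module R) = \<zero>\<^bsub>R\<^esub>"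
  "add (regular_module R) = (\<oplus>\<^bsub>R\<^esub>)" "smult (regular_module R) = (\<otimes>\<^bsub>R\<^esub>)"
  by (simp_all add: regular_module_def)

lemma (in cring) module_regular_module: "module R (regular_module R)"
proof (rule moduleI)
  show "abelian_group (regular_module R)"
    by (rule abelian_groupI) (auto simp: a_ac intro: l_neg)
qed (auto simp: is_cring l_distr r_distr m_assoc)

text \<open>Both kinds of localization are instances: complements of primes give the stalks
  (\<open>prime_denominators\<close>), powers of an element give modules such as \<open>M_f\<close>
  (\<open>powers_denominators\<close>). \<open>S\<close> may contain \<zero>, as it does for the
  powers of a nilpotent element.\<close>

locale module_denominators = module R M for R (structure) and M (structure) +
  fixes S
  assumes denom_closed: "S \<subseteq> carrier R"
    and denom_one [simp, intro]: "\<one> \<in> S"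
    and denom_mult [simp, intro]: "s \<in> S \<Longrightarrow> t \<in> S \<Longrightarrow> s \<otimes> t \<in> S"
begin

lemma denom_carrier [simp]: "s \<in> S \<Longrightarrow> s \<in> carrier R"
  using denom_closed by auto

lemma mem_frac_iff:
  "(m', s') \<in> frac R S M m s \<longleftrightarrow> m' \<in> carrier M \<and> s' \<in> S \<and>
     (\<exists>t\<in>S. t \<odot>\<^bsub>M\<^esub> (s' \<odot>\<^bsub>M\<^esub> m) = t \<odot>\<^bsub>M\<^esub> (s \<odot>\<^bsub>M\<^esub> m'))"
  by (simp add: frac_def)

lemma self_mem_frac: "m \<in> carrier M \<Longrightarrow> s \<in> S \<Longrightarrow> (m, s) \<in> frac R S M m s"
  using denom_one by (auto simp: mem_frac_iff)

lemma frac_cong: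
  assumes m: "m \<in> carrier M" "n \<in> carrier M" and s: "s \<in> S" "t \<in> S"
    and u: "u \<in> S" "u \<odot>\<^bsub>M\<^esub> (t \<odot>\<^bsub>M\<^esub> m) = u \<odot>\<^bsub>M\<^esub> (s \<odot>\<^bsub>M\<^esub> n)"
  shows "frac R S M m s \<subseteq> frac R S M n t"
proof (rule subsetI, clarsimp simp: mem_frac_iff)
  fix x r v assume x: "x \<in> carrier M" "r \<in> S" "v \<in> S"
    and eq: "v \<odot>\<^bsub>M\<^esub> (r \<odot>\<^bsub>M\<^esub> m) = v \<odot>\<^bsub>M\<^esub> (s \<odot>\<^bsub>M\<^esub> x)"
  note c = m s u(1) x denom_carrier
  \<comment> \<open>Eliminating \<open>m\<close> from the equation for \<open>n\<close>, multiplied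
    by \<open>v r\<close>, and the equation for \<open>x\<close>, multiplied by \<open>u t\<close>,
    leaves a factor \<open>s\<close> on both sides; hence the multiplier
    \<open>u v s\<close>.\<close>
  have "(u \<otimes> v \<otimes> s) \<odot>\<^bsub>M\<^esub> (r \<odot>\<^bsub>M\<^esub> n) = (v \<otimes> r) \<odot>\<^bsub>M\<^esub> (u \<odot>\<^bsub>M\<^esub> (s \<odot>\<^bsub>M\<^esub> n))"
    using c by (simp add: smult_assoc1[symmetric] m_ac)
  also have "\<dots> = (v \<otimes> r) \<odot>\<^bsub>M\<^esub> (u \<odot>\<^bsub>M\<^esub> (t \<odot>\<^bsub>M\<^esub> m))" by (simp add: u)
  also have "\<dots> = (u \<otimes> t) \<odot>\<^bsub>M\<^esub> (v \<odot>\<^bsub>M\<^esub> (r \<odot>\<^bsub>M\<^esub> m))"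
    using c by (simp add: smult_assoc1[symmetric] m_ac)
  also have "\<dots> = (u \<otimes> t) \<odot>\<^bsub>M\<^esub> (v \<odot>\<^bsub>M\<^esub> (s \<odot>\<^bsub>M\<^esub> x))" by (simp add: eq)
  also have "\<dots> = (u \<otimes> v \<otimes> s) \<odot>\<^bsub>M\<^esub> (t \<odot>\<^bsub>M\<^esub> x)"
    using c by (simp add: smult_assoc1[symmetric] m_ac)
  finally show "\<exists>w\<in>S. w \<odot>\<^bsub>M\<^esub> (r \<odot>\<^bsub>M\<^esub> n) = w \<odot>\<^bsub>M\<^esub> (t \<odot>\<^bsub>M\<^esub> x)"
    using c by blast
qed

lemma frac_eq_iff:
  assumes "m \<in> carrier M" "n \<in> carrier M" "s \<in> S" "t \<in> S"
  shows "frac R S M m s = frac R S M n t \<longleftrightarrow>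
    (\<exists>u\<in>S. u \<odot>\<^bsub>M\<^esub> (t \<odot>\<^bsub>M\<^esub> m) = u \<odot>\<^bsub>M\<^esub> (s \<odot>\<^bsub>M\<^esub> n))"
proof
  assume "frac R S M m s = frac R S M n t"
  then have "(n, t) \<in> frac R S M m s" using assms self_mem_frac by simp
  then show "\<exists>u\<in>S. u \<odot>\<^bsub>M\<^esub> (t \<odot>\<^bsub>M\<^esub> m) = u \<odot>\<^bsub>M\<^esub> (s \<odot>\<^bsub>M\<^esub> n)" by (auto simp: mem_frac_iff)
next
  assume "\<exists>u\<in>S. u \<odot>\<^bsub>M\<^esub> (t \<odot>\<^bsub>M\<^esub> m) = u \<odot>\<^bsub>M\<^esub> (s \<odot>\<^bsub>M\<^esub> n)"
  then obtain u where "u \<in> S" "u \<odot>\<^bsub>M\<^esub> (t \<odot>\<^bsub>M\<^esub> m) = u \<odot>\<^bsub>M\<^esub> (s \<odot>\<^bsub>M\<^esub> n)" by blast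
  then show "frac R S M m s = frac R S M n t"
    using frac_cong[of m n s t u] frac_cong[of n m t s u] assms by auto
qed

lemma frac_eqI:
  assumes "m \<in> carrier M" "n \<in> carrier M" "s \<in> S" "t \<in> S"
    and "t \<odot>\<^bsub>M\<^esub> m = s \<odot>\<^bsub>M\<^esub> n"
  shows "frac R S M m s = frac R S M n t"
  using assms by (auto simp: frac_eq_iff)

lemma frac_cancel:
  "m \<in> carrier M \<Longrightarrow> s \<in> S \<Longrightarrow> u \<in> S \<Longrightarrow> frac R S M (u \<odot>\<^bsub>M\<^esub> m) (u \<otimes> s) = frac R S M m s"
  by (rule frac_eqI) (auto simp: smult_assoc1[symmetric] m_ac)

lemma frac_mem_eq:
  assumes "(m', s') \<in> frac R S M m s" "m \<in> carrier M" "s \<in> S"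
  shows "m' \<in> carrier M" "s' \<in> S" "frac R S M m' s' = frac R S M m s"
proof -
  show 1: "m' \<in> carrier M" "s' \<in> S" using assms(1) by (auto simp: mem_frac_iff)
  show "frac R S M m' s' = frac R S M m s"
    unfolding frac_eq_iff[OF 1(1) assms(2) 1(2) assms(3)]
    using assms(1) unfolding mem_frac_iff by metis
qed

lemma carrier_localization: "carrier (localization R S M) = {frac R S M m s | m s. m \<in> carrier M \<and> s \<in> S}"
  by (simp add: localization_def)

lemma frac_in_carrier [simp, intro]:
  "m \<in> carrier M \<Longrightarrow> s \<in> S \<Longrightarrow> frac R S M m s \<in> carrier (localization R S M)"
  by (auto simp: carrier_localization)

lemma localizationE:
  assumes "x \<in> carrier (localization R S M)"
  obtains m s where "m \<in> carrier M" "s \<in> S" "x = frac R S M m s"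
  using assms by (auto simp: carrier_localization)

lemma zero_localization: "\<zero>\<^bsub>localization R S M\<^esub> = frac R S M \<zero>\<^bsub>M\<^esub> \<one>"
  by (simp add: localization_def)

lemma frac_zero: "s \<in> S \<Longrightarrow> frac R S M \<zero>\<^bsub>M\<^esub> s = \<zero>\<^bsub>localization R S M\<^esub>"
  unfolding zero_localization by (rule frac_eqI) auto

text \<open>The operations of a localization are unions over representatives, hence it suffices to show
  that the terms of the union agree.\<close>

lemma union_frac_eq:
  assumes "m \<in> carrier M" "s \<in> S" "\<And>m' s'. (m', s') \<in> frac R S M m s \<Longrightarrow> F m' s' = c"
  shows "(\<Union>(m', s')\<in>frac R S M m s. F m' s') = c"
  using assms(3) self_mem_frac[OF assms(1,2)] by fastforce

text \<open>If \<open>u\<close> and \<open>v\<close> witness the two changes of representative, then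
  \<open>u v\<close> witnesses the change of the sum.\<close>

lemma add_frac_cong:
  assumes "(m', s') \<in> frac R S M m s" "(n', t') \<in> frac R S M n t"
    "m \<in> carrier M" "n \<in> carrier M" "s \<in> S" "t \<in> S"
  shows "frac R S M (t' \<odot>\<^bsub>M\<^esub> m' \<oplus>\<^bsub>M\<^esub> s' \<odot>\<^bsub>M\<^esub> n') (s' \<otimes> t')
       = frac R S M (t \<odot>\<^bsub>M\<^esub> m \<oplus>\<^bsub>M\<^esub> s \<odot>\<^bsub>M\<^esub> n) (s \<otimes> t)"
proof -
  from assms(1,2) obtain u v where c: "m' \<in> carrier M" "s' \<in> S" "n' \<in> carrier M" "t' \<in> S" "u \<in> S" "v \<in> S"
    and u: "u \<odot>\<^bsub>M\<^esub> (s' \<odot>\<^bsub>M\<^esub> m) = u \<odot>\<^bsub>M\<^esub> (s \<odot>\<^bsub>M\<^esub> m')"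
    and v: "v \<odot>\<^bsub>M\<^esub> (t' \<odot>\<^bsub>M\<^esub> n) = v \<odot>\<^bsub>M\<^esub> (t \<odot>\<^bsub>M\<^esub> n')"
    by (auto simp: mem_frac_iff)
  note c = c assms(3-6) denom_carrier
  have "(u \<otimes> v) \<odot>\<^bsub>M\<^esub> ((s \<otimes> t) \<odot>\<^bsub>M\<^esub> (t' \<odot>\<^bsub>M\<^esub> m' \<oplus>\<^bsub>M\<^esub> s' \<odot>\<^bsub>M\<^esub> n'))
      = (v \<otimes> t \<otimes> t') \<odot>\<^bsub>M\<^esub> (u \<odot>\<^bsub>M\<^esub> (s \<odot>\<^bsub>M\<^esub> m')) \<oplus>\<^bsub>M\<^esub> (u \<otimes> s \<otimes> s') \<odot>\<^bsub>M\<^esub> (v \<odot>\<^bsub>M\<^esub> (t \<odot>\<^bsub>M\<^esub> n'))"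
    using c by (simp add: smult_r_distr smult_assoc1[symmetric] m_ac)
  also have "\<dots> = (v \<otimes> t \<otimes> t') \<odot>\<^bsub>M\<^esub> (u \<odot>\<^bsub>M\<^esub> (s' \<odot>\<^bsub>M\<^esub> m)) \<oplus>\<^bsub>M\<^esub> (u \<otimes> s \<otimes> s') \<odot>\<^bsub>M\<^esub> (v \<odot>\<^bsub>M\<^esub> (t' \<odot>\<^bsub>M\<^esub> n))"
    by (simp add: u v)
  also have "\<dots> = (u \<otimes> v) \<odot>\<^bsub>M\<^esub> ((s' \<otimes> t') \<odot>\<^bsub>M\<^esub> (t \<odot>\<^bsub>M\<^esub> m \<oplus>\<^bsub>M\<^esub> s \<odot>\<^bsub>M\<^esub> n))"
    using c by (simp add: smult_r_distr smult_assoc1[symmetric] m_ac)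
  finally show ?thesis using c by (subst frac_eq_iff) auto
qed

lemma add_frac:
  assumes "m \<in> carrier M" "n \<in> carrier M" "s \<in> S" "t \<in> S"
  shows "frac R S M m s \<oplus>\<^bsub>localization R S M\<^esub> frac R S M n t
    = frac R S M (t \<odot>\<^bsub>M\<^esub> m \<oplus>\<^bsub>M\<^esub> s \<odot>\<^bsub>M\<^esub> n) (s \<otimes> t)"
  using assms unfolding localization_def by (simp, intro union_frac_eq add_frac_cong)

lemma add_frac_same:
  assumes "m \<in> carrier M" "n \<in> carrier M" "s \<in> S"
  shows "frac R S M m s \<oplus>\<^bsub>localization R S M\<^esub> frac R S M n s = frac R S M (m \<oplus>\<^bsub>M\<^esub> n) s"
  unfolding add_frac[OF assms assms(3)]
  using assms by (intro frac_eqI) (auto simp: smult_r_distr smult_assoc1[symmetric] m_ac)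

lemma regular_denominators: "module_denominators R (regular_module R) S"
  by (intro module_denominators.intro module_regular_module module_denominators_axioms.intro
      denom_closed denom_one denom_mult)

lemma smult_frac_cong:
  assumes a: "(a', s') \<in> frac R S (regular_module R) a s" and n: "(n', t') \<in> frac R S M n t"
    and c: "a \<in> carrier R" "n \<in> carrier M" "s \<in> S" "t \<in> S"
  shows "frac R S M (a' \<odot>\<^bsub>M\<^esub> n') (s' \<otimes> t') = frac R S M (a \<odot>\<^bsub>M\<^esub> n) (s \<otimes> t)"
proof -
  interpret reg: module_denominators R "regular_module R" S by (rule regular_denominators)
  from a n obtain u v where c: "a' \<in> carrier R" "s' \<in> S" "n' \<in> carrier M" "t' \<in> S" "u \<in> S" "v \<in> S"
    and u: "u \<otimes> (s' \<otimes> a) = u \<otimes> (s \<otimes> a')"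
    and v: "v \<odot>\<^bsub>M\<^esub> (t' \<odot>\<^bsub>M\<^esub> n) = v \<odot>\<^bsub>M\<^esub> (t \<odot>\<^bsub>M\<^esub> n')"
    by (auto simp: mem_frac_iff reg.mem_frac_iff)
  note c = c assms(3-6) denom_carrier
  have "(u \<otimes> v) \<odot>\<^bsub>M\<^esub> ((s \<otimes> t) \<odot>\<^bsub>M\<^esub> (a' \<odot>\<^bsub>M\<^esub> n')) = (u \<otimes> (s \<otimes> a')) \<odot>\<^bsub>M\<^esub> (v \<odot>\<^bsub>M\<^esub> (t \<odot>\<^bsub>M\<^esub> n'))"
    using c by (simp add: smult_assoc1[symmetric] m_ac)
  also have "\<dots> = (u \<otimes> (s' \<otimes> a)) \<odot>\<^bsub>M\<^esub> (v \<odot>\<^bsub>M\<^esub> (t' \<odot>\<^bsub>M\<^esub> n))" by (simp add: u v)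
  also have "\<dots> = (u \<otimes> v) \<odot>\<^bsub>M\<^esub> ((s' \<otimes> t') \<odot>\<^bsub>M\<^esub> (a \<odot>\<^bsub>M\<^esub> n))"
    using c by (simp add: smult_assoc1[symmetric] m_ac)
  finally show ?thesis using c by (subst frac_eq_iff) auto
qed

lemma smult_frac:
  assumes "a \<in> carrier R" "n \<in> carrier M" "s \<in> S" "t \<in> S"
  shows "frac R S (regular_module R) a s \<odot>\<^bsub>localization R S M\<^esub> frac R S M n t
    = frac R S M (a \<odot>\<^bsub>M\<^esub> n) (s \<otimes> t)"
proof -
  interpret reg: module_denominators R "regular_module R" S by (rule regular_denominators)
  show ?thesis
    using assms unfolding localization_def
    by (simp, intro union_frac_eq reg.union_frac_eq smult_frac_cong) auto
qed

text \<open>With equal denominators addition takes place in the numerators alone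
  (\<open>add_frac_same\<close>), so the group laws and the distributive laws of a localization
  reduce to those of \<open>M\<close>.\<close>

lemma common_denominator:
  assumes "x \<in> carrier (localization R S M)" "y \<in> carrier (localization R S M)"
  obtains m n s where "m \<in> carrier M" "n \<in> carrier M" "s \<in> S" "x = frac R S M m s" "y = frac R S M n s"
proof -
  obtain m s n t where *: "m \<in> carrier M" "s \<in> S" "x = frac R S M m s"
    "n \<in> carrier M" "t \<in> S" "y = frac R S M n t"
    using assms by (metis localizationE)
  have "x = frac R S M (t \<odot>\<^bsub>M\<^esub> m) (s \<otimes> t)" "y = frac R S M (s \<odot>\<^bsub>M\<^esub> n) (s \<otimes> t)"
    using * frac_cancel[of m s t] frac_cancel[of n t s] by (auto simp: m_comm)
  with * show thesis by (intro that[of "t \<odot>\<^bsub>M\<^esub> m" "s \<odot>\<^bsub>M\<^esub> n" "s \<otimes> t"]) auto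
qed

lemma abelian_group_localization: "abelian_group (localization R S M)"
proof (rule abelian_groupI)
  let ?L = "localization R S M"
  show "x \<oplus>\<^bsub>?L\<^esub> y \<in> carrier ?L" "x \<oplus>\<^bsub>?L\<^esub> y = y \<oplus>\<^bsub>?L\<^esub> x"
    if "x \<in> carrier ?L" "y \<in> carrier ?L" for x y
    using that by (auto elim!: common_denominator simp: add_frac_same M.a_comm)
  show "\<zero>\<^bsub>?L\<^esub> \<in> carrier ?L" by (auto simp: zero_localization)
  show "\<zero>\<^bsub>?L\<^esub> \<oplus>\<^bsub>?L\<^esub> x = x" if "x \<in> carrier ?L" for x
    using that
  proof (rule localizationE)
    fix m s assume "m \<in> carrier M" "s \<in> S" "x = frac R S M m s"
    then show ?thesis using add_frac_same[of "\<zero>\<^bsub>M\<^esub>" m s] by (simp add: frac_zero)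
  qed
  show "\<exists>y\<in>carrier ?L. y \<oplus>\<^bsub>?L\<^esub> x = \<zero>\<^bsub>?L\<^esub>" if "x \<in> carrier ?L" for x
    using that
  proof (rule localizationE)
    fix m s assume "m \<in> carrier M" "s \<in> S" "x = frac R S M m s"
    then show ?thesis
      by (intro bexI[of _ "frac R S M (\<ominus>\<^bsub>M\<^esub> m) s"]) (auto simp: add_frac_same M.l_neg frac_zero)
  qed
  fix x y z assume *: "x \<in> carrier ?L" "y \<in> carrier ?L" "z \<in> carrier ?L"
  obtain m n s where 1: "m \<in> carrier M" "n \<in> carrier M" "s \<in> S" "x = frac R S M m s" "y = frac R S M n s"
    using *(1,2) by (rule common_denominator)
  obtain k t where 2: "k \<in> carrier M" "t \<in> S" "z = frac R S M k t"
    using *(3) by (rule localizationE)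
  have "x = frac R S M (t \<odot>\<^bsub>M\<^esub> m) (t \<otimes> s)" "y = frac R S M (t \<odot>\<^bsub>M\<^esub> n) (t \<otimes> s)" "z = frac R S M (s \<odot>\<^bsub>M\<^esub> k) (t \<otimes> s)"
    using 1 2 frac_cancel[of k t s] frac_cancel[of m s t] frac_cancel[of n s t] by (simp_all add: m_comm[of s t])
  then show "x \<oplus>\<^bsub>?L\<^esub> y \<oplus>\<^bsub>?L\<^esub> z = x \<oplus>\<^bsub>?L\<^esub> (y \<oplus>\<^bsub>?L\<^esub> z)"
    using 1 2 by (simp add: add_frac_same M.a_assoc)
qed

end

section \<open>The ring of fractions and its modules\<close>

lemma mult_localization_regular:
  "(\<otimes>\<^bsub>localization R S (regular_module R)\<^esub>) = (\<odot>\<^bsub>localization R S (regular_module R)\<^esub>)"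
  by (simp add: localization_def)

lemma one_localization_regular:
  "\<one>\<^bsub>localization R S (regular_module R)\<^esub> = frac R S (regular_module R) \<one>\<^bsub>R\<^esub> \<one>\<^bsub>R\<^esub>"
  by (simp add: localization_def)

text \<open>The product of the ring of fractions is given by the same formula as its action on
  itself, so \<open>smult_frac\<close> already contains the rule for products.\<close>

lemma localization_regular:
  assumes "module_denominators R (regular_module R) S"
  shows cring_localization: "cring (localization R S (regular_module R))"
    and frac_mult: "\<And>a b s t. a \<in> carrier R \<Longrightarrow> b \<in> carrier R \<Longrightarrow> s \<in> S \<Longrightarrow> t \<in> S \<Longrightarrow>
      frac R S (regular_module R) a s \<otimes>\<^bsub>localization R S (regular_module R)\<^esub> frac R S (regular_module R) b t
      = frac R S (regular_module R) (a \<otimes>\<^bsub>R\<^esub> b) (s \<otimes>\<^bsub>R\<^esub> t)"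
proof -
  interpret module_denominators R "regular_module R" S by fact
  let ?L = "localization R S (regular_module R)"
  show mult: "frac R S (regular_module R) a s \<otimes>\<^bsub>?L\<^esub> frac R S (regular_module R) b t
      = frac R S (regular_module R) (a \<otimes>\<^bsub>R\<^esub> b) (s \<otimes>\<^bsub>R\<^esub> t)"
    if "a \<in> carrier R" "b \<in> carrier R" "s \<in> S" "t \<in> S" for a b s t
    using that smult_frac by (simp add: mult_localization_regular)
  note one = one_localization_regular[of R S]
  show "cring ?L"
  proof (rule cringI)
    show "abelian_group ?L" by (rule abelian_group_localization)
    show "Group.comm_monoid ?L"
    proof (rule comm_monoidI)
      show "x \<otimes>\<^bsub>?L\<^esub> y \<in> carrier ?L" "x \<otimes>\<^bsub>?L\<^esub> y = y \<otimes>\<^bsub>?L\<^esub> x" if "x \<in> carrier ?L" "y \<in> carrier ?L" for x y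
        using that by (auto elim!: localizationE simp: mult R.m_comm)
      show "\<one>\<^bsub>?L\<^esub> \<in> carrier ?L" by (auto simp: one)
      show "\<one>\<^bsub>?L\<^esub> \<otimes>\<^bsub>?L\<^esub> x = x" if "x \<in> carrier ?L" for x
        using that by (auto elim!: localizationE simp: mult one)
      show "x \<otimes>\<^bsub>?L\<^esub> y \<otimes>\<^bsub>?L\<^esub> z = x \<otimes>\<^bsub>?L\<^esub> (y \<otimes>\<^bsub>?L\<^esub> z)"
        if "x \<in> carrier ?L" "y \<in> carrier ?L" "z \<in> carrier ?L" for x y z
        using that by (auto elim!: localizationE simp: mult R.m_assoc)
    qed
    show "(x \<oplus>\<^bsub>?L\<^esub> y) \<otimes>\<^bsub>?L\<^esub> z = x \<otimes>\<^bsub>?L\<^esub> z \<oplus>\<^bsub>?L\<^esub> y \<otimes>\<^bsub>?L\<^esub> z"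
      if xyz: "x \<in> carrier ?L" "y \<in> carrier ?L" "z \<in> carrier ?L" for x y z
    proof -
      obtain a b s where "a \<in> carrier R" "b \<in> carrier R" "s \<in> S"
        "x = frac R S (regular_module R) a s" "y = frac R S (regular_module R) b s"
        using common_denominator[OF xyz(1,2)] by auto
      moreover obtain c t where "c \<in> carrier R" "t \<in> S" "z = frac R S (regular_module R) c t"
        using localizationE[OF xyz(3)] by auto
      ultimately show ?thesis using add_frac_same by (simp add: mult R.l_distr)
    qed
  qed
qed

lemma (in module_denominators) module_localization:
  "module (localization R S (regular_module R)) (localization R S M)"
proof -
  interpret reg: module_denominators R "regular_module R" S by (rule regular_denominators)
  let ?A = "localization R S (regular_module R)" and ?L = "localization R S M"
  show ?thesis
  proof (rule moduleI)
    show "cring ?A" by (rule cring_localization[OF regular_denominators])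
    show "abelian_group ?L" by (rule abelian_group_localization)
    show "a \<odot>\<^bsub>?L\<^esub> x \<in> carrier ?L" if "a \<in> carrier ?A" "x \<in> carrier ?L" for a x
      using that by (auto elim!: localizationE reg.localizationE simp: smult_frac)
    show "\<one>\<^bsub>?A\<^esub> \<odot>\<^bsub>?L\<^esub> x = x" if "x \<in> carrier ?L" for x
      using that by (auto elim!: localizationE simp: smult_frac one_localization_regular)
    show "(a \<otimes>\<^bsub>?A\<^esub> b) \<odot>\<^bsub>?L\<^esub> x = a \<odot>\<^bsub>?L\<^esub> (b \<odot>\<^bsub>?L\<^esub> x)"
      if "a \<in> carrier ?A" "b \<in> carrier ?A" "x \<in> carrier ?L" for a b x
      using that by (auto elim!: localizationE reg.localizationE
          simp: smult_frac frac_mult[OF regular_denominators] m_assoc smult_assoc1)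
    show "(a \<oplus>\<^bsub>?A\<^esub> b) \<odot>\<^bsub>?L\<^esub> x = a \<odot>\<^bsub>?L\<^esub> x \<oplus>\<^bsub>?L\<^esub> b \<odot>\<^bsub>?L\<^esub> x"
      if abx: "a \<in> carrier ?A" "b \<in> carrier ?A" "x \<in> carrier ?L" for a b x
    proof -
      obtain c d s where "c \<in> carrier R" "d \<in> carrier R" "s \<in> S"
        "a = frac R S (regular_module R) c s" "b = frac R S (regular_module R) d s"
        using reg.common_denominator[OF abx(1,2)] by auto
      moreover obtain m t where "m \<in> carrier M" "t \<in> S" "x = frac R S M m t"
        using localizationE[OF abx(3)] by auto
      ultimately show ?thesis
        using reg.add_frac_same by (simp add: smult_frac add_frac_same smult_l_distr)
    qed
    show "a \<odot>\<^bsub>?L\<^esub> (x \<oplus>\<^bsub>?L\<^esub> y) = a \<odot>\<^bsub>?L\<^esub> x \<oplus>\<^bsub>?L\<^esub> a \<odot>\<^bsub>?L\<^esub> y"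
      if axy: "a \<in> carrier ?A" "x \<in> carrier ?L" "y \<in> carrier ?L" for a x y
    proof -
      obtain m n s where "m \<in> carrier M" "n \<in> carrier M" "s \<in> S" "x = frac R S M m s" "y = frac R S M n s"
        using common_denominator[OF axy(2,3)] by auto
      moreover obtain c t where "c \<in> carrier R" "t \<in> S" "a = frac R S (regular_module R) c t"
        using reg.localizationE[OF axy(1)] by auto
      ultimately show ?thesis by (simp add: smult_frac add_frac_same smult_r_distr)
    qed
  qed
qed

section \<open>Prime ideals and the Zariski topology\<close>

context cring
begin

text \<open>Supplies the upper bounds for Zorn's lemma in \<open>exists_prime_avoiding\<close>.
  Comparability within the chain is what makes the union closed under addition.\<close>

lemma ideal_Union_chain:
  assumes "C \<noteq> {}" "\<And>I. I \<in> C \<Longrightarrow> ideal I R" "\<And>I J. I \<in> C \<Longrightarrow> J \<in> C \<Longrightarrow> I \<subseteq> J \<or> J \<subseteq> I"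
  shows "ideal (\<Union>C) R"
proof (rule idealI[OF ring_axioms])
  note I = assms(2)[unfolded ideal_def, THEN conjunct1, THEN additive_subgroup.a_subgroup]
  show "subgroup (\<Union>C) (add_monoid R)"
  proof (rule add.subgroupI)
    show "\<Union>C \<subseteq> carrier R" using assms(2) ideal.Icarr by fast
    show "\<Union>C \<noteq> {}" using assms(1,2) additive_subgroup.zero_closed ideal.axioms(1) by fastforce
    show "\<ominus> a \<in> \<Union>C" if "a \<in> \<Union>C" for a
      using that I subgroup.m_inv_closed by (fastforce simp: a_inv_def)
    fix a b assume "a \<in> \<Union>C" "b \<in> \<Union>C"
    then obtain J where "J \<in> C" "a \<in> J" "b \<in> J" using assms(3) by blast
    then show "a \<oplus> b \<in> \<Union>C" using subgroup.m_closed[OF I, of J a b] by auto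
  qed
  fix a x assume "a \<in> \<Union>C" and x: "x \<in> carrier R"
  then obtain J where J: "J \<in> C" "a \<in> J" by blast
  then show "x \<otimes> a \<in> \<Union>C" "a \<otimes> x \<in> \<Union>C"
    using ideal.I_l_closed[OF assms(2)[OF J(1)] J(2) x] ideal.I_r_closed[OF assms(2)[OF J(1)] J(2) x] by auto
qed

text \<open>Zorn's lemma gives an ideal \<open>P\<close> that is maximal among the ideals above
  \<open>I\<close> without powers of \<open>f\<close>. If \<open>a\<close> and \<open>b\<close> lie
  outside \<open>P\<close>, then P + (a) and P + (b) contain powers of \<open>f\<close>. Their
  product is a power of \<open>f\<close> in P + (a b), so a b is not in \<open>P\<close>.\<close>

lemma exists_prime_avoiding:
  assumes I: "ideal I R" and f: "f \<in> carrier R" and n: "\<And>n::nat. f [^] n \<notin> I"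
  obtains p where "primeideal p R" "I \<subseteq> p" "f \<notin> p"
proof -
  define \<A> where "\<A> = {J. ideal J R \<and> I \<subseteq> J \<and> (\<forall>n::nat. f [^] n \<notin> J)}"
  have "\<exists>P\<in>\<A>. \<forall>X\<in>\<A>. P \<subseteq> X \<longrightarrow> X = P"
  proof (rule subset_Zorn_nonempty)
    show "\<A> \<noteq> {}" using I n by (auto simp: \<A>_def)
    fix C assume C: "C \<noteq> {}" "subset.chain \<A> C"
    have "ideal (\<Union>C) R"
      by (rule ideal_Union_chain) (use C in \<open>auto simp: subset.chain_def \<A>_def\<close>)
    then show "\<Union>C \<in> \<A>" using C by (auto simp: subset.chain_def \<A>_def)
  qed
  then obtain P where P: "P \<in> \<A>" "\<And>X. X \<in> \<A> \<Longrightarrow> P \<subseteq> X \<Longrightarrow> X = P" by auto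
  then have idP: "ideal P R" and IP: "I \<subseteq> P" and fP: "\<And>n::nat. f [^] n \<notin> P" by (auto simp: \<A>_def)
  interpret P: ideal P R by (rule idP)
  have step: "\<exists>n::nat. \<exists>m\<in>P. \<exists>r\<in>carrier R. f [^] n = m \<oplus> r \<otimes> a" if a: "a \<in> carrier R" "a \<notin> P" for a
  proof -
    have id: "ideal (P <+> PIdl a) R" by (intro add_ideals idP cgenideal_ideal a)
    have "P \<subseteq> P <+> PIdl a"
    proof
      fix x assume "x \<in> P"
      moreover have "\<zero> \<in> PIdl a" using a unfolding cgenideal_def by (intro CollectI exI[of _ \<zero>]) simp
      ultimately show "x \<in> P <+> PIdl a" using P.Icarr by (force simp: set_add_def' intro!: bexI)
    qed
    moreover have "a \<in> P <+> PIdl a"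
      unfolding set_add_def' using a cgenideal_self[OF a(1)] P.zero_closed
      by (intro UN_I[of \<zero>] UN_I[of a]) auto
    ultimately have "P <+> PIdl a \<notin> \<A>" using P(2) a(2) by blast
    with id IP \<open>P \<subseteq> P <+> PIdl a\<close> obtain n :: nat where "f [^] n \<in> P <+> PIdl a" by (auto simp: \<A>_def)
    then show ?thesis by (auto simp: set_add_def' cgenideal_def)
  qed
  have "primeideal P R"
  proof (rule primeidealI[OF idP is_cring])
    show "carrier R \<noteq> P" using fP[of 0] by auto
    fix a b assume ab: "a \<in> carrier R" "b \<in> carrier R" "a \<otimes> b \<in> P"
    show "a \<in> P \<or> b \<in> P"
    proof (rule ccontr)
      assume "\<not> (a \<in> P \<or> b \<in> P)"
      then obtain n k :: nat and m m' r r' where *: "m \<in> P" "r \<in> carrier R" "f [^] n = m \<oplus> r \<otimes> a"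
        "m' \<in> P" "r' \<in> carrier R" "f [^] k = m' \<oplus> r' \<otimes> b"
        using step[of a] step[of b] ab by blast
      have c: "m \<in> carrier R" "m' \<in> carrier R" using * P.Icarr by auto
      have "f [^] (n + k) = m \<otimes> (m' \<oplus> r' \<otimes> b) \<oplus> (r \<otimes> a) \<otimes> m' \<oplus> (r \<otimes> r') \<otimes> (a \<otimes> b)"
        using * c ab f by (simp add: nat_pow_mult[symmetric] l_distr r_distr a_ac m_ac)
      moreover have "\<dots> \<in> P"
        using * c ab P.I_r_closed[of m "m' \<oplus> r' \<otimes> b"] P.I_l_closed[of m' "r \<otimes> a"]
          P.I_l_closed[of "a \<otimes> b" "r \<otimes> r'"] by auto
      ultimately show False using fP by metis
    qed
  qed
  moreover have "f \<notin> P" using fP[of 1] f by simp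
  ultimately show thesis using IP that by blast
qed

text \<open>\<open>genideal\<close> is an intersection of ideals and does not display linear
  combinations. Instead, the elements that need only finitely many members of \<open>H\<close> form
  an ideal containing \<open>H\<close>, hence the whole ideal generated by \<open>H\<close>.\<close>

lemma mem_Idl_finite:
  assumes "H \<subseteq> carrier R" "x \<in> Idl H"
  obtains F where "finite F" "F \<subseteq> H" "x \<in> Idl F"
proof -
  define J where "J = {x. \<exists>F. finite F \<and> F \<subseteq> H \<and> x \<in> Idl F}"
  have id: "F \<subseteq> H \<Longrightarrow> ideal (Idl F) R" for F using assms(1) genideal_ideal by blast
  note sub = id[unfolded ideal_def, THEN conjunct1, THEN additive_subgroup.a_subgroup]
  have "ideal J R"
  proof (rule idealI[OF ring_axioms])
    show "subgroup J (add_monoid R)"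
    proof (rule add.subgroupI)
      show "J \<subseteq> carrier R" using ideal.Icarr[OF id] by (auto simp: J_def)
      show "J \<noteq> {}" using id[of "{}"] additive_subgroup.zero_closed ideal.axioms(1) unfolding J_def by blast
      show "\<ominus> a \<in> J" if "a \<in> J" for a
        using that subgroup.m_inv_closed[OF sub] by (auto simp: J_def a_inv_def)
      fix a b assume "a \<in> J" "b \<in> J"
      then obtain F G where FG: "finite F" "F \<subseteq> H" "a \<in> Idl F" "finite G" "G \<subseteq> H" "b \<in> Idl G"
        by (auto simp: J_def)
      then have "F \<union> G \<subseteq> H" "F \<union> G \<subseteq> carrier R" using assms(1) by auto
      then have "a \<in> Idl (F \<union> G)" "b \<in> Idl (F \<union> G)"
        using FG subset_Idl_subset[of "F \<union> G" F] subset_Idl_subset[of "F \<union> G" G] by auto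
      then have "a \<oplus> b \<in> Idl (F \<union> G)" using subgroup.m_closed[OF sub, of "F \<union> G" a b] \<open>F \<union> G \<subseteq> H\<close> by simp
      then show "a \<oplus> b \<in> J" using FG \<open>F \<union> G \<subseteq> H\<close> unfolding J_def by blast
    qed
    fix a x assume "a \<in> J" and x: "x \<in> carrier R"
    then obtain F where F: "finite F" "F \<subseteq> H" "a \<in> Idl F" by (auto simp: J_def)
    then show "x \<otimes> a \<in> J" "a \<otimes> x \<in> J"
      using ideal.I_l_closed[OF id[OF F(2)] F(3) x] ideal.I_r_closed[OF id[OF F(2)] F(3) x]
      by (auto simp: J_def)
  qed
  moreover have "H \<subseteq> J"
  proof
    fix h assume "h \<in> H"
    then show "h \<in> J" using assms(1) genideal_self[of "{h}"] unfolding J_def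
      by (intro CollectI exI[of _ "{h}"]) auto
  qed
  ultimately have "Idl H \<subseteq> J" by (rule genideal_minimal)
  then show thesis using that assms(2) by (auto simp: J_def)
qed

section \<open>Covers by basic open sets as ideal membership\<close>

lemma mem_Idl_if_basic_open_subset:
  assumes "H \<subseteq> carrier R" "f \<in> carrier R" "basic_open R f \<subseteq> (\<Union>h\<in>H. basic_open R h)"
  obtains n :: nat where "f [^] n \<in> Idl H"
proof (rule ccontr)
  assume "\<not> thesis"
  then have "\<And>n::nat. f [^] n \<notin> Idl H" using that by blast
  \<comment> \<open>Such a prime is a point of D(f) that lies in none of the D(h).\<close>
  then obtain p where p: "primeideal p R" "Idl H \<subseteq> p" "f \<notin> p"
    using exists_prime_avoiding[OF genideal_ideal[OF assms(1)] assms(2)] by blast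
  then have "p \<in> basic_open R f" by (simp add: basic_open_def spec_def)
  moreover have "H \<subseteq> p" using p(2) genideal_self[OF assms(1)] by blast
  ultimately show False using assms(3) by (auto simp: basic_open_def)
qed

text \<open>A prime missing \<open>f\<close> misses every power of \<open>f\<close>. It therefore
  cannot contain the ideal generated by \<open>H\<close>, and so it misses some element of
  \<open>H\<close>.\<close>

lemma basic_open_subset_if_mem_Idl:
  assumes "H \<subseteq> carrier R" "f \<in> carrier R" "f [^] (n::nat) \<in> Idl H"
  shows "basic_open R f \<subseteq> (\<Union>h\<in>H. basic_open R h)"
proof
  fix p assume p: "p \<in> basic_open R f"
  then interpret p: primeideal p R by (simp add: basic_open_def spec_def)
  have "f [^] n \<notin> p"
  proof (induction n)
    case 0 then show ?case using p.I_notcarr p.one_imp_carrier by auto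
  next
    case (Suc n) then show ?case using p p.I_prime[of "f [^] n" f] assms(2) by (auto simp: basic_open_def)
  qed
  then have "\<not> H \<subseteq> p" using genideal_minimal[OF p.is_ideal] assms(3) by blast
  then show "p \<in> (\<Union>h\<in>H. basic_open R h)" using p by (auto simp: basic_open_def)
qed

lemma basic_open_one: "basic_open R \<one> = spec R"
proof -
  have "\<one> \<notin> p" if "primeideal p R" for p
  proof -
    interpret primeideal p R by fact
    show ?thesis using I_notcarr one_imp_carrier by auto
  qed
  then show ?thesis by (auto simp: basic_open_def spec_def)
qed

lemma basic_open_mult:
  assumes "f \<in> carrier R" "h \<in> carrier R"
  shows "basic_open R (f \<otimes> h) = basic_open R f \<inter> basic_open R h"
proof -
  have "f \<otimes> h \<in> p \<longleftrightarrow> f \<in> p \<or> h \<in> p" if "p \<in> spec R" for p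
  proof -
    interpret primeideal p R using that by (simp add: spec_def)
    show ?thesis
      using I_prime[OF assms] I_l_closed[OF _ assms(1), of h] I_r_closed[OF _ assms(2), of f] by blast
  qed
  then show ?thesis by (auto simp: basic_open_def)
qed

lemma basic_open_subset_spec: "basic_open R f \<subseteq> spec R"
  by (auto simp: basic_open_def)

text \<open>Only an inclusion, since the exponent 0 gives all of Spec; \<open>basic_open_Suc\<close>
  has the equality for positive exponents.\<close>

lemma basic_open_pow_subset: "f \<in> carrier R \<Longrightarrow> basic_open R f \<subseteq> basic_open R (f [^] (n::nat))"
  by (induction n) (auto simp: basic_open_one basic_open_mult basic_open_subset_spec)

lemma basic_open_Suc: "f \<in> carrier R \<Longrightarrow> basic_open R (f [^] Suc n) = basic_open R f"
  using basic_open_pow_subset[of f n] by (auto simp: basic_open_mult)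

lemma openin_basic_open: "f \<in> carrier R \<Longrightarrow> openin (zariski R) (basic_open R f)"
  unfolding openin_zariski zariski_open_def
  by (rule exI[of _ "{f}"]) (auto simp: basic_open_def)

lemma openin_zariski_subset: "openin (zariski R) U \<Longrightarrow> U \<subseteq> spec R"
  by (auto simp: openin_zariski zariski_open_def)

lemma openin_spec: "openin (zariski R) (spec R)"
  using openin_basic_open[OF one_closed] by (simp add: basic_open_one)

lemma topspace_zariski: "topspace (zariski R) = spec R"
  using openin_zariski_subset openin_spec by (metis openin_subset openin_topspace subset_antisym)

lemma basic_open_basis:
  assumes "openin (zariski R) U" "p \<in> U"
  obtains h where "h \<in> carrier R" "p \<in> basic_open R h" "basic_open R h \<subseteq> U"
proof -
  obtain E where E: "E \<subseteq> carrier R" "U = {p \<in> spec R. \<not> E \<subseteq> p}"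
    using assms(1) by (auto simp: openin_zariski zariski_open_def)
  then obtain h where "h \<in> E" "h \<notin> p" using assms(2) by auto
  then show thesis using E assms(2) by (intro that[of h]) (auto simp: basic_open_def)
qed

lemma compact_space_zariski: "compact_space (zariski R)"
  unfolding compact_space_alt
proof (intro allI impI, elim conjE)
  fix \<U> assume \<U>: "\<forall>U\<in>\<U>. openin (zariski R) U" "topspace (zariski R) \<subseteq> \<Union>\<U>"
  \<comment> \<open>The cover is refined by basic open sets, for which covering is a statement about
    the ideal generated by \<open>H\<close>: membership of 1 in it involves finitely many elements
    of \<open>H\<close> only.\<close>
  define H where "H = {h \<in> carrier R. \<exists>U\<in>\<U>. basic_open R h \<subseteq> U}"
  have H: "H \<subseteq> carrier R" by (auto simp: H_def)
  have "basic_open R \<one> \<subseteq> (\<Union>h\<in>H. basic_open R h)"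
  proof
    fix p assume "p \<in> basic_open R \<one>"
    then obtain U where U: "U \<in> \<U>" "p \<in> U" using \<U>(2) by (auto simp: topspace_zariski basic_open_one)
    then obtain h where "h \<in> carrier R" "p \<in> basic_open R h" "basic_open R h \<subseteq> U"
      using \<U>(1) basic_open_basis by blast
    then show "p \<in> (\<Union>h\<in>H. basic_open R h)" using U by (auto simp: H_def)
  qed
  then obtain n :: nat where "\<one> [^] n \<in> Idl H" using mem_Idl_if_basic_open_subset[OF H one_closed] by blast
  then obtain F where F: "finite F" "F \<subseteq> H" "\<one> [^] n \<in> Idl F" using mem_Idl_finite[OF H] by blast
  then have cover: "spec R \<subseteq> (\<Union>h\<in>F. basic_open R h)"
    using basic_open_subset_if_mem_Idl[of F \<one> n] H basic_open_one by auto
  obtain W where W: "\<And>h. h \<in> H \<Longrightarrow> W h \<in> \<U> \<and> basic_open R h \<subseteq> W h"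
    using bchoice[of H "\<lambda>h U. U \<in> \<U> \<and> basic_open R h \<subseteq> U"] unfolding H_def by blast
  show "\<exists>\<F>. finite \<F> \<and> \<F> \<subseteq> \<U> \<and> topspace (zariski R) \<subseteq> \<Union>\<F>"
  proof (intro exI[of _ "W ` F"] conjI)
    show "W ` F \<subseteq> \<U>" using F(2) W by auto
    show "topspace (zariski R) \<subseteq> \<Union>(W ` F)" unfolding topspace_zariski
    proof
      fix p assume "p \<in> spec R"
      then obtain h where h: "h \<in> F" "p \<in> basic_open R h" using cover by blast
      then have "p \<in> W h" using W[of h] F(2) by auto
      then show "p \<in> \<Union>(W ` F)" using h(1) by blast
    qed
  qed (use F in simp)
qed

end

lemma (in module) prime_denominators:
  assumes "p \<in> spec R"
  shows "module_denominators R M (carrier R - p)"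
proof -
  interpret p: primeideal p R using assms by (simp add: spec_def)
  show ?thesis
    by unfold_locales (use p.I_notcarr p.one_imp_carrier p.I_prime in auto)
qed

lemma (in module) powers_denominators:
  assumes "f \<in> carrier R"
  shows "module_denominators R M (powers R f)"
  by unfold_locales
    (use assms in \<open>auto simp: powers_def nat_pow_mult intro: exI[of _ "0::nat"]\<close>)

section \<open>Sections of the sheaf associated to a module\<close>

text \<open>The germ m/f is meaningful where \<open>f\<close> is invertible, hence the recurring
  hypothesis that \<open>U\<close> lies in \<open>basic_open R f\<close>.\<close>

definition fraction_section ::
    "('r, 'c) ring_scheme \<Rightarrow> ('r, 'm, 'd) module_scheme \<Rightarrow> 'r set set \<Rightarrow> 'm \<Rightarrow> 'r \<Rightarrow> ('r, 'm) sections"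
  where "fraction_section R M U m f = (\<lambda>p\<in>U. frac R (carrier R - p) M m f)"

lemma to_sections_eq_fraction_section:
  "to_sections R U r = fraction_section R (regular_module R) U r \<one>\<^bsub>R\<^esub>"
  by (simp add: to_sections_def fraction_section_def)

lemma restrict_fraction_section:
  "V \<subseteq> U \<Longrightarrow> restrict (fraction_section R M U m f) V = fraction_section R M V m f"
  by (intro ext) (auto simp: fraction_section_def)

text \<open>Each member of a finite cover yields its own exponent; as exponents may be increased,
  the maximum serves all of them. The increase has the form n + k because it arises from
  multiplication by a further power.\<close>

lemma finite_common_bound:
  assumes "finite F" "\<And>x. x \<in> F \<Longrightarrow> \<exists>n. P x n" "\<And>x n k. x \<in> F \<Longrightarrow> P x n \<Longrightarrow> P x (n + k :: nat)"
  shows "\<exists>N. \<forall>x\<in>F. P x N"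
proof -
  obtain b where b: "\<And>x. x \<in> F \<Longrightarrow> P x (b x)" using assms(2) by metis
  have "P x (Max (b ` F))" if "x \<in> F" for x
  proof -
    have "b x \<le> Max (b ` F)" using that assms(1) by simp
    then show ?thesis using assms(3)[OF that b[OF that]] by (metis le_add_diff_inverse)
  qed
  then show ?thesis by blast
qed

text \<open>Describes the sheaf of \<open>L\<close> inside that of \<open>M\<close> without treating
  \<open>L\<close> as a module of its own: over an open set it is \<open>tilde_sub\<close> for a
  submodule \<open>L\<close>, and the carrier of \<open>tilde\<close> for
  \<open>L = carrier M\<close>. One \<open>h\<close> serves as denominator and as
  neighbourhood.\<close>

definition local_fractions ::
    "('r, 'c) ring_scheme \<Rightarrow> ('r, 'm, 'd) module_scheme \<Rightarrow> 'm set \<Rightarrow> 'r set set \<Rightarrow> ('r, 'm) sections set"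
  where "local_fractions R M L U = {s \<in> extensional U.
    \<forall>p\<in>U. \<exists>h\<in>carrier R. \<exists>m\<in>L. p \<in> basic_open R h \<and> basic_open R h \<subseteq> U \<and>
      (\<forall>q\<in>basic_open R h. s q = frac R (carrier R - q) M m h)}"

lemma local_fractionsI:
  assumes "s \<in> extensional U"
    and "\<And>p. p \<in> U \<Longrightarrow> \<exists>h\<in>carrier R. \<exists>m\<in>L. p \<in> basic_open R h \<and> basic_open R h \<subseteq> U \<and>
      (\<forall>q\<in>basic_open R h. s q = frac R (carrier R - q) M m h)"
  shows "s \<in> local_fractions R M L U"
  using assms by (simp add: local_fractions_def)

lemma local_fractionsE:
  assumes "s \<in> local_fractions R M L U" "p \<in> U"
  obtains h m where "h \<in> carrier R" "m \<in> L" "p \<in> basic_open R h" "basic_open R h \<subseteq> U"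
    "\<And>q. q \<in> basic_open R h \<Longrightarrow> s q = frac R (carrier R - q) M m h"
  using assms unfolding local_fractions_def by auto

context module
begin

lemma smult_commute:
  "a \<in> carrier R \<Longrightarrow> b \<in> carrier R \<Longrightarrow> x \<in> carrier M \<Longrightarrow> a \<odot>\<^bsub>M\<^esub> (b \<odot>\<^bsub>M\<^esub> x) = b \<odot>\<^bsub>M\<^esub> (a \<odot>\<^bsub>M\<^esub> x)"
  by (metis m_comm smult_assoc1)

lemma basic_openD: "p \<in> basic_open R f \<Longrightarrow> p \<in> spec R" "p \<in> basic_open R f \<Longrightarrow> f \<notin> p"
  by (auto simp: basic_open_def)

lemma pow_smult_eq_mono:
  assumes "f \<in> carrier R" "x \<in> carrier M" "y \<in> carrier M" "f [^] (k::nat) \<odot>\<^bsub>M\<^esub> x = f [^] k \<odot>\<^bsub>M\<^esub> y"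
  shows "f [^] (k + j) \<odot>\<^bsub>M\<^esub> x = f [^] (k + j) \<odot>\<^bsub>M\<^esub> y"
proof -
  have "f [^] (k + j) \<odot>\<^bsub>M\<^esub> z = f [^] j \<odot>\<^bsub>M\<^esub> (f [^] k \<odot>\<^bsub>M\<^esub> z)" if "z \<in> carrier M" for z
    using that assms(1) by (simp add: smult_assoc1[symmetric] nat_pow_mult add.commute)
  then show ?thesis using assms by simp
qed

lemma frac_eq_at_primeI:
  assumes "p \<in> spec R" "m \<in> carrier M" "n \<in> carrier M" "s \<in> carrier R - p" "t \<in> carrier R - p"
    and "u \<in> carrier R - p" "u \<odot>\<^bsub>M\<^esub> (t \<odot>\<^bsub>M\<^esub> m) = u \<odot>\<^bsub>M\<^esub> (s \<odot>\<^bsub>M\<^esub> n)"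
  shows "frac R (carrier R - p) M m s = frac R (carrier R - p) M n t"
  using module_denominators.frac_eq_iff[OF prime_denominators[OF assms(1)] assms(2-5)] assms(6,7) by blast

lemma ideal_equalizer:
  assumes "x \<in> carrier M" "y \<in> carrier M"
  shows "ideal {a \<in> carrier R. a \<odot>\<^bsub>M\<^esub> x = a \<odot>\<^bsub>M\<^esub> y} R"
proof (rule idealI[OF R.ring_axioms])
  show "subgroup {a \<in> carrier R. a \<odot>\<^bsub>M\<^esub> x = a \<odot>\<^bsub>M\<^esub> y} (add_monoid R)"
    by (rule R.add.subgroupI) (use assms in \<open>auto simp: smult_l_distr smult_l_minus a_inv_def[symmetric] intro: exI[of _ \<zero>]\<close>)
  fix a b assume "a \<in> {a \<in> carrier R. a \<odot>\<^bsub>M\<^esub> x = a \<odot>\<^bsub>M\<^esub> y}" "b \<in> carrier R"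
  then show "b \<otimes> a \<in> {a \<in> carrier R. a \<odot>\<^bsub>M\<^esub> x = a \<odot>\<^bsub>M\<^esub> y}"
    and "a \<otimes> b \<in> {a \<in> carrier R. a \<odot>\<^bsub>M\<^esub> x = a \<odot>\<^bsub>M\<^esub> y}"
    using assms by (auto simp: smult_assoc1 smult_commute[of a b])
qed

text \<open>The elements \<open>a\<close> with \<open>a t m = a s n\<close> form an ideal. If it
  contained no power of \<open>f\<close>, it would lie in a prime missing \<open>f\<close>; but
  equality of the germs at this prime puts an element outside the prime into the ideal.\<close>

lemma frac_eq_on_basic_open:
  assumes m: "m \<in> carrier M" "n \<in> carrier M" "f \<in> carrier R" "s \<in> carrier R" "t \<in> carrier R"
    and sub: "basic_open R f \<subseteq> basic_open R s" "basic_open R f \<subseteq> basic_open R t"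
    and eq: "\<And>q. q \<in> basic_open R f \<Longrightarrow> frac R (carrier R - q) M m s = frac R (carrier R - q) M n t"
  obtains k :: nat where "f [^] k \<odot>\<^bsub>M\<^esub> (t \<odot>\<^bsub>M\<^esub> m) = f [^] k \<odot>\<^bsub>M\<^esub> (s \<odot>\<^bsub>M\<^esub> n)"
proof (rule ccontr)
  assume *: "\<not> thesis"
  let ?I = "{a \<in> carrier R. a \<odot>\<^bsub>M\<^esub> (t \<odot>\<^bsub>M\<^esub> m) = a \<odot>\<^bsub>M\<^esub> (s \<odot>\<^bsub>M\<^esub> n)}"
  have "ideal ?I R" using m by (intro ideal_equalizer) auto
  moreover have "\<And>k::nat. f [^] k \<notin> ?I" using * that by blast
  ultimately obtain p where p: "primeideal p R" "?I \<subseteq> p" "f \<notin> p"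
    using R.exists_prime_avoiding[OF _ m(3)] by blast
  then have pf: "p \<in> basic_open R f" by (simp add: basic_open_def spec_def)
  then interpret loc: module_denominators R M "carrier R - p" by (intro prime_denominators basic_openD)
  have "s \<in> carrier R - p" "t \<in> carrier R - p" using pf sub m basic_openD by blast+
  then obtain u where "u \<in> carrier R - p" "u \<odot>\<^bsub>M\<^esub> (t \<odot>\<^bsub>M\<^esub> m) = u \<odot>\<^bsub>M\<^esub> (s \<odot>\<^bsub>M\<^esub> n)"
    using loc.frac_eq_iff[OF m(1,2)] eq[OF pf] by auto
  then show False using p(2) by blast
qed

lemma mem_tilde_iff:
  assumes U: "openin (zariski R) U"
  shows "s \<in> carrier (tilde R M U) \<longleftrightarrow> s \<in> extensional U \<and>
    (\<forall>p\<in>U. \<exists>h\<in>carrier R. \<exists>m\<in>carrier M. p \<in> basic_open R h \<and> basic_open R h \<subseteq> U \<and>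
      (\<forall>q\<in>basic_open R h. s q = frac R (carrier R - q) M m h))" (is "?l \<longleftrightarrow> ?r")
proof
  assume l: ?l
  have "\<exists>h\<in>carrier R. \<exists>m\<in>carrier M. p \<in> basic_open R h \<and> basic_open R h \<subseteq> U \<and>
      (\<forall>q\<in>basic_open R h. s q = frac R (carrier R - q) M m h)" if "p \<in> U" for p
  proof -
    have "\<exists>V m f. openin (zariski R) V \<and> p \<in> V \<and> V \<subseteq> U \<and> m \<in> carrier M \<and> f \<in> carrier R \<and>
          (\<forall>q\<in>V. f \<notin> q \<and> s q = frac R (carrier R - q) M m f)"
      using l that by (simp add: tilde_def)
    then obtain V m f where V: "openin (zariski R) V" "p \<in> V" "V \<subseteq> U" and c: "m \<in> carrier M" "f \<in> carrier R"
      and s: "\<And>q. q \<in> V \<Longrightarrow> f \<notin> q \<and> s q = frac R (carrier R - q) M m f"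
      by auto
    obtain k where k: "k \<in> carrier R" "p \<in> basic_open R k" "basic_open R k \<subseteq> V"
      using R.basic_open_basis[OF V(1,2)] by blast
    \<comment> \<open>On D(k) the germ m/f equals (k m)/(k f), and D(k f) = D(k). So
      \<open>k f\<close> is at once denominator and neighbourhood.\<close>
    have eq: "basic_open R (k \<otimes> f) = basic_open R k"
    proof -
      have "basic_open R k \<subseteq> basic_open R f"
        using s k R.basic_open_subset_spec[of k] by (auto simp: basic_open_def)
      then show ?thesis using k c by (auto simp: R.basic_open_mult)
    qed
    show ?thesis
    proof (intro bexI conjI ballI)
      show "p \<in> basic_open R (k \<otimes> f)" "basic_open R (k \<otimes> f) \<subseteq> U" using eq k V by auto
      fix q assume "q \<in> basic_open R (k \<otimes> f)"
      then have q: "q \<in> basic_open R k" using eq by simp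
      then interpret loc: module_denominators R M "carrier R - q" by (intro prime_denominators basic_openD)
      show "s q = frac R (carrier R - q) M (k \<odot>\<^bsub>M\<^esub> m) (k \<otimes> f)"
        using s[of q] q k c basic_openD by (subst loc.frac_cancel) auto
    qed (use k c in auto)
  qed
  then show ?r using l by (auto simp: tilde_def PiE_def)
next
  assume r: ?r
  have "s p \<in> carrier (stalk_at R M p)" if p: "p \<in> U" for p
  proof -
    obtain h m where h: "h \<in> carrier R" "m \<in> carrier M" "p \<in> basic_open R h"
      "s p = frac R (carrier R - p) M m h" using bspec[OF conjunct2[OF r] p] by auto
    then interpret loc: module_denominators R M "carrier R - p" by (intro prime_denominators basic_openD)
    show ?thesis using h basic_openD by (auto simp: stalk_at_def)
  qed
  moreover have "\<exists>V m f. openin (zariski R) V \<and> p \<in> V \<and> V \<subseteq> U \<and> m \<in> carrier M \<and> f \<in> carrier R \<and>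
          (\<forall>q\<in>V. f \<notin> q \<and> s q = frac R (carrier R - q) M m f)" if p: "p \<in> U" for p
  proof -
    obtain h m where h: "h \<in> carrier R" "m \<in> carrier M" "p \<in> basic_open R h" "basic_open R h \<subseteq> U"
      "\<forall>q\<in>basic_open R h. s q = frac R (carrier R - q) M m h" using bspec[OF conjunct2[OF r] p] by auto
    then show ?thesis
      by (intro exI[of _ "basic_open R h"] exI[of _ m] exI[of _ h])
        (auto simp: R.openin_basic_open dest: basic_openD)
  qed
  ultimately show ?l using r by (auto simp: tilde_def PiE_def)
qed

lemma tilde_extensional: "s \<in> carrier (tilde R M U) \<Longrightarrow> s \<in> extensional U"
  by (simp add: tilde_def PiE_def)

lemma tilde_in_stalk: "s \<in> carrier (tilde R M U) \<Longrightarrow> p \<in> U \<Longrightarrow> s p \<in> carrier (localization R (carrier R - p) M)"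
  by (auto simp: tilde_def stalk_at_def)

lemma tilde_locally:
  assumes "openin (zariski R) U" "s \<in> carrier (tilde R M U)" "p \<in> U"
  obtains h m where "h \<in> carrier R" "m \<in> carrier M" "p \<in> basic_open R h" "basic_open R h \<subseteq> U"
    "\<And>q. q \<in> basic_open R h \<Longrightarrow> s q = frac R (carrier R - q) M m h"
  using assms by (auto simp: mem_tilde_iff)

lemma carrier_tilde: "openin (zariski R) U \<Longrightarrow> carrier (tilde R M U) = local_fractions R M (carrier M) U"
  using mem_tilde_iff by (auto simp: local_fractions_def)

lemma submodule_subset: "submodule L R M \<Longrightarrow> L \<subseteq> carrier M"
  by (rule submoduleE(1))

lemma fraction_section_in_local_fractions:
  assumes L: "submodule L R M" and U: "openin (zariski R) U" "U \<subseteq> basic_open R f" and l: "l \<in> L" "f \<in> carrier R"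
  shows "fraction_section R M U l f \<in> local_fractions R M L U"
proof (rule local_fractionsI)
  show "fraction_section R M U l f \<in> extensional U" by (simp add: fraction_section_def)
  fix p assume "p \<in> U"
  then obtain h where h: "h \<in> carrier R" "p \<in> basic_open R h" "basic_open R h \<subseteq> U"
    using R.basic_open_basis[OF U(1)] by blast
  have lM: "l \<in> carrier M" using l submodule_subset[OF L] by auto
  have eq: "basic_open R (h \<otimes> f) = basic_open R h" using h U l by (auto simp: R.basic_open_mult)
  show "\<exists>h\<in>carrier R. \<exists>m'\<in>L. p \<in> basic_open R h \<and> basic_open R h \<subseteq> U \<and>
      (\<forall>q\<in>basic_open R h. fraction_section R M U l f q = frac R (carrier R - q) M m' h)"
  proof (intro bexI conjI ballI)
    show "p \<in> basic_open R (h \<otimes> f)" "basic_open R (h \<otimes> f) \<subseteq> U" using eq h by auto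
    show "h \<odot>\<^bsub>M\<^esub> l \<in> L" using submodule.smult_closed[OF L h(1) l(1)] .
    fix q assume "q \<in> basic_open R (h \<otimes> f)"
    then have q: "q \<in> basic_open R h" "q \<in> basic_open R f" using eq h U by auto
    then interpret loc: module_denominators R M "carrier R - q" by (intro prime_denominators basic_openD)
    show "fraction_section R M U l f q = frac R (carrier R - q) M (h \<odot>\<^bsub>M\<^esub> l) (h \<otimes> f)"
      using q h lM l basic_openD[of q] loc.frac_cancel[of l f h] by (auto simp: fraction_section_def)
  qed (use h l in auto)
qed

text \<open>A test for membership in which neighbourhood and denominator are tied together only by
  invertibility of \<open>g\<close> on \<open>V\<close>; it absorbs the passage to a common
  \<open>h\<close>.\<close>

lemma local_fractionsI_open:
  assumes L: "submodule L R M" and s: "s \<in> extensional U"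
    and loc: "\<And>p. p \<in> U \<Longrightarrow> \<exists>V m g. openin (zariski R) V \<and> p \<in> V \<and> V \<subseteq> U \<and> V \<subseteq> basic_open R g \<and> m \<in> L \<and> g \<in> carrier R
      \<and> (\<forall>q\<in>V. s q = frac R (carrier R - q) M m g)"
  shows "s \<in> local_fractions R M L U"
proof (rule local_fractionsI[OF s])
  fix p assume "p \<in> U"
  then obtain V m g where V: "openin (zariski R) V" "p \<in> V" "V \<subseteq> U" "V \<subseteq> basic_open R g" "m \<in> L" "g \<in> carrier R"
    and sV: "\<And>q. q \<in> V \<Longrightarrow> s q = frac R (carrier R - q) M m g" using loc by metis
  obtain h m' where h: "h \<in> carrier R" "m' \<in> L" "p \<in> basic_open R h" "basic_open R h \<subseteq> V"
    and *: "\<And>q. q \<in> basic_open R h \<Longrightarrow> fraction_section R M V m g q = frac R (carrier R - q) M m' h"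
    using local_fractionsE[OF fraction_section_in_local_fractions[OF L V(1,4,5,6)] V(2)] by metis
  have "s q = frac R (carrier R - q) M m' h" if "q \<in> basic_open R h" for q
    using *[OF that] sV[of q] that h(4) by (auto simp: fraction_section_def)
  then show "\<exists>h\<in>carrier R. \<exists>m\<in>L. p \<in> basic_open R h \<and> basic_open R h \<subseteq> U \<and>
      (\<forall>q\<in>basic_open R h. s q = frac R (carrier R - q) M m h)" using h V by blast
qed

lemma restrict_local_fractions:
  assumes L: "submodule L R M" and U: "openin (zariski R) V" "V \<subseteq> U" and s: "s \<in> local_fractions R M L U"
  shows "restrict s V \<in> local_fractions R M L V"
proof (rule local_fractionsI_open[OF L])
  show "restrict s V \<in> extensional V" by simp
  fix p assume p: "p \<in> V"
  obtain h m where h: "h \<in> carrier R" "m \<in> L" "p \<in> basic_open R h" "basic_open R h \<subseteq> U"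
    "\<And>q. q \<in> basic_open R h \<Longrightarrow> s q = frac R (carrier R - q) M m h"
    using local_fractionsE[OF s] p U(2) by (metis subsetD)
  then show "\<exists>W m g. openin (zariski R) W \<and> p \<in> W \<and> W \<subseteq> V \<and> W \<subseteq> basic_open R g \<and> m \<in> L \<and> g \<in> carrier R \<and>
      (\<forall>q\<in>W. restrict s V q = frac R (carrier R - q) M m g)"
    using p U(1) R.openin_basic_open
    by (intro exI[of _ "V \<inter> basic_open R h"] exI[of _ m] exI[of _ h]) auto
qed

lemma fraction_section_in_tilde:
  assumes "openin (zariski R) U" "U \<subseteq> basic_open R f" "m \<in> carrier M" "f \<in> carrier R"
  shows "fraction_section R M U m f \<in> carrier (tilde R M U)"
  using fraction_section_in_local_fractions[OF carrier_is_submodule assms] carrier_tilde[OF assms(1)] by simp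

lemma restrict_in_tilde:
  assumes "openin (zariski R) U" "openin (zariski R) V" "V \<subseteq> U" "s \<in> carrier (tilde R M U)"
  shows "restrict s V \<in> carrier (tilde R M V)"
  using restrict_local_fractions[OF carrier_is_submodule assms(2,3)] assms carrier_tilde by simp

text \<open>Being a fraction near each point is a local condition. Compatibility on overlaps is
  built into the single function \<open>s\<close>, because restriction of sections is restriction of
  functions.\<close>

lemma tilde_glue:
  assumes "\<And>U. U \<in> \<U> \<Longrightarrow> openin (zariski R) U" "s \<in> extensional (\<Union>\<U>)"
    "\<And>U. U \<in> \<U> \<Longrightarrow> restrict s U \<in> carrier (tilde R M U)"
  shows "s \<in> carrier (tilde R M (\<Union>\<U>))"
proof -
  have o: "openin (zariski R) (\<Union>\<U>)" using assms(1) by blast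
  show ?thesis
    unfolding mem_tilde_iff[OF o]
  proof (intro conjI ballI assms(2))
    fix p assume "p \<in> \<Union>\<U>"
    then obtain U where U: "U \<in> \<U>" "p \<in> U" by blast
    obtain h m where h: "h \<in> carrier R" "m \<in> carrier M" "p \<in> basic_open R h" "basic_open R h \<subseteq> U"
      "\<And>q. q \<in> basic_open R h \<Longrightarrow> restrict s U q = frac R (carrier R - q) M m h"
      using tilde_locally[OF assms(1)[OF U(1)] assms(3)[OF U(1)] U(2)] by metis
    then have "\<And>q. q \<in> basic_open R h \<Longrightarrow> s q = frac R (carrier R - q) M m h"
      by (metis restrict_apply' subsetD)
    then show "\<exists>h\<in>carrier R. \<exists>m\<in>carrier M. p \<in> basic_open R h \<and> basic_open R h \<subseteq> \<Union>\<U> \<and>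
      (\<forall>q\<in>basic_open R h. s q = frac R (carrier R - q) M m h)" using h U by blast
  qed
qed

text \<open>The numerators that solve the gluing equations form an ideal; since it contains the
  denominators of the given local fractions, it contains a power of \<open>f\<close>.\<close>

lemma tilde_basic_openE:
  assumes f: "f \<in> carrier R" and s: "s \<in> carrier (tilde R M (basic_open R f))"
  obtains m and n :: nat where "m \<in> carrier M" "s = fraction_section R M (basic_open R f) m (f [^] n)"
proof -
  let ?D = "basic_open R"
  define H where "H = {h \<in> carrier R. ?D h \<subseteq> ?D f \<and> (\<exists>m\<in>carrier M. \<forall>q\<in>?D h. s q = frac R (carrier R - q) M m h)}"
  have H: "H \<subseteq> carrier R" by (auto simp: H_def)
  have "?D f \<subseteq> (\<Union>h\<in>H. ?D h)"
  proof
    fix p assume "p \<in> ?D f"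
    then obtain h m where h: "h \<in> carrier R" "m \<in> carrier M" "p \<in> ?D h" "?D h \<subseteq> ?D f"
      "\<And>q. q \<in> ?D h \<Longrightarrow> s q = frac R (carrier R - q) M m h"
      using tilde_locally[OF R.openin_basic_open[OF f] s] by metis
    then have "h \<in> H" by (auto simp: H_def)
    then show "p \<in> (\<Union>h\<in>H. ?D h)" using h(3) by blast
  qed
  then obtain n0 :: nat where "f [^] n0 \<in> Idl H" using R.mem_Idl_if_basic_open_subset[OF H f] by blast
  then obtain F where F: "finite F" "F \<subseteq> H" and n0: "f [^] n0 \<in> Idl F" using R.mem_Idl_finite[OF H] by blast
  have FR: "F \<subseteq> carrier R" using F H by auto
  obtain \<mu> where \<mu>: "\<And>h. h \<in> F \<Longrightarrow> \<mu> h \<in> carrier M \<and> (\<forall>q\<in>?D h. s q = frac R (carrier R - q) M (\<mu> h) h)"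
  proof -
    have "\<forall>h\<in>F. \<exists>m. m \<in> carrier M \<and> (\<forall>q\<in>?D h. s q = frac R (carrier R - q) M m h)"
      using F(2) by (auto simp: H_def)
    from bchoice[OF this] obtain \<mu> where
      "\<forall>h\<in>F. \<mu> h \<in> carrier M \<and> (\<forall>q\<in>?D h. s q = frac R (carrier R - q) M (\<mu> h) h)" ..
    then show thesis by (intro that) blast
  qed
  have hR: "h \<in> carrier R" if "h \<in> F" for h using that FR by auto
  have \<mu>M: "\<mu> h \<in> carrier M" if "h \<in> F" for h using \<mu>[OF that] by simp
  define E where "E = (\<lambda>x n. (fst x \<otimes> snd x) [^] (n::nat) \<odot>\<^bsub>M\<^esub> (snd x \<odot>\<^bsub>M\<^esub> \<mu> (fst x))
      = (fst x \<otimes> snd x) [^] n \<odot>\<^bsub>M\<^esub> (fst x \<odot>\<^bsub>M\<^esub> \<mu> (snd x)))"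
  have "\<exists>N. \<forall>x\<in>F \<times> F. E x N"
  proof (rule finite_common_bound)
    show "finite (F \<times> F)" using F by simp
    fix x assume "x \<in> F \<times> F"
    then obtain h k where x: "x = (h, k)" "h \<in> F" "k \<in> F" by auto
    have D: "?D (h \<otimes> k) = ?D h \<inter> ?D k" using x hR by (simp add: R.basic_open_mult)
    obtain n :: nat where "(h \<otimes> k) [^] n \<odot>\<^bsub>M\<^esub> (k \<odot>\<^bsub>M\<^esub> \<mu> h) = (h \<otimes> k) [^] n \<odot>\<^bsub>M\<^esub> (h \<odot>\<^bsub>M\<^esub> \<mu> k)"
    proof (rule frac_eq_on_basic_open[of "\<mu> h" "\<mu> k" "h \<otimes> k" h k])
      fix q assume "q \<in> ?D (h \<otimes> k)"
      then have "q \<in> ?D h" "q \<in> ?D k" using D by auto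
      then show "frac R (carrier R - q) M (\<mu> h) h = frac R (carrier R - q) M (\<mu> k) k"
        using \<mu>[OF x(2)] \<mu>[OF x(3)] by metis
    qed (use x hR \<mu>M D in auto)
    then show "\<exists>n. E x n" using x by (auto simp: E_def)
  next
    fix x and n k :: nat
    assume "x \<in> F \<times> F" "E x n"
    then show "E x (n + k)"
      using hR \<mu>M unfolding E_def by (intro pow_smult_eq_mono) auto
  qed
  then obtain N where N: "\<And>x. x \<in> F \<times> F \<Longrightarrow> E x N" by blast
  \<comment> \<open>Writing \<mu>(h)/h as (h^N \<mu>(h))/h^(N+1) removes the torsion: the fractions
    now agree on overlaps by exact cross multiplication.\<close>
  have N': "k [^] Suc N \<odot>\<^bsub>M\<^esub> (h [^] N \<odot>\<^bsub>M\<^esub> \<mu> h) = h [^] Suc N \<odot>\<^bsub>M\<^esub> (k [^] N \<odot>\<^bsub>M\<^esub> \<mu> k)" if "h \<in> F" "k \<in> F" for h k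
    using N[of "(h, k)", unfolded E_def] that hR \<mu>M
    by (simp add: smult_assoc1[symmetric] nat_pow_distrib m_ac)
  \<comment> \<open>\<open>x\<close> lies in \<open>J\<close> if one element \<open>m\<close> of
    \<open>M\<close> represents \<open>x s\<close> on every member of the cover. For
    \<open>x = k^(N+1)\<close> with \<open>k\<close> in \<open>F\<close>, the equations
    \<open>N'\<close> say that \<open>m = k^N \<mu>(k)\<close> does.\<close>
  define J where "J = {x \<in> carrier R. \<exists>m\<in>carrier M. \<forall>h\<in>F. h [^] Suc N \<odot>\<^bsub>M\<^esub> m = x \<odot>\<^bsub>M\<^esub> (h [^] N \<odot>\<^bsub>M\<^esub> \<mu> h)}"
  have "ideal J R"
  proof (rule idealI[OF R.ring_axioms])
    show "subgroup J (add_monoid R)"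
    proof (rule R.add.subgroupI)
      show "J \<subseteq> carrier R" by (auto simp: J_def)
      have "\<zero> \<in> J" using hR \<mu>M by (auto simp: J_def intro!: bexI[of _ "\<zero>\<^bsub>M\<^esub>"])
      then show "J \<noteq> {}" by auto
    next
      fix a assume "a \<in> J"
      then obtain m where m: "a \<in> carrier R" "m \<in> carrier M"
        "\<forall>h\<in>F. h [^] Suc N \<odot>\<^bsub>M\<^esub> m = a \<odot>\<^bsub>M\<^esub> (h [^] N \<odot>\<^bsub>M\<^esub> \<mu> h)" by (auto simp: J_def)
      then have "\<forall>h\<in>F. h [^] Suc N \<odot>\<^bsub>M\<^esub> (\<ominus>\<^bsub>M\<^esub> m) = (\<ominus> a) \<odot>\<^bsub>M\<^esub> (h [^] N \<odot>\<^bsub>M\<^esub> \<mu> h)"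
        using hR \<mu>M by (simp add: smult_r_minus smult_l_minus del: nat_pow_Suc)
      then show "\<ominus> a \<in> J" using m unfolding J_def by blast
    next
      fix a b assume "a \<in> J" "b \<in> J"
      then obtain m n where m: "a \<in> carrier R" "m \<in> carrier M" "b \<in> carrier R" "n \<in> carrier M"
        "\<forall>h\<in>F. h [^] Suc N \<odot>\<^bsub>M\<^esub> m = a \<odot>\<^bsub>M\<^esub> (h [^] N \<odot>\<^bsub>M\<^esub> \<mu> h)"
        "\<forall>h\<in>F. h [^] Suc N \<odot>\<^bsub>M\<^esub> n = b \<odot>\<^bsub>M\<^esub> (h [^] N \<odot>\<^bsub>M\<^esub> \<mu> h)" by (auto simp: J_def)
      then have "\<forall>h\<in>F. h [^] Suc N \<odot>\<^bsub>M\<^esub> (m \<oplus>\<^bsub>M\<^esub> n) = (a \<oplus> b) \<odot>\<^bsub>M\<^esub> (h [^] N \<odot>\<^bsub>M\<^esub> \<mu> h)"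
        using hR \<mu>M by (simp add: smult_r_distr smult_l_distr del: nat_pow_Suc)
      then show "a \<oplus> b \<in> J" using m unfolding J_def by blast
    qed
    fix a x assume a: "a \<in> J" and x: "x \<in> carrier R"
    then obtain m where m: "a \<in> carrier R" "m \<in> carrier M"
      "\<forall>h\<in>F. h [^] Suc N \<odot>\<^bsub>M\<^esub> m = a \<odot>\<^bsub>M\<^esub> (h [^] N \<odot>\<^bsub>M\<^esub> \<mu> h)" by (auto simp: J_def)
    have "\<forall>h\<in>F. h [^] Suc N \<odot>\<^bsub>M\<^esub> (x \<odot>\<^bsub>M\<^esub> m) = (x \<otimes> a) \<odot>\<^bsub>M\<^esub> (h [^] N \<odot>\<^bsub>M\<^esub> \<mu> h)"
    proof
      fix h assume h: "h \<in> F"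
      have "h [^] Suc N \<odot>\<^bsub>M\<^esub> (x \<odot>\<^bsub>M\<^esub> m) = x \<odot>\<^bsub>M\<^esub> (h [^] Suc N \<odot>\<^bsub>M\<^esub> m)"
        using h hR m x by (intro smult_commute) auto
      then show "h [^] Suc N \<odot>\<^bsub>M\<^esub> (x \<odot>\<^bsub>M\<^esub> m) = (x \<otimes> a) \<odot>\<^bsub>M\<^esub> (h [^] N \<odot>\<^bsub>M\<^esub> \<mu> h)"
        using h hR \<mu>M m x by (simp add: smult_assoc1 del: nat_pow_Suc)
    qed
    then show "x \<otimes> a \<in> J" using m x unfolding J_def by blast
    then show "a \<otimes> x \<in> J" using m x by (simp add: m_comm)
  qed
  moreover have "(\<lambda>h. h [^] Suc N) ` F \<subseteq> J"
  proof clarify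
    fix k assume k: "k \<in> F"
    then show "k [^] Suc N \<in> J" using N' hR \<mu>M unfolding J_def
      by (intro CollectI conjI bexI[of _ "k [^] N \<odot>\<^bsub>M\<^esub> \<mu> k"]) auto
  qed
  ultimately have sub: "Idl ((\<lambda>h. h [^] Suc N) ` F) \<subseteq> J" by (rule R.genideal_minimal)
  have cover: "?D f \<subseteq> (\<Union>h\<in>F. ?D h)" by (rule R.basic_open_subset_if_mem_Idl[OF FR f n0])
  then have "?D f \<subseteq> (\<Union>h\<in>(\<lambda>h. h [^] Suc N) ` F. ?D h)"
    using R.basic_open_Suc hR by (simp del: nat_pow_Suc)
  then obtain n :: nat where "f [^] n \<in> Idl ((\<lambda>h. h [^] Suc N) ` F)"
    using R.mem_Idl_if_basic_open_subset[of "(\<lambda>h. h [^] Suc N) ` F" f] FR f by blast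
  then have "f [^] n \<in> J" using sub by auto
  then obtain m where m: "m \<in> carrier M" "\<And>h. h \<in> F \<Longrightarrow> h [^] Suc N \<odot>\<^bsub>M\<^esub> m = f [^] n \<odot>\<^bsub>M\<^esub> (h [^] N \<odot>\<^bsub>M\<^esub> \<mu> h)"
    by (auto simp: J_def)
  have "s = fraction_section R M (?D f) m (f [^] n)"
  proof (rule extensionalityI[where A = "?D f"])
    show "s \<in> extensional (?D f)" using s by (rule tilde_extensional)
    show "fraction_section R M (?D f) m (f [^] n) \<in> extensional (?D f)" by (simp add: fraction_section_def)
    fix q assume q: "q \<in> ?D f"
    then obtain h where h: "h \<in> F" "q \<in> ?D h" using cover by blast
    \<comment> \<open>The equation solved by \<open>m\<close> is h^N times the cross multiplication
      of the two fractions, and h^N is an admissible multiplier at \<open>q\<close>.\<close>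
    have "frac R (carrier R - q) M (\<mu> h) h = frac R (carrier R - q) M m (f [^] n)"
    proof (rule frac_eq_at_primeI[where u = "h [^] N"])
      have "q \<in> ?D (h [^] N)" "q \<in> ?D (f [^] n)" using h q f hR R.basic_open_pow_subset by blast+
      then show "h [^] N \<in> carrier R - q" "f [^] n \<in> carrier R - q" "h \<in> carrier R - q" "q \<in> spec R"
        using h hR f basic_openD by auto
      show "h [^] N \<odot>\<^bsub>M\<^esub> (f [^] n \<odot>\<^bsub>M\<^esub> \<mu> h) = h [^] N \<odot>\<^bsub>M\<^esub> (h \<odot>\<^bsub>M\<^esub> m)"
        using m(2)[OF h(1)] hR[OF h(1)] \<mu>M[OF h(1)] f m(1)
        by (simp add: smult_assoc1 smult_commute[of "h [^] N" "f [^] n"])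
    qed (use h \<mu>M m in auto)
    then show "s q = fraction_section R M (?D f) m (f [^] n) q"
      using \<mu>[OF h(1)] h(2) q by (simp add: fraction_section_def)
  qed
  with m(1) show thesis by (rule that)
qed

end

text \<open>Equality of fractions with numerators in \<open>L\<close> is tested by the same
  equations over \<open>L\<close> and over \<open>M\<close>, so a class over \<open>L\<close> is the
  trace of the class over \<open>M\<close>. This makes the injectivity of the map from
  \<open>L_p\<close> to \<open>M_p\<close> explicit.\<close>

lemma carrier_updated_frac:
  "m \<in> L \<Longrightarrow> L \<subseteq> carrier M \<Longrightarrow> frac R S (M\<lparr>carrier := L\<rparr>) m s = frac R S M m s \<inter> (L \<times> UNIV)"
  by (auto simp: frac_def)

lemma tilde_add: "s \<oplus>\<^bsub>tilde R M U\<^esub> t = (\<lambda>p\<in>U. s p \<oplus>\<^bsub>localization R (carrier R - p) M\<^esub> t p)"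
  and tilde_zero: "\<zero>\<^bsub>tilde R M U\<^esub> = (\<lambda>p\<in>U. \<zero>\<^bsub>localization R (carrier R - p) M\<^esub>)"
  and tilde_smult: "a \<odot>\<^bsub>tilde R M U\<^esub> s = (\<lambda>p\<in>U. a p \<odot>\<^bsub>localization R (carrier R - p) M\<^esub> s p)"
  and tilde_mult: "s \<otimes>\<^bsub>tilde R M U\<^esub> t = (\<lambda>p\<in>U. s p \<otimes>\<^bsub>localization R (carrier R - p) M\<^esub> t p)"
  and tilde_one: "\<one>\<^bsub>tilde R M U\<^esub> = (\<lambda>p\<in>U. \<one>\<^bsub>localization R (carrier R - p) M\<^esub>)"
  by (simp_all add: tilde_def stalk_at_def)

lemma structure_sheaf_mult: "s \<otimes>\<^bsub>\<O> R U\<^esub> t = s \<odot>\<^bsub>\<O> R U\<^esub> t"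
  by (simp add: structure_sheaf_def tilde_mult tilde_smult mult_localization_regular)

lemma restrict_tilde_add:
  "V \<subseteq> U \<Longrightarrow> restrict (s \<oplus>\<^bsub>tilde R M U\<^esub> t) V = restrict s V \<oplus>\<^bsub>tilde R M V\<^esub> restrict t V"
  by (intro ext) (auto simp: tilde_add)

lemma restrict_tilde_smult:
  "V \<subseteq> U \<Longrightarrow> restrict (a \<odot>\<^bsub>tilde R M U\<^esub> s) V = restrict a V \<odot>\<^bsub>tilde R M V\<^esub> restrict s V"
  by (intro ext) (auto simp: tilde_smult)

context module
begin

lemma tilde_sub_eq:
  assumes L: "submodule L R M" and U: "openin (zariski R) U"
  shows "tilde_sub R M L U = local_fractions R M L U"
proof (intro subset_antisym subsetI)
  interpret LM: module R "M\<lparr>carrier := L\<rparr>" by (rule submodule.submodule_is_module[OF L module_axioms])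
  note sub = submodule_subset[OF L]
  fix s assume "s \<in> tilde_sub R M L U"
  then obtain t where t: "t \<in> carrier (tilde R (M\<lparr>carrier := L\<rparr>) U)"
    and s: "s = (\<lambda>p\<in>U. \<Union>(l, f)\<in>t p. frac R (carrier R - p) M l f)"
    by (auto simp: tilde_sub_def)
  show "s \<in> local_fractions R M L U"
  proof (rule local_fractionsI)
    show "s \<in> extensional U" by (simp add: s)
    fix p assume "p \<in> U"
    then obtain h m where h: "h \<in> carrier R" "m \<in> L" "p \<in> basic_open R h" "basic_open R h \<subseteq> U"
      and t: "\<And>q. q \<in> basic_open R h \<Longrightarrow> t q = frac R (carrier R - q) (M\<lparr>carrier := L\<rparr>) m h"
      using LM.tilde_locally[OF U t] by auto
    have "s q = frac R (carrier R - q) M m h" if q: "q \<in> basic_open R h" for q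
    proof -
      interpret loc: module_denominators R M "carrier R - q" using q by (intro prime_denominators basic_openD)
      have "\<And>l f. (l, f) \<in> t q \<Longrightarrow> frac R (carrier R - q) M l f = frac R (carrier R - q) M m h"
        by (rule loc.frac_mem_eq(3)) (use t[OF q] h sub basic_openD(2)[OF q] in \<open>auto simp: carrier_updated_frac\<close>)
      moreover have "(m, h) \<in> t q"
        using t[OF q] h sub basic_openD(2)[OF q] by (auto simp: carrier_updated_frac intro: loc.self_mem_frac)
      ultimately have "(\<Union>(l, f)\<in>t q. frac R (carrier R - q) M l f) = frac R (carrier R - q) M m h" by fast
      then show ?thesis using q h by (auto simp: s)
    qed
    then show "\<exists>h\<in>carrier R. \<exists>m\<in>L. p \<in> basic_open R h \<and> basic_open R h \<subseteq> U \<and>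
      (\<forall>q\<in>basic_open R h. s q = frac R (carrier R - q) M m h)" using h by blast
  qed
next
  interpret LM: module R "M\<lparr>carrier := L\<rparr>" by (rule submodule.submodule_is_module[OF L module_axioms])
  note sub = submodule_subset[OF L]
  fix s assume s: "s \<in> local_fractions R M L U"
  \<comment> \<open>By \<open>carrier_updated_frac\<close>, cutting a germ down to numerators in
    \<open>L\<close> gives the germ over \<open>L\<close>; this is the preimage of
    \<open>s\<close>.\<close>
  define t where "t = (\<lambda>p\<in>U. s p \<inter> (L \<times> UNIV))"
  have "t \<in> carrier (tilde R (M\<lparr>carrier := L\<rparr>) U)"
    unfolding LM.carrier_tilde[OF U]
  proof (rule local_fractionsI)
    show "t \<in> extensional U" by (simp add: t_def)
    fix p assume "p \<in> U"
    then obtain h m where h: "h \<in> carrier R" "m \<in> L" "p \<in> basic_open R h" "basic_open R h \<subseteq> U"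
      and s: "\<And>q. q \<in> basic_open R h \<Longrightarrow> s q = frac R (carrier R - q) M m h"
      using local_fractionsE[OF s] by metis
    have "t q = frac R (carrier R - q) (M\<lparr>carrier := L\<rparr>) m h" if "q \<in> basic_open R h" for q
      using that h s sub by (auto simp: t_def carrier_updated_frac)
    then show "\<exists>h\<in>carrier R. \<exists>m\<in>carrier (M\<lparr>carrier := L\<rparr>). p \<in> basic_open R h \<and> basic_open R h \<subseteq> U \<and>
      (\<forall>q\<in>basic_open R h. t q = frac R (carrier R - q) (M\<lparr>carrier := L\<rparr>) m h)" using h by auto
  qed
  moreover have "s = (\<lambda>p\<in>U. \<Union>(l, f)\<in>t p. frac R (carrier R - p) M l f)"
  proof (rule extensionalityI[where A = U])
    show "s \<in> extensional U" using s by (simp add: local_fractions_def)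
    fix p assume p: "p \<in> U"
    then obtain h m where h: "h \<in> carrier R" "m \<in> L" "p \<in> basic_open R h"
      and sp: "s p = frac R (carrier R - p) M m h"
      using local_fractionsE[OF s p] by metis
    interpret loc: module_denominators R M "carrier R - p" using h(3) by (intro prime_denominators basic_openD)
    have "\<And>l f. (l, f) \<in> t p \<Longrightarrow> frac R (carrier R - p) M l f = frac R (carrier R - p) M m h"
      by (rule loc.frac_mem_eq(3)) (use p sp h sub basic_openD(2)[OF h(3)] in \<open>auto simp: t_def\<close>)
    moreover have "(m, h) \<in> t p"
      using p sp h sub basic_openD(2)[OF h(3)] by (auto simp: t_def intro: loc.self_mem_frac)
    ultimately have "(\<Union>(l, f)\<in>t p. frac R (carrier R - p) M l f) = frac R (carrier R - p) M m h" by fast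
    then show "s p = (\<lambda>p\<in>U. \<Union>(l, f)\<in>t p. frac R (carrier R - p) M l f) p" using p sp by simp
  qed simp
  ultimately show "s \<in> tilde_sub R M L U" unfolding tilde_sub_def by blast
qed

text \<open>\<open>L\<close> is a module in its own right, so \<open>tilde_basic_openE\<close>
  applies to it and yields a single numerator that lies in \<open>L\<close>, not merely in
  \<open>M\<close>: the sections of the sheaf of \<open>L\<close> over D(f) form
  \<open>L_f\<close>.\<close>

lemma tilde_sub_basic_openE:
  assumes L: "submodule L R M" and f: "f \<in> carrier R" and s: "s \<in> tilde_sub R M L (basic_open R f)"
  obtains l and n :: nat where "l \<in> L" "s = fraction_section R M (basic_open R f) l (f [^] n)"
proof -
  interpret LM: module R "M\<lparr>carrier := L\<rparr>" by (rule submodule.submodule_is_module[OF L module_axioms])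
  note sub = submodule_subset[OF L]
  from s obtain t where t: "t \<in> carrier (tilde R (M\<lparr>carrier := L\<rparr>) (basic_open R f))"
    and st: "s = (\<lambda>p\<in>basic_open R f. \<Union>(l, f)\<in>t p. frac R (carrier R - p) M l f)"
    by (auto simp: tilde_sub_def)
  obtain l and n :: nat where l: "l \<in> L" and tl: "t = fraction_section R (M\<lparr>carrier := L\<rparr>) (basic_open R f) l (f [^] n)"
    using LM.tilde_basic_openE[OF f t] by auto
  have "s = fraction_section R M (basic_open R f) l (f [^] n)"
    unfolding st fraction_section_def
  proof (rule restrict_ext)
    fix p assume p: "p \<in> basic_open R f"
    then interpret loc: module_denominators R M "carrier R - p" by (intro prime_denominators basic_openD)
    have fn: "f [^] n \<in> carrier R - p" using p f R.basic_open_pow_subset[of f n] basic_openD by auto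
    have "\<And>m g. (m, g) \<in> t p \<Longrightarrow> frac R (carrier R - p) M m g = frac R (carrier R - p) M l (f [^] n)"
      by (rule loc.frac_mem_eq(3)) (use p l sub fn in \<open>auto simp: tl fraction_section_def carrier_updated_frac\<close>)
    moreover have "(l, f [^] n) \<in> t p"
      using p l sub fn by (auto simp: tl fraction_section_def carrier_updated_frac intro: loc.self_mem_frac)
    ultimately show "(\<Union>(m, g)\<in>t p. frac R (carrier R - p) M m g) = frac R (carrier R - p) M l (f [^] n)" by fast
  qed
  with l show thesis by (rule that)
qed

section \<open>The module structure on sections\<close>

lemma local_fractions_add:
  assumes L: "submodule L R M" and s: "s \<in> local_fractions R M L U" and t: "t \<in> local_fractions R M L U"
  shows "s \<oplus>\<^bsub>tilde R M U\<^esub> t \<in> local_fractions R M L U"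
proof (rule local_fractionsI)
  show "s \<oplus>\<^bsub>tilde R M U\<^esub> t \<in> extensional U" by (simp add: tilde_add)
  fix p assume p: "p \<in> U"
  note sub = submodule_subset[OF L]
  obtain h m where h: "h \<in> carrier R" "m \<in> L" "p \<in> basic_open R h" "basic_open R h \<subseteq> U"
    and sh: "\<And>q. q \<in> basic_open R h \<Longrightarrow> s q = frac R (carrier R - q) M m h"
    using local_fractionsE[OF s p] by metis
  obtain k n where k: "k \<in> carrier R" "n \<in> L" "p \<in> basic_open R k" "basic_open R k \<subseteq> U"
    and tk: "\<And>q. q \<in> basic_open R k \<Longrightarrow> t q = frac R (carrier R - q) M n k"
    using local_fractionsE[OF t p] by metis
  have eq: "basic_open R (h \<otimes> k) = basic_open R h \<inter> basic_open R k" using h k by (simp add: R.basic_open_mult)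
  show "\<exists>h\<in>carrier R. \<exists>m\<in>L. p \<in> basic_open R h \<and> basic_open R h \<subseteq> U \<and>
      (\<forall>q\<in>basic_open R h. (s \<oplus>\<^bsub>tilde R M U\<^esub> t) q = frac R (carrier R - q) M m h)"
  proof (intro bexI conjI ballI)
    show "p \<in> basic_open R (h \<otimes> k)" "basic_open R (h \<otimes> k) \<subseteq> U" using eq h k by auto
    show "k \<odot>\<^bsub>M\<^esub> m \<oplus>\<^bsub>M\<^esub> h \<odot>\<^bsub>M\<^esub> n \<in> L" using h k submoduleE(4,5)[OF L] by simp
    fix q assume "q \<in> basic_open R (h \<otimes> k)"
    then have q: "q \<in> basic_open R h" "q \<in> basic_open R k" using eq by auto
    then interpret loc: module_denominators R M "carrier R - q" by (intro prime_denominators basic_openD)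
    have "q \<in> U" using q h by auto
    then show "(s \<oplus>\<^bsub>tilde R M U\<^esub> t) q = frac R (carrier R - q) M (k \<odot>\<^bsub>M\<^esub> m \<oplus>\<^bsub>M\<^esub> h \<odot>\<^bsub>M\<^esub> n) (h \<otimes> k)"
      using loc.add_frac[of m n h k] q h k sub basic_openD[of q] by (auto simp: tilde_add sh tk)
  qed (use h k in auto)
qed

lemma local_fractions_smult:
  assumes L: "submodule L R M" and a: "a \<in> carrier (\<O> R U)" and s: "s \<in> local_fractions R M L U"
    and U: "openin (zariski R) U"
  shows "a \<odot>\<^bsub>tilde R M U\<^esub> s \<in> local_fractions R M L U"
proof (rule local_fractionsI)
  interpret reg: module R "regular_module R" by (rule module_regular_module)
  show "a \<odot>\<^bsub>tilde R M U\<^esub> s \<in> extensional U" by (simp add: tilde_smult)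
  fix p assume p: "p \<in> U"
  note sub = submodule_subset[OF L]
  obtain h m where h: "h \<in> carrier R" "m \<in> L" "p \<in> basic_open R h" "basic_open R h \<subseteq> U"
    and sh: "\<And>q. q \<in> basic_open R h \<Longrightarrow> s q = frac R (carrier R - q) M m h"
    using local_fractionsE[OF s p] by metis
  obtain k c where k: "k \<in> carrier R" "c \<in> carrier R" "p \<in> basic_open R k" "basic_open R k \<subseteq> U"
    and ak: "\<And>q. q \<in> basic_open R k \<Longrightarrow> a q = frac R (carrier R - q) (regular_module R) c k"
    using reg.tilde_locally[OF U, of a p] a p unfolding structure_sheaf_def by auto
  have eq: "basic_open R (k \<otimes> h) = basic_open R k \<inter> basic_open R h" using h k by (simp add: R.basic_open_mult)
  show "\<exists>h\<in>carrier R. \<exists>m\<in>L. p \<in> basic_open R h \<and> basic_open R h \<subseteq> U \<and>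
      (\<forall>q\<in>basic_open R h. (a \<odot>\<^bsub>tilde R M U\<^esub> s) q = frac R (carrier R - q) M m h)"
  proof (intro bexI conjI ballI)
    show "p \<in> basic_open R (k \<otimes> h)" "basic_open R (k \<otimes> h) \<subseteq> U" using eq h k by auto
    show "c \<odot>\<^bsub>M\<^esub> m \<in> L" using h k submoduleE(4)[OF L] by simp
    fix q assume "q \<in> basic_open R (k \<otimes> h)"
    then have q: "q \<in> basic_open R h" "q \<in> basic_open R k" using eq by auto
    then interpret loc: module_denominators R M "carrier R - q" by (intro prime_denominators basic_openD)
    have "q \<in> U" using q h by auto
    then show "(a \<odot>\<^bsub>tilde R M U\<^esub> s) q = frac R (carrier R - q) M (c \<odot>\<^bsub>M\<^esub> m) (k \<otimes> h)"
      using loc.smult_frac[of c m k h] q h k sub basic_openD[of q] by (auto simp: tilde_smult sh ak)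
  qed (use h k in auto)
qed

lemma local_fractions_mono: "K \<subseteq> L \<Longrightarrow> local_fractions R M K U \<subseteq> local_fractions R M L U"
  unfolding local_fractions_def by blast

lemma tilde_zero_eq:
  assumes "openin (zariski R) U"
  shows "\<zero>\<^bsub>tilde R M U\<^esub> = fraction_section R M U \<zero>\<^bsub>M\<^esub> \<one>"
  unfolding tilde_zero fraction_section_def
proof (rule restrict_ext)
  fix p assume "p \<in> U"
  then interpret loc: module_denominators R M "carrier R - p"
    using R.openin_zariski_subset[OF assms] by (intro prime_denominators) auto
  show "\<zero>\<^bsub>localization R (carrier R - p) M\<^esub> = frac R (carrier R - p) M \<zero>\<^bsub>M\<^esub> \<one>"
    by (simp add: loc.zero_localization)
qed

lemma fraction_section_in_sub:
  assumes "submodule L R M" "openin (zariski R) U" "l \<in> L"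
  shows "fraction_section R M U l \<one> \<in> local_fractions R M L U"
  using fraction_section_in_local_fractions[OF assms(1,2), of \<one> l] R.openin_zariski_subset[OF assms(2)] assms(3)
  by (simp add: R.basic_open_one)

lemma fraction_section_in_tilde_one:
  assumes "openin (zariski R) U" "l \<in> carrier M"
  shows "fraction_section R M U l \<one> \<in> carrier (tilde R M U)"
  using fraction_section_in_sub[OF carrier_is_submodule assms] carrier_tilde[OF assms(1)] by simp

text \<open>The laws hold pointwise because they hold in every stalk. What remains is that sums,
  zero and negatives are again locally fractions.\<close>

lemma abelian_group_tilde:
  assumes U: "openin (zariski R) U"
  shows "abelian_group (tilde R M U)"
proof (rule abelian_groupI)
  have ag: "abelian_group (localization R (carrier R - p) M)" if "p \<in> U" for p
    using that R.openin_zariski_subset[OF U]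
    by (intro module_denominators.abelian_group_localization prime_denominators) auto
  note am = abelian_group.axioms(1)[OF ag]
  let ?T = "tilde R M U"
  show "x \<oplus>\<^bsub>?T\<^esub> y \<in> carrier ?T" if "x \<in> carrier ?T" "y \<in> carrier ?T" for x y
    using that local_fractions_add[OF carrier_is_submodule] by (simp add: carrier_tilde[OF U])
  show "\<zero>\<^bsub>?T\<^esub> \<in> carrier ?T"
    unfolding tilde_zero_eq[OF U] by (rule fraction_section_in_tilde_one[OF U]) simp
  show "x \<oplus>\<^bsub>?T\<^esub> y \<oplus>\<^bsub>?T\<^esub> z = x \<oplus>\<^bsub>?T\<^esub> (y \<oplus>\<^bsub>?T\<^esub> z)"
    if "x \<in> carrier ?T" "y \<in> carrier ?T" "z \<in> carrier ?T" for x y z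
    unfolding tilde_add by (rule restrict_ext) (simp add: abelian_monoid.a_assoc[OF am] tilde_in_stalk[where U = U] that)
  show "x \<oplus>\<^bsub>?T\<^esub> y = y \<oplus>\<^bsub>?T\<^esub> x" if "x \<in> carrier ?T" "y \<in> carrier ?T" for x y
    unfolding tilde_add by (rule restrict_ext) (simp add: abelian_monoid.a_comm[OF am] tilde_in_stalk[where U = U] that)
  show "\<zero>\<^bsub>?T\<^esub> \<oplus>\<^bsub>?T\<^esub> x = x" if "x \<in> carrier ?T" for x
  proof (rule extensionalityI[where A = U])
    show "x \<in> extensional U" using that by (rule tilde_extensional)
    show "(\<zero>\<^bsub>?T\<^esub> \<oplus>\<^bsub>?T\<^esub> x) p = x p" if "p \<in> U" for p
      using \<open>x \<in> carrier ?T\<close> that by (simp add: tilde_add tilde_zero abelian_monoid.l_zero[OF am] tilde_in_stalk)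
  qed (simp add: tilde_add)
  show "\<exists>y\<in>carrier ?T. y \<oplus>\<^bsub>?T\<^esub> x = \<zero>\<^bsub>?T\<^esub>" if x: "x \<in> carrier ?T" for x
  proof
    let ?y = "\<lambda>p\<in>U. \<ominus>\<^bsub>localization R (carrier R - p) M\<^esub> x p"
    show "?y \<oplus>\<^bsub>?T\<^esub> x = \<zero>\<^bsub>?T\<^esub>"
      unfolding tilde_add tilde_zero
      by (rule restrict_ext) (simp add: abelian_group.l_neg[OF ag] tilde_in_stalk[OF x])
    show "?y \<in> carrier ?T" unfolding carrier_tilde[OF U]
    proof (rule local_fractionsI)
      fix p assume "p \<in> U"
      then obtain h m where h: "h \<in> carrier R" "m \<in> carrier M" "p \<in> basic_open R h" "basic_open R h \<subseteq> U"
        and xh: "\<And>q. q \<in> basic_open R h \<Longrightarrow> x q = frac R (carrier R - q) M m h"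
        using tilde_locally[OF U x] by metis
      have "?y q = frac R (carrier R - q) M (\<ominus>\<^bsub>M\<^esub> m) h" if q: "q \<in> basic_open R h" for q
      proof -
        interpret loc: module_denominators R M "carrier R - q" using q by (intro prime_denominators basic_openD)
        have h': "h \<in> carrier R - q" using h q basic_openD by blast
        have "\<ominus>\<^bsub>localization R (carrier R - q) M\<^esub> frac R (carrier R - q) M m h = frac R (carrier R - q) M (\<ominus>\<^bsub>M\<^esub> m) h"
          using h h' by (intro abelian_group.minus_equality[OF loc.abelian_group_localization])
            (simp_all add: loc.add_frac_same M.l_neg loc.frac_zero)
        then show ?thesis using q h xh by auto
      qed
      then show "\<exists>h\<in>carrier R. \<exists>m\<in>carrier M. p \<in> basic_open R h \<and> basic_open R h \<subseteq> U \<and>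
        (\<forall>q\<in>basic_open R h. ?y q = frac R (carrier R - q) M m h)"
        using h M.a_inv_closed[OF h(2)] by blast
    qed simp
  qed
qed

end

lemma (in cring) cring_structure_sheaf:
  assumes U: "openin (zariski R) U"
  shows "cring (\<O> R U)"
proof -
  interpret reg: module R "regular_module R" by (rule module_regular_module)
  have cr: "cring (localization R (carrier R - p) (regular_module R))" if "p \<in> U" for p
    using that openin_zariski_subset[OF U] by (intro localization_regular reg.prime_denominators) auto
  note mon = comm_monoid.axioms(1)[OF cring.axioms(2)[OF cr]]
  let ?T = "\<O> R U"
  have st: "x p \<in> carrier (localization R (carrier R - p) (regular_module R))" if "x \<in> carrier ?T" "p \<in> U" for x p
    using that reg.tilde_in_stalk by (simp add: structure_sheaf_def)
  have ext: "x \<in> extensional U" if "x \<in> carrier ?T" for x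
    using that reg.tilde_extensional by (simp add: structure_sheaf_def)
  note m = structure_sheaf_def[of R, THEN fun_cong, of U]
  show ?thesis
  proof (rule cringI)
    show "abelian_group ?T" unfolding structure_sheaf_def by (rule reg.abelian_group_tilde[OF U])
    show "Group.comm_monoid ?T"
    proof (rule comm_monoidI)
      show "x \<otimes>\<^bsub>?T\<^esub> y \<in> carrier ?T" if "x \<in> carrier ?T" "y \<in> carrier ?T" for x y
        using reg.local_fractions_smult[OF reg.carrier_is_submodule that(1) _ U] that(2)
        unfolding structure_sheaf_mult by (simp add: structure_sheaf_def reg.carrier_tilde[OF U])
      have "\<one>\<^bsub>?T\<^esub> = fraction_section R (regular_module R) U \<one> \<one>"
        by (simp add: structure_sheaf_def tilde_one fraction_section_def one_localization_regular)
      then show "\<one>\<^bsub>?T\<^esub> \<in> carrier ?T"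
        using reg.fraction_section_in_tilde_one[OF U] by (simp add: structure_sheaf_def)
      show "x \<otimes>\<^bsub>?T\<^esub> y \<otimes>\<^bsub>?T\<^esub> z = x \<otimes>\<^bsub>?T\<^esub> (y \<otimes>\<^bsub>?T\<^esub> z)"
        if "x \<in> carrier ?T" "y \<in> carrier ?T" "z \<in> carrier ?T" for x y z
        unfolding m tilde_mult by (rule restrict_ext) (simp add: monoid.m_assoc[OF mon] st that)
      show "x \<otimes>\<^bsub>?T\<^esub> y = y \<otimes>\<^bsub>?T\<^esub> x" if "x \<in> carrier ?T" "y \<in> carrier ?T" for x y
        unfolding m tilde_mult
        by (rule restrict_ext) (simp add: comm_monoid.m_comm[OF cring.axioms(2)[OF cr]] st that)
      show "\<one>\<^bsub>?T\<^esub> \<otimes>\<^bsub>?T\<^esub> x = x" if "x \<in> carrier ?T" for x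
      proof (rule extensionalityI[where A = U])
        show "x \<in> extensional U" using that by (rule ext)
        show "(\<one>\<^bsub>?T\<^esub> \<otimes>\<^bsub>?T\<^esub> x) p = x p" if "p \<in> U" for p
          using \<open>x \<in> carrier ?T\<close> that by (simp add: m tilde_mult tilde_one monoid.l_one[OF mon] st[unfolded m])
      qed (simp add: m tilde_mult)
    qed
    show "(x \<oplus>\<^bsub>?T\<^esub> y) \<otimes>\<^bsub>?T\<^esub> z = x \<otimes>\<^bsub>?T\<^esub> z \<oplus>\<^bsub>?T\<^esub> y \<otimes>\<^bsub>?T\<^esub> z"
      if "x \<in> carrier ?T" "y \<in> carrier ?T" "z \<in> carrier ?T" for x y z
      unfolding m tilde_mult tilde_add
    proof (rule restrict_ext)
      fix p assume p: "p \<in> U"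
      interpret loc: cring "localization R (carrier R - p) (regular_module R)" by (rule cr[OF p])
      show "(restrict (\<lambda>p. x p \<oplus>\<^bsub>localization R (carrier R - p) (regular_module R)\<^esub> y p) U) p
          \<otimes>\<^bsub>localization R (carrier R - p) (regular_module R)\<^esub> z p
        = restrict (\<lambda>p. x p \<otimes>\<^bsub>localization R (carrier R - p) (regular_module R)\<^esub> z p) U p
          \<oplus>\<^bsub>localization R (carrier R - p) (regular_module R)\<^esub>
          restrict (\<lambda>p. y p \<otimes>\<^bsub>localization R (carrier R - p) (regular_module R)\<^esub> z p) U p"
        using p st[OF that(1) p] st[OF that(2) p] st[OF that(3) p] by (simp add: loc.l_distr)
    qed
  qed
qed

context module
begin

lemma module_tilde:
  assumes U: "openin (zariski R) U"
  shows "module (\<O> R U) (tilde R M U)"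
proof (rule moduleI)
  interpret reg: module R "regular_module R" by (rule module_regular_module)
  let ?T = "tilde R M U" and ?A = "\<O> R U"
  have md: "module (localization R (carrier R - p) (regular_module R)) (localization R (carrier R - p) M)"
    if "p \<in> U" for p
    using that R.openin_zariski_subset[OF U]
    by (intro module_denominators.module_localization prime_denominators) auto
  have st: "x p \<in> carrier (localization R (carrier R - p) (regular_module R))" if "x \<in> carrier ?A" "p \<in> U" for x p
    using that reg.tilde_in_stalk by (simp add: structure_sheaf_def)
  note m = structure_sheaf_def[of R, THEN fun_cong, of U]
  show "cring ?A" by (rule R.cring_structure_sheaf[OF U])
  show "abelian_group ?T" by (rule abelian_group_tilde[OF U])
  show "a \<odot>\<^bsub>?T\<^esub> x \<in> carrier ?T" if "a \<in> carrier ?A" "x \<in> carrier ?T" for a x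
    using local_fractions_smult[OF carrier_is_submodule that(1) _ U] that(2) by (simp add: carrier_tilde[OF U])
  show "(a \<oplus>\<^bsub>?A\<^esub> b) \<odot>\<^bsub>?T\<^esub> x = a \<odot>\<^bsub>?T\<^esub> x \<oplus>\<^bsub>?T\<^esub> b \<odot>\<^bsub>?T\<^esub> x"
    if "a \<in> carrier ?A" "b \<in> carrier ?A" "x \<in> carrier ?T" for a b x
    unfolding tilde_smult tilde_add m
    by (rule restrict_ext) (simp add: module.smult_l_distr[OF md] st that tilde_in_stalk[where U = U])
  show "a \<odot>\<^bsub>?T\<^esub> (x \<oplus>\<^bsub>?T\<^esub> y) = a \<odot>\<^bsub>?T\<^esub> x \<oplus>\<^bsub>?T\<^esub> a \<odot>\<^bsub>?T\<^esub> y"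
    if "a \<in> carrier ?A" "x \<in> carrier ?T" "y \<in> carrier ?T" for a x y
    unfolding tilde_smult tilde_add m
    by (rule restrict_ext) (simp add: module.smult_r_distr[OF md] st that tilde_in_stalk[where U = U])
  show "(a \<otimes>\<^bsub>?A\<^esub> b) \<odot>\<^bsub>?T\<^esub> x = a \<odot>\<^bsub>?T\<^esub> (b \<odot>\<^bsub>?T\<^esub> x)"
    if "a \<in> carrier ?A" "b \<in> carrier ?A" "x \<in> carrier ?T" for a b x
    unfolding tilde_smult tilde_mult m
    by (rule restrict_ext) (simp add: module.smult_assoc1[OF md] st that tilde_in_stalk[where U = U])
  show "\<one>\<^bsub>?A\<^esub> \<odot>\<^bsub>?T\<^esub> x = x" if "x \<in> carrier ?T" for x
  proof (rule extensionalityI[where A = U])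
    show "x \<in> extensional U" using that by (rule tilde_extensional)
    show "(\<one>\<^bsub>?A\<^esub> \<odot>\<^bsub>?T\<^esub> x) p = x p" if "p \<in> U" for p
      using \<open>x \<in> carrier ?T\<close> that by (simp add: m tilde_smult tilde_one module.smult_one[OF md] tilde_in_stalk)
  qed (simp add: tilde_smult)
qed

lemma submodule_local_fractions:
  assumes L: "submodule L R M" and U: "openin (zariski R) U"
  shows "submodule (local_fractions R M L U) (\<O> R U) (tilde R M U)"
proof -
  interpret T: module "\<O> R U" "tilde R M U" by (rule module_tilde[OF U])
  show ?thesis
  proof (rule T.submoduleI)
    show sub: "local_fractions R M L U \<subseteq> carrier (tilde R M U)"
      unfolding carrier_tilde[OF U] by (rule local_fractions_mono[OF submodule_subset[OF L]])
    have "\<zero>\<^bsub>M\<^esub> \<in> L" using submodule.axioms(1)[OF L] subgroup.one_closed by fastforce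
    then show "\<zero>\<^bsub>tilde R M U\<^esub> \<in> local_fractions R M L U"
      unfolding tilde_zero_eq[OF U] by (rule fraction_section_in_sub[OF L U])
    show "a \<oplus>\<^bsub>tilde R M U\<^esub> b \<in> local_fractions R M L U"
      if "a \<in> local_fractions R M L U" "b \<in> local_fractions R M L U" for a b
      using L that by (rule local_fractions_add)
    show smult: "a \<odot>\<^bsub>tilde R M U\<^esub> b \<in> local_fractions R M L U"
      if "a \<in> carrier (\<O> R U)" "b \<in> local_fractions R M L U" for a b
      using L that U by (rule local_fractions_smult)
    show "\<ominus>\<^bsub>tilde R M U\<^esub> a \<in> local_fractions R M L U" if "a \<in> local_fractions R M L U" for a
    proof -
      have "\<ominus>\<^bsub>tilde R M U\<^esub> a = (\<ominus>\<^bsub>\<O> R U\<^esub> \<one>\<^bsub>\<O> R U\<^esub>) \<odot>\<^bsub>tilde R M U\<^esub> a"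
        using that sub by (subst T.smult_l_minus) auto
      then show ?thesis using smult[OF _ that] by simp
    qed
  qed
qed

lemma submodule_tilde_sub:
  assumes L: "submodule L R M" and U: "openin (zariski R) U"
  shows "submodule (tilde_sub R M L U) (\<O> R U) (tilde R M U)"
  unfolding tilde_sub_eq[OF assms] by (rule submodule_local_fractions[OF assms])

lemma fraction_section_add:
  assumes "openin (zariski R) U" "U \<subseteq> basic_open R f" "f \<in> carrier R" "m \<in> carrier M" "n \<in> carrier M"
  shows "fraction_section R M U m f \<oplus>\<^bsub>tilde R M U\<^esub> fraction_section R M U n f = fraction_section R M U (m \<oplus>\<^bsub>M\<^esub> n) f"
  unfolding tilde_add unfolding fraction_section_def
proof (rule restrict_ext)
  fix p assume p: "p \<in> U"
  then have f: "p \<in> basic_open R f" using assms by auto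
  then interpret loc: module_denominators R M "carrier R - p" by (intro prime_denominators basic_openD)
  show "restrict (\<lambda>p. frac R (carrier R - p) M m f) U p \<oplus>\<^bsub>localization R (carrier R - p) M\<^esub>
      restrict (\<lambda>p. frac R (carrier R - p) M n f) U p = frac R (carrier R - p) M (m \<oplus>\<^bsub>M\<^esub> n) f"
    using p assms basic_openD(2)[OF f] by (simp add: loc.add_frac_same)
qed

lemma fraction_section_smult:
  assumes "U \<subseteq> basic_open R f" "U \<subseteq> basic_open R g" "f \<in> carrier R" "g \<in> carrier R" "a \<in> carrier R" "m \<in> carrier M"
  shows "fraction_section R (regular_module R) U a f \<odot>\<^bsub>tilde R M U\<^esub> fraction_section R M U m g
    = fraction_section R M U (a \<odot>\<^bsub>M\<^esub> m) (f \<otimes> g)"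
  unfolding tilde_smult unfolding fraction_section_def
proof (rule restrict_ext)
  fix p assume p: "p \<in> U"
  then have f: "p \<in> basic_open R f" "p \<in> basic_open R g" using assms by auto
  then interpret loc: module_denominators R M "carrier R - p" by (intro prime_denominators basic_openD)
  show "restrict (\<lambda>p. frac R (carrier R - p) (regular_module R) a f) U p \<odot>\<^bsub>localization R (carrier R - p) M\<^esub>
      restrict (\<lambda>p. frac R (carrier R - p) M m g) U p = frac R (carrier R - p) M (a \<odot>\<^bsub>M\<^esub> m) (f \<otimes> g)"
    using p assms basic_openD(2)[OF f(1)] basic_openD(2)[OF f(2)] by (simp add: loc.smult_frac)
qed

lemma fraction_section_eqI:
  assumes "U \<subseteq> basic_open R f" "U \<subseteq> basic_open R g" "U \<subseteq> basic_open R c" "f \<in> carrier R" "g \<in> carrier R" "c \<in> carrier R"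
    and "m \<in> carrier M" "n \<in> carrier M" "c \<odot>\<^bsub>M\<^esub> (g \<odot>\<^bsub>M\<^esub> m) = c \<odot>\<^bsub>M\<^esub> (f \<odot>\<^bsub>M\<^esub> n)"
  shows "fraction_section R M U m f = fraction_section R M U n g"
  unfolding fraction_section_def
proof (rule restrict_ext)
  fix p assume "p \<in> U"
  then have "p \<in> basic_open R f" "p \<in> basic_open R g" "p \<in> basic_open R c" using assms by auto
  then show "frac R (carrier R - p) M m f = frac R (carrier R - p) M n g"
    using assms basic_openD by (intro frac_eq_at_primeI[where u = c]) auto
qed

lemma fraction_section_eqD:
  assumes "fraction_section R M (basic_open R f) m s = fraction_section R M (basic_open R f) n t"
    and "m \<in> carrier M" "n \<in> carrier M" "f \<in> carrier R" "s \<in> carrier R" "t \<in> carrier R"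
    and "basic_open R f \<subseteq> basic_open R s" "basic_open R f \<subseteq> basic_open R t"
  obtains k :: nat where "f [^] k \<odot>\<^bsub>M\<^esub> (t \<odot>\<^bsub>M\<^esub> m) = f [^] k \<odot>\<^bsub>M\<^esub> (s \<odot>\<^bsub>M\<^esub> n)"
proof (rule frac_eq_on_basic_open[OF assms(2-8)])
  fix q assume "q \<in> basic_open R f"
  then show "frac R (carrier R - q) M m s = frac R (carrier R - q) M n t"
    using fun_cong[OF assms(1), of q] by (simp add: fraction_section_def)
qed

end

lemma (in cring) to_sections_hom:
  assumes U: "openin (zariski R) U"
  shows "to_sections R U \<in> ring_hom R (\<O> R U)"
proof -
  interpret reg: module R "regular_module R" by (rule module_regular_module)
  have sub: "U \<subseteq> basic_open R \<one>" using openin_zariski_subset[OF U] by (simp add: basic_open_one)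
  show ?thesis
    unfolding to_sections_eq_fraction_section[abs_def]
  proof (rule ring_hom_memI)
    fix x y assume "x \<in> carrier R" "y \<in> carrier R"
    then show "fraction_section R (regular_module R) U (x \<otimes> y) \<one> = fraction_section R (regular_module R) U x \<one>
        \<otimes>\<^bsub>\<O> R U\<^esub> fraction_section R (regular_module R) U y \<one>"
      using reg.fraction_section_smult[OF sub sub, of x y]
      unfolding structure_sheaf_mult by (simp add: structure_sheaf_def)
    show "fraction_section R (regular_module R) U (x \<oplus> y) \<one> = fraction_section R (regular_module R) U x \<one>
        \<oplus>\<^bsub>\<O> R U\<^esub> fraction_section R (regular_module R) U y \<one>"
      using reg.fraction_section_add[OF U sub, of x y] \<open>x \<in> carrier R\<close> \<open>y \<in> carrier R\<close>
      by (simp add: structure_sheaf_def)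
  next
    fix x assume "x \<in> carrier R"
    then show "fraction_section R (regular_module R) U x \<one> \<in> carrier (\<O> R U)"
      using reg.fraction_section_in_tilde_one[OF U] by (simp add: structure_sheaf_def)
  next
    show "fraction_section R (regular_module R) U \<one> \<one> = \<one>\<^bsub>\<O> R U\<^esub>"
      by (simp add: structure_sheaf_def tilde_one fraction_section_def one_localization_regular)
  qed
qed

section \<open>Localization maps\<close>

text \<open>The map \<open>\<kappa>\<close> exhibits \<open>A\<close> as the localization of \<open>R\<close> at \<open>f\<close>.\<close>

locale localized_ring = R?: cring R + A: cring A for R (structure) and A (structure) +
  fixes f \<kappa>
  assumes f_closed [simp]: "f \<in> carrier R"
    and hom: "\<kappa> \<in> ring_hom R A"
    and unit: "\<kappa> f \<in> Units A"
    and ring_surj: "a \<in> carrier A \<Longrightarrow> \<exists>r\<in>carrier R. \<exists>n::nat. a \<otimes>\<^bsub>A\<^esub> \<kappa> f [^]\<^bsub>A\<^esub> n = \<kappa> r"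
    and ring_inj: "r \<in> carrier R \<Longrightarrow> s \<in> carrier R \<Longrightarrow> \<kappa> r = \<kappa> s \<Longrightarrow> \<exists>n::nat. f [^] n \<otimes> r = f [^] n \<otimes> s"
begin

sublocale ring_hom_cring R A \<kappa>
  by unfold_locales (rule hom)

text \<open>For \<open>p\<close> in D(f) this is the extension of \<open>p\<close> to
  \<open>A\<close>, the localization at \<open>f\<close>, and \<open>\<pi>\<close> is the
  contraction. They will be the two mutually inverse maps between D(f) and Spec A.\<close>

definition \<psi> where "\<psi> p = {a \<in> carrier A. \<exists>r\<in>p. \<exists>n::nat. a \<otimes>\<^bsub>A\<^esub> \<kappa> f [^]\<^bsub>A\<^esub> n = \<kappa> r}"
definition \<pi> where "\<pi> q = {r \<in> carrier R. \<kappa> r \<in> q}"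

lemma hom_pow_f [simp]: "\<kappa> (f [^] (n::nat)) = \<kappa> f [^]\<^bsub>A\<^esub> n"
  by (induction n) auto

lemma pow_notin: "p \<in> basic_open R f \<Longrightarrow> f [^] (n::nat) \<in> carrier R - p"
  using R.basic_open_pow_subset[OF f_closed, of n] by (auto simp: basic_open_def)

text \<open>Membership does not depend on how \<open>a\<close> is represented: two representations
  become equal in \<open>R\<close> after multiplication by powers of \<open>f\<close>, and these lie
  outside \<open>p\<close>.\<close>

lemma mem_psi_iff:
  assumes p: "p \<in> basic_open R f" and a: "a \<in> carrier A" "r \<in> carrier R" "a \<otimes>\<^bsub>A\<^esub> \<kappa> f [^]\<^bsub>A\<^esub> (n::nat) = \<kappa> r"
  shows "a \<in> \<psi> p \<longleftrightarrow> r \<in> p"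
proof
  interpret p: primeideal p R using p by (simp add: basic_open_def spec_def)
  assume "a \<in> \<psi> p"
  then obtain r' and k :: nat where r': "r' \<in> p" "a \<otimes>\<^bsub>A\<^esub> \<kappa> f [^]\<^bsub>A\<^esub> k = \<kappa> r'" by (auto simp: \<psi>_def)
  have c: "r' \<in> carrier R" using r' p.Icarr by auto
  have "\<kappa> (r \<otimes> f [^] k) = (a \<otimes>\<^bsub>A\<^esub> \<kappa> f [^]\<^bsub>A\<^esub> n) \<otimes>\<^bsub>A\<^esub> \<kappa> f [^]\<^bsub>A\<^esub> k" using a by simp
  also have "\<dots> = (a \<otimes>\<^bsub>A\<^esub> \<kappa> f [^]\<^bsub>A\<^esub> k) \<otimes>\<^bsub>A\<^esub> \<kappa> f [^]\<^bsub>A\<^esub> n"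
    using a(1) by (simp add: A.m_ac)
  also have "\<dots> = \<kappa> (r' \<otimes> f [^] n)" using r' c by simp
  finally obtain j :: nat where "f [^] j \<otimes> (r \<otimes> f [^] k) = f [^] j \<otimes> (r' \<otimes> f [^] n)"
    using ring_inj[of "r \<otimes> f [^] k" "r' \<otimes> f [^] n"] a c by auto
  moreover have "f [^] j \<otimes> (r' \<otimes> f [^] n) \<in> p"
    using r' p.I_l_closed[of "r' \<otimes> f [^] n" "f [^] j"] p.I_r_closed[of r' "f [^] n"] by simp
  ultimately have "f [^] j \<otimes> (r \<otimes> f [^] k) \<in> p" by simp
  then have "r \<otimes> f [^] k \<in> p" using p.I_prime[of "f [^] j" "r \<otimes> f [^] k"] pow_notin[OF p, of j] a by auto
  then show "r \<in> p" using p.I_prime[of r "f [^] k"] pow_notin[OF p, of k] a by auto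
next
  assume "r \<in> p" then show "a \<in> \<psi> p" using a by (auto simp: \<psi>_def)
qed

lemma hom_mem_psi_iff: "p \<in> basic_open R f \<Longrightarrow> r \<in> carrier R \<Longrightarrow> \<kappa> r \<in> \<psi> p \<longleftrightarrow> r \<in> p"
  by (rule mem_psi_iff[where n = 0]) auto

lemma psi_prime:
  assumes p: "p \<in> basic_open R f"
  shows "\<psi> p \<in> spec A"
proof -
  interpret p: primeideal p R using p by (simp add: basic_open_def spec_def)
  have sub: "\<psi> p \<subseteq> carrier A" by (auto simp: \<psi>_def)
  have mult: "a \<otimes>\<^bsub>A\<^esub> b \<in> \<psi> p" if "a \<in> \<psi> p" "b \<in> carrier A" for a b
  proof -
    from that obtain r s and n k :: nat where *: "r \<in> p" "a \<otimes>\<^bsub>A\<^esub> \<kappa> f [^]\<^bsub>A\<^esub> n = \<kappa> r" "a \<in> carrier A"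
      "s \<in> carrier R" "b \<otimes>\<^bsub>A\<^esub> \<kappa> f [^]\<^bsub>A\<^esub> k = \<kappa> s"
      using ring_surj[of b] by (auto simp: \<psi>_def)
    have c: "r \<in> carrier R" using * p.Icarr by auto
    have "(a \<otimes>\<^bsub>A\<^esub> b) \<otimes>\<^bsub>A\<^esub> \<kappa> f [^]\<^bsub>A\<^esub> (n + k) = (a \<otimes>\<^bsub>A\<^esub> \<kappa> f [^]\<^bsub>A\<^esub> n) \<otimes>\<^bsub>A\<^esub> (b \<otimes>\<^bsub>A\<^esub> \<kappa> f [^]\<^bsub>A\<^esub> k)"
      using *(3) that(2) by (simp add: A.nat_pow_mult[symmetric] A.m_ac)
    also have "\<dots> = \<kappa> (r \<otimes> s)" using * c by simp
    finally show ?thesis using * that(2) p.I_r_closed[of r s]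
      unfolding \<psi>_def by (intro CollectI conjI bexI[of _ "r \<otimes> s"] exI[of _ "n + k"]) auto
  qed
  have ideal: "ideal (\<psi> p) A"
  proof (rule idealI[OF A.ring_axioms])
    show "subgroup (\<psi> p) (add_monoid A)"
    proof (rule A.add.subgroupI[OF sub])
      have "\<kappa> \<zero> \<in> \<psi> p" using p.zero_closed by (subst hom_mem_psi_iff[OF p]) auto
      then show "\<psi> p \<noteq> {}" by auto
      show "\<ominus>\<^bsub>A\<^esub> a \<in> \<psi> p" if "a \<in> \<psi> p" for a
        using mult[OF that, of "\<ominus>\<^bsub>A\<^esub> \<one>\<^bsub>A\<^esub>"] that sub by (auto simp: A.r_minus)
      fix a b assume "a \<in> \<psi> p" "b \<in> \<psi> p"
      then obtain r s and n k :: nat where *: "r \<in> p" "a \<otimes>\<^bsub>A\<^esub> \<kappa> f [^]\<^bsub>A\<^esub> n = \<kappa> r" "a \<in> carrier A"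
        "s \<in> p" "b \<otimes>\<^bsub>A\<^esub> \<kappa> f [^]\<^bsub>A\<^esub> k = \<kappa> s" "b \<in> carrier A"
        by (auto simp: \<psi>_def)
      have c: "r \<in> carrier R" "s \<in> carrier R" using * p.Icarr by auto
      have "(a \<oplus>\<^bsub>A\<^esub> b) \<otimes>\<^bsub>A\<^esub> \<kappa> f [^]\<^bsub>A\<^esub> (n + k) = (a \<otimes>\<^bsub>A\<^esub> \<kappa> f [^]\<^bsub>A\<^esub> n) \<otimes>\<^bsub>A\<^esub> \<kappa> f [^]\<^bsub>A\<^esub> k \<oplus>\<^bsub>A\<^esub> (b \<otimes>\<^bsub>A\<^esub> \<kappa> f [^]\<^bsub>A\<^esub> k) \<otimes>\<^bsub>A\<^esub> \<kappa> f [^]\<^bsub>A\<^esub> n"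
        using *(3,6) by (simp add: A.nat_pow_mult[symmetric] A.m_ac A.l_distr)
      also have "\<dots> = \<kappa> (r \<otimes> f [^] k \<oplus> s \<otimes> f [^] n)" using * c by simp
      finally show "a \<oplus>\<^bsub>A\<^esub> b \<in> \<psi> p"
        using * p.I_r_closed[of r "f [^] k"] p.I_r_closed[of s "f [^] n"] p.a_closed
        unfolding \<psi>_def by (intro CollectI conjI bexI[of _ "r \<otimes> f [^] k \<oplus> s \<otimes> f [^] n"] exI[of _ "n + k"]) auto
    qed
    fix a x assume ax: "a \<in> \<psi> p" "x \<in> carrier A"
    show "a \<otimes>\<^bsub>A\<^esub> x \<in> \<psi> p" using mult ax by simp
    then show "x \<otimes>\<^bsub>A\<^esub> a \<in> \<psi> p" using ax sub A.m_comm[of x a] by auto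
  qed
  have "primeideal (\<psi> p) A"
  proof (rule primeidealI[OF ideal A.is_cring])
    have "\<one> \<notin> p" using p.I_notcarr p.one_imp_carrier by auto
    then have "\<kappa> \<one> \<notin> \<psi> p" by (subst hom_mem_psi_iff[OF p]) auto
    then show "carrier A \<noteq> \<psi> p" by auto
    fix a b assume ab: "a \<in> carrier A" "b \<in> carrier A" "a \<otimes>\<^bsub>A\<^esub> b \<in> \<psi> p"
    then obtain r s and n k :: nat where *: "r \<in> carrier R" "a \<otimes>\<^bsub>A\<^esub> \<kappa> f [^]\<^bsub>A\<^esub> n = \<kappa> r"
        "s \<in> carrier R" "b \<otimes>\<^bsub>A\<^esub> \<kappa> f [^]\<^bsub>A\<^esub> k = \<kappa> s"
      using ring_surj by metis
    have "(a \<otimes>\<^bsub>A\<^esub> b) \<otimes>\<^bsub>A\<^esub> \<kappa> f [^]\<^bsub>A\<^esub> (n + k) = (a \<otimes>\<^bsub>A\<^esub> \<kappa> f [^]\<^bsub>A\<^esub> n) \<otimes>\<^bsub>A\<^esub> (b \<otimes>\<^bsub>A\<^esub> \<kappa> f [^]\<^bsub>A\<^esub> k)"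
      using ab by (simp add: A.nat_pow_mult[symmetric] A.m_ac)
    also have "\<dots> = \<kappa> (r \<otimes> s)" using * by simp
    finally have "r \<otimes> s \<in> p" using mem_psi_iff[OF p, of "a \<otimes>\<^bsub>A\<^esub> b" "r \<otimes> s" "n + k"] ab * by simp
    then have "r \<in> p \<or> s \<in> p" using p.I_prime * by blast
    then show "a \<in> \<psi> p \<or> b \<in> \<psi> p" using mem_psi_iff[OF p] ab * by blast
  qed
  then show ?thesis by (simp add: spec_def)
qed

lemma pi_prime:
  assumes q: "q \<in> spec A"
  shows "\<pi> q \<in> basic_open R f"
proof -
  interpret q: primeideal q A using q by (simp add: spec_def)
  have one: "\<one>\<^bsub>A\<^esub> \<notin> q" using q.I_notcarr q.one_imp_carrier by auto
  have "ideal (\<pi> q) R"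
  proof (rule idealI[OF R.ring_axioms])
    show "subgroup (\<pi> q) (add_monoid R)"
      by (rule R.add.subgroupI)
        (auto simp: \<pi>_def a_inv_def[symmetric] intro!: exI[of _ \<zero>])
  qed (auto simp: \<pi>_def q.I_l_closed q.I_r_closed)
  then have "primeideal (\<pi> q) R"
  proof (rule primeidealI[OF _ R.is_cring])
    have "\<one> \<notin> \<pi> q" using one by (simp add: \<pi>_def)
    then show "carrier R \<noteq> \<pi> q" by auto
    fix a b assume "a \<in> carrier R" "b \<in> carrier R" "a \<otimes> b \<in> \<pi> q"
    then show "a \<in> \<pi> q \<or> b \<in> \<pi> q" using q.I_prime[of "\<kappa> a" "\<kappa> b"] by (auto simp: \<pi>_def)
  qed
  moreover have "\<kappa> f \<notin> q"
  proof
    assume "\<kappa> f \<in> q"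
    then have "inv\<^bsub>A\<^esub> (\<kappa> f) \<otimes>\<^bsub>A\<^esub> \<kappa> f \<in> q" using unit by (intro q.I_l_closed) auto
    then show False using one unit by simp
  qed
  ultimately show ?thesis by (auto simp: basic_open_def spec_def \<pi>_def)
qed

lemma pi_psi: "p \<in> basic_open R f \<Longrightarrow> \<pi> (\<psi> p) = p"
proof -
  assume p: "p \<in> basic_open R f"
  then interpret p: primeideal p R by (simp add: basic_open_def spec_def)
  show ?thesis using hom_mem_psi_iff[OF p] p.Icarr by (auto simp: \<pi>_def)
qed

lemma psi_pi:
  assumes q: "q \<in> spec A"
  shows "\<psi> (\<pi> q) = q"
proof -
  interpret q: primeideal q A using q by (simp add: spec_def)
  have "a \<in> \<psi> (\<pi> q) \<longleftrightarrow> a \<in> q" if a: "a \<in> carrier A" for a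
  proof -
    obtain r and n :: nat where r: "r \<in> carrier R" "a \<otimes>\<^bsub>A\<^esub> \<kappa> f [^]\<^bsub>A\<^esub> n = \<kappa> r" using ring_surj[OF a] by blast
    have "a \<in> \<psi> (\<pi> q) \<longleftrightarrow> r \<in> \<pi> q" by (rule mem_psi_iff[OF pi_prime[OF q] a r])
    also have "\<dots> \<longleftrightarrow> \<kappa> r \<in> q" using r by (simp add: \<pi>_def)
    also have "\<dots> \<longleftrightarrow> a \<in> q"
    proof
      assume "\<kappa> r \<in> q"
      moreover have "\<kappa> f [^]\<^bsub>A\<^esub> n \<notin> q"
        using pow_notin[OF pi_prime[OF q], of n] by (auto simp: \<pi>_def)
      ultimately show "a \<in> q" using q.I_prime[of a "\<kappa> f [^]\<^bsub>A\<^esub> n"] a r by auto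
    next
      assume "a \<in> q"
      then have "a \<otimes>\<^bsub>A\<^esub> \<kappa> f [^]\<^bsub>A\<^esub> n \<in> q" by (intro q.I_r_closed) auto
      then show "\<kappa> r \<in> q" using r by simp
    qed
    finally show ?thesis .
  qed
  then show ?thesis using q.Icarr by (auto simp: \<psi>_def)
qed

lemma psi_mem_basic_open:
  "p \<in> basic_open R f \<Longrightarrow> r \<in> carrier R \<Longrightarrow> \<psi> p \<in> basic_open A (\<kappa> r) \<longleftrightarrow> p \<in> basic_open R r"
  using psi_prime hom_mem_psi_iff by (auto simp: basic_open_def)

lemma open_psi_vimage:
  assumes W: "openin (zariski A) W"
  shows "openin (zariski R) (basic_open R f \<inter> \<psi> -` W)"
proof (subst openin_subopen, intro ballI)
  fix p assume p: "p \<in> basic_open R f \<inter> \<psi> -` W"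
  then obtain a where a: "a \<in> carrier A" "\<psi> p \<in> basic_open A a" "basic_open A a \<subseteq> W"
    using A.basic_open_basis[OF W, of "\<psi> p"] by blast
  obtain r and n :: nat where r: "r \<in> carrier R" "a \<otimes>\<^bsub>A\<^esub> \<kappa> f [^]\<^bsub>A\<^esub> n = \<kappa> r" using ring_surj[OF a(1)] by blast
  \<comment> \<open>As \<open>\<kappa> f\<close> is a unit, \<open>a\<close> and
    \<open>\<kappa> r\<close> define the same basic open set, so inside D(f) the preimage of D(a) is
    D(r).\<close>
  have *: "\<psi> p' \<in> basic_open A a \<longleftrightarrow> p' \<in> basic_open R r" if "p' \<in> basic_open R f" for p'
    using mem_psi_iff[OF that a(1) r] psi_prime[OF that] that by (auto simp: basic_open_def)
  show "\<exists>T. openin (zariski R) T \<and> p \<in> T \<and> T \<subseteq> basic_open R f \<inter> \<psi> -` W"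
    using r p a * by (intro exI[of _ "basic_open R (f \<otimes> r)"]) (auto simp: R.openin_basic_open R.basic_open_mult)
qed

lemma open_pi_vimage:
  assumes U: "openin (zariski R) U"
  shows "openin (zariski A) (spec A \<inter> \<pi> -` U)"
proof (subst openin_subopen, intro ballI)
  fix q assume q: "q \<in> spec A \<inter> \<pi> -` U"
  then obtain r where r: "r \<in> carrier R" "\<pi> q \<in> basic_open R r" "basic_open R r \<subseteq> U"
    using R.basic_open_basis[OF U, of "\<pi> q"] by blast
  have *: "q' \<in> basic_open A (\<kappa> r) \<longleftrightarrow> \<pi> q' \<in> basic_open R r" if "q' \<in> spec A" for q'
    using psi_mem_basic_open[OF pi_prime[OF that] r(1)] psi_pi[OF that] by simp
  show "\<exists>T. openin (zariski A) T \<and> q \<in> T \<and> T \<subseteq> spec A \<inter> \<pi> -` U"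
    using r q * A.basic_open_subset_spec[of "\<kappa> r"]
    by (intro exI[of _ "basic_open A (\<kappa> r)"]) (auto simp: A.openin_basic_open)
qed

lemma homeomorphic_psi: "homeomorphic_map (subtopology (zariski R) (basic_open R f)) (zariski A) \<psi>"
proof -
  have top: "topspace (subtopology (zariski R) (basic_open R f)) = basic_open R f"
    using R.basic_open_subset_spec[of f] by (auto simp: R.topspace_zariski)
  have "homeomorphic_maps (subtopology (zariski R) (basic_open R f)) (zariski A) \<psi> \<pi>"
    unfolding homeomorphic_maps_def
  proof (intro conjI ballI)
    show "continuous_map (subtopology (zariski R) (basic_open R f)) (zariski A) \<psi>"
      unfolding continuous_map
    proof (intro conjI allI impI)
      show "\<psi> ` topspace (subtopology (zariski R) (basic_open R f)) \<subseteq> topspace (zariski A)"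
        unfolding top using psi_prime by (auto simp: A.topspace_zariski)
      fix W assume "openin (zariski A) W"
      then have "openin (zariski R) (basic_open R f \<inter> \<psi> -` W)" by (rule open_psi_vimage)
      moreover have "{x \<in> basic_open R f. \<psi> x \<in> W} = (basic_open R f \<inter> \<psi> -` W) \<inter> basic_open R f" by auto
      ultimately show "openin (subtopology (zariski R) (basic_open R f))
          {x \<in> topspace (subtopology (zariski R) (basic_open R f)). \<psi> x \<in> W}"
        unfolding top openin_subtopology by blast
    qed
    show "continuous_map (zariski A) (subtopology (zariski R) (basic_open R f)) \<pi>"
    proof (rule continuous_map_into_subtopology)
      show "\<pi> \<in> topspace (zariski A) \<rightarrow> basic_open R f" using pi_prime by (auto simp: A.topspace_zariski)
      show "continuous_map (zariski A) (zariski R) \<pi>"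
        unfolding continuous_map
      proof (intro conjI allI impI)
        show "\<pi> ` topspace (zariski A) \<subseteq> topspace (zariski R)"
          using pi_prime R.basic_open_subset_spec by (auto simp: A.topspace_zariski R.topspace_zariski)
        fix U assume "openin (zariski R) U"
        moreover have "{x \<in> topspace (zariski A). \<pi> x \<in> U} = spec A \<inter> \<pi> -` U"
          by (auto simp: A.topspace_zariski)
        ultimately show "openin (zariski A) {x \<in> topspace (zariski A). \<pi> x \<in> U}" using open_pi_vimage by simp
      qed
    qed
  next
    fix x assume "x \<in> topspace (subtopology (zariski R) (basic_open R f))"
    then show "\<pi> (\<psi> x) = x" unfolding top by (rule pi_psi)
  next
    fix y assume "y \<in> topspace (zariski A)"
    then show "\<psi> (\<pi> y) = y" unfolding A.topspace_zariski by (rule psi_pi)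
  qed
  then show ?thesis using homeomorphic_map_maps by blast
qed

end

text \<open>If \<open>\<phi>\<close> exhibits a module as a localization of \<open>M\<close>, it induces bijections on the stalks.  As elements of
  stalks are equivalence classes of pairs, their inverses simply take preimages.\<close>

definition pullback_section ::
    "('r, 'c) ring_scheme \<Rightarrow> ('r, 'm, 'd) module_scheme \<Rightarrow> ('r \<Rightarrow> 'a) \<Rightarrow> ('m \<Rightarrow> 'n) \<Rightarrow> ('r set \<Rightarrow> 'a set)
      \<Rightarrow> 'r set set \<Rightarrow> ('a, 'n) sections \<Rightarrow> ('r, 'm) sections"
  where "pullback_section R M \<kappa> \<phi> \<psi> U s =
    (\<lambda>p\<in>U. {(m, r). m \<in> carrier M \<and> r \<in> carrier R \<and> (\<phi> m, \<kappa> r) \<in> s (\<psi> p)})"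

locale localized_module = localized_ring R A f \<kappa> + M: module R M + P: module A P
  for R (structure) and A (structure) and f \<kappa> and M and P +
  fixes \<phi>
  assumes phi_closed [simp]: "m \<in> carrier M \<Longrightarrow> \<phi> m \<in> carrier P"
    and phi_add: "m \<in> carrier M \<Longrightarrow> n \<in> carrier M \<Longrightarrow> \<phi> (m \<oplus>\<^bsub>M\<^esub> n) = \<phi> m \<oplus>\<^bsub>P\<^esub> \<phi> n"
    and phi_smult: "r \<in> carrier R \<Longrightarrow> m \<in> carrier M \<Longrightarrow> \<phi> (r \<odot>\<^bsub>M\<^esub> m) = \<kappa> r \<odot>\<^bsub>P\<^esub> \<phi> m"
    and mod_surj: "c \<in> carrier P \<Longrightarrow> \<exists>m\<in>carrier M. \<exists>n::nat. \<kappa> f [^]\<^bsub>A\<^esub> n \<odot>\<^bsub>P\<^esub> c = \<phi> m"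
    and mod_inj: "m \<in> carrier M \<Longrightarrow> n \<in> carrier M \<Longrightarrow> \<phi> m = \<phi> n \<Longrightarrow>
      \<exists>k::nat. f [^] k \<odot>\<^bsub>M\<^esub> m = f [^] k \<odot>\<^bsub>M\<^esub> n"
begin

abbreviation "stalk_R p \<equiv> localization R (carrier R - p) M"
abbreviation "stalk_A q \<equiv> localization A (carrier A - q) P"

definition "pre x = {(m, r). m \<in> carrier M \<and> r \<in> carrier R \<and> (\<phi> m, \<kappa> r) \<in> x}"

lemma pullback_section_eq: "pullback_section R M \<kappa> \<phi> \<psi> U s = (\<lambda>p\<in>U. pre (s (\<psi> p)))"
  by (simp add: pullback_section_def pre_def)

lemma denominators_R: "p \<in> basic_open R f \<Longrightarrow> module_denominators R M (carrier R - p)"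
  by (intro M.prime_denominators) (auto simp: basic_open_def)

lemma denominators_A: "p \<in> basic_open R f \<Longrightarrow> module_denominators A P (carrier A - \<psi> p)"
  by (intro P.prime_denominators psi_prime)

lemma hom_notin: "p \<in> basic_open R f \<Longrightarrow> r \<in> carrier R - p \<Longrightarrow> \<kappa> r \<in> carrier A - \<psi> p"
  using hom_mem_psi_iff by auto

text \<open>On the way from \<open>A\<close> back to \<open>R\<close>, a multiplier \<open>t\<close>
  outside \<open>\<psi> p\<close> becomes some \<open>u\<close> outside \<open>p\<close> after
  multiplication by a power of \<open>f\<close>, and an equation in \<open>P\<close> lifts to
  \<open>M\<close> up to a further power of \<open>f\<close>. Powers of \<open>f\<close> lie outside
  \<open>p\<close>, so the stalk at \<open>p\<close> absorbs both.\<close>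

lemma pre_frac:
  assumes p: "p \<in> basic_open R f" and m: "m \<in> carrier M" and r: "r \<in> carrier R - p"
  shows "pre (frac A (carrier A - \<psi> p) P (\<phi> m) (\<kappa> r)) = frac R (carrier R - p) M m r"
proof -
  interpret locR: module_denominators R M "carrier R - p" by (rule denominators_R[OF p])
  interpret locA: module_denominators A P "carrier A - \<psi> p" by (rule denominators_A[OF p])
  have "(\<exists>t\<in>carrier A - \<psi> p. t \<odot>\<^bsub>P\<^esub> (\<kappa> s \<odot>\<^bsub>P\<^esub> \<phi> m) = t \<odot>\<^bsub>P\<^esub> (\<kappa> r \<odot>\<^bsub>P\<^esub> \<phi> n)) \<longleftrightarrow>
      (\<exists>t\<in>carrier R - p. t \<odot>\<^bsub>M\<^esub> (s \<odot>\<^bsub>M\<^esub> m) = t \<odot>\<^bsub>M\<^esub> (r \<odot>\<^bsub>M\<^esub> n))" (is "?l \<longleftrightarrow> ?r")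
    if n: "n \<in> carrier M" and s: "s \<in> carrier R - p" for n s
  proof
    assume ?r
    then obtain t where t: "t \<in> carrier R - p" "t \<odot>\<^bsub>M\<^esub> (s \<odot>\<^bsub>M\<^esub> m) = t \<odot>\<^bsub>M\<^esub> (r \<odot>\<^bsub>M\<^esub> n)" by blast
    have "\<kappa> t \<odot>\<^bsub>P\<^esub> (\<kappa> s \<odot>\<^bsub>P\<^esub> \<phi> m) = \<phi> (t \<odot>\<^bsub>M\<^esub> (s \<odot>\<^bsub>M\<^esub> m))"
      using t(1) s m by (simp add: phi_smult)
    also have "\<dots> = \<kappa> t \<odot>\<^bsub>P\<^esub> (\<kappa> r \<odot>\<^bsub>P\<^esub> \<phi> n)" using t(1) r n by (simp add: phi_smult t(2))
    finally show ?l using hom_notin[OF p t(1)] by blast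
  next
    assume ?l
    then obtain t where t: "t \<in> carrier A - \<psi> p" "t \<odot>\<^bsub>P\<^esub> (\<kappa> s \<odot>\<^bsub>P\<^esub> \<phi> m) = t \<odot>\<^bsub>P\<^esub> (\<kappa> r \<odot>\<^bsub>P\<^esub> \<phi> n)" by blast
    obtain u and k :: nat where u: "u \<in> carrier R" "t \<otimes>\<^bsub>A\<^esub> \<kappa> f [^]\<^bsub>A\<^esub> k = \<kappa> u" using ring_surj t(1) by blast
    have up: "u \<in> carrier R - p" using mem_psi_iff[OF p DiffD1[OF t(1)] u] t(1) u(1) by simp
    have eq: "\<kappa> u \<odot>\<^bsub>P\<^esub> x = \<kappa> f [^]\<^bsub>A\<^esub> k \<odot>\<^bsub>P\<^esub> (t \<odot>\<^bsub>P\<^esub> x)" if "x \<in> carrier P" for x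
    proof -
      have "\<kappa> u = \<kappa> f [^]\<^bsub>A\<^esub> k \<otimes>\<^bsub>A\<^esub> t" using t(1) A.m_comm[of t "\<kappa> f [^]\<^bsub>A\<^esub> k"] u(2) by simp
      then show ?thesis using that t(1) by (simp add: P.smult_assoc1)
    qed
    have "\<phi> (u \<odot>\<^bsub>M\<^esub> (s \<odot>\<^bsub>M\<^esub> m)) = \<kappa> u \<odot>\<^bsub>P\<^esub> (\<kappa> s \<odot>\<^bsub>P\<^esub> \<phi> m)" using u s m by (simp add: phi_smult)
    also have "\<dots> = \<kappa> u \<odot>\<^bsub>P\<^esub> (\<kappa> r \<odot>\<^bsub>P\<^esub> \<phi> n)" using eq t(2) s m r n by simp
    also have "\<dots> = \<phi> (u \<odot>\<^bsub>M\<^esub> (r \<odot>\<^bsub>M\<^esub> n))" using u r n by (simp add: phi_smult)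
    finally obtain j :: nat where "f [^] j \<odot>\<^bsub>M\<^esub> (u \<odot>\<^bsub>M\<^esub> (s \<odot>\<^bsub>M\<^esub> m)) = f [^] j \<odot>\<^bsub>M\<^esub> (u \<odot>\<^bsub>M\<^esub> (r \<odot>\<^bsub>M\<^esub> n))"
      using mod_inj[of "u \<odot>\<^bsub>M\<^esub> (s \<odot>\<^bsub>M\<^esub> m)" "u \<odot>\<^bsub>M\<^esub> (r \<odot>\<^bsub>M\<^esub> n)"] u r s m n by auto
    then have "(f [^] j \<otimes> u) \<odot>\<^bsub>M\<^esub> (s \<odot>\<^bsub>M\<^esub> m) = (f [^] j \<otimes> u) \<odot>\<^bsub>M\<^esub> (r \<odot>\<^bsub>M\<^esub> n)"
      using u r s m n by (simp add: M.smult_assoc1)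
    moreover have "f [^] j \<otimes> u \<in> carrier R - p" using pow_notin[OF p] up by (intro locR.denom_mult)
    ultimately show ?r by blast
  qed
  note 1 = this
  have 2: "\<kappa> s \<in> carrier A - \<psi> p \<longleftrightarrow> s \<in> carrier R - p" if "s \<in> carrier R" for s
    using that hom_mem_psi_iff[OF p that] by simp
  have "(n, s) \<in> pre (frac A (carrier A - \<psi> p) P (\<phi> m) (\<kappa> r)) \<longleftrightarrow> (n, s) \<in> frac R (carrier R - p) M m r" for n s
  proof (cases "n \<in> carrier M \<and> s \<in> carrier R - p")
    case True
    then have n: "n \<in> carrier M" and s: "s \<in> carrier R - p" by auto
    have "\<kappa> s \<in> carrier A - \<psi> p" using 2[of s] s by blast
    then show ?thesis
      using 1[OF n s] n s by (simp add: pre_def locA.mem_frac_iff locR.mem_frac_iff del: Diff_iff)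
  next
    case False
    then have "\<not> (n \<in> carrier M \<and> s \<in> carrier R \<and> \<kappa> s \<in> carrier A - \<psi> p)" using 2[of s] by blast
    with False show ?thesis by (simp add: pre_def locA.mem_frac_iff locR.mem_frac_iff del: Diff_iff) blast
  qed
  then show ?thesis by auto
qed

text \<open>From \<open>\<phi> m = f^n c\<close> and \<open>\<kappa> r = f^k a\<close> one gets
  \<open>c/a = (f^k f^n c)/(f^n f^k a)\<close>. The new numerator and denominator do not involve
  \<open>p\<close>, so they serve on a whole neighbourhood in \<open>pull_in_tilde\<close>.\<close>

lemma rep_frac:
  assumes p: "p \<in> basic_open R f" and c: "c \<in> carrier P" "m \<in> carrier M" "\<kappa> f [^]\<^bsub>A\<^esub> (n::nat) \<odot>\<^bsub>P\<^esub> c = \<phi> m"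
    and a: "a \<in> carrier A - \<psi> p" "r \<in> carrier R" "a \<otimes>\<^bsub>A\<^esub> \<kappa> f [^]\<^bsub>A\<^esub> (k::nat) = \<kappa> r"
  shows "f [^] n \<otimes> r \<in> carrier R - p"
    and "frac A (carrier A - \<psi> p) P c a = frac A (carrier A - \<psi> p) P (\<phi> (f [^] k \<odot>\<^bsub>M\<^esub> m)) (\<kappa> (f [^] n \<otimes> r))"
proof -
  interpret locR: module_denominators R M "carrier R - p" by (rule denominators_R[OF p])
  interpret locA: module_denominators A P "carrier A - \<psi> p" by (rule denominators_A[OF p])
  have r: "r \<in> carrier R - p" using mem_psi_iff[OF p DiffD1[OF a(1)] a(2,3)] a(1,2) by simp
  then show 1: "f [^] n \<otimes> r \<in> carrier R - p" using pow_notin[OF p] by (intro locR.denom_mult)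
  have eq: "\<kappa> (f [^] n \<otimes> r) = \<kappa> r \<otimes>\<^bsub>A\<^esub> \<kappa> f [^]\<^bsub>A\<^esub> n" using a(2) by (simp add: A.m_comm)
  have "\<kappa> (f [^] n \<otimes> r) \<odot>\<^bsub>P\<^esub> c = \<kappa> r \<odot>\<^bsub>P\<^esub> \<phi> m"
    unfolding eq using a(2) c by (simp add: P.smult_assoc1)
  also have "\<dots> = a \<odot>\<^bsub>P\<^esub> (\<kappa> f [^]\<^bsub>A\<^esub> k \<odot>\<^bsub>P\<^esub> \<phi> m)"
    unfolding a(3)[symmetric] using a(1) c by (intro P.smult_assoc1) auto
  also have "\<dots> = a \<odot>\<^bsub>P\<^esub> \<phi> (f [^] k \<odot>\<^bsub>M\<^esub> m)" using c(2) by (simp add: phi_smult)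
  finally show "frac A (carrier A - \<psi> p) P c a = frac A (carrier A - \<psi> p) P (\<phi> (f [^] k \<odot>\<^bsub>M\<^esub> m)) (\<kappa> (f [^] n \<otimes> r))"
    by - (rule locA.frac_eqI[OF c(1) phi_closed[OF M.smult_closed[OF _ c(2)]] a(1) hom_notin[OF p 1]], simp_all)
qed

lemma stalk_rep:
  assumes p: "p \<in> basic_open R f" and x: "x \<in> carrier (stalk_A (\<psi> p))"
  obtains m r where "m \<in> carrier M" "r \<in> carrier R - p" "x = frac A (carrier A - \<psi> p) P (\<phi> m) (\<kappa> r)"
proof -
  obtain c a where c: "c \<in> carrier P" "a \<in> carrier A - \<psi> p" "x = frac A (carrier A - \<psi> p) P c a"
    using module_denominators.localizationE[OF denominators_A[OF p] x] by metis
  obtain m and n :: nat where m: "m \<in> carrier M" "\<kappa> f [^]\<^bsub>A\<^esub> n \<odot>\<^bsub>P\<^esub> c = \<phi> m" using mod_surj[OF c(1)] by blast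
  obtain r and k :: nat where r: "r \<in> carrier R" "a \<otimes>\<^bsub>A\<^esub> \<kappa> f [^]\<^bsub>A\<^esub> k = \<kappa> r" using ring_surj[of a] c by blast
  show thesis using rep_frac[OF p c(1) m c(2) r] c(3) m by (intro that) auto
qed

lemma pre_add:
  assumes p: "p \<in> basic_open R f" and x: "x \<in> carrier (stalk_A (\<psi> p))" "y \<in> carrier (stalk_A (\<psi> p))"
  shows "pre (x \<oplus>\<^bsub>stalk_A (\<psi> p)\<^esub> y) = pre x \<oplus>\<^bsub>stalk_R p\<^esub> pre y"
proof -
  interpret locR: module_denominators R M "carrier R - p" by (rule denominators_R[OF p])
  interpret locA: module_denominators A P "carrier A - \<psi> p" by (rule denominators_A[OF p])
  obtain m r where m: "m \<in> carrier M" "r \<in> carrier R - p" "x = frac A (carrier A - \<psi> p) P (\<phi> m) (\<kappa> r)"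
    using stalk_rep[OF p x(1)] by metis
  obtain n s where n: "n \<in> carrier M" "s \<in> carrier R - p" "y = frac A (carrier A - \<psi> p) P (\<phi> n) (\<kappa> s)"
    using stalk_rep[OF p x(2)] by metis
  have "x \<oplus>\<^bsub>stalk_A (\<psi> p)\<^esub> y = frac A (carrier A - \<psi> p) P (\<phi> (s \<odot>\<^bsub>M\<^esub> m \<oplus>\<^bsub>M\<^esub> r \<odot>\<^bsub>M\<^esub> n)) (\<kappa> (r \<otimes> s))"
    using m n hom_notin[OF p] by (simp add: locA.add_frac phi_add phi_smult)
  then show ?thesis
    using m n pre_frac[OF p m(1,2)] pre_frac[OF p n(1,2)]
      pre_frac[OF p _ locR.denom_mult[OF m(2) n(2)], of "s \<odot>\<^bsub>M\<^esub> m \<oplus>\<^bsub>M\<^esub> r \<odot>\<^bsub>M\<^esub> n"]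
    by (simp add: locR.add_frac)
qed

text \<open>Every germ contains a pair of the form \<open>(\<phi> m, \<kappa> r)\<close>, and one
  pair determines the class.\<close>

lemma pre_inj:
  assumes p: "p \<in> basic_open R f" and x: "x \<in> carrier (stalk_A (\<psi> p))" "y \<in> carrier (stalk_A (\<psi> p))"
    and eq: "pre x = pre y"
  shows "x = y"
proof -
  interpret locR: module_denominators R M "carrier R - p" by (rule denominators_R[OF p])
  interpret locA: module_denominators A P "carrier A - \<psi> p" by (rule denominators_A[OF p])
  obtain m r where m: "m \<in> carrier M" "r \<in> carrier R - p" "x = frac A (carrier A - \<psi> p) P (\<phi> m) (\<kappa> r)"
    using stalk_rep[OF p x(1)] by metis
  obtain n s where n: "n \<in> carrier M" "s \<in> carrier R - p" "y = frac A (carrier A - \<psi> p) P (\<phi> n) (\<kappa> s)"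
    using stalk_rep[OF p x(2)] by metis
  have "(\<phi> m, \<kappa> r) \<in> x" using m hom_notin[OF p] by (auto intro: locA.self_mem_frac)
  then have "(m, r) \<in> pre x" using m by (simp add: pre_def)
  then have "(m, r) \<in> pre y" using eq by simp
  then have "(\<phi> m, \<kappa> r) \<in> y" by (simp add: pre_def)
  then show ?thesis
    using locA.frac_mem_eq(3)[of "\<phi> m" "\<kappa> r" "\<phi> n" "\<kappa> s"] m n hom_notin[OF p n(2)] by auto
qed

definition "inverse_image W = basic_open R f \<inter> \<psi> -` W"

abbreviation "pull W \<equiv> pullback_section R M \<kappa> \<phi> \<psi> (inverse_image W)"

lemma inverse_image_open: "openin (zariski A) W \<Longrightarrow> openin (zariski R) (inverse_image W)"
  unfolding inverse_image_def by (rule open_psi_vimage)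

lemma inverse_imageD: "p \<in> inverse_image W \<Longrightarrow> p \<in> basic_open R f" "p \<in> inverse_image W \<Longrightarrow> \<psi> p \<in> W"
  by (auto simp: inverse_image_def)

lemma pull_in_tilde:
  assumes W: "openin (zariski A) W" and s: "s \<in> carrier (tilde A P W)"
  shows "pull W s \<in> carrier (tilde R M (inverse_image W))"
  unfolding M.carrier_tilde[OF inverse_image_open[OF W]]
proof (rule M.local_fractionsI_open[OF M.carrier_is_submodule])
  show "pull W s \<in> extensional (inverse_image W)" by (simp add: pullback_section_def)
  fix p assume p: "p \<in> inverse_image W"
  obtain a c where a: "a \<in> carrier A" "c \<in> carrier P" "\<psi> p \<in> basic_open A a" "basic_open A a \<subseteq> W"
    and s: "\<And>q. q \<in> basic_open A a \<Longrightarrow> s q = frac A (carrier A - q) P c a"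
    using P.tilde_locally[OF W s inverse_imageD(2)[OF p]] by metis
  obtain m and n :: nat where m: "m \<in> carrier M" "\<kappa> f [^]\<^bsub>A\<^esub> n \<odot>\<^bsub>P\<^esub> c = \<phi> m" using mod_surj[OF a(2)] by blast
  obtain r and k :: nat where r: "r \<in> carrier R" "a \<otimes>\<^bsub>A\<^esub> \<kappa> f [^]\<^bsub>A\<^esub> k = \<kappa> r" using ring_surj[OF a(1)] by blast
  let ?V = "inverse_image (basic_open A a)"
  have q: "q \<in> basic_open R f" "a \<in> carrier A - \<psi> q" if "q \<in> ?V" for q
    using that a by (auto simp: inverse_image_def basic_open_def)
  show "\<exists>V m g. openin (zariski R) V \<and> p \<in> V \<and> V \<subseteq> inverse_image W \<and> V \<subseteq> basic_open R g \<and> m \<in> carrier M \<and>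
      g \<in> carrier R \<and> (\<forall>q\<in>V. pull W s q = frac R (carrier R - q) M m g)"
  proof (intro exI conjI ballI)
    show "openin (zariski R) ?V" by (rule inverse_image_open[OF A.openin_basic_open[OF a(1)]])
    show "p \<in> ?V" using p a by (auto simp: inverse_image_def)
    show sub: "?V \<subseteq> inverse_image W" using a by (auto simp: inverse_image_def)
    show "?V \<subseteq> basic_open R (f [^] n \<otimes> r)"
    proof
      fix q assume "q \<in> ?V"
      then show "q \<in> basic_open R (f [^] n \<otimes> r)"
        using rep_frac(1)[OF q(1) a(2) m q(2) r] q(1) by (auto simp: basic_open_def)
    qed
    show "f [^] k \<odot>\<^bsub>M\<^esub> m \<in> carrier M" "f [^] n \<otimes> r \<in> carrier R" using m r by auto
    fix q assume qV: "q \<in> ?V"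
    have "s (\<psi> q) = frac A (carrier A - \<psi> q) P (\<phi> (f [^] k \<odot>\<^bsub>M\<^esub> m)) (\<kappa> (f [^] n \<otimes> r))"
      using s[of "\<psi> q"] inverse_imageD(2)[OF qV] rep_frac(2)[OF q(1)[OF qV] a(2) m q(2)[OF qV] r] by simp
    then have "pre (s (\<psi> q)) = frac R (carrier R - q) M (f [^] k \<odot>\<^bsub>M\<^esub> m) (f [^] n \<otimes> r)"
      using pre_frac[OF q(1)[OF qV] _ rep_frac(1)[OF q(1)[OF qV] a(2) m q(2)[OF qV] r], of "f [^] k \<odot>\<^bsub>M\<^esub> m"] m
      by simp
    then show "pull W s q = frac R (carrier R - q) M (f [^] k \<odot>\<^bsub>M\<^esub> m) (f [^] n \<otimes> r)"
      using qV sub by (auto simp: pullback_section_eq)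
  qed
qed

lemma pull_surj:
  assumes W: "openin (zariski A) W" and t: "t \<in> carrier (tilde R M (inverse_image W))"
  shows "\<exists>s\<in>carrier (tilde A P W). pull W s = t"
proof
  note W' = inverse_image_open[OF W]
  \<comment> \<open>The preimage of \<open>t\<close> pushes representatives forward by
    \<open>\<phi>\<close> and \<open>\<kappa>\<close>. By \<open>pre_frac\<close> all
    representatives of one germ give the same class, so the union is that class.\<close>
  define s where "s = (\<lambda>q\<in>W. \<Union>(m, r)\<in>t (\<pi> q). frac A (carrier A - q) P (\<phi> m) (\<kappa> r))"
  have Wspec: "W \<subseteq> spec A" by (rule A.openin_zariski_subset[OF W])
  have s_eq: "s (\<psi> p) = frac A (carrier A - \<psi> p) P (\<phi> m) (\<kappa> h)"
    if p: "p \<in> inverse_image W" and m: "m \<in> carrier M" "h \<in> carrier R - p" and tp: "t p = frac R (carrier R - p) M m h"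
    for p m h
  proof -
    note pf = inverse_imageD(1)[OF p]
    interpret locR: module_denominators R M "carrier R - p" by (rule denominators_R[OF pf])
    interpret locA: module_denominators A P "carrier A - \<psi> p" by (rule denominators_A[OF pf])
    have "frac A (carrier A - \<psi> p) P (\<phi> m') (\<kappa> r') = frac A (carrier A - \<psi> p) P (\<phi> m) (\<kappa> h)"
      if mem: "(m', r') \<in> t p" for m' r'
    proof -
      have "(m', r') \<in> pre (frac A (carrier A - \<psi> p) P (\<phi> m) (\<kappa> h))"
        using mem unfolding pre_frac[OF pf m] tp .
      then have "(\<phi> m', \<kappa> r') \<in> frac A (carrier A - \<psi> p) P (\<phi> m) (\<kappa> h)" by (simp add: pre_def)
      then show ?thesis by (rule locA.frac_mem_eq(3)[OF _ phi_closed[OF m(1)] hom_notin[OF pf m(2)]])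
    qed
    moreover have "(m, h) \<in> t p" unfolding tp by (rule locR.self_mem_frac[OF m])
    ultimately have "(\<Union>(m, r)\<in>t p. frac A (carrier A - \<psi> p) P (\<phi> m) (\<kappa> r)) = frac A (carrier A - \<psi> p) P (\<phi> m) (\<kappa> h)"
      by fast
    then show ?thesis using inverse_imageD(2)[OF p] pi_psi[OF pf] by (simp add: s_def)
  qed
  show "s \<in> carrier (tilde A P W)"
    unfolding P.mem_tilde_iff[OF W]
  proof (intro conjI ballI)
    show "s \<in> extensional W" by (simp add: s_def)
    fix q assume q: "q \<in> W"
    then have qs: "q \<in> spec A" using Wspec by auto
    have "\<pi> q \<in> inverse_image W" using q psi_pi[OF qs] pi_prime[OF qs] by (simp add: inverse_image_def)
    then obtain h m where h: "h \<in> carrier R" "m \<in> carrier M" "\<pi> q \<in> basic_open R h" "basic_open R h \<subseteq> inverse_image W"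
      and th: "\<And>p. p \<in> basic_open R h \<Longrightarrow> t p = frac R (carrier R - p) M m h"
      using M.tilde_locally[OF W' t] by metis
    show "\<exists>a\<in>carrier A. \<exists>c\<in>carrier P. q \<in> basic_open A a \<and> basic_open A a \<subseteq> W \<and>
      (\<forall>q\<in>basic_open A a. s q = frac A (carrier A - q) P c a)"
    proof (intro bexI conjI ballI subsetI)
      show "q \<in> basic_open A (\<kappa> h)"
        using psi_mem_basic_open[OF pi_prime[OF qs] h(1)] psi_pi[OF qs] h(3) by simp
      fix q' assume q': "q' \<in> basic_open A (\<kappa> h)"
      then have qs': "q' \<in> spec A" by (simp add: basic_open_def)
      have "\<pi> q' \<in> basic_open R h" using psi_mem_basic_open[OF pi_prime[OF qs'] h(1)] psi_pi[OF qs'] q' by simp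
      then have p': "\<pi> q' \<in> inverse_image W" "h \<in> carrier R - \<pi> q'" and "t (\<pi> q') = frac R (carrier R - \<pi> q') M m h"
        using h th by (auto simp: basic_open_def)
      then show "s q' = frac A (carrier A - q') P (\<phi> m) (\<kappa> h)"
        using s_eq[OF p'(1) h(2) p'(2)] psi_pi[OF qs'] by simp
      show "q' \<in> W" using inverse_imageD(2)[OF p'(1)] psi_pi[OF qs'] by simp
    qed (use h in auto)
  qed
  show "pull W s = t"
  proof (rule extensionalityI[where A = "inverse_image W"])
    show "t \<in> extensional (inverse_image W)" using t by (rule M.tilde_extensional)
    fix p assume p: "p \<in> inverse_image W"
    obtain h m where h: "h \<in> carrier R" "m \<in> carrier M" "p \<in> basic_open R h"
      and tp: "t p = frac R (carrier R - p) M m h"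
      using M.tilde_locally[OF W' t p] by metis
    have hp: "h \<in> carrier R - p" using h by (simp add: basic_open_def)
    show "pull W s p = t p"
      using p tp s_eq[OF p h(2) hp tp] pre_frac[OF inverse_imageD(1)[OF p] h(2) hp] by (simp add: pullback_section_eq)
  qed (simp add: pullback_section_def)
qed

lemma pull_inj:
  assumes W: "openin (zariski A) W" and s: "s \<in> carrier (tilde A P W)" "t \<in> carrier (tilde A P W)"
    and eq: "pull W s = pull W t"
  shows "s = t"
proof (rule extensionalityI[where A = W])
  show "s \<in> extensional W" "t \<in> extensional W" using s P.tilde_extensional by auto
  fix q assume q: "q \<in> W"
  then have qs: "q \<in> spec A" using A.openin_zariski_subset[OF W] by auto
  then have p: "\<pi> q \<in> inverse_image W" using q psi_pi[OF qs] pi_prime[OF qs] by (simp add: inverse_image_def)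
  have "pre (s q) = pre (t q)"
    using fun_cong[OF eq, of "\<pi> q"] p psi_pi[OF qs] by (simp add: pullback_section_eq)
  then show "s q = t q"
    using pre_inj[OF pi_prime[OF qs], of "s q" "t q"] P.tilde_in_stalk[OF s(1) q] P.tilde_in_stalk[OF s(2) q] psi_pi[OF qs]
    by simp
qed

lemma pull_bij:
  assumes W: "openin (zariski A) W"
  shows "bij_betw (pull W) (carrier (tilde A P W)) (carrier (tilde R M (inverse_image W)))"
  unfolding bij_betw_def inj_on_def
  using pull_in_tilde[OF W] pull_surj[OF W] pull_inj[OF W] by blast

lemma pull_add:
  assumes W: "openin (zariski A) W" and s: "s \<in> carrier (tilde A P W)" "t \<in> carrier (tilde A P W)"
  shows "pull W (s \<oplus>\<^bsub>tilde A P W\<^esub> t) = pull W s \<oplus>\<^bsub>tilde R M (inverse_image W)\<^esub> pull W t"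
  unfolding tilde_add pullback_section_eq
proof (rule restrict_ext)
  fix p assume p: "p \<in> inverse_image W"
  note pW = inverse_imageD[OF p]
  show "pre (restrict (\<lambda>p. s p \<oplus>\<^bsub>localization A (carrier A - p) P\<^esub> t p) W (\<psi> p))
    = restrict (\<lambda>p. pre (s (\<psi> p))) (inverse_image W) p \<oplus>\<^bsub>localization R (carrier R - p) M\<^esub>
      restrict (\<lambda>p. pre (t (\<psi> p))) (inverse_image W) p"
    using p pW pre_add[OF pW(1) P.tilde_in_stalk[OF s(1) pW(2)] P.tilde_in_stalk[OF s(2) pW(2)]] by simp
qed

lemma restrict_pull:
  assumes "W' \<subseteq> W"
  shows "pull W' (restrict s W') = restrict (pull W s) (inverse_image W')"
  using assms by (intro ext) (auto simp: pullback_section_def inverse_image_def)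

end

context localized_ring
begin

lemma regular_localized_module: "localized_module R A f \<kappa> (regular_module R) (regular_module A) \<kappa>"
proof -
  interpret M: module R "regular_module R" by (rule R.module_regular_module)
  interpret P: module A "regular_module A" by (rule A.module_regular_module)
  have surj: "\<exists>m\<in>carrier R. \<exists>n::nat. \<kappa> f [^]\<^bsub>A\<^esub> n \<otimes>\<^bsub>A\<^esub> c = \<kappa> m" if c: "c \<in> carrier A" for c
  proof -
    obtain r and n :: nat where "r \<in> carrier R" "c \<otimes>\<^bsub>A\<^esub> \<kappa> f [^]\<^bsub>A\<^esub> n = \<kappa> r" using ring_surj[OF c] by blast
    then show ?thesis using c A.m_comm[of c "\<kappa> f [^]\<^bsub>A\<^esub> n"] by auto
  qed
  show ?thesis
    by (intro localized_module.intro localized_ring_axioms M.module_axioms P.module_axioms localized_module_axioms.intro)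
      (simp_all add: surj ring_inj)
qed

end

context localized_module
begin

abbreviation "pull_ring W \<equiv> pullback_section R (regular_module R) \<kappa> \<kappa> \<psi> (inverse_image W)"

lemma pre_smult:
  assumes p: "p \<in> basic_open R f" and a: "a \<in> carrier (localization A (carrier A - \<psi> p) (regular_module A))"
    and x: "x \<in> carrier (stalk_A (\<psi> p))"
  shows "pre (a \<odot>\<^bsub>stalk_A (\<psi> p)\<^esub> x)
    = localized_module.pre R \<kappa> (regular_module R) \<kappa> a \<odot>\<^bsub>stalk_R p\<^esub> pre x"
proof -
  interpret reg: localized_module R A f \<kappa> "regular_module R" "regular_module A" \<kappa> by (rule regular_localized_module)
  interpret locR: module_denominators R M "carrier R - p" by (rule denominators_R[OF p])
  interpret locA: module_denominators A P "carrier A - \<psi> p" by (rule denominators_A[OF p])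
  obtain b r where b: "b \<in> carrier R" "r \<in> carrier R - p" "a = frac A (carrier A - \<psi> p) (regular_module A) (\<kappa> b) (\<kappa> r)"
    using reg.stalk_rep[OF p a] by auto
  obtain n s where n: "n \<in> carrier M" "s \<in> carrier R - p" "x = frac A (carrier A - \<psi> p) P (\<phi> n) (\<kappa> s)"
    using stalk_rep[OF p x] by metis
  have "a \<odot>\<^bsub>stalk_A (\<psi> p)\<^esub> x = frac A (carrier A - \<psi> p) P (\<phi> (b \<odot>\<^bsub>M\<^esub> n)) (\<kappa> (r \<otimes> s))"
    using b n hom_notin[OF p] by (simp add: locA.smult_frac phi_smult)
  then have "pre (a \<odot>\<^bsub>stalk_A (\<psi> p)\<^esub> x) = frac R (carrier R - p) M (b \<odot>\<^bsub>M\<^esub> n) (r \<otimes> s)"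
    using pre_frac[OF p _ locR.denom_mult[OF b(2) n(2)], of "b \<odot>\<^bsub>M\<^esub> n"] b n by simp
  moreover have "reg.pre a = frac R (carrier R - p) (regular_module R) b r"
    using reg.pre_frac[OF p _ b(2), of b] b by simp
  moreover have "pre x = frac R (carrier R - p) M n s" using pre_frac[OF p n(1,2)] n(3) by simp
  ultimately show ?thesis using b n by (simp add: locR.smult_frac)
qed

lemma pull_smult:
  assumes W: "openin (zariski A) W" and a: "a \<in> carrier (\<O> A W)" and s: "s \<in> carrier (tilde A P W)"
  shows "pull W (a \<odot>\<^bsub>tilde A P W\<^esub> s) = pull_ring W a \<odot>\<^bsub>tilde R M (inverse_image W)\<^esub> pull W s"
proof -
  interpret reg: localized_module R A f \<kappa> "regular_module R" "regular_module A" \<kappa> by (rule regular_localized_module)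
  show ?thesis
    unfolding tilde_smult pullback_section_eq reg.pullback_section_eq
  proof (rule restrict_ext)
    fix p assume p: "p \<in> inverse_image W"
    note pW = inverse_imageD[OF p]
    have "a (\<psi> p) \<in> carrier (localization A (carrier A - \<psi> p) (regular_module A))"
      using a reg.P.tilde_in_stalk[OF _ pW(2)] by (simp add: structure_sheaf_def)
    then show "pre (restrict (\<lambda>p. a p \<odot>\<^bsub>localization A (carrier A - p) P\<^esub> s p) W (\<psi> p))
      = restrict (\<lambda>p. reg.pre (a (\<psi> p))) (inverse_image W) p \<odot>\<^bsub>localization R (carrier R - p) M\<^esub>
        restrict (\<lambda>p. pre (s (\<psi> p))) (inverse_image W) p"
      using p pW pre_smult[OF pW(1) _ P.tilde_in_stalk[OF s pW(2)]] by simp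
  qed
qed

lemma semilinear_iso_pull:
  assumes "openin (zariski A) W"
  shows "semilinear_iso (\<O> A W) (pull_ring W) (tilde A P W) (tilde R M (inverse_image W)) (pull W)"
  unfolding semilinear_iso_def using pull_bij[OF assms] pull_add[OF assms] pull_smult[OF assms] by blast

end

context localized_ring
begin

text \<open>The case of \<open>R\<close> as a module over itself. Compatibility with the action of
  the ring is then compatibility with products, since \<open>structure_sheaf_mult\<close> identifies
  the two.\<close>

lemma ringed_iso_pullback:
  "ringed_iso R (basic_open R f) A \<psi> (\<lambda>W. pullback_section R (regular_module R) \<kappa> \<kappa> \<psi> (basic_open R f \<inter> \<psi> -` W))"
proof -
  interpret reg: localized_module R A f \<kappa> "regular_module R" "regular_module A" \<kappa> by (rule regular_localized_module)
  let ?\<theta> = "\<lambda>W. pullback_section R (regular_module R) \<kappa> \<kappa> \<psi> (basic_open R f \<inter> \<psi> -` W)"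
  have iso: "?\<theta> W \<in> ring_iso (\<O> A W) (\<O> R (basic_open R f \<inter> \<psi> -` W))" if W: "openin (zariski A) W" for W
  proof -
    let ?U = "basic_open R f \<inter> \<psi> -` W"
    have U: "?U = reg.inverse_image W" by (simp add: reg.inverse_image_def)
    have "?\<theta> W \<one>\<^bsub>\<O> A W\<^esub> = \<one>\<^bsub>\<O> R ?U\<^esub>"
      unfolding structure_sheaf_def tilde_one reg.pullback_section_eq
    proof (rule restrict_ext)
      fix p assume p: "p \<in> ?U"
      have "\<one> \<in> carrier R - p" using pow_notin[of p 0] p by simp
      then show "reg.pre (restrict (\<lambda>p. \<one>\<^bsub>localization A (carrier A - p) (regular_module A)\<^esub>) W (\<psi> p)) =
          \<one>\<^bsub>localization R (carrier R - p) (regular_module R)\<^esub>"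
        using reg.pre_frac[of p \<one> \<one>] p by (simp add: one_localization_regular)
    qed
    then show ?thesis
      using reg.pull_bij[OF W] reg.pull_add[OF W] reg.pull_smult[OF W]
      unfolding U ring_iso_def ring_hom_def structure_sheaf_mult
      by (auto simp: structure_sheaf_def bij_betw_def)
  qed
  show ?thesis
    unfolding ringed_iso_def
  proof (intro conjI allI impI ballI)
    show "homeomorphic_map (subtopology (zariski R) (basic_open R f)) (zariski A) \<psi>" by (rule homeomorphic_psi)
    show "?\<theta> W \<in> ring_iso (\<O> A W) (\<O> R (basic_open R f \<inter> \<psi> -` W))" if "openin (zariski A) W" for W
      using that by (rule iso)
    show "?\<theta> W' (restrict s W') = restrict (?\<theta> W s) (basic_open R f \<inter> \<psi> -` W')" if "W' \<subseteq> W" for W W' s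
      using reg.restrict_pull[OF that] by (simp add: reg.inverse_image_def)
  qed
qed

end

section \<open>Basic open subsets are affine\<close>

text \<open>The extended record type of \<open>\<O> R U\<close> has to be dropped, since the coordinate rings in
  \<open>affine_open\<close> and \<open>quasi_coherent\<close> have the plain type of rings.\<close>

definition plain_ring :: "('a, 'c) ring_scheme \<Rightarrow> 'a ring" where
  "plain_ring A = \<lparr>carrier = carrier A, monoid.mult = (\<otimes>\<^bsub>A\<^esub>), one = \<one>\<^bsub>A\<^esub>, ring.zero = \<zero>\<^bsub>A\<^esub>, add = (\<oplus>\<^bsub>A\<^esub>)\<rparr>"

lemma plain_ring_simps [simp]:
  "carrier (plain_ring A) = carrier A" "monoid.mult (plain_ring A) = (\<otimes>\<^bsub>A\<^esub>)" "one (plain_ring A) = \<one>\<^bsub>A\<^esub>"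
  "ring.zero (plain_ring A) = \<zero>\<^bsub>A\<^esub>" "add (plain_ring A) = (\<oplus>\<^bsub>A\<^esub>)"
  by (simp_all add: plain_ring_def)

lemma plain_ring_nat_pow [simp]: "x [^]\<^bsub>plain_ring A\<^esub> (n::nat) = x [^]\<^bsub>A\<^esub> n"
  by (simp add: nat_pow_def)

lemma (in cring) cring_plain_ring: "cring (plain_ring R)"
proof (rule cringI)
  show "abelian_group (plain_ring R)"
    by (rule abelian_groupI) (auto simp: a_ac intro: l_neg)
  show "Group.comm_monoid (plain_ring R)"
    by (rule comm_monoidI) (auto simp: m_ac)
qed (auto simp: l_distr)

lemma module_plain_ring:
  assumes "module A P"
  shows "module (plain_ring A) P"
proof -
  interpret module A P by fact
  show ?thesis
    by (rule moduleI)
      (auto simp: R.cring_plain_ring M.abelian_group_axioms smult_l_distr smult_r_distr smult_assoc1)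
qed

context cring
begin

lemma to_sections_closed: "openin (zariski R) U \<Longrightarrow> r \<in> carrier R \<Longrightarrow> to_sections R U r \<in> carrier (\<O> R U)"
  using to_sections_hom by (rule ring_hom_closed)

lemma to_sections_pow:
  assumes U: "openin (zariski R) U" and r: "r \<in> carrier R"
  shows "to_sections R U (r [^] (n::nat)) = to_sections R U r [^]\<^bsub>\<O> R U\<^esub> n"
proof -
  interpret S: cring "\<O> R U" by (rule cring_structure_sheaf[OF U])
  interpret ring_hom_ring R "\<O> R U" "to_sections R U"
    by (intro ring_hom_ringI2 ring_axioms S.ring_axioms to_sections_hom[OF U])
  show ?thesis using r by (rule hom_nat_pow)
qed

lemma restrict_to_sections: "V \<subseteq> U \<Longrightarrow> restrict (to_sections R U r) V = to_sections R V r"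
  by (simp add: to_sections_eq_fraction_section restrict_fraction_section)

lemma structure_fraction_mult:
  assumes "U \<subseteq> basic_open R f" "U \<subseteq> basic_open R g" "f \<in> carrier R" "g \<in> carrier R" "a \<in> carrier R" "b \<in> carrier R"
  shows "fraction_section R (regular_module R) U a f \<otimes>\<^bsub>\<O> R U\<^esub> fraction_section R (regular_module R) U b g
    = fraction_section R (regular_module R) U (a \<otimes> b) (f \<otimes> g)"
proof -
  interpret reg: module R "regular_module R" by (rule module_regular_module)
  show ?thesis
    using reg.fraction_section_smult[of U f g a b] assms
    unfolding structure_sheaf_mult by (simp add: structure_sheaf_def)
qed

lemma structure_one: "\<one>\<^bsub>\<O> R U\<^esub> = fraction_section R (regular_module R) U \<one> \<one>"
  by (simp add: structure_sheaf_def tilde_one fraction_section_def one_localization_regular)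

lemma structure_fraction_closed:
  assumes "openin (zariski R) U" "U \<subseteq> basic_open R f" "f \<in> carrier R" "a \<in> carrier R"
  shows "fraction_section R (regular_module R) U a f \<in> carrier (\<O> R U)"
proof -
  interpret reg: module R "regular_module R" by (rule module_regular_module)
  show ?thesis using reg.fraction_section_in_tilde[of U f a] assms by (simp add: structure_sheaf_def)
qed

lemma structure_fraction_cancel:
  assumes U: "openin (zariski R) U" "U \<subseteq> basic_open R f" and c: "f \<in> carrier R" "a \<in> carrier R"
  shows "fraction_section R (regular_module R) U a f \<otimes>\<^bsub>\<O> R U\<^esub> to_sections R U f = to_sections R U a"
proof -
  interpret reg: module R "regular_module R" by (rule module_regular_module)
  have one: "U \<subseteq> basic_open R \<one>" using openin_zariski_subset[OF U(1)] by (simp add: basic_open_one)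
  show ?thesis
    unfolding to_sections_eq_fraction_section
    using structure_fraction_mult[OF U(2) one, of a f] c
      reg.fraction_section_eqI[of U "f \<otimes> \<one>" \<one> \<one> "a \<otimes> f" a] one U(2)
    by (simp add: m_comm)
qed

lemma structure_unit:
  assumes U: "openin (zariski R) U" "U \<subseteq> basic_open R f" and f: "f \<in> carrier R"
  shows "to_sections R U f \<in> Units (\<O> R U)"
proof -
  interpret S: cring "\<O> R U" by (rule cring_structure_sheaf[OF U(1)])
  have "to_sections R U \<one> = \<one>\<^bsub>\<O> R U\<^esub>" by (simp add: structure_one to_sections_eq_fraction_section)
  then have "fraction_section R (regular_module R) U \<one> f \<otimes>\<^bsub>\<O> R U\<^esub> to_sections R U f = \<one>\<^bsub>\<O> R U\<^esub>"
    using structure_fraction_cancel[OF U f one_closed] by simp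
  then show ?thesis
    using structure_fraction_closed[OF U f one_closed] to_sections_closed[OF U(1) f] S.m_comm
    unfolding Units_def by (intro CollectI conjI bexI[of _ "fraction_section R (regular_module R) U \<one> f"]) auto
qed

text \<open>Surjectivity up to powers of \<open>f\<close> is the form r/f^n of the sections over
  D(f); injectivity up to powers of \<open>f\<close> is \<open>frac_eq_on_basic_open\<close>, used
  through \<open>fraction_section_eqD\<close>. Both are statements about modules, applied to
  \<open>R\<close> itself.\<close>

lemma localized_structure_sheaf:
  assumes f: "f \<in> carrier R"
  shows "localized_ring R (plain_ring (\<O> R (basic_open R f))) f (to_sections R (basic_open R f))"
proof -
  let ?D = "basic_open R f" and ?\<kappa> = "to_sections R (basic_open R f)"
  note D = openin_basic_open[OF f]
  interpret S: cring "\<O> R ?D" by (rule cring_structure_sheaf[OF D])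
  interpret reg: module R "regular_module R" by (rule module_regular_module)
  have hom: "?\<kappa> \<in> ring_hom R (plain_ring (\<O> R ?D))"
    using to_sections_hom[OF D] by (simp add: ring_hom_def)
  have unit: "?\<kappa> f \<in> Units (plain_ring (\<O> R ?D))"
    using structure_unit[OF D _ f] by (simp add: Units_def)
  have surj: "\<exists>r\<in>carrier R. \<exists>n::nat. a \<otimes>\<^bsub>\<O> R ?D\<^esub> ?\<kappa> f [^]\<^bsub>\<O> R ?D\<^esub> n = ?\<kappa> r" if a: "a \<in> carrier (\<O> R ?D)" for a
  proof -
    obtain r and n :: nat where r: "r \<in> carrier R" "a = fraction_section R (regular_module R) ?D r (f [^] n)"
      using reg.tilde_basic_openE[OF f, of a] a by (auto simp: structure_sheaf_def)
    have "a \<otimes>\<^bsub>\<O> R ?D\<^esub> ?\<kappa> f [^]\<^bsub>\<O> R ?D\<^esub> n = ?\<kappa> r"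
      unfolding to_sections_pow[OF D f, symmetric] r(2)
      using r(1) f basic_open_pow_subset[OF f] by (intro structure_fraction_cancel[OF D]) auto
    then show ?thesis using r(1) by blast
  qed
  have inj: "\<exists>n::nat. f [^] n \<otimes> r = f [^] n \<otimes> s" if rs: "r \<in> carrier R" "s \<in> carrier R" "?\<kappa> r = ?\<kappa> s" for r s
  proof -
    have "basic_open R f \<subseteq> basic_open R \<one>" using basic_open_subset_spec[of f] by (simp add: basic_open_one)
    then obtain k :: nat where "f [^] k \<odot>\<^bsub>regular_module R\<^esub> (\<one> \<odot>\<^bsub>regular_module R\<^esub> r)
        = f [^] k \<odot>\<^bsub>regular_module R\<^esub> (\<one> \<odot>\<^bsub>regular_module R\<^esub> s)"
      using reg.fraction_section_eqD[of f r \<one> s \<one>] rs f unfolding to_sections_eq_fraction_section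
      by (metis one_closed regular_module_simps(1))
    then show ?thesis using rs by auto
  qed
  show ?thesis
    by (intro localized_ring.intro is_cring S.cring_plain_ring localized_ring_axioms.intro)
      (use f hom unit surj inj in auto)
qed

lemma affine_basic_open:
  assumes f: "f \<in> carrier R"
  shows "affine_open R (basic_open R f)"
proof -
  interpret localized_ring R "plain_ring (\<O> R (basic_open R f))" f "to_sections R (basic_open R f)"
    by (rule localized_structure_sheaf[OF f])
  show ?thesis
    unfolding affine_open_def using openin_basic_open[OF f] ringed_iso_pullback A.is_cring by blast
qed

lemma affine_spec: "affine_open R (spec R)"
  using affine_basic_open[OF one_closed] by (simp add: basic_open_one)

lemma affine_open_open: "affine_open R U \<Longrightarrow> openin (zariski R) U"
  by (simp add: affine_open_def)

text \<open>Quasi-compactness of Spec A is carried over by the homeomorphism; \<open>U\<close>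
  itself need not be a basic open set.\<close>

lemma affine_open_compact:
  assumes "affine_open R U" and cover: "\<And>p. p \<in> U \<Longrightarrow> \<exists>h\<in>H. p \<in> basic_open R h"
    and H: "H \<subseteq> carrier R"
  obtains F where "finite F" "F \<subseteq> H" "U \<subseteq> (\<Union>h\<in>F. basic_open R h)"
proof -
  obtain A :: "('a, 'a) sections ring" and \<psi> \<theta> where A: "cring A" "ringed_iso R U A \<psi> \<theta>" and U: "openin (zariski R) U"
    using assms(1) by (auto simp: affine_open_def)
  interpret A: cring A by fact
  have "homeomorphic_map (subtopology (zariski R) U) (zariski A) \<psi>" using A(2) by (simp add: ringed_iso_def)
  then have "subtopology (zariski R) U homeomorphic_space zariski A" by (rule homeomorphic_map_imp_homeomorphic_space)
  then have "compact_space (subtopology (zariski R) U)"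
    using homeomorphic_compact_space A.compact_space_zariski by blast
  then have "compactin (zariski R) U"
    using openin_subset[OF U] by (simp add: compact_space_subtopology compactin_subspace)
  moreover have "\<forall>T\<in>basic_open R ` H. openin (zariski R) T" using openin_basic_open H by blast
  moreover have "U \<subseteq> \<Union>(basic_open R ` H)" using cover by blast
  ultimately obtain \<F> where "finite \<F>" "\<F> \<subseteq> basic_open R ` H" "U \<subseteq> \<Union>\<F>"
    unfolding compactin_def by meson
  then obtain F where "finite F" "F \<subseteq> H" "\<F> = basic_open R ` F" by (meson finite_subset_image)
  then show thesis using that \<open>U \<subseteq> \<Union>\<F>\<close> by blast
qed

end

section \<open>Closures and isomorphisms\<close>

lemma semilinear_iso_trans:
  assumes "semilinear_iso A \<theta> N N2 \<beta>" "semilinear_iso B \<theta>' N2 N3 \<phi>" "\<theta> ` carrier A \<subseteq> carrier B"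
  shows "semilinear_iso A (\<theta>' \<circ> \<theta>) N N3 (\<phi> \<circ> \<beta>)"
proof -
  have b: "\<beta> x \<in> carrier N2" if "x \<in> carrier N" for x
    using that assms(1) by (auto simp: semilinear_iso_def bij_betw_def)
  have "bij_betw (\<phi> \<circ> \<beta>) (carrier N) (carrier N3)"
    using assms(1,2) by (auto simp: semilinear_iso_def intro: bij_betw_trans)
  then show ?thesis using assms b unfolding semilinear_iso_def by (auto simp: image_subset_iff)
qed

text \<open>A right inverse \<open>\<sigma>\<close> of \<open>\<theta>\<close> on the scalars
  suffices, because \<open>\<beta>\<close> turns the action of \<open>\<sigma> b\<close> into that
  of \<open>\<theta> (\<sigma> b) = b\<close>.\<close>

lemma semilinear_iso_inv:
  assumes iso: "semilinear_iso A \<theta> N N2 \<beta>" and onto: "\<theta> ` carrier A = carrier B"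
    and sections: "\<And>b. b \<in> carrier B \<Longrightarrow> \<sigma> b \<in> carrier A \<and> \<theta> (\<sigma> b) = b"
    and closed: "\<And>x y. x \<in> carrier N \<Longrightarrow> y \<in> carrier N \<Longrightarrow> x \<oplus>\<^bsub>N\<^esub> y \<in> carrier N"
      "\<And>a x. a \<in> carrier A \<Longrightarrow> x \<in> carrier N \<Longrightarrow> a \<odot>\<^bsub>N\<^esub> x \<in> carrier N"
  shows "semilinear_iso B \<sigma> N2 N (inv_into (carrier N) \<beta>)"
proof -
  let ?i = "inv_into (carrier N) \<beta>"
  have bij: "bij_betw \<beta> (carrier N) (carrier N2)" using iso by (simp add: semilinear_iso_def)
  have i: "?i y \<in> carrier N" "\<beta> (?i y) = y" if "y \<in> carrier N2" for y
    using that bij by (auto simp: bij_betw_def inv_into_into f_inv_into_f)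
  have l: "?i (\<beta> x) = x" if "x \<in> carrier N" for x
    using that bij by (auto simp: bij_betw_def)
  have add: "\<beta> (x \<oplus>\<^bsub>N\<^esub> y) = \<beta> x \<oplus>\<^bsub>N2\<^esub> \<beta> y" if "x \<in> carrier N" "y \<in> carrier N" for x y
    using that iso by (simp add: semilinear_iso_def)
  have sm: "\<beta> (a \<odot>\<^bsub>N\<^esub> x) = \<theta> a \<odot>\<^bsub>N2\<^esub> \<beta> x" if "a \<in> carrier A" "x \<in> carrier N" for a x
    using that iso by (simp add: semilinear_iso_def)
  show ?thesis
    unfolding semilinear_iso_def
  proof (intro conjI ballI)
    show "bij_betw ?i (carrier N2) (carrier N)" by (rule bij_betw_inv_into[OF bij])
    show "?i (x \<oplus>\<^bsub>N2\<^esub> y) = ?i x \<oplus>\<^bsub>N\<^esub> ?i y" if "x \<in> carrier N2" "y \<in> carrier N2" for x y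
      using l[OF closed(1)[OF i(1)[OF that(1)] i(1)[OF that(2)]]] add[OF i(1)[OF that(1)] i(1)[OF that(2)]]
        i(2)[OF that(1)] i(2)[OF that(2)] by simp
    show "?i (b \<odot>\<^bsub>N2\<^esub> y) = \<sigma> b \<odot>\<^bsub>N\<^esub> ?i y" if "b \<in> carrier B" "y \<in> carrier N2" for b y
      using l[OF closed(2)[OF _ i(1)[OF that(2)], of "\<sigma> b"]] sm[OF _ i(1)[OF that(2)], of "\<sigma> b"]
        i(2)[OF that(2)] sections[OF that(1)] by simp
  qed
qed

lemma semilinear_iso_cong:
  "semilinear_iso A \<theta> N N2 \<beta> \<Longrightarrow> (\<And>a. a \<in> carrier A \<Longrightarrow> \<theta> a = \<theta>' a) \<Longrightarrow> semilinear_iso A \<theta>' N N2 \<beta>"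
  by (simp add: semilinear_iso_def)

text \<open>A copy of \<open>N2\<close> in the universe becomes one of \<open>N\<close> by
  composition with \<open>\<beta>\<close>, and conversely by composition with its inverse, so both
  sides quantify over the same closures. About \<open>N\<close> the lemma asks for closed
  operations, which is what is shown of \<open>base_change\<close> later.\<close>

lemma closure_in_semilinear_iso:
  assumes iso: "semilinear_iso A \<theta> N N2 \<beta>" and onto: "\<theta> ` carrier A = carrier (\<O> R U)"
    and closed: "\<And>x y. x \<in> carrier N \<Longrightarrow> y \<in> carrier N \<Longrightarrow> x \<oplus>\<^bsub>N\<^esub> y \<in> carrier N"
      "\<And>a x. a \<in> carrier A \<Longrightarrow> x \<in> carrier N \<Longrightarrow> a \<odot>\<^bsub>N\<^esub> x \<in> carrier N"
    and K: "K \<subseteq> carrier N"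
  shows "x \<in> closure_in R cl U A \<theta> N K \<longleftrightarrow> x \<in> carrier N \<and> \<beta> x \<in> closure_in R cl U (\<O> R U) id N2 (\<beta> ` K)"
proof -
  have bij: "bij_betw \<beta> (carrier N) (carrier N2)" using iso by (simp add: semilinear_iso_def)
  have b: "\<beta> x \<in> carrier N2" if "x \<in> carrier N" for x using that bij by (auto simp: bij_betw_def)
  have l: "inv_into (carrier N) \<beta> (\<beta> x) = x" if "x \<in> carrier N" for x
    using that bij by (auto simp: bij_betw_def)
  define \<sigma> where "\<sigma> = inv_into (carrier A) \<theta>"
  have \<sigma>: "\<sigma> b \<in> carrier A \<and> \<theta> (\<sigma> b) = b" if "b \<in> carrier (\<O> R U)" for b
    using that onto unfolding \<sigma>_def by (metis f_inv_into_f inv_into_into)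
  note inv = semilinear_iso_inv[OF iso onto \<sigma> closed]
  show ?thesis
  proof (intro iffI conjI)
    assume x: "x \<in> closure_in R cl U A \<theta> N K"
    then show xN: "x \<in> carrier N" by (simp add: closure_in_def)
    obtain N' \<phi> where N': "module (\<O> R U) N'" "semilinear_iso A \<theta> N N' \<phi>" "\<phi> x \<in> cl U N' (\<phi> ` K)"
      using x by (auto simp: closure_in_def)
    have "semilinear_iso (\<O> R U) (\<theta> \<circ> \<sigma>) N2 N' (\<phi> \<circ> inv_into (carrier N) \<beta>)"
      using semilinear_iso_trans[OF inv N'(2)] \<sigma> by auto
    then have "semilinear_iso (\<O> R U) id N2 N' (\<phi> \<circ> inv_into (carrier N) \<beta>)"
      by (rule semilinear_iso_cong) (use \<sigma> in auto)
    moreover have "(\<phi> \<circ> inv_into (carrier N) \<beta>) ` \<beta> ` K = \<phi> ` K"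
      using K l by (force simp: image_image)
    ultimately show "\<beta> x \<in> closure_in R cl U (\<O> R U) id N2 (\<beta> ` K)"
      using N' b[OF xN] l[OF xN] unfolding closure_in_def
      by (intro CollectI conjI exI[of _ N'] exI[of _ "\<phi> \<circ> inv_into (carrier N) \<beta>"]) auto
  next
    assume x: "x \<in> carrier N \<and> \<beta> x \<in> closure_in R cl U (\<O> R U) id N2 (\<beta> ` K)"
    then obtain N' \<phi> where N': "module (\<O> R U) N'" "semilinear_iso (\<O> R U) id N2 N' \<phi>" "\<phi> (\<beta> x) \<in> cl U N' (\<phi> ` \<beta> ` K)"
      by (auto simp: closure_in_def)
    have "semilinear_iso A (id \<circ> \<theta>) N N' (\<phi> \<circ> \<beta>)"
      using semilinear_iso_trans[OF iso N'(2)] onto by auto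
    then show "x \<in> closure_in R cl U A \<theta> N K"
      using N' x unfolding closure_in_def
      by (intro CollectI conjI exI[of _ N'] exI[of _ "\<phi> \<circ> \<beta>"]) (auto simp: image_comp)
  qed
qed

lemma semilinear_iso_submodule_image:
  assumes "semilinear_iso A id E N' \<phi>" and E: "module A E" and N': "module A N'" and K: "submodule K A E"
  shows "submodule (\<phi> ` K) A N'"
proof -
  interpret E: module A E by fact
  interpret N': module A N' by fact
  note sub = E.submoduleE(1)[OF K]
  have bij: "bij_betw \<phi> (carrier E) (carrier N')" using assms(1) by (simp add: semilinear_iso_def)
  have b: "\<phi> x \<in> carrier N'" if "x \<in> carrier E" for x using that bij by (auto simp: bij_betw_def)
  have add: "\<phi> (x \<oplus>\<^bsub>E\<^esub> y) = \<phi> x \<oplus>\<^bsub>N'\<^esub> \<phi> y" if "x \<in> carrier E" "y \<in> carrier E" for x y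
    using that assms(1) by (simp add: semilinear_iso_def)
  have sm: "\<phi> (a \<odot>\<^bsub>E\<^esub> x) = a \<odot>\<^bsub>N'\<^esub> \<phi> x" if "a \<in> carrier A" "x \<in> carrier E" for a x
    using that assms(1) by (simp add: semilinear_iso_def)
  have smc: "a \<odot>\<^bsub>N'\<^esub> y \<in> \<phi> ` K" if "a \<in> carrier A" "y \<in> \<phi> ` K" for a y
  proof -
    from that obtain x where x: "x \<in> K" "y = \<phi> x" by blast
    then have "a \<odot>\<^bsub>N'\<^esub> y = \<phi> (a \<odot>\<^bsub>E\<^esub> x)" using sm[OF that(1)] sub by auto
    then show ?thesis using E.submoduleE(4)[OF K that(1) x(1)] by blast
  qed
  show ?thesis
  proof (rule N'.submoduleI)
    show s: "\<phi> ` K \<subseteq> carrier N'" using sub b by auto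
    obtain x where x: "x \<in> K" using E.submoduleE(2)[OF K] by blast
    then have "\<zero>\<^bsub>A\<^esub> \<odot>\<^bsub>N'\<^esub> \<phi> x = \<zero>\<^bsub>N'\<^esub>" using s by auto
    then show "\<zero>\<^bsub>N'\<^esub> \<in> \<phi> ` K" using smc[of "\<zero>\<^bsub>A\<^esub>" "\<phi> x"] x by auto
    show "\<ominus>\<^bsub>N'\<^esub> y \<in> \<phi> ` K" if "y \<in> \<phi> ` K" for y
      using smc[of "\<ominus>\<^bsub>A\<^esub> \<one>\<^bsub>A\<^esub>" y] that s by (auto simp: N'.smult_l_minus)
    show "y \<oplus>\<^bsub>N'\<^esub> z \<in> \<phi> ` K" if yz: "y \<in> \<phi> ` K" "z \<in> \<phi> ` K" for y z
    proof -
      obtain x x' where x: "x \<in> K" "y = \<phi> x" "x' \<in> K" "z = \<phi> x'" using yz by blast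
      then have "y \<oplus>\<^bsub>N'\<^esub> z = \<phi> (x \<oplus>\<^bsub>E\<^esub> x')"
        using add[OF subsetD[OF sub x(1)] subsetD[OF sub x(3)]] by simp
      then show ?thesis using E.submoduleE(5)[OF K x(1,3)] by simp
    qed
    show "a \<odot>\<^bsub>N'\<^esub> y \<in> \<phi> ` K" if "a \<in> carrier A" "y \<in> \<phi> ` K" for a y using that by (rule smc)
  qed
qed

text \<open>Produces the copies with elements in a prescribed type over which
  \<open>closure_in\<close> quantifies; \<open>j\<close> will come from a cardinality
  estimate.\<close>

lemma module_transport:
  fixes E :: "('a, 'e, 'd) module_scheme" and j :: "'e \<Rightarrow> 'u"
  assumes "module A E" and j: "inj_on j (carrier E)"
  obtains N' :: "('a, 'u) module" where "module A N'" "semilinear_iso A id E N' j"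
proof -
  interpret E: module A E by fact
  let ?i = "inv_into (carrier E) j"
  define N' :: "('a, 'u) module" where "N' = \<lparr>carrier = j ` carrier E, monoid.mult = undefined, one = undefined,
    ring.zero = j \<zero>\<^bsub>E\<^esub>, add = (\<lambda>x y. j (?i x \<oplus>\<^bsub>E\<^esub> ?i y)), smult = (\<lambda>a x. j (a \<odot>\<^bsub>E\<^esub> ?i x))\<rparr>"
  have simps: "carrier N' = j ` carrier E" "\<zero>\<^bsub>N'\<^esub> = j \<zero>\<^bsub>E\<^esub>"
    "\<And>x y. x \<oplus>\<^bsub>N'\<^esub> y = j (?i x \<oplus>\<^bsub>E\<^esub> ?i y)" "\<And>a x. a \<odot>\<^bsub>N'\<^esub> x = j (a \<odot>\<^bsub>E\<^esub> ?i x)"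
    by (simp_all add: N'_def)
  have i: "?i (j x) = x" if "x \<in> carrier E" for x using that j by simp
  have ag: "abelian_group N'"
  proof (rule abelian_groupI)
    show "\<exists>y\<in>carrier N'. y \<oplus>\<^bsub>N'\<^esub> x = \<zero>\<^bsub>N'\<^esub>" if "x \<in> carrier N'" for x
    proof -
      from that obtain e where "e \<in> carrier E" "x = j e" by (auto simp: simps)
      then show ?thesis by (intro bexI[of _ "j (\<ominus>\<^bsub>E\<^esub> e)"]) (auto simp: simps i E.l_neg)
    qed
  qed (auto simp: simps i E.a_ac)
  have "module A N'"
    by (rule moduleI[OF E.R.is_cring ag])
      (auto simp: simps i E.smult_l_distr E.smult_r_distr E.smult_assoc1)
  moreover have "semilinear_iso A id E N' j"
    using j by (auto simp: semilinear_iso_def simps i bij_betw_def)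
  ultimately show thesis by (rule that)
qed

text \<open>One module seen over two isomorphic rings. It is used with
  \<open>A = \<O> R (spec R)\<close>, the ring over which the glueing condition is applied, and with
  \<open>A = R\<close>, the ring over which (a) is stated.\<close>

locale module_iso = module R M + A: cring A + N: module A N
  for R (structure) and M (structure) and A and N +
  fixes \<kappa> \<phi> f
  assumes kappa_hom: "\<kappa> \<in> ring_hom A R" and kappa_bij: "bij_betw \<kappa> (carrier A) (carrier R)"
    and phi_iso: "semilinear_iso A \<kappa> N M \<phi>" and f_closed [simp]: "f \<in> carrier A"
begin

sublocale kappa: ring_hom_ring A R \<kappa>
  by (intro ring_hom_ringI2 A.ring_axioms R.ring_axioms kappa_hom)

abbreviation "D \<equiv> basic_open R (\<kappa> f)"
abbreviation "S \<equiv> powers A f"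

text \<open>The canonical map from the localization of \<open>N\<close> at \<open>f\<close> to the
  sections of the sheaf of \<open>M\<close> over D(\<kappa> f). As with the operations of a
  localization, the union picks out a common value.\<close>

definition "to_section x = (\<lambda>p\<in>D. \<Union>(n, a)\<in>x. frac R (carrier R - p) M (\<phi> n) (\<kappa> a))"

lemma phi: "n \<in> carrier N \<Longrightarrow> \<phi> n \<in> carrier M"
  "n \<in> carrier N \<Longrightarrow> n' \<in> carrier N \<Longrightarrow> \<phi> (n \<oplus>\<^bsub>N\<^esub> n') = \<phi> n \<oplus>\<^bsub>M\<^esub> \<phi> n'"
  "a \<in> carrier A \<Longrightarrow> n \<in> carrier N \<Longrightarrow> \<phi> (a \<odot>\<^bsub>N\<^esub> n) = \<kappa> a \<odot>\<^bsub>M\<^esub> \<phi> n"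
  "n \<in> carrier N \<Longrightarrow> n' \<in> carrier N \<Longrightarrow> \<phi> n = \<phi> n' \<Longrightarrow> n = n'"
  "m \<in> carrier M \<Longrightarrow> \<exists>n\<in>carrier N. \<phi> n = m"
proof -
  have "m \<in> \<phi> ` carrier N" if "m \<in> carrier M" for m
    using that phi_iso by (simp add: semilinear_iso_def bij_betw_def)
  then show "m \<in> carrier M \<Longrightarrow> \<exists>n\<in>carrier N. \<phi> n = m" by blast
qed (use phi_iso in \<open>auto simp: semilinear_iso_def bij_betw_def inj_on_def\<close>)

sublocale denom: module_denominators A N S
  by (rule N.powers_denominators) simp

lemma D_open: "openin (zariski R) D"
  by (simp add: R.openin_basic_open)

lemma kappa_pow: "\<kappa> (f [^]\<^bsub>A\<^esub> (n::nat)) = \<kappa> f [^] n"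
  by (rule kappa.hom_nat_pow) simp

lemma powersE:
  assumes "s \<in> S" obtains n :: nat where "s = f [^]\<^bsub>A\<^esub> n"
  using assms by (auto simp: powers_def)

lemma denominators: "s \<in> S \<Longrightarrow> s \<in> carrier A" "s \<in> S \<Longrightarrow> \<kappa> s \<in> carrier R" "s \<in> S \<Longrightarrow> D \<subseteq> basic_open R (\<kappa> s)"
proof -
  assume s: "s \<in> S"
  then obtain n :: nat where n: "s = f [^]\<^bsub>A\<^esub> n" by (rule powersE)
  show "s \<in> carrier A" "\<kappa> s \<in> carrier R" using s by simp_all
  show "D \<subseteq> basic_open R (\<kappa> s)" unfolding n kappa_pow by (rule R.basic_open_pow_subset) simp
qed

lemma to_section_frac:
  assumes n: "n \<in> carrier N" and s: "s \<in> S"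
  shows "to_section (frac A S N n s) = fraction_section R M D (\<phi> n) (\<kappa> s)"
  unfolding to_section_def fraction_section_def
proof (rule restrict_ext)
  fix p assume p: "p \<in> D"
  then interpret loc: module_denominators R M "carrier R - p" by (intro prime_denominators basic_openD)
  have notin: "\<kappa> t \<in> carrier R - p" if "t \<in> S" for t
    using denominators(2,3)[OF that] p by (auto simp: basic_open_def)
  show "(\<Union>(n', a)\<in>frac A S N n s. frac R (carrier R - p) M (\<phi> n') (\<kappa> a)) = frac R (carrier R - p) M (\<phi> n) (\<kappa> s)"
  proof (rule denom.union_frac_eq[OF n s])
    fix n' s' assume "(n', s') \<in> frac A S N n s"
    then obtain t where t: "n' \<in> carrier N" "s' \<in> S" "t \<in> S" "t \<odot>\<^bsub>N\<^esub> (s' \<odot>\<^bsub>N\<^esub> n) = t \<odot>\<^bsub>N\<^esub> (s \<odot>\<^bsub>N\<^esub> n')"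
      by (auto simp: denom.mem_frac_iff)
    have "\<kappa> t \<odot>\<^bsub>M\<^esub> (\<kappa> s \<odot>\<^bsub>M\<^esub> \<phi> n') = \<phi> (t \<odot>\<^bsub>N\<^esub> (s \<odot>\<^bsub>N\<^esub> n'))"
      using t(1-3) s denominators(1) by (simp add: phi)
    also have "\<dots> = \<kappa> t \<odot>\<^bsub>M\<^esub> (\<kappa> s' \<odot>\<^bsub>M\<^esub> \<phi> n)"
      unfolding t(4)[symmetric] using t(1-3) n denominators(1) by (simp add: phi)
    finally show "frac R (carrier R - p) M (\<phi> n') (\<kappa> s') = frac R (carrier R - p) M (\<phi> n) (\<kappa> s)"
      unfolding loc.frac_eq_iff[OF phi(1)[OF t(1)] phi(1)[OF n] notin[OF t(2)] notin[OF s]]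
      using notin[OF t(3)] by auto
  qed
qed

lemma to_section_closed: "x \<in> carrier (localization A S N) \<Longrightarrow> to_section x \<in> carrier (tilde R M D)"
  by (erule denom.localizationE)
    (simp add: to_section_frac fraction_section_in_tilde[OF D_open] denominators phi)

text \<open>Equality of sections gives cross multiplication in \<open>M\<close> up to a power of
  \<open>\<kappa> f\<close>. As \<open>\<phi>\<close> is injective and semilinear, the equation
  holds in \<open>N\<close> with the same power of \<open>f\<close>, which is an admissible
  multiplier there.\<close>

lemma to_section_inj:
  assumes x: "x \<in> carrier (localization A S N)" "y \<in> carrier (localization A S N)" and eq: "to_section x = to_section y"
  shows "x = y"
proof -
  obtain m n s where *: "m \<in> carrier N" "n \<in> carrier N" "s \<in> S" "x = frac A S N m s" "y = frac A S N n s"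
    using denom.common_denominator[OF x] by metis
  have "fraction_section R M D (\<phi> m) (\<kappa> s) = fraction_section R M D (\<phi> n) (\<kappa> s)"
    using eq * by (simp add: to_section_frac)
  then obtain k :: nat where "\<kappa> f [^] k \<odot>\<^bsub>M\<^esub> (\<kappa> s \<odot>\<^bsub>M\<^esub> \<phi> m) = \<kappa> f [^] k \<odot>\<^bsub>M\<^esub> (\<kappa> s \<odot>\<^bsub>M\<^esub> \<phi> n)"
    by (rule fraction_section_eqD) (use * denominators[OF *(3)] phi in auto)
  then have "\<phi> (f [^]\<^bsub>A\<^esub> k \<odot>\<^bsub>N\<^esub> (s \<odot>\<^bsub>N\<^esub> m)) = \<phi> (f [^]\<^bsub>A\<^esub> k \<odot>\<^bsub>N\<^esub> (s \<odot>\<^bsub>N\<^esub> n))"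
    using * denominators[OF *(3)] by (simp add: phi kappa_pow)
  then have "f [^]\<^bsub>A\<^esub> k \<odot>\<^bsub>N\<^esub> (s \<odot>\<^bsub>N\<^esub> m) = f [^]\<^bsub>A\<^esub> k \<odot>\<^bsub>N\<^esub> (s \<odot>\<^bsub>N\<^esub> n)"
    using * denominators[OF *(3)] by (intro phi(4)) auto
  moreover have "f [^]\<^bsub>A\<^esub> k \<in> S" by (auto simp: powers_def)
  ultimately show ?thesis using * by (auto simp: denom.frac_eq_iff)
qed

text \<open>By \<open>tilde_sub_basic_openE\<close> a section of the sheaf of the image of
  \<open>K\<close> has a single numerator in that image, so it comes from a fraction with numerator
  in \<open>K\<close>.\<close>

lemma to_section_image_submodule:
  assumes K: "submodule K A N" and L: "submodule (\<phi> ` K) R M"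
  shows "to_section ` localized_submodule A S N K = tilde_sub R M (\<phi> ` K) D"
proof (intro subset_antisym subsetI)
  have sub: "K \<subseteq> carrier N" by (rule N.submoduleE(1)[OF K])
  fix t assume "t \<in> to_section ` localized_submodule A S N K"
  then obtain n s where *: "n \<in> K" "s \<in> S" "t = to_section (frac A S N n s)" by (auto simp: localized_submodule_def)
  then have "t = fraction_section R M D (\<phi> n) (\<kappa> s)" using sub by (auto simp: to_section_frac)
  then show "t \<in> tilde_sub R M (\<phi> ` K) D"
    unfolding tilde_sub_eq[OF L D_open]
    using fraction_section_in_local_fractions[OF L D_open denominators(3)[OF *(2)]] * denominators(2) by auto
next
  have sub: "K \<subseteq> carrier N" by (rule N.submoduleE(1)[OF K])
  fix t assume t: "t \<in> tilde_sub R M (\<phi> ` K) D"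
  obtain l and k :: nat where l: "l \<in> \<phi> ` K" "t = fraction_section R M D l (\<kappa> f [^] k)"
    using tilde_sub_basic_openE[OF L kappa.hom_closed[OF f_closed] t] by metis
  then obtain n where n: "n \<in> K" "l = \<phi> n" by blast
  have "f [^]\<^bsub>A\<^esub> k \<in> S" by (auto simp: powers_def)
  moreover have "t = to_section (frac A S N n (f [^]\<^bsub>A\<^esub> k))"
    using l(2) n sub \<open>f [^]\<^bsub>A\<^esub> k \<in> S\<close> by (auto simp: to_section_frac kappa_pow)
  ultimately show "t \<in> to_section ` localized_submodule A S N K"
    using n by (auto simp: localized_submodule_def)
qed

lemma to_section_bij: "bij_betw to_section (carrier (localization A S N)) (carrier (tilde R M D))"
proof -
  have "carrier (tilde R M D) \<subseteq> to_section ` carrier (localization A S N)"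
  proof
    fix t assume "t \<in> carrier (tilde R M D)"
    then obtain m and k :: nat where m: "m \<in> carrier M" "t = fraction_section R M D m (\<kappa> f [^] k)"
      by (rule tilde_basic_openE[OF kappa.hom_closed[OF f_closed]])
    obtain n where n: "n \<in> carrier N" "\<phi> n = m" using phi(5)[OF m(1)] by blast
    have S: "f [^]\<^bsub>A\<^esub> k \<in> S" by (auto simp: powers_def)
    have "t = to_section (frac A S N n (f [^]\<^bsub>A\<^esub> k))" using m n S by (simp add: to_section_frac kappa_pow)
    then show "t \<in> to_section ` carrier (localization A S N)" using n S by blast
  qed
  then show ?thesis unfolding bij_betw_def inj_on_def using to_section_closed to_section_inj by blast
qed

lemma to_section_add:
  assumes x: "x \<in> carrier (localization A S N)" "y \<in> carrier (localization A S N)"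
  shows "to_section (x \<oplus>\<^bsub>localization A S N\<^esub> y) = to_section x \<oplus>\<^bsub>tilde R M D\<^esub> to_section y"
proof -
  obtain m n s where *: "m \<in> carrier N" "n \<in> carrier N" "s \<in> S" "x = frac A S N m s" "y = frac A S N n s"
    using denom.common_denominator[OF x] by metis
  then show ?thesis
    using fraction_section_add[OF D_open denominators(3,2)[OF *(3)], of "\<phi> m" "\<phi> n"]
    by (simp add: denom.add_frac_same to_section_frac phi)
qed

lemma regular_module_iso: "module_iso R (regular_module R) A (regular_module A) \<kappa> \<kappa> f"
proof -
  have "semilinear_iso A \<kappa> (regular_module A) (regular_module R) \<kappa>"
    using kappa_bij by (auto simp: semilinear_iso_def)
  then show ?thesis
    by (intro module_iso.intro R.module_regular_module A.module_regular_module A.is_cring module_iso_axioms.intro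
        kappa_hom kappa_bij f_closed)
qed

text \<open>\<open>localization_lift\<close> is a definite description. The canonical map for the
  ring itself satisfies it, and the solution is unique because \<open>\<kappa> f\<close> is
  invertible on \<open>D\<close>.\<close>

lemma localization_lift_eq:
  assumes rho: "\<And>a. a \<in> carrier A \<Longrightarrow> \<rho> a = to_sections R D (\<kappa> a)"
    and q: "q \<in> carrier (localization A S (regular_module A))"
  shows "localization_lift A f (\<O> R D) \<rho> q = module_iso.to_section R (regular_module R) \<kappa> \<kappa> f q"
proof -
  interpret reg: module_iso R "regular_module R" A "regular_module A" \<kappa> \<kappa> f by (rule regular_module_iso)
  interpret O: cring "\<O> R D" by (rule R.cring_structure_sheaf[OF D_open])
  have rho_pow: "\<rho> f [^]\<^bsub>\<O> R D\<^esub> (n::nat) = to_sections R D (\<kappa> f [^] n)" for n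
    by (simp add: rho R.to_sections_pow[OF D_open])
  have Dpow: "D \<subseteq> basic_open R (\<kappa> f [^] (n::nat))" for n by (rule R.basic_open_pow_subset) simp
  have powS: "f [^]\<^bsub>A\<^esub> (n::nat) \<in> S" for n by (auto simp: powers_def)
  have val: "reg.to_section (frac A S (regular_module A) a (f [^]\<^bsub>A\<^esub> (n::nat)))
      = fraction_section R (regular_module R) D (\<kappa> a) (\<kappa> f [^] n)" if "a \<in> carrier A" for a n
    using that powS by (simp add: reg.to_section_frac kappa_pow)
  show ?thesis
    unfolding localization_lift_def
  proof (rule the_equality)
    obtain a s where a: "a \<in> carrier A" "s \<in> S" "q = frac A S (regular_module A) a s"
      using reg.denom.localizationE[OF q] by auto
    then obtain n :: nat where n: "s = f [^]\<^bsub>A\<^esub> n" by (auto elim: powersE)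
    show "reg.to_section q \<in> carrier (\<O> R D) \<and>
      (\<exists>a\<in>carrier A. \<exists>n::nat. q = frac A S (regular_module A) a (f [^]\<^bsub>A\<^esub> n) \<and>
        reg.to_section q \<otimes>\<^bsub>\<O> R D\<^esub> \<rho> f [^]\<^bsub>\<O> R D\<^esub> n = \<rho> a)"
    proof (intro conjI bexI[of _ a] exI[of _ n])
      show "reg.to_section q \<in> carrier (\<O> R D)" using reg.to_section_closed[OF q] by (simp add: structure_sheaf_def)
      show "reg.to_section q \<otimes>\<^bsub>\<O> R D\<^esub> \<rho> f [^]\<^bsub>\<O> R D\<^esub> n = \<rho> a"
        unfolding a(3) n val[OF a(1)] rho_pow rho[OF a(1)]
        by (rule R.structure_fraction_cancel[OF D_open Dpow]) (use a in auto)
    qed (use a n in auto)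
  next
    fix y assume "y \<in> carrier (\<O> R D) \<and>
      (\<exists>a\<in>carrier A. \<exists>n::nat. q = frac A S (regular_module A) a (f [^]\<^bsub>A\<^esub> n) \<and>
        y \<otimes>\<^bsub>\<O> R D\<^esub> \<rho> f [^]\<^bsub>\<O> R D\<^esub> n = \<rho> a)"
    then obtain a and n :: nat where y: "y \<in> carrier (\<O> R D)" and a: "a \<in> carrier A"
      and qa: "q = frac A S (regular_module A) a (f [^]\<^bsub>A\<^esub> n)"
      and eq: "y \<otimes>\<^bsub>\<O> R D\<^esub> \<rho> f [^]\<^bsub>\<O> R D\<^esub> n = \<rho> a" by blast
    let ?z = "fraction_section R (regular_module R) D (\<kappa> a) (\<kappa> f [^] n)"
    have z: "?z \<in> carrier (\<O> R D)" by (rule R.structure_fraction_closed[OF D_open Dpow]) (use a in auto)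
    have "?z \<otimes>\<^bsub>\<O> R D\<^esub> to_sections R D (\<kappa> f [^] n) = y \<otimes>\<^bsub>\<O> R D\<^esub> to_sections R D (\<kappa> f [^] n)"
      using R.structure_fraction_cancel[OF D_open Dpow, of n "\<kappa> a"] a eq[unfolded rho_pow rho[OF a]] by simp
    moreover have "to_sections R D (\<kappa> f [^] n) \<in> Units (\<O> R D)"
      by (rule R.structure_unit[OF D_open Dpow]) simp
    ultimately have "?z = y" using y z by (metis O.Units_closed O.m_comm O.Units_l_cancel)
    then show "y = reg.to_section q" using val[OF a] qa by simp
  qed
qed

text \<open>Turns a closure in a localization into a closure in a module of sections. Both the
  glueing condition and (a) are read through this equivalence.\<close>

lemma localized_closure_iff:
  assumes rho: "\<And>a. a \<in> carrier A \<Longrightarrow> \<rho> a = to_sections R D (\<kappa> a)"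
    and K: "submodule K A N" and L: "submodule (\<phi> ` K) R M"
  shows "x \<in> localized_closure R cl D A \<rho> f N K \<longleftrightarrow> x \<in> carrier (localization A S N) \<and>
    to_section x \<in> closure_in R cl D (\<O> R D) id (tilde R M D) (tilde_sub R M (\<phi> ` K) D)"
proof -
  interpret reg: module_iso R "regular_module R" A "regular_module A" \<kappa> \<kappa> f by (rule regular_module_iso)
  interpret LN: module "localization A S (regular_module A)" "localization A S N" by (rule denom.module_localization)
  let ?\<theta> = "localization_lift A f (\<O> R D) \<rho>"
  have lift: "?\<theta> q = reg.to_section q" if "q \<in> carrier (localization A S (regular_module A))" for q
    using that by (intro localization_lift_eq rho)
  have onto: "?\<theta> ` carrier (localization A S (regular_module A)) = carrier (\<O> R D)"
    using lift reg.to_section_bij by (simp add: bij_betw_def structure_sheaf_def)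
  have smult: "to_section (a \<odot>\<^bsub>localization A S N\<^esub> y) = ?\<theta> a \<odot>\<^bsub>tilde R M D\<^esub> to_section y"
    if ay: "a \<in> carrier (localization A S (regular_module A))" "y \<in> carrier (localization A S N)" for a y
  proof -
    obtain b s where b: "b \<in> carrier A" "s \<in> S" "a = frac A S (regular_module A) b s"
      using reg.denom.localizationE[OF ay(1)] by auto
    obtain n t where n: "n \<in> carrier N" "t \<in> S" "y = frac A S N n t" using denom.localizationE[OF ay(2)] by metis
    have "fraction_section R (regular_module R) D (\<kappa> b) (\<kappa> s) \<odot>\<^bsub>tilde R M D\<^esub> fraction_section R M D (\<phi> n) (\<kappa> t)
        = fraction_section R M D (\<kappa> b \<odot>\<^bsub>M\<^esub> \<phi> n) (\<kappa> s \<otimes> \<kappa> t)"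
      by (rule fraction_section_smult) (use b n denominators phi in auto)
    moreover have "a \<odot>\<^bsub>localization A S N\<^esub> y = frac A S N (b \<odot>\<^bsub>N\<^esub> n) (s \<otimes>\<^bsub>A\<^esub> t)"
      using b n by (simp add: denom.smult_frac)
    ultimately show ?thesis
      using b n denominators(1) denom.denom_mult[OF b(2) n(2)] lift[OF ay(1)]
      by (simp add: to_section_frac reg.to_section_frac phi)
  qed
  have iso: "semilinear_iso (localization A S (regular_module A)) ?\<theta> (localization A S N) (tilde R M D) to_section"
    unfolding semilinear_iso_def using to_section_bij to_section_add smult by blast
  have sub: "localized_submodule A S N K \<subseteq> carrier (localization A S N)"
    using N.submoduleE(1)[OF K] by (auto simp: localized_submodule_def)
  show ?thesis
    unfolding localized_closure_def to_section_image_submodule[OF K L, symmetric]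
    by (rule closure_in_semilinear_iso[OF iso onto LN.M.a_closed LN.smult_closed sub])
qed

end

section \<open>Base change to a basic open subset\<close>

context module
begin

text \<open>This is where the quasi-compactness of affine schemes enters.\<close>

lemma vanishing_section_torsion:
  assumes V: "affine_open R V" and h: "h \<in> carrier R" and s: "s \<in> carrier (tilde R M V)"
    and zero: "\<And>p. p \<in> V \<inter> basic_open R h \<Longrightarrow> s p = \<zero>\<^bsub>localization R (carrier R - p) M\<^esub>"
  obtains k :: nat where "to_sections R V (h [^] k) \<odot>\<^bsub>tilde R M V\<^esub> s = \<zero>\<^bsub>tilde R M V\<^esub>"
proof -
  note Vo = R.affine_open_open[OF V]
  \<comment> \<open>The numerator \<open>m\<close> of \<open>s\<close> on D(g) is killed by a power
    of \<open>g h\<close> rather than of \<open>h\<close>, because the vanishing of m/g is known on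
    D(g h) only.\<close>
  define P where "P = (\<lambda>g (k::nat). \<exists>m\<in>carrier M. (\<forall>q\<in>basic_open R g. s q = frac R (carrier R - q) M m g) \<and>
    (g \<otimes> h) [^] k \<odot>\<^bsub>M\<^esub> m = \<zero>\<^bsub>M\<^esub>)"
  define H where "H = {g \<in> carrier R. \<exists>k. P g k}"
  have "\<exists>g\<in>H. p \<in> basic_open R g" if p: "p \<in> V" for p
  proof -
    obtain g m where g: "g \<in> carrier R" "m \<in> carrier M" "p \<in> basic_open R g" "basic_open R g \<subseteq> V"
      and sg: "\<And>q. q \<in> basic_open R g \<Longrightarrow> s q = frac R (carrier R - q) M m g"
      using tilde_locally[OF Vo s p] by metis
    have D: "basic_open R (g \<otimes> h) = basic_open R g \<inter> basic_open R h" using g h by (simp add: R.basic_open_mult)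
    obtain k :: nat where "(g \<otimes> h) [^] k \<odot>\<^bsub>M\<^esub> (\<one> \<odot>\<^bsub>M\<^esub> m) = (g \<otimes> h) [^] k \<odot>\<^bsub>M\<^esub> (g \<odot>\<^bsub>M\<^esub> \<zero>\<^bsub>M\<^esub>)"
    proof (rule frac_eq_on_basic_open[of m "\<zero>\<^bsub>M\<^esub>" "g \<otimes> h" g \<one>])
      show "basic_open R (g \<otimes> h) \<subseteq> basic_open R \<one>" by (simp add: R.basic_open_one R.basic_open_subset_spec)
      show "basic_open R (g \<otimes> h) \<subseteq> basic_open R g" using D by simp
      fix q assume "q \<in> basic_open R (g \<otimes> h)"
      then have q: "q \<in> basic_open R g" "q \<in> basic_open R h" using D by auto
      then interpret loc: module_denominators R M "carrier R - q" by (intro prime_denominators basic_openD)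
      have "s q = \<zero>\<^bsub>localization R (carrier R - q) M\<^esub>" using zero[of q] q g(4) by blast
      then show "frac R (carrier R - q) M m g = frac R (carrier R - q) M \<zero>\<^bsub>M\<^esub> \<one>"
        using sg[OF q(1)] by (simp add: loc.zero_localization)
    qed (use g h in simp_all)
    then have "P g k" using g h sg unfolding P_def by (intro bexI[of _ m]) auto
    then show ?thesis using g by (auto simp: H_def)
  qed
  then obtain F where F: "finite F" "F \<subseteq> H" "V \<subseteq> (\<Union>g\<in>F. basic_open R g)"
    using R.affine_open_compact[OF V, of H] by (auto simp: H_def)
  have FR: "g \<in> carrier R" if "g \<in> F" for g using that F(2) by (auto simp: H_def)
  have "\<exists>K. \<forall>g\<in>F. P g K"
  proof (rule finite_common_bound[OF F(1)])
    show "\<exists>n. P g n" if "g \<in> F" for g using that F(2) by (auto simp: H_def)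
    show "P g (n + k)" if gF: "g \<in> F" and Pg: "P g n" for g n k
    proof -
      obtain m where m: "m \<in> carrier M" "\<forall>q\<in>basic_open R g. s q = frac R (carrier R - q) M m g"
        "(g \<otimes> h) [^] n \<odot>\<^bsub>M\<^esub> m = \<zero>\<^bsub>M\<^esub>" using Pg by (auto simp: P_def)
      have "(g \<otimes> h) [^] (n + k) \<odot>\<^bsub>M\<^esub> m = \<zero>\<^bsub>M\<^esub>"
        using pow_smult_eq_mono[of "g \<otimes> h" m "\<zero>\<^bsub>M\<^esub>" n k] m FR[OF gF] h by simp
      then show ?thesis using m by (auto simp: P_def)
    qed
  qed
  then obtain K where K: "\<And>g. g \<in> F \<Longrightarrow> P g K" by blast
  have "to_sections R V (h [^] K) \<odot>\<^bsub>tilde R M V\<^esub> s = \<zero>\<^bsub>tilde R M V\<^esub>"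
    unfolding tilde_smult tilde_zero
  proof (rule restrict_ext)
    fix p assume p: "p \<in> V"
    then obtain g where g: "g \<in> F" "p \<in> basic_open R g" using F(3) by blast
    obtain m where m: "m \<in> carrier M" "\<forall>q\<in>basic_open R g. s q = frac R (carrier R - q) M m g"
      "(g \<otimes> h) [^] K \<odot>\<^bsub>M\<^esub> m = \<zero>\<^bsub>M\<^esub>" using K[OF g(1)] by (auto simp: P_def)
    have gR: "g \<in> carrier R" "g \<in> carrier R - p" using FR[OF g(1)] g(2) basic_openD by blast+
    interpret loc: module_denominators R M "carrier R - p" using g by (intro prime_denominators basic_openD)
    have gK: "g [^] K \<in> carrier R - p"
      using g gR(1) R.basic_open_pow_subset[of g K] basic_openD(2)[of p "g [^] K"] by auto
    \<comment> \<open>At \<open>p\<close> the factor g^K of (g h)^K is invertible, so h^K alone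
      kills the germ m/g.\<close>
    have "g [^] K \<odot>\<^bsub>M\<^esub> (\<one> \<odot>\<^bsub>M\<^esub> (h [^] K \<odot>\<^bsub>M\<^esub> m)) = (g \<otimes> h) [^] K \<odot>\<^bsub>M\<^esub> m"
      using gR(1) h m(1) by (simp add: smult_assoc1 nat_pow_distrib)
    then have "frac R (carrier R - p) M (h [^] K \<odot>\<^bsub>M\<^esub> m) g = frac R (carrier R - p) M \<zero>\<^bsub>M\<^esub> \<one>"
      using m h gR gK loc.denom_one by (subst loc.frac_eq_iff) (auto intro!: bexI[of _ "g [^] K"])
    then show "to_sections R V (h [^] K) p \<odot>\<^bsub>localization R (carrier R - p) M\<^esub> s p = \<zero>\<^bsub>localization R (carrier R - p) M\<^esub>"
      using p m g gR h loc.smult_frac[of "h [^] K" m \<one> g] loc.denom_one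
      by (simp add: to_sections_def loc.zero_localization)
  qed
  then show thesis by (rule that)
qed

end

text \<open>The setting of open persistence for a basic D(h) inside an affine \<open>V\<close>.
  \<open>N\<close> is an arbitrary copy of M(V), as supplied by membership in
  \<open>closure_in\<close>. The aim is to identify its base change to D(h) with M(D(h)), compatibly
  with the images of a submodule of \<open>M\<close>.\<close>

locale restriction_base_change = module R M for R (structure) and M (structure) +
  fixes V h and N :: "(('a, 'a) sections, 'n) module" and \<phi>
  assumes V: "affine_open R V" and h: "h \<in> carrier R" and sub: "basic_open R h \<subseteq> V"
    and N: "module (\<O> R V) N" and phi_iso: "semilinear_iso (\<O> R V) id (tilde R M V) N \<phi>"
begin

abbreviation "A \<equiv> \<O> R V"
abbreviation "D \<equiv> basic_open R h"
abbreviation "B \<equiv> \<O> R D"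
abbreviation "E \<equiv> tilde R M D"
abbreviation "\<rho> \<equiv> \<lambda>s::('a, 'a) sections. restrict s D"
abbreviation "G \<equiv> free_Abelian_group (carrier N \<times> carrier B)"
abbreviation "Rel \<equiv> tensor_relations A \<rho> B N"
definition "\<chi> = inv_into (carrier (tilde R M V)) \<phi>"
definition "ih n = fraction_section R (regular_module R) D \<one> (h [^] (n::nat))"

lemma V_open: "openin (zariski R) V" by (rule R.affine_open_open[OF V])
lemma D_open: "openin (zariski R) D" by (rule R.openin_basic_open[OF h])

sublocale N: module "\<O> R V" N by (rule N)
sublocale TV: module "\<O> R V" "tilde R M V" by (rule module_tilde[OF V_open])
sublocale E: module "\<O> R D" "tilde R M D" by (rule module_tilde[OF D_open])
sublocale reg: module R "regular_module R" by (rule R.module_regular_module)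

lemma phi: "s \<in> carrier (tilde R M V) \<Longrightarrow> \<phi> s \<in> carrier N"
  "s \<in> carrier (tilde R M V) \<Longrightarrow> t \<in> carrier (tilde R M V) \<Longrightarrow> \<phi> (s \<oplus>\<^bsub>tilde R M V\<^esub> t) = \<phi> s \<oplus>\<^bsub>N\<^esub> \<phi> t"
  "a \<in> carrier A \<Longrightarrow> s \<in> carrier (tilde R M V) \<Longrightarrow> \<phi> (a \<odot>\<^bsub>tilde R M V\<^esub> s) = a \<odot>\<^bsub>N\<^esub> \<phi> s"
  using phi_iso by (auto simp: semilinear_iso_def bij_betw_def)

lemma chi: "x \<in> carrier N \<Longrightarrow> \<chi> x \<in> carrier (tilde R M V)" "x \<in> carrier N \<Longrightarrow> \<phi> (\<chi> x) = x"
  "s \<in> carrier (tilde R M V) \<Longrightarrow> \<chi> (\<phi> s) = s"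
  using phi_iso by (auto simp: \<chi>_def semilinear_iso_def bij_betw_def inv_into_into f_inv_into_f)

lemma chi_add: "x \<in> carrier N \<Longrightarrow> y \<in> carrier N \<Longrightarrow> \<chi> (x \<oplus>\<^bsub>N\<^esub> y) = \<chi> x \<oplus>\<^bsub>tilde R M V\<^esub> \<chi> y"
  using phi(2)[OF chi(1) chi(1)] chi by (metis TV.M.a_closed)

lemma chi_smult: "a \<in> carrier A \<Longrightarrow> x \<in> carrier N \<Longrightarrow> \<chi> (a \<odot>\<^bsub>N\<^esub> x) = a \<odot>\<^bsub>tilde R M V\<^esub> \<chi> x"
  using phi(3)[OF _ chi(1)] chi by (metis TV.smult_closed)

lemma phi_zero: "\<phi> \<zero>\<^bsub>tilde R M V\<^esub> = \<zero>\<^bsub>N\<^esub>"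
  using phi(3)[of "\<zero>\<^bsub>A\<^esub>" "\<zero>\<^bsub>tilde R M V\<^esub>"] phi(1)[of "\<zero>\<^bsub>tilde R M V\<^esub>"] by simp

lemma D_pow: "D \<subseteq> basic_open R (h [^] (n::nat))"
  by (rule R.basic_open_pow_subset[OF h])

lemma ih_closed: "ih n \<in> carrier B"
  unfolding ih_def by (rule R.structure_fraction_closed[OF D_open D_pow]) (use h in auto)

lemma rho_to_sections: "\<rho> (to_sections R V r) = to_sections R D r"
  by (rule R.restrict_to_sections[OF sub])

lemma rho_closed: "a \<in> carrier A \<Longrightarrow> \<rho> a \<in> carrier B"
  using reg.restrict_in_tilde[OF V_open D_open sub] by (simp add: structure_sheaf_def)

lemma D_one: "D \<subseteq> basic_open R \<one>"
  using R.basic_open_subset_spec[of h] by (simp add: R.basic_open_one)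

lemma fraction_eq:
  assumes r: "r \<in> carrier R"
  shows "\<rho> (to_sections R V r) \<otimes>\<^bsub>B\<^esub> ih n = fraction_section R (regular_module R) D r (h [^] n)"
  unfolding rho_to_sections ih_def unfolding to_sections_eq_fraction_section
  using R.structure_fraction_mult[OF D_one D_pow, of n r \<one>] r h by simp

lemma ih_shift: "\<rho> (to_sections R V (h [^] k)) \<otimes>\<^bsub>B\<^esub> ih (n + k) = ih n"
proof -
  have "fraction_section R (regular_module R) D (h [^] k) (h [^] (n + k)) = ih n"
    unfolding ih_def
    by (rule reg.fraction_section_eqI[OF D_pow D_pow D_one]) (use h in \<open>auto simp: nat_pow_mult\<close>)
  then show ?thesis using fraction_eq[of "h [^] k" "n + k"] h by simp
qed

text \<open>The intended value of the pure tensor of \<open>x\<close> and \<open>b\<close> in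
  M(D(h)).\<close>

definition "pure_value x b = b \<odot>\<^bsub>E\<^esub> restrict (\<chi> x) D"

lemma restrict_chi: "x \<in> carrier N \<Longrightarrow> restrict (\<chi> x) D \<in> carrier E"
  by (rule restrict_in_tilde[OF V_open D_open sub chi(1)])

lemma pure_value_closed: "x \<in> carrier N \<Longrightarrow> b \<in> carrier B \<Longrightarrow> pure_value x b \<in> carrier E"
  unfolding pure_value_def using restrict_chi by simp

definition "rels = {frag_of (m \<oplus>\<^bsub>N\<^esub> n, b) - frag_of (m, b) - frag_of (n, b) | m n b.
        m \<in> carrier N \<and> n \<in> carrier N \<and> b \<in> carrier B} \<union>
     {frag_of (n, b \<oplus>\<^bsub>B\<^esub> c) - frag_of (n, b) - frag_of (n, c) | n b c.
        n \<in> carrier N \<and> b \<in> carrier B \<and> c \<in> carrier B} \<union>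
     {frag_of (a \<odot>\<^bsub>N\<^esub> n, b) - frag_of (n, \<rho> a \<otimes>\<^bsub>B\<^esub> b) | a n b.
        a \<in> carrier A \<and> n \<in> carrier N \<and> b \<in> carrier B}"

lemma Rel_eq: "Rel = generate G rels"
  unfolding tensor_relations_def rels_def ..

lemma keys_minus: "Poly_Mapping.keys x \<subseteq> S \<Longrightarrow> Poly_Mapping.keys y \<subseteq> S \<Longrightarrow> Poly_Mapping.keys (x - y) \<subseteq> S"
  using keys_diff[of x y] by blast

lemma rels_subset: "rels \<subseteq> carrier G"
proof
  fix z assume "z \<in> rels"
  then show "z \<in> carrier G"
    unfolding carrier_free_Abelian_group_iff rels_def
    by (elim UnE CollectE exE conjE) (simp only:, intro keys_minus; simp add: rho_closed)+
qed

lemma group_G: "group G" by simp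

lemma Rel_subgroup: "subgroup Rel G"
  unfolding Rel_eq by (rule group.generate_is_subgroup[OF group_G rels_subset])

lemma Rel_carrier: "z \<in> Rel \<Longrightarrow> Poly_Mapping.keys z \<subseteq> carrier N \<times> carrier B"
  using subsetD[OF subgroup.subset[OF Rel_subgroup]] unfolding carrier_free_Abelian_group_iff by blast

lemma Rel_add: "x \<in> Rel \<Longrightarrow> y \<in> Rel \<Longrightarrow> x + y \<in> Rel"
  using subgroup.m_closed[OF Rel_subgroup] by simp

lemma Rel_uminus: "x \<in> Rel \<Longrightarrow> - x \<in> Rel"
  using subgroup.m_inv_closed[OF Rel_subgroup, of x] Rel_carrier by simp

lemma Rel_minus: "x \<in> Rel \<Longrightarrow> y \<in> Rel \<Longrightarrow> x - y \<in> Rel"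
  using Rel_add[OF _ Rel_uminus, of x y] by simp

lemma Rel_zero: "0 \<in> Rel"
  using subgroup.one_closed[OF Rel_subgroup] by simp

lemma rels_Rel: "x \<in> rels \<Longrightarrow> x \<in> Rel"
  unfolding Rel_eq by (rule generate.incl)

lemma relation_add:
  "m \<in> carrier N \<Longrightarrow> n \<in> carrier N \<Longrightarrow> b \<in> carrier B \<Longrightarrow>
    frag_of (m \<oplus>\<^bsub>N\<^esub> n, b) - frag_of (m, b) - frag_of (n, b) \<in> Rel"
  by (rule rels_Rel) (auto simp: rels_def)

lemma relation_scalar:
  "a \<in> carrier A \<Longrightarrow> n \<in> carrier N \<Longrightarrow> b \<in> carrier B \<Longrightarrow> frag_of (a \<odot>\<^bsub>N\<^esub> n, b) - frag_of (n, \<rho> a \<otimes>\<^bsub>B\<^esub> b) \<in> Rel"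
  by (rule rels_Rel) (auto simp: rels_def)

lemma to_V: "r \<in> carrier R \<Longrightarrow> to_sections R V r \<in> carrier A"
  by (rule R.to_sections_closed[OF V_open])

lemma shift: "x \<in> carrier N \<Longrightarrow> frag_of (to_sections R V (h [^] k) \<odot>\<^bsub>N\<^esub> x, ih (n + k)) - frag_of (x, ih n) \<in> Rel"
  using relation_scalar[OF to_V _ ih_closed, of "h [^] k" x "n + k"] h by (simp add: ih_shift)

text \<open>Every tensor is of the form \<open>x \<otimes> h\<^sup>-\<^sup>n\<close>; as \<open>x\<close> is torsion if it vanishes on \<open>D(h)\<close>, evaluation is
  injective on the tensor product.\<close>

lemma single_fraction:
  assumes "Poly_Mapping.keys z \<subseteq> carrier N \<times> carrier B"
  shows "\<exists>x\<in>carrier N. \<exists>n. z - frag_of (x, ih n) \<in> Rel"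
proof (rule free_Abelian_group_induct[OF assms])
  \<comment> \<open>With \<zero> + \<zero> = \<zero> the additivity relation is the negative of the
    generator at \<zero>, so 0 is represented by a fraction with numerator \<zero>.\<close>
  have "frag_of (\<zero>\<^bsub>N\<^esub> \<oplus>\<^bsub>N\<^esub> \<zero>\<^bsub>N\<^esub>, ih 0) - frag_of (\<zero>\<^bsub>N\<^esub>, ih 0) - frag_of (\<zero>\<^bsub>N\<^esub>, ih 0) \<in> Rel"
    by (rule relation_add) (auto simp: ih_closed)
  then show "\<exists>x\<in>carrier N. \<exists>n. 0 - frag_of (x, ih n) \<in> Rel"
    by (intro bexI[of _ "\<zero>\<^bsub>N\<^esub>"] exI[of _ 0]) auto
next
  fix z w
  assume "\<exists>x\<in>carrier N. \<exists>n. z - frag_of (x, ih n) \<in> Rel" "\<exists>x\<in>carrier N. \<exists>n. w - frag_of (x, ih n) \<in> Rel"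
  then obtain x y n k where x: "x \<in> carrier N" "z - frag_of (x, ih n) \<in> Rel" and y: "y \<in> carrier N" "w - frag_of (y, ih k) \<in> Rel"
    by blast
  \<comment> \<open>\<open>shift\<close> brings both tensors to the denominator h^(n+k). The
    induction runs over differences, so the fraction for \<open>z - w\<close> has numerator
    \<open>?u \<ominus> ?v\<close>.\<close>
  let ?u = "to_sections R V (h [^] k) \<odot>\<^bsub>N\<^esub> x" and ?v = "to_sections R V (h [^] n) \<odot>\<^bsub>N\<^esub> y"
  have c: "?u \<in> carrier N" "?v \<in> carrier N" using x y to_V h by auto
  have u: "frag_of (?u, ih (n + k)) - frag_of (x, ih n) \<in> Rel" by (rule shift[OF x(1)])
  have v: "frag_of (?v, ih (n + k)) - frag_of (y, ih k) \<in> Rel" using shift[OF y(1), of n k] by (simp add: add.commute)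
  have d: "?u \<ominus>\<^bsub>N\<^esub> ?v \<oplus>\<^bsub>N\<^esub> ?v = ?u" using c by (simp add: N.M.minus_eq N.M.a_assoc N.M.l_neg)
  have "frag_of (?u \<ominus>\<^bsub>N\<^esub> ?v \<oplus>\<^bsub>N\<^esub> ?v, ih (n + k)) - frag_of (?u \<ominus>\<^bsub>N\<^esub> ?v, ih (n + k)) - frag_of (?v, ih (n + k)) \<in> Rel"
    using c by (intro relation_add ih_closed) auto
  then have w: "frag_of (?u, ih (n + k)) - frag_of (?u \<ominus>\<^bsub>N\<^esub> ?v, ih (n + k)) - frag_of (?v, ih (n + k)) \<in> Rel"
    by (simp only: d)
  \<comment> \<open>In this combination of five relations everything cancels except
    \<open>z - w\<close> and the new fraction.\<close>
  have "(z - frag_of (x, ih n)) - (w - frag_of (y, ih k)) - (frag_of (?u, ih (n + k)) - frag_of (x, ih n))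
      + (frag_of (?v, ih (n + k)) - frag_of (y, ih k))
      + (frag_of (?u, ih (n + k)) - frag_of (?u \<ominus>\<^bsub>N\<^esub> ?v, ih (n + k)) - frag_of (?v, ih (n + k))) \<in> Rel"
    by (intro Rel_add Rel_minus x(2) y(2) u v w)
  moreover have "(z - frag_of (x, ih n)) - (w - frag_of (y, ih k)) - (frag_of (?u, ih (n + k)) - frag_of (x, ih n))
      + (frag_of (?v, ih (n + k)) - frag_of (y, ih k))
      + (frag_of (?u, ih (n + k)) - frag_of (?u \<ominus>\<^bsub>N\<^esub> ?v, ih (n + k)) - frag_of (?v, ih (n + k)))
    = (z - w) - frag_of (?u \<ominus>\<^bsub>N\<^esub> ?v, ih (n + k))" by simp
  ultimately have "(z - w) - frag_of (?u \<ominus>\<^bsub>N\<^esub> ?v, ih (n + k)) \<in> Rel" by (simp only:)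
  then show "\<exists>x\<in>carrier N. \<exists>n. z - w - frag_of (x, ih n) \<in> Rel" using c by blast
next
  fix a assume "a \<in> carrier N \<times> carrier B"
  then obtain x b where a: "a = (x, b)" "x \<in> carrier N" "b \<in> carrier B" by auto
  \<comment> \<open>With \<open>b = r/h^n\<close>, the scalar \<open>r\<close> moves over to
    \<open>x\<close> and leaves the denominator alone.\<close>
  obtain r and n :: nat where r: "r \<in> carrier R" "b = fraction_section R (regular_module R) D r (h [^] n)"
    using reg.tilde_basic_openE[OF h, of b] a(3) by (auto simp: structure_sheaf_def)
  have "frag_of (to_sections R V r \<odot>\<^bsub>N\<^esub> x, ih n) - frag_of (x, b) \<in> Rel"
    using relation_scalar[OF to_V[OF r(1)] a(2) ih_closed, of n] fraction_eq[OF r(1), of n] r(2) by simp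
  then have "- (frag_of (to_sections R V r \<odot>\<^bsub>N\<^esub> x, ih n) - frag_of (x, b)) \<in> Rel" by (rule Rel_uminus)
  then show "\<exists>x\<in>carrier N. \<exists>n. frag_of a - frag_of (x, ih n) \<in> Rel" using a to_V[OF r(1)] by (intro bexI[of _ "to_sections R V r \<odot>\<^bsub>N\<^esub> x"] exI[of _ n]) auto
qed

lemma pure_value_add_left:
  assumes x: "x \<in> carrier N" "y \<in> carrier N" and b: "b \<in> carrier B"
  shows "pure_value (x \<oplus>\<^bsub>N\<^esub> y) b = pure_value x b \<oplus>\<^bsub>E\<^esub> pure_value y b"
  unfolding pure_value_def chi_add[OF x] restrict_tilde_add[OF sub] using restrict_chi x b by (simp add: E.smult_r_distr)

lemma pure_value_add_right:
  assumes x: "x \<in> carrier N" and b: "b \<in> carrier B" "c \<in> carrier B"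
  shows "pure_value x (b \<oplus>\<^bsub>B\<^esub> c) = pure_value x b \<oplus>\<^bsub>E\<^esub> pure_value x c"
  unfolding pure_value_def using restrict_chi x b by (simp add: E.smult_l_distr)

lemma pure_value_scalar:
  assumes a: "a \<in> carrier A" and x: "x \<in> carrier N" and b: "b \<in> carrier B"
  shows "pure_value (a \<odot>\<^bsub>N\<^esub> x) b = pure_value x (\<rho> a \<otimes>\<^bsub>B\<^esub> b)"
proof -
  have "pure_value (a \<odot>\<^bsub>N\<^esub> x) b = b \<odot>\<^bsub>E\<^esub> (\<rho> a \<odot>\<^bsub>E\<^esub> restrict (\<chi> x) D)"
    unfolding pure_value_def chi_smult[OF a x] restrict_tilde_smult[OF sub] ..
  also have "\<dots> = (b \<otimes>\<^bsub>B\<^esub> \<rho> a) \<odot>\<^bsub>E\<^esub> restrict (\<chi> x) D"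
    using E.smult_assoc1[OF b rho_closed[OF a] restrict_chi[OF x]] by simp
  finally show ?thesis unfolding pure_value_def using E.R.m_comm[OF b rho_closed[OF a]] by simp
qed

lemma pure_value_mult:
  assumes x: "x \<in> carrier N" and b: "b \<in> carrier B" "c \<in> carrier B"
  shows "pure_value x (b \<otimes>\<^bsub>B\<^esub> c) = b \<odot>\<^bsub>E\<^esub> pure_value x c"
  unfolding pure_value_def by (rule E.smult_assoc1[OF b restrict_chi[OF x]])

text \<open>Multiplying the value by h^n shows that the section behind \<open>x\<close> vanishes on
  D(h); then \<open>vanishing_section_torsion\<close> applies over the affine set
  \<open>V\<close>.\<close>

lemma pure_value_ih_torsion:
  assumes x: "x \<in> carrier N" and zero: "pure_value x (ih n) = \<zero>\<^bsub>E\<^esub>"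
  shows "\<exists>k. to_sections R V (h [^] (k::nat)) \<odot>\<^bsub>N\<^esub> x = \<zero>\<^bsub>N\<^esub>"
proof -
  have one: "to_sections R D (h [^] n) \<otimes>\<^bsub>B\<^esub> ih n = \<one>\<^bsub>B\<^esub>"
    using fraction_eq[of "h [^] n" n] h
      reg.fraction_section_eqI[OF D_pow[of n] D_one D_one, of "h [^] n" \<one>]
    by (simp add: rho_to_sections R.structure_one)
  have tD: "to_sections R D (h [^] n) \<in> carrier B" by (rule R.to_sections_closed[OF D_open]) (use h in simp)
  have "restrict (\<chi> x) D = (to_sections R D (h [^] n) \<otimes>\<^bsub>B\<^esub> ih n) \<odot>\<^bsub>E\<^esub> restrict (\<chi> x) D"
    unfolding one using restrict_chi[OF x] by simp
  also have "\<dots> = to_sections R D (h [^] n) \<odot>\<^bsub>E\<^esub> pure_value x (ih n)"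
    unfolding pure_value_def by (rule E.smult_assoc1[OF tD ih_closed restrict_chi[OF x]])
  finally have r0: "restrict (\<chi> x) D = \<zero>\<^bsub>E\<^esub>" using zero tD by simp
  have "\<chi> x p = \<zero>\<^bsub>localization R (carrier R - p) M\<^esub>" if "p \<in> V \<inter> D" for p
    using fun_cong[OF r0, of p] that by (simp add: tilde_zero)
  then obtain k :: nat where k: "to_sections R V (h [^] k) \<odot>\<^bsub>tilde R M V\<^esub> \<chi> x = \<zero>\<^bsub>tilde R M V\<^esub>"
    using vanishing_section_torsion[OF V h chi(1)[OF x]] by blast
  have "to_sections R V (h [^] k) \<odot>\<^bsub>N\<^esub> x = \<phi> \<zero>\<^bsub>tilde R M V\<^esub>"
    unfolding k[symmetric] using phi(3)[OF to_V chi(1)[OF x], of "h [^] k"] chi(2)[OF x] h by simp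
  then show ?thesis unfolding phi_zero by blast
qed

text \<open>In the tensor product, x \<otimes> 1/h^n equals h^k x \<otimes> 1/h^(n+k), and a
  generator with first entry \<zero> is a relation.\<close>

lemma torsion_fraction_relation:
  assumes x: "x \<in> carrier N" and k: "to_sections R V (h [^] (k::nat)) \<odot>\<^bsub>N\<^esub> x = \<zero>\<^bsub>N\<^esub>"
  shows "frag_of (x, ih n) \<in> Rel"
proof -
  have "frag_of (\<zero>\<^bsub>N\<^esub> \<oplus>\<^bsub>N\<^esub> \<zero>\<^bsub>N\<^esub>, ih (n + k)) - frag_of (\<zero>\<^bsub>N\<^esub>, ih (n + k)) - frag_of (\<zero>\<^bsub>N\<^esub>, ih (n + k)) \<in> Rel"
    by (rule relation_add) (auto simp: ih_closed)
  then have "- frag_of (\<zero>\<^bsub>N\<^esub>, ih (n + k)) \<in> Rel" by simp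
  moreover have "frag_of (\<zero>\<^bsub>N\<^esub>, ih (n + k)) - frag_of (x, ih n) \<in> Rel"
    using shift[OF x, of k n] unfolding k .
  ultimately have "- frag_of (\<zero>\<^bsub>N\<^esub>, ih (n + k)) + (frag_of (\<zero>\<^bsub>N\<^esub>, ih (n + k)) - frag_of (x, ih n)) \<in> Rel"
    by (rule Rel_add)
  then have "- frag_of (x, ih n) \<in> Rel" by simp
  then show ?thesis using Rel_uminus by fastforce
qed

section \<open>Evaluation of tensors in the sections over D(h)\<close>

lemma comm_group_E: "comm_group (add_monoid E)"
  by (rule E.M.a_comm_group)

text \<open>The universal property of the free abelian group provides the extension of
  \<open>pure_value\<close> to formal sums as an existence statement, hence the choice.\<close>

definition "eval_frag = (SOME \<Phi>. \<Phi> \<in> hom G (add_monoid E) \<and>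
  (\<forall>x\<in>carrier N. \<forall>b\<in>carrier B. \<Phi> (frag_of (x, b)) = pure_value x b))"

lemma eval_frag: "eval_frag \<in> hom G (add_monoid E)"
  "x \<in> carrier N \<Longrightarrow> b \<in> carrier B \<Longrightarrow> eval_frag (frag_of (x, b)) = pure_value x b"
proof -
  have "\<exists>\<Phi>. \<Phi> \<in> hom G (add_monoid E) \<and> (\<forall>x\<in>carrier N. \<forall>b\<in>carrier B. \<Phi> (frag_of (x, b)) = pure_value x b)"
  proof (rule comm_group.free_Abelian_group_universal[OF comm_group_E, of "case_prod pure_value" "carrier N \<times> carrier B"])
    show "case_prod pure_value ` (carrier N \<times> carrier B) \<subseteq> carrier (add_monoid E)" using pure_value_closed by auto
  qed auto
  from someI_ex[OF this, folded eval_frag_def]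
  show "eval_frag \<in> hom G (add_monoid E)"
    "x \<in> carrier N \<Longrightarrow> b \<in> carrier B \<Longrightarrow> eval_frag (frag_of (x, b)) = pure_value x b" by auto
qed

sublocale eval: group_hom G "add_monoid E" eval_frag
  using eval_frag(1) comm_group_E by (simp add: group_hom_def group_hom_axioms_def comm_group_def)

lemma eval_closed: "Poly_Mapping.keys z \<subseteq> carrier N \<times> carrier B \<Longrightarrow> eval_frag z \<in> carrier E"
  using eval.hom_closed[of z] by simp

lemma eval_minus:
  assumes "Poly_Mapping.keys z \<subseteq> carrier N \<times> carrier B" "Poly_Mapping.keys w \<subseteq> carrier N \<times> carrier B"
  shows "eval_frag (z - w) = eval_frag z \<ominus>\<^bsub>E\<^esub> eval_frag w"
proof -
  have "eval_frag (z \<otimes>\<^bsub>G\<^esub> inv\<^bsub>G\<^esub> w) = eval_frag z \<otimes>\<^bsub>add_monoid E\<^esub> inv\<^bsub>add_monoid E\<^esub> eval_frag w"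
    using eval.hom_mult[of z "inv\<^bsub>G\<^esub> w"] eval.hom_inv[of w] assms by (simp add: keys_minus)
  then show ?thesis using assms by (simp add: a_minus_def a_inv_def)
qed

lemma eval_zero: "eval_frag 0 = \<zero>\<^bsub>E\<^esub>"
  using eval.hom_one by simp

text \<open>It suffices to look at the generating relations; their three kinds correspond to the
  laws \<open>pure_value_add_left\<close>, \<open>pure_value_add_right\<close> and
  \<open>pure_value_scalar\<close>.\<close>

lemma Rel_subset_kernel: "Rel \<subseteq> kernel G (add_monoid E) eval_frag"
  unfolding Rel_eq
proof (rule group.generate_subgroup_incl[OF group_G _ eval.subgroup_kernel], rule subsetI)
  fix z assume z: "z \<in> rels"
  have m3: "eval_frag (frag_of (x, b) - frag_of (y, c) - frag_of (u, d)) = pure_value x b \<ominus>\<^bsub>E\<^esub> pure_value y c \<ominus>\<^bsub>E\<^esub> pure_value u d"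
    if "x \<in> carrier N" "y \<in> carrier N" "u \<in> carrier N" "b \<in> carrier B" "c \<in> carrier B" "d \<in> carrier B" for x y u b c d
    using that by (subst eval_minus eval_minus; simp add: keys_minus eval_frag(2))+
  have m2: "eval_frag (frag_of (x, b) - frag_of (y, c)) = pure_value x b \<ominus>\<^bsub>E\<^esub> pure_value y c"
    if "x \<in> carrier N" "y \<in> carrier N" "b \<in> carrier B" "c \<in> carrier B" for x y b c
    using that by (subst eval_minus) (simp_all add: eval_frag(2))
  have c3: "u \<oplus>\<^bsub>E\<^esub> v \<ominus>\<^bsub>E\<^esub> u \<ominus>\<^bsub>E\<^esub> v = \<zero>\<^bsub>E\<^esub>" if "u \<in> carrier E" "v \<in> carrier E" for u v
  proof -
    have "u \<oplus>\<^bsub>E\<^esub> v \<ominus>\<^bsub>E\<^esub> u \<ominus>\<^bsub>E\<^esub> v = (u \<oplus>\<^bsub>E\<^esub> v) \<oplus>\<^bsub>E\<^esub> \<ominus>\<^bsub>E\<^esub> (u \<oplus>\<^bsub>E\<^esub> v)"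
      using that by (simp add: E.M.minus_eq E.M.minus_add E.M.a_ac)
    then show ?thesis using that by (simp add: E.M.r_neg)
  qed
  have "eval_frag z = \<zero>\<^bsub>E\<^esub>"
    using z unfolding rels_def
  proof (elim UnE CollectE exE conjE)
    fix m n b assume "z = frag_of (m \<oplus>\<^bsub>N\<^esub> n, b) - frag_of (m, b) - frag_of (n, b)" "m \<in> carrier N" "n \<in> carrier N" "b \<in> carrier B"
    then show ?thesis using m3[of "m \<oplus>\<^bsub>N\<^esub> n" m n b b b] c3[of "pure_value m b" "pure_value n b"] by (simp add: pure_value_add_left pure_value_closed)
  next
    fix n b c assume "z = frag_of (n, b \<oplus>\<^bsub>B\<^esub> c) - frag_of (n, b) - frag_of (n, c)" "n \<in> carrier N" "b \<in> carrier B" "c \<in> carrier B"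
    then show ?thesis using m3[of n n n "b \<oplus>\<^bsub>B\<^esub> c" b c] c3[of "pure_value n b" "pure_value n c"] by (simp add: pure_value_add_right pure_value_closed)
  next
    fix a n b assume *: "z = frag_of (a \<odot>\<^bsub>N\<^esub> n, b) - frag_of (n, \<rho> a \<otimes>\<^bsub>B\<^esub> b)" "a \<in> carrier A" "n \<in> carrier N" "b \<in> carrier B"
    then have "\<rho> a \<otimes>\<^bsub>B\<^esub> b \<in> carrier B" using rho_closed by simp
    with * show ?thesis using m2[of "a \<odot>\<^bsub>N\<^esub> n" n b "\<rho> a \<otimes>\<^bsub>B\<^esub> b"] pure_value_scalar[OF *(2-4)]
      pure_value_closed[OF *(3), of "\<rho> a \<otimes>\<^bsub>B\<^esub> b"] by (simp add: E.M.r_neg E.M.minus_eq)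
  qed
  then show "z \<in> kernel G (add_monoid E) eval_frag" using subsetD[OF rels_subset z] by (simp add: kernel_def)
qed

text \<open>Modulo relations \<open>z\<close> is a single fraction x \<otimes> 1/h^n. If its value
  is zero, then \<open>x\<close> is torsion, and a torsion fraction is itself a relation.\<close>

lemma kernel_eval: "kernel G (add_monoid E) eval_frag = Rel"
proof (intro subset_antisym Rel_subset_kernel subsetI)
  fix z assume "z \<in> kernel G (add_monoid E) eval_frag"
  then have z: "Poly_Mapping.keys z \<subseteq> carrier N \<times> carrier B" "eval_frag z = \<zero>\<^bsub>E\<^esub>" by (auto simp: kernel_def)
  obtain x n where x: "x \<in> carrier N" "z - frag_of (x, ih n) \<in> Rel" using single_fraction[OF z(1)] by blast
  have "eval_frag (z - frag_of (x, ih n)) = \<zero>\<^bsub>E\<^esub>" using x(2) Rel_subset_kernel by (auto simp: kernel_def)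
  moreover have "eval_frag (z - frag_of (x, ih n)) = \<zero>\<^bsub>E\<^esub> \<ominus>\<^bsub>E\<^esub> pure_value x (ih n)"
    using eval_minus[OF z(1), of "frag_of (x, ih n)"] z(2) x(1) ih_closed by (simp add: eval_frag(2))
  ultimately have "\<ominus>\<^bsub>E\<^esub> pure_value x (ih n) = \<zero>\<^bsub>E\<^esub>"
    using pure_value_closed[OF x(1) ih_closed] by (simp add: E.M.minus_eq)
  then have "pure_value x (ih n) = \<zero>\<^bsub>E\<^esub>"
    using pure_value_closed[OF x(1) ih_closed] by (metis E.M.r_neg E.M.r_zero)
  then obtain k :: nat where "to_sections R V (h [^] k) \<odot>\<^bsub>N\<^esub> x = \<zero>\<^bsub>N\<^esub>" using pure_value_ih_torsion[OF x(1)] by blast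
  then have "frag_of (x, ih n) \<in> Rel" by (rule torsion_fraction_relation[OF x(1)])
  then show "z \<in> Rel" using Rel_add[OF x(2)] by fastforce
qed

lemma eval_single: "m \<in> carrier M \<Longrightarrow> eval_frag (frag_of (\<phi> (fraction_section R M V m \<one>), ih n)) = fraction_section R M D m (h [^] n)"
proof -
  assume m: "m \<in> carrier M"
  have c: "fraction_section R M V m \<one> \<in> carrier (tilde R M V)" by (rule fraction_section_in_tilde_one[OF V_open m])
  have "pure_value (\<phi> (fraction_section R M V m \<one>)) (ih n) = fraction_section R M D m (h [^] n)"
    unfolding pure_value_def chi(3)[OF c] restrict_fraction_section[OF sub] ih_def
    using fraction_section_smult[OF D_pow D_one, of n \<one> m] m h by simp
  then show ?thesis using eval_frag(2)[OF phi(1)[OF c] ih_closed] by simp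
qed

text \<open>A section over D(h) is m/h^n with \<open>m\<close> in \<open>M\<close>. Hence the
  sections m/1 over \<open>V\<close>, divided by powers of \<open>h\<close>, already reach
  everything, although M(V) may contain further sections.\<close>

lemma eval_surj: "eval_frag ` carrier G = carrier (add_monoid E)"
proof (intro subset_antisym subsetI)
  show "e \<in> carrier (add_monoid E)" if "e \<in> eval_frag ` carrier G" for e using that eval_closed by auto
  fix e assume "e \<in> carrier (add_monoid E)"
  then have "e \<in> carrier E" by simp
  then obtain m and n :: nat where m: "m \<in> carrier M" "e = fraction_section R M D m (h [^] n)"
    by (rule tilde_basic_openE[OF h])
  have "frag_of (\<phi> (fraction_section R M V m \<one>), ih n) \<in> carrier G"
    using phi(1)[OF fraction_section_in_tilde_one[OF V_open m(1)]] ih_closed by simp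
  then show "e \<in> eval_frag ` carrier G" using eval_single[OF m(1), of n] m(2) by (metis image_eqI)
qed

section \<open>The base change as the module of sections over D(h)\<close>

abbreviation "BC \<equiv> base_change A \<rho> B N"
abbreviation "tc \<equiv> tensor_class A \<rho> B N"

text \<open>\<open>eval_frag\<close> is constant on the cosets of its kernel, and
  \<open>the_elem\<close> extracts the value; this is the form in which
  \<open>FactGroup_iso_set\<close> states the isomorphism.\<close>

definition "bc_iso X = the_elem (eval_frag ` X)"

lemma tc_eq: "tc z = Rel #>\<^bsub>G\<^esub> z"
  by (simp add: tensor_class_def)

lemma BC_simps: "carrier BC = carrier (G Mod Rel)" "add BC = monoid.mult (G Mod Rel)"
  by (simp_all add: base_change_def Let_def)

lemma carrier_BC: "carrier BC = tc ` carrier G"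
  unfolding BC_simps tc_eq by (auto simp: FactGroup_def RCOSETS_def)

lemma eval_tc:
  assumes z: "z \<in> carrier G" and w: "w \<in> tc z"
  shows "w \<in> carrier G" "eval_frag w = eval_frag z"
proof -
  obtain r where r: "r \<in> Rel" "w = r \<otimes>\<^bsub>G\<^esub> z" using w unfolding tc_eq r_coset_def by auto
  have "r \<in> kernel G (add_monoid E) eval_frag" using r(1) kernel_eval by simp
  then have rG: "r \<in> carrier G" and r1: "eval_frag r = \<one>\<^bsub>add_monoid E\<^esub>" unfolding kernel_def by blast+
  show "w \<in> carrier G" unfolding r(2) by (rule monoid.m_closed[OF group.is_monoid[OF group_G] rG z])
  have "eval_frag w = \<one>\<^bsub>add_monoid E\<^esub> \<otimes>\<^bsub>add_monoid E\<^esub> eval_frag z"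
    unfolding r(2) r1[symmetric] by (rule eval.hom_mult[OF rG z])
  then show "eval_frag w = eval_frag z" using eval.hom_closed[OF z] by simp
qed

lemma bc_iso_tc: "z \<in> carrier G \<Longrightarrow> bc_iso (tc z) = eval_frag z"
proof -
  assume z: "z \<in> carrier G"
  have "eval_frag w = eval_frag z" if "w \<in> tc z" for w
    using eval_tc[OF z that] by simp
  moreover have "z \<in> tc z" unfolding tc_eq r_coset_def using Rel_zero by force
  ultimately have "eval_frag ` tc z = {eval_frag z}" by blast
  then show ?thesis by (simp add: bc_iso_def)
qed

lemma bc_iso_iso: "bc_iso \<in> iso (G Mod Rel) (add_monoid E)"
  using eval.FactGroup_iso_set[OF eval_surj] unfolding kernel_eval bc_iso_def[abs_def] .

definition "scale b = frag_extend (\<lambda>(n, c). frag_of (n, b \<otimes>\<^bsub>B\<^esub> c))"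

lemma scale_closed:
  assumes b: "b \<in> carrier B" and z: "Poly_Mapping.keys z \<subseteq> carrier N \<times> carrier B"
  shows "Poly_Mapping.keys (scale b z) \<subseteq> carrier N \<times> carrier B"
proof (rule free_Abelian_group_induct[OF z])
  show "Poly_Mapping.keys (scale b 0) \<subseteq> carrier N \<times> carrier B" by (simp add: scale_def)
  show "Poly_Mapping.keys (scale b (x - y)) \<subseteq> carrier N \<times> carrier B"
    if "Poly_Mapping.keys (scale b x) \<subseteq> carrier N \<times> carrier B" "Poly_Mapping.keys (scale b y) \<subseteq> carrier N \<times> carrier B" for x y
    using keys_minus[OF that] by (simp add: scale_def frag_extend_diff)
  show "Poly_Mapping.keys (scale b (frag_of a)) \<subseteq> carrier N \<times> carrier B" if "a \<in> carrier N \<times> carrier B" for a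
    using that b by (auto simp: scale_def)
qed

lemma eval_scale:
  assumes b: "b \<in> carrier B" and z: "Poly_Mapping.keys z \<subseteq> carrier N \<times> carrier B"
  shows "eval_frag (scale b z) = b \<odot>\<^bsub>E\<^esub> eval_frag z"
proof (rule free_Abelian_group_induct[OF z])
  show "eval_frag (scale b 0) = b \<odot>\<^bsub>E\<^esub> eval_frag 0" using b by (simp add: scale_def eval_zero)
  show "eval_frag (scale b (x - y)) = b \<odot>\<^bsub>E\<^esub> eval_frag (x - y)"
    if k: "Poly_Mapping.keys x \<subseteq> carrier N \<times> carrier B" "Poly_Mapping.keys y \<subseteq> carrier N \<times> carrier B"
      and "eval_frag (scale b x) = b \<odot>\<^bsub>E\<^esub> eval_frag x" "eval_frag (scale b y) = b \<odot>\<^bsub>E\<^esub> eval_frag y" for x y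
  proof -
    have "scale b (x - y) = scale b x - scale b y" by (simp add: scale_def frag_extend_diff)
    then show ?thesis
      using that eval_minus[OF scale_closed[OF b k(1)] scale_closed[OF b k(2)]] eval_minus[OF k] eval_closed[OF k(1)] eval_closed[OF k(2)] b
      by (simp add: E.M.minus_eq E.smult_r_distr E.smult_r_minus)
  qed
  show "eval_frag (scale b (frag_of a)) = b \<odot>\<^bsub>E\<^esub> eval_frag (frag_of a)" if "a \<in> carrier N \<times> carrier B" for a
    using that b by (auto simp: scale_def eval_frag(2) pure_value_mult)
qed

lemma tc_cong:
  assumes z: "z \<in> carrier G" "w \<in> carrier G" and eq: "eval_frag z = eval_frag w"
  shows "tc z = tc w"
proof -
  have i: "inj_on bc_iso (carrier BC)" using bc_iso_iso by (simp add: BC_simps iso_def bij_betw_def)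
  have c: "tc z \<in> carrier BC" "tc w \<in> carrier BC" using z carrier_BC by auto
  have e: "bc_iso (tc z) = bc_iso (tc w)" using bc_iso_tc[OF z(1)] bc_iso_tc[OF z(2)] eq by simp
  show ?thesis by (rule inj_onD[OF i e c])
qed

text \<open>The action on \<open>base_change\<close> is a union over all representatives of a coset.
  That they agree is seen after evaluation, where scaling becomes multiplication by \<open>b\<close>
  (\<open>eval_scale\<close>), instead of by checking that scaling preserves the relations.\<close>

lemma smult_tc:
  assumes b: "b \<in> carrier B" and z: "z \<in> carrier G"
  shows "b \<odot>\<^bsub>BC\<^esub> tc z = tc (scale b z)"
proof -
  have "tc (scale b w) = tc (scale b z)" if w: "w \<in> tc z" for w
  proof -
    have wG: "w \<in> carrier G" and "eval_frag w = eval_frag z" using eval_tc[OF z w] by auto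
    then show ?thesis
      using wG z b by (intro tc_cong) (auto simp: eval_scale dest: scale_closed[OF b, THEN subsetD])
  qed
  moreover have "z \<in> tc z" unfolding tc_eq r_coset_def using Rel_zero by force
  moreover have "b \<odot>\<^bsub>BC\<^esub> tc z = (\<Union>w\<in>tc z. tc (scale b w))"
    by (simp add: base_change_def Let_def scale_def)
  ultimately show ?thesis by blast
qed

lemma BC_add_closed: "x \<in> carrier BC \<Longrightarrow> y \<in> carrier BC \<Longrightarrow> x \<oplus>\<^bsub>BC\<^esub> y \<in> carrier BC"
  unfolding BC_simps
  by (rule monoid.m_closed[OF group.is_monoid[OF normal.factorgroup_is_group[OF eval.normal_kernel, unfolded kernel_eval]]])

lemma BC_smult_closed: "b \<in> carrier B \<Longrightarrow> x \<in> carrier BC \<Longrightarrow> b \<odot>\<^bsub>BC\<^esub> x \<in> carrier BC"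
  using smult_tc scale_closed unfolding carrier_BC by auto

lemma semilinear_iso_bc: "semilinear_iso B id BC E bc_iso"
  unfolding semilinear_iso_def
proof (intro conjI ballI)
  show "bij_betw bc_iso (carrier BC) (carrier E)" using bc_iso_iso by (simp add: iso_def BC_simps)
  show "bc_iso (x \<oplus>\<^bsub>BC\<^esub> y) = bc_iso x \<oplus>\<^bsub>E\<^esub> bc_iso y" if "x \<in> carrier BC" "y \<in> carrier BC" for x y
    using bc_iso_iso that by (auto simp: iso_def hom_def BC_simps)
  show "bc_iso (b \<odot>\<^bsub>BC\<^esub> x) = id b \<odot>\<^bsub>E\<^esub> bc_iso x" if bx: "b \<in> carrier B" "x \<in> carrier BC" for b x
  proof -
    obtain z where z: "z \<in> carrier G" "x = tc z" using bx(2) carrier_BC by auto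
    then have "scale b z \<in> carrier G" using scale_closed[OF bx(1)] by simp
    then show ?thesis using z smult_tc[OF bx(1) z(1)] bc_iso_tc eval_scale[OF bx(1), of z] by simp
  qed
qed

text \<open>Tensors with first factor from the sheaf of \<open>L\<close> evaluate into the sheaf of
  \<open>L\<close>, by induction on the free abelian group. Conversely, a section of it over D(h) is
  l/h^n with \<open>l\<close> in \<open>L\<close> itself (\<open>tilde_sub_basic_openE\<close>), the
  value of the tensor of l/1 and 1/h^n.\<close>

lemma bc_iso_extended:
  assumes L: "submodule L R M"
  shows "bc_iso ` extended_submodule A \<rho> B N (\<phi> ` tilde_sub R M L V) = tilde_sub R M L D"
proof -
  let ?K = "\<phi> ` tilde_sub R M L V"
  note LV = submodule_tilde_sub[OF L V_open] and LD = submodule_tilde_sub[OF L D_open]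
  have LVc: "tilde_sub R M L V \<subseteq> carrier (tilde R M V)" by (rule TV.submoduleE(1)[OF LV])
  have K: "?K \<subseteq> carrier N" using LVc phi(1) by auto
  have sub': "Poly_Mapping.keys z \<subseteq> carrier N \<times> carrier B" if "Poly_Mapping.keys z \<subseteq> ?K \<times> carrier B" for z
    using that K by blast
  have eq: "bc_iso ` extended_submodule A \<rho> B N ?K = eval_frag ` carrier (free_Abelian_group (?K \<times> carrier B))"
    unfolding extended_submodule_def image_image using bc_iso_tc sub' by (intro image_cong) auto
  have "eval_frag z \<in> tilde_sub R M L D" if z: "Poly_Mapping.keys z \<subseteq> ?K \<times> carrier B" for z
  proof (rule free_Abelian_group_induct[OF z])
    show "eval_frag 0 \<in> tilde_sub R M L D"
      unfolding eval_zero using subgroup.one_closed[OF submodule.axioms(1)[OF LD]] by simp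
    show "eval_frag (x - y) \<in> tilde_sub R M L D"
      if "Poly_Mapping.keys x \<subseteq> ?K \<times> carrier B" "Poly_Mapping.keys y \<subseteq> ?K \<times> carrier B"
        "eval_frag x \<in> tilde_sub R M L D" "eval_frag y \<in> tilde_sub R M L D" for x y
      unfolding eval_minus[OF sub'[OF that(1)] sub'[OF that(2)]] E.M.minus_eq
      by (rule E.submoduleE(5)[OF LD that(3) E.submoduleE(3)[OF LD that(4)]])
    show "eval_frag (frag_of a) \<in> tilde_sub R M L D" if aK: "a \<in> ?K \<times> carrier B" for a
    proof -
      obtain s b where a: "a = (\<phi> s, b)" "s \<in> tilde_sub R M L V" "b \<in> carrier B" using aK by auto
      then have sV: "s \<in> carrier (tilde R M V)" using LVc by auto
      have "restrict s D \<in> tilde_sub R M L D"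
        using restrict_local_fractions[OF L D_open sub] a(2) tilde_sub_eq[OF L V_open] tilde_sub_eq[OF L D_open] by simp
      then have "pure_value (\<phi> s) b \<in> tilde_sub R M L D"
        unfolding pure_value_def chi(3)[OF sV] by (rule E.submoduleE(4)[OF LD a(3)])
      then show ?thesis using eval_frag(2)[OF phi(1)[OF sV] a(3)] a(1) by simp
    qed
  qed
  moreover have "e \<in> eval_frag ` carrier (free_Abelian_group (?K \<times> carrier B))" if e: "e \<in> tilde_sub R M L D" for e
  proof -
    obtain l and n :: nat where l: "l \<in> L" "e = fraction_section R M D l (h [^] n)"
      using tilde_sub_basic_openE[OF L h e] by metis
    have "fraction_section R M V l \<one> \<in> tilde_sub R M L V"
      using fraction_section_in_sub[OF L V_open l(1)] tilde_sub_eq[OF L V_open] by simp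
    then have "frag_of (\<phi> (fraction_section R M V l \<one>), ih n) \<in> carrier (free_Abelian_group (?K \<times> carrier B))"
      using ih_closed by simp
    moreover have "e = eval_frag (frag_of (\<phi> (fraction_section R M V l \<one>), ih n))"
      using eval_single[of l n] l submodule_subset[OF L] by auto
    ultimately show ?thesis by (rule rev_image_eqI)
  qed
  ultimately show ?thesis unfolding eq by auto
qed

lemma bc_iso_pure: "s \<in> carrier (tilde R M V) \<Longrightarrow> tc (frag_of (\<phi> s, \<one>\<^bsub>B\<^esub>)) \<in> carrier BC"
  "s \<in> carrier (tilde R M V) \<Longrightarrow> bc_iso (tc (frag_of (\<phi> s, \<one>\<^bsub>B\<^esub>))) = restrict s D"
proof -
  assume s: "s \<in> carrier (tilde R M V)"
  then have G: "frag_of (\<phi> s, \<one>\<^bsub>B\<^esub>) \<in> carrier G" using phi(1) by simp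
  then show "tc (frag_of (\<phi> s, \<one>\<^bsub>B\<^esub>)) \<in> carrier BC" by (auto simp: carrier_BC)
  have "restrict s D \<in> carrier E" by (rule restrict_in_tilde[OF V_open D_open sub s])
  then show "bc_iso (tc (frag_of (\<phi> s, \<one>\<^bsub>B\<^esub>))) = restrict s D"
    using bc_iso_tc[OF G] eval_frag(2)[OF phi(1)[OF s], of "\<one>\<^bsub>B\<^esub>"] chi(3)[OF s] by (simp add: pure_value_def)
qed

lemma extended_subset:
  assumes L: "submodule L R M"
  shows "extended_submodule A \<rho> B N (\<phi> ` tilde_sub R M L V) \<subseteq> carrier BC"
proof -
  have "\<phi> ` tilde_sub R M L V \<subseteq> carrier N"
    using TV.submoduleE(1)[OF submodule_tilde_sub[OF L V_open]] phi(1) by auto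
  then have "carrier (free_Abelian_group (\<phi> ` tilde_sub R M L V \<times> carrier B)) \<subseteq> carrier G"
    unfolding subset_iff[of "carrier (free_Abelian_group _)"] carrier_free_Abelian_group_iff by blast
  then show ?thesis unfolding extended_submodule_def carrier_BC by (rule image_mono)
qed

end

section \<open>The closure of a sheaf of submodules\<close>

lemma (in cring) to_sections_unit_imp_notin:
  assumes p: "p \<in> spec R" and r: "r \<in> carrier R" and y: "y \<in> carrier (localization R (carrier R - p) (regular_module R))"
    and eq: "frac R (carrier R - p) (regular_module R) r \<one> \<otimes>\<^bsub>localization R (carrier R - p) (regular_module R)\<^esub> y
      = \<one>\<^bsub>localization R (carrier R - p) (regular_module R)\<^esub>"
  shows "r \<notin> p"
proof
  assume rp: "r \<in> p"
  interpret reg: module R "regular_module R" by (rule module_regular_module)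
  interpret loc: module_denominators R "regular_module R" "carrier R - p" by (rule reg.prime_denominators[OF p])
  interpret p: primeideal p R using p by (simp add: spec_def)
  obtain b s where b: "b \<in> carrier R" "s \<in> carrier R - p" "y = frac R (carrier R - p) (regular_module R) b s"
    using loc.localizationE[OF y] by auto
  have "frac R (carrier R - p) (regular_module R) (r \<otimes> b) (\<one> \<otimes> s) = frac R (carrier R - p) (regular_module R) \<one> \<one>"
    using eq localization_regular(2)[OF loc.module_denominators_axioms r b(1) _ b(2), of \<one>] b(3) loc.denom_one
    by (simp add: one_localization_regular)
  moreover have "r \<otimes> b \<in> carrier (regular_module R)" "\<one> \<in> carrier (regular_module R)" "\<one> \<otimes> s \<in> carrier R - p"
    using r b by auto
  ultimately have "\<exists>u\<in>carrier R - p. u \<otimes> (\<one> \<otimes> (r \<otimes> b)) = u \<otimes> ((\<one> \<otimes> s) \<otimes> \<one>)"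
    using loc.frac_eq_iff[of "r \<otimes> b" \<one> "\<one> \<otimes> s" \<one>] loc.denom_one by (simp only: regular_module_simps simp_thms)
  then obtain u where u: "u \<in> carrier R - p" "u \<otimes> (\<one> \<otimes> (r \<otimes> b)) = u \<otimes> ((\<one> \<otimes> s) \<otimes> \<one>)" by blast
  \<comment> \<open>Clearing denominators in (r/1)(b/s) = 1 at \<open>p\<close>. With
    \<open>r\<close> in \<open>p\<close> the product \<open>u s\<close> falls into the prime
    \<open>p\<close>, which contains neither factor.\<close>
  have "u \<otimes> s = r \<otimes> (u \<otimes> b)" using u r b by (simp add: m_ac)
  also have "\<dots> \<in> p" using rp u b by (intro p.I_r_closed) auto
  finally show False using p.I_prime[of u s] u b by auto
qed

lemma (in cring) unit_imp_subset_basic_open: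
  assumes U: "openin (zariski R) U" and r: "r \<in> carrier R" and unit: "to_sections R U r \<in> Units (\<O> R U)"
  shows "U \<subseteq> basic_open R r"
proof
  fix p assume p: "p \<in> U"
  interpret reg: module R "regular_module R" by (rule module_regular_module)
  have ps: "p \<in> spec R" using p openin_zariski_subset[OF U] by auto
  obtain y where y: "y \<in> carrier (\<O> R U)" "to_sections R U r \<otimes>\<^bsub>\<O> R U\<^esub> y = \<one>\<^bsub>\<O> R U\<^esub>"
    using unit by (auto simp: Units_def)
  have "frac R (carrier R - p) (regular_module R) r \<one> \<otimes>\<^bsub>localization R (carrier R - p) (regular_module R)\<^esub> y p
      = \<one>\<^bsub>localization R (carrier R - p) (regular_module R)\<^esub>"
    using fun_cong[OF y(2), of p] p by (simp add: structure_sheaf_def tilde_mult tilde_one to_sections_def)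
  then have "r \<notin> p"
    using to_sections_unit_imp_notin[OF ps r reg.tilde_in_stalk[of y U p]] y(1) p by (simp add: structure_sheaf_def)
  then show "p \<in> basic_open R r" using ps by (simp add: basic_open_def)
qed

text \<open>\<open>glueable\<close> is phrased with invertibility loci; this brings it back to basic
  open sets when the affine open is Spec R.\<close>

lemma (in cring) invertibility_locus_to_sections:
  assumes r: "r \<in> carrier R"
  shows "invertibility_locus R (spec R) (to_sections R (spec R) r) = basic_open R r"
proof -
  interpret reg: module R "regular_module R" by (rule module_regular_module)
  have "frac R (carrier R - p) (regular_module R) r \<one> \<in> Units (localization R (carrier R - p) (regular_module R)) \<longleftrightarrow> r \<notin> p"
    if p: "p \<in> spec R" for p
  proof -
    interpret loc: module_denominators R "regular_module R" "carrier R - p" by (rule reg.prime_denominators[OF p])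
    note mult = localization_regular(2)[OF loc.module_denominators_axioms]
    show ?thesis
    proof
      assume "frac R (carrier R - p) (regular_module R) r \<one> \<in> Units (localization R (carrier R - p) (regular_module R))"
      then show "r \<notin> p" using to_sections_unit_imp_notin[OF p r] by (auto simp: Units_def)
    next
      assume "r \<notin> p"
      then have rp: "r \<in> carrier R - p" using r by simp
      have e: "frac R (carrier R - p) (regular_module R) r r = frac R (carrier R - p) (regular_module R) \<one> \<one>"
        using rp loc.denom_one by (intro loc.frac_eqI) auto
      have "frac R (carrier R - p) (regular_module R) \<one> r \<otimes>\<^bsub>localization R (carrier R - p) (regular_module R)\<^esub>
          frac R (carrier R - p) (regular_module R) r \<one> = \<one>\<^bsub>localization R (carrier R - p) (regular_module R)\<^esub>"
        "frac R (carrier R - p) (regular_module R) r \<one> \<otimes>\<^bsub>localization R (carrier R - p) (regular_module R)\<^esub>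
          frac R (carrier R - p) (regular_module R) \<one> r = \<one>\<^bsub>localization R (carrier R - p) (regular_module R)\<^esub>"
        using mult[of \<one> r r \<one>] mult[of r \<one> \<one> r] rp loc.denom_one r e by (simp_all add: one_localization_regular)
      moreover have "frac R (carrier R - p) (regular_module R) \<one> r \<in> carrier (localization R (carrier R - p) (regular_module R))"
        "frac R (carrier R - p) (regular_module R) r \<one> \<in> carrier (localization R (carrier R - p) (regular_module R))"
        using rp r loc.denom_one by (auto intro!: loc.frac_in_carrier)
      ultimately show "frac R (carrier R - p) (regular_module R) r \<one> \<in> Units (localization R (carrier R - p) (regular_module R))"
        unfolding Units_def by blast
    qed
  qed
  then show ?thesis by (auto simp: invertibility_locus_def stalk_at_def to_sections_def basic_open_def)
qed

text \<open>The case \<open>f = 1\<close> of \<open>localized_structure_sheaf\<close>, where powers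
  of \<open>f\<close> leave nothing to clear.\<close>

lemma (in cring) to_sections_spec_bij: "bij_betw (to_sections R (spec R)) (carrier R) (carrier (\<O> R (spec R)))"
proof -
  interpret localized_ring R "plain_ring (\<O> R (spec R))" \<one> "to_sections R (spec R)"
    using localized_structure_sheaf[OF one_closed] by (simp add: basic_open_one)
  have one: "to_sections R (spec R) \<one> = \<one>\<^bsub>\<O> R (spec R)\<^esub>" using hom_one by simp
  interpret O: cring "\<O> R (spec R)" by (rule cring_structure_sheaf[OF openin_spec])
  show ?thesis
    unfolding bij_betw_def
  proof (intro conjI inj_onI subset_antisym subsetI)
    show "r = s" if "r \<in> carrier R" "s \<in> carrier R" "to_sections R (spec R) r = to_sections R (spec R) s" for r s
      using ring_inj[OF that] that by auto
    show "a \<in> to_sections R (spec R) ` carrier R" if "a \<in> carrier (\<O> R (spec R))" for a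
      using ring_surj[of a] that by (auto simp: one)
  qed (auto simp: to_sections_closed[OF openin_spec])
qed

section \<open>Closures of the sheaf of \<open>L\<close> over affine open sets\<close>

locale glueable_closure = module R M for R :: "'r ring" (structure) and M :: "('r, 'u) module" (structure) +
  fixes L :: "'u set" and cl :: "('r, 'u) operation"
  assumes inf: "infinite (UNIV :: 'u set)" and L: "submodule L R M"
    and pre: "preclosure_operation R cl" and glue: "glueable R cl"
begin

abbreviation "D \<equiv> basic_open R"
abbreviation "T U \<equiv> tilde R M U"
definition "CL U = closure_in R cl U (\<O> R U) id (T U) (tilde_sub R M L U)"

lemma CL_subset: "CL U \<subseteq> carrier (T U)"
  by (auto simp: CL_def closure_in_def)

lemma L_submodule: "openin (zariski R) U \<Longrightarrow> submodule (tilde_sub R M L U) (\<O> R U) (T U)"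
  by (rule submodule_tilde_sub[OF L])

lemma pre_submodule: "affine_open R U \<Longrightarrow> module (\<O> R U) N \<Longrightarrow> submodule K (\<O> R U) N \<Longrightarrow>
    submodule (cl U N K) (\<O> R U) N"
  using pre unfolding preclosure_operation_def by simp

lemma pre_iso: "affine_open R U \<Longrightarrow> module (\<O> R U) N \<Longrightarrow> module (\<O> R U) N' \<Longrightarrow> semilinear_iso (\<O> R U) id N N' \<phi> \<Longrightarrow>
    submodule K (\<O> R U) N \<Longrightarrow> cl U N' (\<phi> ` K) = \<phi> ` cl U N K"
  using pre unfolding preclosure_operation_def by blast

text \<open>Exchanges the existential copy in \<open>closure_in\<close> for any copy at hand: two
  copies are isomorphic through M(U), and \<open>cl\<close> is invariant under isomorphisms.\<close>

lemma CL_witness: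
  fixes N' :: "(('r, 'r) sections, 'u) module"
  assumes U: "affine_open R U" and N': "module (\<O> R U) N'" and iso: "semilinear_iso (\<O> R U) id (T U) N' \<phi>"
    and s: "s \<in> carrier (T U)"
  shows "s \<in> CL U \<longleftrightarrow> \<phi> s \<in> cl U N' (\<phi> ` tilde_sub R M L U)"
proof
  note Uo = R.affine_open_open[OF U]
  interpret T: module "\<O> R U" "T U" by (rule module_tilde[OF Uo])
  assume "s \<in> CL U"
  then obtain N \<chi> where N: "module (\<O> R U) N" "semilinear_iso (\<O> R U) id (T U) N \<chi>" "\<chi> s \<in> cl U N (\<chi> ` tilde_sub R M L U)"
    by (auto simp: CL_def closure_in_def)
  let ?i = "inv_into (carrier (T U)) \<chi>"
  have i: "?i (\<chi> t) = t" if "t \<in> carrier (T U)" for t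
    using that N(2) by (auto simp: semilinear_iso_def bij_betw_def)
  have "semilinear_iso (\<O> R U) id N (T U) ?i"
    by (rule semilinear_iso_inv[OF N(2)]) auto
  from semilinear_iso_trans[OF this iso] have "semilinear_iso (\<O> R U) id N N' (\<phi> \<circ> ?i)" by simp
  from pre_iso[OF U N(1) N' this semilinear_iso_submodule_image[OF N(2) T.module_axioms N(1) L_submodule[OF Uo]]]
  have eq: "cl U N' ((\<phi> \<circ> ?i) ` \<chi> ` tilde_sub R M L U) = (\<phi> \<circ> ?i) ` cl U N (\<chi> ` tilde_sub R M L U)" .
  have im: "(\<phi> \<circ> ?i) ` \<chi> ` tilde_sub R M L U = \<phi> ` tilde_sub R M L U"
    unfolding image_image using i T.submoduleE(1)[OF L_submodule[OF Uo]] by (intro image_cong) auto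
  have "(\<phi> \<circ> ?i) (\<chi> s) \<in> (\<phi> \<circ> ?i) ` cl U N (\<chi> ` tilde_sub R M L U)" using N(3) by (rule imageI)
  then show "\<phi> s \<in> cl U N' (\<phi> ` tilde_sub R M L U)" unfolding eq[symmetric] im using i[OF s] by simp
next
  assume "\<phi> s \<in> cl U N' (\<phi> ` tilde_sub R M L U)"
  then show "s \<in> CL U" using N' iso s by (auto simp: CL_def closure_in_def)
qed

text \<open>The submodule property is inherited from one copy in the universe. Here the copy is
  assumed; \<open>witness_basic\<close> provides it over basic open sets.\<close>

lemma CL_submodule:
  fixes N' :: "(('r, 'r) sections, 'u) module"
  assumes U: "affine_open R U" and N': "module (\<O> R U) N'" and iso: "semilinear_iso (\<O> R U) id (T U) N' \<phi>"
  shows "submodule (CL U) (\<O> R U) (T U)"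
proof -
  note Uo = R.affine_open_open[OF U]
  interpret T: module "\<O> R U" "T U" by (rule module_tilde[OF Uo])
  interpret N': module "\<O> R U" N' by (rule N')
  let ?K = "cl U N' (\<phi> ` tilde_sub R M L U)"
  have K: "submodule ?K (\<O> R U) N'"
    by (rule pre_submodule[OF U N' semilinear_iso_submodule_image[OF iso T.module_axioms N' L_submodule[OF Uo]]])
  have add: "\<phi> (x \<oplus>\<^bsub>T U\<^esub> y) = \<phi> x \<oplus>\<^bsub>N'\<^esub> \<phi> y" if "x \<in> carrier (T U)" "y \<in> carrier (T U)" for x y
    using that iso by (simp add: semilinear_iso_def)
  have sm: "\<phi> (a \<odot>\<^bsub>T U\<^esub> x) = a \<odot>\<^bsub>N'\<^esub> \<phi> x" if "a \<in> carrier (\<O> R U)" "x \<in> carrier (T U)" for a x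
    using that iso by (simp add: semilinear_iso_def)
  have cl: "\<phi> x \<in> carrier N'" if "x \<in> carrier (T U)" for x
    using that iso by (auto simp: semilinear_iso_def bij_betw_def)
  note w = CL_witness[OF U N' iso]
  have smc: "a \<odot>\<^bsub>T U\<^esub> x \<in> CL U" if "a \<in> carrier (\<O> R U)" "x \<in> CL U" for a x
  proof -
    have x: "x \<in> carrier (T U)" using that CL_subset by auto
    have "\<phi> x \<in> ?K" using w[OF x] that(2) by simp
    then have "\<phi> (a \<odot>\<^bsub>T U\<^esub> x) \<in> ?K" using sm[OF that(1) x] N'.submoduleE(4)[OF K that(1)] by simp
    then show ?thesis using w[OF T.smult_closed[OF that(1) x]] by simp
  qed
  show ?thesis
  proof (rule T.submoduleI[OF CL_subset])
    have "\<phi> \<zero>\<^bsub>T U\<^esub> = \<zero>\<^bsub>N'\<^esub>"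
      using sm[of "\<zero>\<^bsub>\<O> R U\<^esub>" "\<zero>\<^bsub>T U\<^esub>"] cl[of "\<zero>\<^bsub>T U\<^esub>"] by simp
    then show "\<zero>\<^bsub>T U\<^esub> \<in> CL U"
      using w[of "\<zero>\<^bsub>T U\<^esub>"] subgroup.one_closed[OF submodule.axioms(1)[OF K]] by simp
    show "\<ominus>\<^bsub>T U\<^esub> x \<in> CL U" if "x \<in> CL U" for x
      using smc[of "\<ominus>\<^bsub>\<O> R U\<^esub> \<one>\<^bsub>\<O> R U\<^esub>" x] that subsetD[OF CL_subset that] by (simp add: T.smult_l_minus)
    show "x \<oplus>\<^bsub>T U\<^esub> y \<in> CL U" if xy: "x \<in> CL U" "y \<in> CL U" for x y
    proof -
      have c: "x \<in> carrier (T U)" "y \<in> carrier (T U)" using xy CL_subset by auto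
      have "\<phi> x \<in> ?K" "\<phi> y \<in> ?K" using w[OF c(1)] w[OF c(2)] xy by auto
      then have "\<phi> (x \<oplus>\<^bsub>T U\<^esub> y) \<in> ?K" using add[OF c] N'.submoduleE(5)[OF K] by simp
      then show ?thesis using w[OF T.M.a_closed[OF c]] by simp
    qed
  qed (rule smc)
qed

text \<open>Sections over D(f) are m/f^n, so there are at most as many of them as pairs of an
  element of \<open>'u\<close> and a natural number, and such pairs embed into the infinite type
  \<open>'u\<close>.\<close>

lemma witness_basic:
  assumes f: "f \<in> carrier R"
  obtains N' :: "(('r, 'r) sections, 'u) module" and \<phi>
  where "module (\<O> R (D f)) N'" "semilinear_iso (\<O> R (D f)) id (T (D f)) N' \<phi>"
proof -
  let ?g = "\<lambda>(m, n::nat). fraction_section R M (D f) m (f [^] n)"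
  have "carrier (T (D f)) \<subseteq> ?g ` (UNIV \<times> UNIV)"
  proof
    fix s assume "s \<in> carrier (T (D f))"
    then obtain m and n :: nat where "s = fraction_section R M (D f) m (f [^] n)" using tilde_basic_openE[OF f] by metis
    then show "s \<in> ?g ` (UNIV \<times> UNIV)" by (intro image_eqI[of _ _ "(m, n)"]) auto
  qed
  then have "|carrier (T (D f))| \<le>o |?g ` ((UNIV :: 'u set) \<times> (UNIV :: nat set))|" by (rule card_of_mono1)
  also have "|?g ` ((UNIV :: 'u set) \<times> (UNIV :: nat set))| \<le>o |(UNIV :: 'u set) \<times> (UNIV :: nat set)|" by (rule card_of_image)
  also have "|(UNIV :: 'u set) \<times> (UNIV :: nat set)| \<le>o |UNIV :: 'u set|"
    using inf infinite_iff_card_of_nat[of "UNIV :: 'u set"] by (intro card_of_Times_ordLeq_infinite) auto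
  finally obtain j :: "_ \<Rightarrow> 'u" where j: "inj_on j (carrier (T (D f)))" unfolding card_of_ordLeq[symmetric] by blast
  show thesis
    by (rule module_transport[OF module_tilde[OF R.openin_basic_open[OF f]] j]) (rule that)
qed

lemma CL_submodule_basic: "f \<in> carrier R \<Longrightarrow> submodule (CL (D f)) (\<O> R (D f)) (T (D f))"
  using CL_submodule[OF R.affine_basic_open] witness_basic by metis

text \<open>Membership of \<open>s\<close> in \<open>CL V\<close> itself supplies the copy
  \<open>N'\<close> of M(V), so none has to be constructed for a general affine \<open>V\<close>.
  Open persistence for \<open>N'\<close> becomes the claim under \<open>bc_iso\<close>, which sends
  the tensor of \<open>\<phi> s\<close> and 1 to the restriction of \<open>s\<close>.\<close>

lemma CL_restrict:
  assumes V: "affine_open R V" and h: "h \<in> carrier R" "D h \<subseteq> V" and s: "s \<in> CL V"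
  shows "restrict s (D h) \<in> CL (D h)"
proof -
  note Vo = R.affine_open_open[OF V]
  have sT: "s \<in> carrier (T V)" using s CL_subset by auto
  obtain N' \<phi> where N': "module (\<O> R V) N'" "semilinear_iso (\<O> R V) id (T V) N' \<phi>"
    and sc: "\<phi> s \<in> cl V N' (\<phi> ` tilde_sub R M L V)"
    using s by (auto simp: CL_def closure_in_def)
  interpret bc: restriction_base_change R M V h N' \<phi>
    by (intro restriction_base_change.intro module_axioms restriction_base_change_axioms.intro V h N')
  have K: "submodule (\<phi> ` tilde_sub R M L V) (\<O> R V) N'"
    by (rule semilinear_iso_submodule_image[OF N'(2) module_tilde[OF Vo] N'(1) L_submodule[OF Vo]])
  have "openly_persistent R cl" using glue by (simp add: glueable_def)
  then have "bc.tc (frag_of (\<phi> s, \<one>\<^bsub>\<O> R (D h)\<^esub>)) \<in> closure_in R cl (D h) (\<O> R (D h)) id bc.BC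
      (extended_submodule (\<O> R V) (\<lambda>s. restrict s (D h)) (\<O> R (D h)) N' (\<phi> ` tilde_sub R M L V))"
    unfolding openly_persistent_def Let_def using V R.affine_basic_open[OF h(1)] h(2) N'(1) K sc by blast
  then have "bc.bc_iso (bc.tc (frag_of (\<phi> s, \<one>\<^bsub>\<O> R (D h)\<^esub>))) \<in> closure_in R cl (D h) (\<O> R (D h)) id (T (D h))
      (bc.bc_iso ` extended_submodule (\<O> R V) (\<lambda>s. restrict s (D h)) (\<O> R (D h)) N' (\<phi> ` tilde_sub R M L V))"
    by (subst (asm) closure_in_semilinear_iso[OF bc.semilinear_iso_bc _ bc.BC_add_closed bc.BC_smult_closed bc.extended_subset[OF L]]) simp_all
  then show ?thesis unfolding bc.bc_iso_extended[OF L] bc.bc_iso_pure(2)[OF sT] CL_def .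
qed

section \<open>The global ring and gluing\<close>

definition "\<kappa> = inv_into (carrier R) (to_sections R (spec R))"

text \<open>Glueability is a statement about modules over \<open>\<O> R (spec R)\<close>, hence \<open>M\<close> is regarded as such a module.\<close>

definition "M_global = \<lparr>carrier = carrier M, monoid.mult = (\<otimes>\<^bsub>M\<^esub>), one = \<one>\<^bsub>M\<^esub>, ring.zero = \<zero>\<^bsub>M\<^esub>,
  add = (\<oplus>\<^bsub>M\<^esub>), smult = (\<lambda>a m. \<kappa> a \<odot>\<^bsub>M\<^esub> m)\<rparr>"

lemma M_global_simps [simp]: "carrier M_global = carrier M" "add M_global = (\<oplus>\<^bsub>M\<^esub>)"
  "ring.zero M_global = \<zero>\<^bsub>M\<^esub>" "smult M_global = (\<lambda>a m. \<kappa> a \<odot>\<^bsub>M\<^esub> m)"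
  by (simp_all add: M_global_def)

lemma kappa: "a \<in> carrier (\<O> R (spec R)) \<Longrightarrow> \<kappa> a \<in> carrier R"
  "a \<in> carrier (\<O> R (spec R)) \<Longrightarrow> to_sections R (spec R) (\<kappa> a) = a"
  "r \<in> carrier R \<Longrightarrow> \<kappa> (to_sections R (spec R) r) = r"
  using R.to_sections_spec_bij by (auto simp: \<kappa>_def bij_betw_def inv_into_into f_inv_into_f)

lemma kappa_hom: "\<kappa> \<in> ring_hom (\<O> R (spec R)) R"
proof (rule ring_hom_memI)
  note h = R.to_sections_hom[OF R.openin_spec]
  interpret O: cring "\<O> R (spec R)" by (rule R.cring_structure_sheaf[OF R.openin_spec])
  show "\<kappa> (x \<otimes>\<^bsub>\<O> R (spec R)\<^esub> y) = \<kappa> x \<otimes> \<kappa> y" if xy: "x \<in> carrier (\<O> R (spec R))" "y \<in> carrier (\<O> R (spec R))" for x y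
    using kappa(3)[of "\<kappa> x \<otimes> \<kappa> y"] ring_hom_mult[OF h kappa(1)[OF xy(1)] kappa(1)[OF xy(2)]] kappa(1,2)[OF xy(1)] kappa(1,2)[OF xy(2)] by simp
  show "\<kappa> (x \<oplus>\<^bsub>\<O> R (spec R)\<^esub> y) = \<kappa> x \<oplus> \<kappa> y" if xy: "x \<in> carrier (\<O> R (spec R))" "y \<in> carrier (\<O> R (spec R))" for x y
    using kappa(3)[of "\<kappa> x \<oplus> \<kappa> y"] ring_hom_add[OF h kappa(1)[OF xy(1)] kappa(1)[OF xy(2)]] kappa(1,2)[OF xy(1)] kappa(1,2)[OF xy(2)] by simp
  show "\<kappa> \<one>\<^bsub>\<O> R (spec R)\<^esub> = \<one>" using kappa(3)[of \<one>] ring_hom_one[OF h] by simp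
qed (rule kappa(1))

lemma kappa_bij: "bij_betw \<kappa> (carrier (\<O> R (spec R))) (carrier R)"
  unfolding \<kappa>_def by (rule bij_betw_inv_into[OF R.to_sections_spec_bij])

lemma module_M_global: "module (\<O> R (spec R)) M_global"
proof (rule moduleI)
  show "cring (\<O> R (spec R))" by (rule R.cring_structure_sheaf[OF R.openin_spec])
  show "abelian_group M_global"
    by (rule abelian_groupI) (auto simp: M.a_ac intro: M.l_neg)
qed (use ring_hom_mult[OF kappa_hom] ring_hom_add[OF kappa_hom] ring_hom_one[OF kappa_hom] kappa(1)
    in \<open>auto simp: smult_l_distr smult_r_distr smult_assoc1\<close>)

lemma M_global_iso: "g \<in> carrier (\<O> R (spec R)) \<Longrightarrow> module_iso R M (\<O> R (spec R)) M_global \<kappa> id g"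
  by (intro module_iso.intro module_axioms module_M_global module_iso_axioms.intro kappa_hom kappa_bij
      R.cring_structure_sheaf[OF R.openin_spec]) (auto simp: semilinear_iso_def)

lemma L_global: "submodule L (\<O> R (spec R)) M_global"
proof -
  interpret G: module "\<O> R (spec R)" M_global by (rule module_M_global)
  have m: "\<ominus>\<^bsub>M_global\<^esub> a = \<ominus>\<^bsub>M\<^esub> a" if "a \<in> carrier M" for a
    using that by (intro G.M.minus_equality) (auto simp: M.l_neg)
  show ?thesis
    by (rule G.submoduleI)
      (use submoduleE[OF L] m kappa(1) subgroup.one_closed[OF submodule.axioms(1)[OF L]] in auto)
qed

text \<open>Multiplication by f^n and by its inverse passes between m/f^n and m/1; closures over
  basic open sets, being submodules, are stable under both.\<close>

lemma pow_fraction: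
  assumes f: "f \<in> carrier R" and U: "openin (zariski R) U" "U \<subseteq> D f" and m: "m \<in> carrier M"
  shows "to_sections R U (f [^] (n::nat)) \<odot>\<^bsub>T U\<^esub> fraction_section R M U m (f [^] n) = fraction_section R M U m \<one>"
    and "fraction_section R (regular_module R) U \<one> (f [^] n) \<odot>\<^bsub>T U\<^esub> fraction_section R M U m \<one> = fraction_section R M U m (f [^] n)"
proof -
  have p: "U \<subseteq> D (f [^] n)" using U(2) R.basic_open_pow_subset[OF f] by blast
  have o: "U \<subseteq> D \<one>" using R.openin_zariski_subset[OF U(1)] by (simp add: R.basic_open_one)
  have fn: "f [^] n \<in> carrier R" using f by simp
  show "fraction_section R (regular_module R) U \<one> (f [^] n) \<odot>\<^bsub>T U\<^esub> fraction_section R M U m \<one> = fraction_section R M U m (f [^] n)"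
    using fraction_section_smult[OF p o fn R.one_closed R.one_closed m] m fn by simp
  have "to_sections R U (f [^] n) \<odot>\<^bsub>T U\<^esub> fraction_section R M U m (f [^] n) = fraction_section R M U (f [^] n \<odot>\<^bsub>M\<^esub> m) (f [^] n)"
    unfolding to_sections_eq_fraction_section
    using fraction_section_smult[OF o p R.one_closed fn fn m] fn by simp
  also have "\<dots> = fraction_section R M U m \<one>"
    by (rule fraction_section_eqI[OF p o o]) (use fn m in auto)
  finally show "to_sections R U (f [^] n) \<odot>\<^bsub>T U\<^esub> fraction_section R M U m (f [^] n) = fraction_section R M U m \<one>" .
qed

text \<open>A section over a basic open subset is \<open>m/f\<^sup>n\<close>; since \<open>f\<close> is invertible there, it may be replaced
  by \<open>m/1\<close>, to which the gluing property applies.\<close>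

lemma CL_glue:
  assumes f: "f \<in> carrier R" and s: "s \<in> carrier (T (D f))"
    and loc: "\<And>p. p \<in> D f \<Longrightarrow> \<exists>h\<in>carrier R. p \<in> D h \<and> D h \<subseteq> D f \<and> restrict s (D h) \<in> CL (D h)"
  shows "s \<in> CL (D f)"
proof -
  let ?A = "\<O> R (spec R)" and ?t = "to_sections R (spec R)"
  interpret A: cring ?A by (rule R.cring_structure_sheaf[OF R.openin_spec])
  obtain m and n :: nat where m: "m \<in> carrier M" and sm: "s = fraction_section R M (D f) m (f [^] n)"
    using tilde_basic_openE[OF f s] by metis
  define H where "H = {h \<in> carrier R. D h \<subseteq> D f \<and> restrict s (D h) \<in> CL (D h)}"
  have HR: "H \<subseteq> carrier R" by (auto simp: H_def)
  have tA: "?t r \<in> carrier ?A" if "r \<in> carrier R" for r using that by (rule R.to_sections_closed[OF R.openin_spec])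
  have X: "invertibility_locus R (spec R) (?t r) = D r" if "r \<in> carrier R" for r
    by (rule R.invertibility_locus_to_sections[OF that])
  \<comment> \<open>This equivalence translates both the hypotheses of the glueing condition, for
    \<open>r\<close> in \<open>H\<close>, and its conclusion, for \<open>r = f\<close>.\<close>
  have iff: "frac ?A (powers ?A (?t r)) M_global m \<one>\<^bsub>?A\<^esub>
      \<in> localized_closure R cl (invertibility_locus R (spec R) (?t r)) ?A
          (\<lambda>s. restrict s (invertibility_locus R (spec R) (?t r))) (?t r) M_global L
    \<longleftrightarrow> fraction_section R M (D r) m \<one> \<in> CL (D r)" if r: "r \<in> carrier R" for r
  proof -
    interpret iso: module_iso R M ?A M_global \<kappa> id "?t r" by (rule M_global_iso[OF tA[OF r]])
    have k: "\<kappa> (?t r) = r" by (rule kappa(3)[OF r])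
    have rho: "restrict a (D r) = to_sections R (D r) (\<kappa> a)" if "a \<in> carrier ?A" for a
      using R.restrict_to_sections[OF R.basic_open_subset_spec[of r], of "\<kappa> a"] kappa(2)[OF that] by simp
    have one: "\<kappa> \<one>\<^bsub>?A\<^esub> = \<one>" by (rule ring_hom_one[OF kappa_hom])
    show ?thesis
      unfolding X[OF r]
      using iso.localized_closure_iff[of "\<lambda>s. restrict s (D r)" L "frac ?A (powers ?A (?t r)) M_global m \<one>\<^bsub>?A\<^esub>" cl]
        rho L_global L iso.to_section_frac[of m "\<one>\<^bsub>?A\<^esub>"] m one
      by (simp add: k CL_def iso.denom.frac_in_carrier)
  qed
  have "D f \<subseteq> (\<Union>h\<in>H. D h)" using loc unfolding H_def by blast
  then obtain k :: nat where k: "f [^] k \<in> Idl H" using R.mem_Idl_if_basic_open_subset[OF HR f] by blast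
  have "?t f [^]\<^bsub>?A\<^esub> k \<in> Idl\<^bsub>?A\<^esub> (?t ` H)"
  proof -
    have sub: "?t ` H \<subseteq> carrier ?A" using HR tA by auto
    interpret I: ideal "Idl\<^bsub>?A\<^esub> (?t ` H)" ?A by (rule A.genideal_ideal[OF sub])
    interpret th: ring_hom_ring R ?A ?t
      by (intro ring_hom_ringI2 R.ring_axioms A.ring_axioms R.to_sections_hom[OF R.openin_spec])
    \<comment> \<open>The preimage under \<open>?t\<close> of the ideal generated by the image of
      \<open>H\<close> is an ideal containing \<open>H\<close>, hence it contains f^k.\<close>
    let ?J = "{r \<in> carrier R. ?t r \<in> Idl\<^bsub>?A\<^esub> (?t ` H)}"
    have "ideal ?J R"
    proof (rule idealI[OF R.ring_axioms])
      show "subgroup ?J (add_monoid R)"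
        by (rule R.add.subgroupI) (auto simp: a_inv_def[symmetric] intro!: exI[of _ \<zero>])
    qed (auto simp: I.I_l_closed I.I_r_closed)
    moreover have "H \<subseteq> ?J" using HR A.genideal_self[OF sub] by auto
    ultimately have "Idl H \<subseteq> ?J" by (rule R.genideal_minimal)
    then show ?thesis using k f by (auto simp: th.hom_nat_pow)
  qed
  moreover have "?t ` H \<subseteq> carrier ?A" using HR tA by auto
  moreover have "\<forall>f'\<in>?t ` H. frac ?A (powers ?A f') M_global m \<one>\<^bsub>?A\<^esub>
      \<in> localized_closure R cl (invertibility_locus R (spec R) f') ?A
          (\<lambda>s. restrict s (invertibility_locus R (spec R) f')) f' M_global L"
  proof (intro ballI, elim imageE, hypsubst)
    fix h assume h: "h \<in> H"
    then have hR: "h \<in> carrier R" and hf: "D h \<subseteq> D f" and hC: "restrict s (D h) \<in> CL (D h)" by (auto simp: H_def)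
    interpret T: module "\<O> R (D h)" "T (D h)" by (rule module_tilde[OF R.openin_basic_open[OF hR]])
    have "to_sections R (D h) (f [^] n) \<odot>\<^bsub>T (D h)\<^esub> restrict s (D h) \<in> CL (D h)"
      using T.submoduleE(4)[OF CL_submodule_basic[OF hR] R.to_sections_closed[OF R.openin_basic_open[OF hR]] hC] f by simp
    then have "fraction_section R M (D h) m \<one> \<in> CL (D h)"
      unfolding sm restrict_fraction_section[OF hf] pow_fraction(1)[OF f R.openin_basic_open[OF hR] hf m] .
    then show "frac ?A (powers ?A (?t h)) M_global m \<one>\<^bsub>?A\<^esub>
      \<in> localized_closure R cl (invertibility_locus R (spec R) (?t h)) ?A
          (\<lambda>s. restrict s (invertibility_locus R (spec R) (?t h))) (?t h) M_global L"
      using iff[OF hR] by simp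
  qed
  ultimately have "frac ?A (powers ?A (?t f)) M_global m \<one>\<^bsub>?A\<^esub>
      \<in> localized_closure R cl (invertibility_locus R (spec R) (?t f)) ?A
          (\<lambda>s. restrict s (invertibility_locus R (spec R) (?t f))) (?t f) M_global L"
    using glue[unfolded glueable_def Let_def, THEN conjunct2, THEN spec, of "spec R", THEN spec, of "?t ` H", THEN spec, of "?t f",
        THEN spec, of M_global, THEN spec, of L, THEN spec, of m] R.affine_spec tA[OF f] module_M_global L_global m by auto
  then have c: "fraction_section R M (D f) m \<one> \<in> CL (D f)" using iff[OF f] by simp
  interpret T: module "\<O> R (D f)" "T (D f)" by (rule module_tilde[OF R.openin_basic_open[OF f]])
  have "fraction_section R (regular_module R) (D f) \<one> (f [^] n) \<in> carrier (\<O> R (D f))"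
    using R.structure_fraction_closed[OF R.openin_basic_open[OF f] R.basic_open_pow_subset[OF f]] f by simp
  from T.submoduleE(4)[OF CL_submodule_basic[OF f] this c]
  show ?thesis unfolding sm pow_fraction(2)[OF f R.openin_basic_open[OF f] order_refl m] .
qed

section \<open>The closure sheaf\<close>

definition "SC = sheaf_closure R cl (tilde R M) (tilde_sub R M L)"

lemma SC_eq: "SC U = (T U)\<lparr>carrier := carrier (SC U)\<rparr>"
  by (simp add: SC_def sheaf_closure_def)

lemma SC_ops: "add (SC U) = add (T U)" "smult (SC U) = smult (T U)" "ring.zero (SC U) = ring.zero (T U)"
  by (simp_all add: SC_def sheaf_closure_def)

lemma mem_SC: "s \<in> carrier (SC U) \<longleftrightarrow> s \<in> carrier (T U) \<and>
    (\<forall>x\<in>U. \<exists>V. affine_open R V \<and> x \<in> V \<and> V \<subseteq> U \<and> restrict s V \<in> CL V)"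
  by (simp add: SC_def sheaf_closure_def CL_def)

lemma SC_subset: "carrier (SC U) \<subseteq> carrier (T U)"
  by (auto simp: mem_SC)

lemma mem_SC_iff:
  assumes U: "openin (zariski R) U"
  shows "s \<in> carrier (SC U) \<longleftrightarrow> s \<in> carrier (T U) \<and>
    (\<forall>p\<in>U. \<exists>h\<in>carrier R. p \<in> D h \<and> D h \<subseteq> U \<and> restrict s (D h) \<in> CL (D h))"
proof (intro iffI conjI ballI)
  fix p assume s: "s \<in> carrier (SC U)" and p: "p \<in> U"
  then obtain V where V: "affine_open R V" "p \<in> V" "V \<subseteq> U" "restrict s V \<in> CL V" by (auto simp: mem_SC)
  obtain h where h: "h \<in> carrier R" "p \<in> D h" "D h \<subseteq> V"
    using R.basic_open_basis[OF R.affine_open_open[OF V(1)] V(2)] by blast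
  have "restrict (restrict s V) (D h) = restrict s (D h)" using h(3) by (simp add: Int_absorb1)
  then show "\<exists>h\<in>carrier R. p \<in> D h \<and> D h \<subseteq> U \<and> restrict s (D h) \<in> CL (D h)"
    using CL_restrict[OF V(1) h(1,3) V(4)] h V(3) by auto
next
  assume s: "s \<in> carrier (T U) \<and> (\<forall>p\<in>U. \<exists>h\<in>carrier R. p \<in> D h \<and> D h \<subseteq> U \<and> restrict s (D h) \<in> CL (D h))"
  then show "s \<in> carrier (SC U)" unfolding mem_SC using R.affine_basic_open by meson
qed (auto simp: mem_SC)

lemma SC_basic: "f \<in> carrier R \<Longrightarrow> carrier (SC (D f)) = CL (D f)"
proof (intro subset_antisym subsetI)
  fix s assume f: "f \<in> carrier R" and s: "s \<in> carrier (SC (D f))"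
  then show "s \<in> CL (D f)"
    using CL_glue[OF f] mem_SC_iff[OF R.openin_basic_open[OF f]] by blast
next
  fix s assume f: "f \<in> carrier R" and s: "s \<in> CL (D f)"
  have sT: "s \<in> carrier (T (D f))" using s CL_subset by auto
  then have "restrict s (D f) = s" using tilde_extensional by (auto intro: extensional_restrict)
  then show "s \<in> carrier (SC (D f))"
    unfolding mem_SC using s sT R.affine_basic_open[OF f] by auto
qed

text \<open>A neighbourhood D(h) inside \<open>U\<close> need not lie in \<open>V\<close>; it is
  shrunk to D(h k) with D(k) inside \<open>V\<close>.\<close>

lemma restrict_SC:
  assumes U: "openin (zariski R) U" "openin (zariski R) V" "V \<subseteq> U" and s: "s \<in> carrier (SC U)"
  shows "restrict s V \<in> carrier (SC V)"
  unfolding mem_SC_iff[OF U(2)]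
proof (intro conjI ballI)
  show "restrict s V \<in> carrier (T V)" using restrict_in_tilde[OF U] s SC_subset by blast
  fix p assume p: "p \<in> V"
  obtain h where h: "h \<in> carrier R" "p \<in> D h" "D h \<subseteq> U" "restrict s (D h) \<in> CL (D h)"
    using s p U(3) unfolding mem_SC_iff[OF U(1)] by blast
  obtain k where k: "k \<in> carrier R" "p \<in> D k" "D k \<subseteq> V" using R.basic_open_basis[OF U(2) p] by blast
  have D: "D (h \<otimes> k) = D h \<inter> D k" using h k by (simp add: R.basic_open_mult)
  have "restrict (restrict s (D h)) (D (h \<otimes> k)) \<in> CL (D (h \<otimes> k))"
    using CL_restrict[OF R.affine_basic_open[OF h(1)] _ _ h(4), of "h \<otimes> k"] h(1) k(1) D by simp
  moreover have "restrict (restrict s (D h)) (D (h \<otimes> k)) = restrict (restrict s V) (D (h \<otimes> k))"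
    using D k(3) by (intro ext) auto
  ultimately show "\<exists>h\<in>carrier R. p \<in> D h \<and> D h \<subseteq> V \<and> restrict (restrict s V) (D h) \<in> CL (D h)"
    using D h k by (intro bexI[of _ "h \<otimes> k"]) auto
qed

text \<open>For a sum both sections need the same neighbourhood, and a basic one, where
  \<open>CL_submodule_basic\<close> is available. By \<open>SC_basic\<close> every basic open set
  inside \<open>U\<close> is suitable.\<close>

lemma SC_local2:
  assumes U: "openin (zariski R) U" and s: "s \<in> carrier (SC U)" "t \<in> carrier (SC U)" and p: "p \<in> U"
  obtains h where "h \<in> carrier R" "p \<in> D h" "D h \<subseteq> U" "restrict s (D h) \<in> CL (D h)" "restrict t (D h) \<in> CL (D h)"
proof -
  obtain h where h: "h \<in> carrier R" "p \<in> D h" "D h \<subseteq> U" using R.basic_open_basis[OF U p] by blast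
  note r = restrict_SC[OF U R.openin_basic_open[OF h(1)] h(3)]
  show thesis using that[OF h] r[OF s(1)] r[OF s(2)] SC_basic[OF h(1)] by simp
qed

lemma SC_submodule:
  assumes U: "openin (zariski R) U"
  shows "submodule (carrier (SC U)) (\<O> R U) (T U)"
proof -
  interpret T: module "\<O> R U" "T U" by (rule module_tilde[OF U])
  interpret reg: module R "regular_module R" by (rule R.module_regular_module)
  have sm: "a \<odot>\<^bsub>T U\<^esub> s \<in> carrier (SC U)" if a: "a \<in> carrier (\<O> R U)" and s: "s \<in> carrier (SC U)" for a s
    unfolding mem_SC_iff[OF U]
  proof (intro conjI ballI)
    show "a \<odot>\<^bsub>T U\<^esub> s \<in> carrier (T U)" using a s SC_subset by auto
    fix p assume p: "p \<in> U"
    obtain h where h: "h \<in> carrier R" "p \<in> D h" "D h \<subseteq> U" "restrict s (D h) \<in> CL (D h)"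
      using SC_local2[OF U s s p] by metis
    interpret Th: module "\<O> R (D h)" "T (D h)" by (rule module_tilde[OF R.openin_basic_open[OF h(1)]])
    have "restrict a (D h) \<in> carrier (\<O> R (D h))"
      using reg.restrict_in_tilde[OF U R.openin_basic_open[OF h(1)] h(3)] a by (simp add: structure_sheaf_def)
    then have "restrict (a \<odot>\<^bsub>T U\<^esub> s) (D h) \<in> CL (D h)"
      unfolding restrict_tilde_smult[OF h(3)] by (rule Th.submoduleE(4)[OF CL_submodule_basic[OF h(1)] _ h(4)])
    then show "\<exists>h\<in>carrier R. p \<in> D h \<and> D h \<subseteq> U \<and> restrict (a \<odot>\<^bsub>T U\<^esub> s) (D h) \<in> CL (D h)" using h by blast
  qed
  show ?thesis
  proof (rule T.submoduleI[OF SC_subset])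
    show "\<zero>\<^bsub>T U\<^esub> \<in> carrier (SC U)"
      unfolding mem_SC_iff[OF U]
    proof (intro conjI ballI)
      fix p assume p: "p \<in> U"
      obtain h where h: "h \<in> carrier R" "p \<in> D h" "D h \<subseteq> U" using R.basic_open_basis[OF U p] by blast
      have "\<zero>\<^bsub>T (D h)\<^esub> \<in> CL (D h)"
        using subgroup.one_closed[OF submodule.axioms(1)[OF CL_submodule_basic[OF h(1)]]] by simp
      moreover have "restrict \<zero>\<^bsub>T U\<^esub> (D h) = \<zero>\<^bsub>T (D h)\<^esub>" using h(3) by (intro ext) (auto simp: tilde_zero)
      ultimately show "\<exists>h\<in>carrier R. p \<in> D h \<and> D h \<subseteq> U \<and> restrict \<zero>\<^bsub>T U\<^esub> (D h) \<in> CL (D h)" using h by auto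
    qed simp
    show "\<ominus>\<^bsub>T U\<^esub> s \<in> carrier (SC U)" if "s \<in> carrier (SC U)" for s
      using sm[of "\<ominus>\<^bsub>\<O> R U\<^esub> \<one>\<^bsub>\<O> R U\<^esub>" s] that subsetD[OF SC_subset that] by (simp add: T.smult_l_minus)
    show "s \<oplus>\<^bsub>T U\<^esub> t \<in> carrier (SC U)" if st: "s \<in> carrier (SC U)" "t \<in> carrier (SC U)" for s t
      unfolding mem_SC_iff[OF U]
    proof (intro conjI ballI)
      show "s \<oplus>\<^bsub>T U\<^esub> t \<in> carrier (T U)" using st SC_subset by auto
      fix p assume p: "p \<in> U"
      obtain h where h: "h \<in> carrier R" "p \<in> D h" "D h \<subseteq> U" "restrict s (D h) \<in> CL (D h)" "restrict t (D h) \<in> CL (D h)"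
        using SC_local2[OF U st p] by metis
      interpret Th: module "\<O> R (D h)" "T (D h)" by (rule module_tilde[OF R.openin_basic_open[OF h(1)]])
      have "restrict (s \<oplus>\<^bsub>T U\<^esub> t) (D h) \<in> CL (D h)"
        unfolding restrict_tilde_add[OF h(3)] by (rule Th.submoduleE(5)[OF CL_submodule_basic[OF h(1)] h(4,5)])
      then show "\<exists>h\<in>carrier R. p \<in> D h \<and> D h \<subseteq> U \<and> restrict (s \<oplus>\<^bsub>T U\<^esub> t) (D h) \<in> CL (D h)" using h by blast
    qed
  qed (rule sm)
qed

lemma SC_module: "openin (zariski R) U \<Longrightarrow> module (\<O> R U) (SC U)"
  using submodule.submodule_is_module[OF SC_submodule module_tilde] by (simp add: SC_eq[symmetric])

lemma SC_glue:
  assumes U: "\<And>U. U \<in> \<U> \<Longrightarrow> openin (zariski R) U" and s: "s \<in> extensional (\<Union>\<U>)"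
    and r: "\<And>U. U \<in> \<U> \<Longrightarrow> restrict s U \<in> carrier (SC U)"
  shows "s \<in> carrier (SC (\<Union>\<U>))"
proof -
  have o: "openin (zariski R) (\<Union>\<U>)" using U by blast
  show ?thesis
    unfolding mem_SC_iff[OF o]
  proof (intro conjI ballI)
    show "s \<in> carrier (T (\<Union>\<U>))" by (rule tilde_glue[OF U s]) (use r SC_subset in auto)
    fix p assume "p \<in> \<Union>\<U>"
    then obtain W where W: "W \<in> \<U>" "p \<in> W" by blast
    obtain h where h: "h \<in> carrier R" "p \<in> D h" "D h \<subseteq> W" "restrict (restrict s W) (D h) \<in> CL (D h)"
      using r[OF W(1)] W(2) unfolding mem_SC_iff[OF U[OF W(1)]] by blast
    then have "restrict s (D h) \<in> CL (D h)" by (simp add: Int_absorb1)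
    then show "\<exists>h\<in>carrier R. p \<in> D h \<and> D h \<subseteq> \<Union>\<U> \<and> restrict s (D h) \<in> CL (D h)" using h W by blast
  qed
qed

lemma SC_sheaf: "sheaf_of_modules R SC"
  unfolding sheaf_of_modules_def
proof (intro conjI allI impI ballI)
  show "module (\<O> R U) (SC U)" if "openin (zariski R) U" for U using that by (rule SC_module)
  show "carrier (SC U) \<subseteq> extensional U" for U using SC_subset tilde_extensional by blast
  show "restrict s V \<in> carrier (SC V)" if "openin (zariski R) U" "openin (zariski R) V" "V \<subseteq> U" "s \<in> carrier (SC U)" for U V s
    using that by (rule restrict_SC)
  show "restrict (s \<oplus>\<^bsub>SC U\<^esub> t) V = restrict s V \<oplus>\<^bsub>SC V\<^esub> restrict t V" if "V \<subseteq> U" for U V s t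
    unfolding SC_ops by (rule restrict_tilde_add[OF that])
  show "restrict (a \<odot>\<^bsub>SC U\<^esub> s) V = restrict a V \<odot>\<^bsub>SC V\<^esub> restrict s V" if "V \<subseteq> U" for U V a s
    unfolding SC_ops by (rule restrict_tilde_smult[OF that])
  show "s \<in> carrier (SC (\<Union>\<U>))" if "\<forall>U\<in>\<U>. openin (zariski R) U" "s \<in> extensional (\<Union>\<U>)" "\<forall>U\<in>\<U>. restrict s U \<in> carrier (SC U)" for \<U> s
    using that by (intro SC_glue) auto
qed

section \<open>Global sections and the closure of \<open>L\<close> in \<open>M\<close>\<close>

abbreviation "global_section m \<equiv> fraction_section R M (spec R) m \<one>"
definition "C = closure_in R cl (spec R) R (to_sections R (spec R)) M L"

lemma spec_one: "D \<one> = spec R"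
  by (rule R.basic_open_one)

lemma global_section_onto:
  assumes "s \<in> carrier (T (spec R))"
  obtains m where "m \<in> carrier M" "s = global_section m"
  using tilde_basic_openE[OF R.one_closed, of s] assms by (auto simp: spec_one)

lemma global_section_inj:
  assumes "m \<in> carrier M" "n \<in> carrier M" "global_section m = global_section n"
  shows "m = n"
proof -
  obtain k :: nat where "\<one> [^] k \<odot>\<^bsub>M\<^esub> (\<one> \<odot>\<^bsub>M\<^esub> m) = \<one> [^] k \<odot>\<^bsub>M\<^esub> (\<one> \<odot>\<^bsub>M\<^esub> n)"
    using fraction_section_eqD[of \<one> m \<one> n \<one>] assms by (auto simp: spec_one)
  then show ?thesis using assms by simp
qed

lemma global_section_iso: "semilinear_iso R (to_sections R (spec R)) M (T (spec R)) global_section"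
proof -
  have one: "spec R \<subseteq> D \<one>" by (simp add: spec_one)
  have "bij_betw global_section (carrier M) (carrier (T (spec R)))"
    unfolding bij_betw_def
  proof (intro conjI inj_onI subset_antisym subsetI)
    show "s \<in> global_section ` carrier M" if "s \<in> carrier (T (spec R))" for s
      using global_section_onto[OF that] by blast
  qed (auto intro: global_section_inj fraction_section_in_tilde_one[OF R.openin_spec])
  moreover have "global_section (a \<odot>\<^bsub>M\<^esub> m) = to_sections R (spec R) a \<odot>\<^bsub>T (spec R)\<^esub> global_section m"
    if "a \<in> carrier R" "m \<in> carrier M" for a m
    unfolding to_sections_eq_fraction_section using fraction_section_smult[OF one one _ _ that] by simp
  ultimately show ?thesis
    unfolding semilinear_iso_def using fraction_section_add[OF R.openin_spec one R.one_closed] by simp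
qed

text \<open>The closure is transferred along the isomorphism of \<open>M\<close> with its global
  sections, which takes \<open>L\<close> onto the global sections of its own sheaf.\<close>

lemma C_iff: "c \<in> C \<longleftrightarrow> c \<in> carrier M \<and> global_section c \<in> CL (spec R)"
proof -
  have "global_section ` L = tilde_sub R M L (spec R)"
  proof (intro subset_antisym subsetI)
    show "s \<in> tilde_sub R M L (spec R)" if "s \<in> global_section ` L" for s
      using that fraction_section_in_sub[OF L R.openin_spec] tilde_sub_eq[OF L R.openin_spec] by auto
    show "s \<in> global_section ` L" if "s \<in> tilde_sub R M L (spec R)" for s
      using tilde_sub_basic_openE[OF L R.one_closed, of s] that by (auto simp: spec_one)
  qed
  moreover have onto: "to_sections R (spec R) ` carrier R = carrier (\<O> R (spec R))"
    using R.to_sections_spec_bij by (simp add: bij_betw_def)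
  ultimately show ?thesis
    unfolding C_def CL_def
    using closure_in_semilinear_iso[OF global_section_iso onto M.a_closed smult_closed submodule_subset[OF L]] by simp
qed

lemma C_submodule: "submodule C R M"
proof -
  interpret S: module "\<O> R (spec R)" "T (spec R)" by (rule module_tilde[OF R.openin_spec])
  have CLs: "submodule (CL (spec R)) (\<O> R (spec R)) (T (spec R))"
    using CL_submodule_basic[OF R.one_closed] by (simp add: spec_one)
  have add: "global_section (m \<oplus>\<^bsub>M\<^esub> n) = global_section m \<oplus>\<^bsub>T (spec R)\<^esub> global_section n"
    if "m \<in> carrier M" "n \<in> carrier M" for m n using that global_section_iso by (simp add: semilinear_iso_def)
  have sm: "global_section (a \<odot>\<^bsub>M\<^esub> m) = to_sections R (spec R) a \<odot>\<^bsub>T (spec R)\<^esub> global_section m"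
    if "a \<in> carrier R" "m \<in> carrier M" for a m using that global_section_iso by (simp add: semilinear_iso_def)
  have smc: "a \<odot>\<^bsub>M\<^esub> c \<in> C" if "a \<in> carrier R" "c \<in> C" for a c
    using that sm[of a c] S.submoduleE(4)[OF CLs R.to_sections_closed[OF R.openin_spec]] by (auto simp: C_iff)
  show ?thesis
  proof (rule submoduleI)
    show "C \<subseteq> carrier M" by (auto simp: C_iff)
    show "\<zero>\<^bsub>M\<^esub> \<in> C"
      using subgroup.one_closed[OF submodule.axioms(1)[OF CLs]] tilde_zero_eq[OF R.openin_spec] by (simp add: C_iff)
    show "\<ominus>\<^bsub>M\<^esub> c \<in> C" if "c \<in> C" for c
      using smc[of "\<ominus> \<one>" c] that by (simp add: C_iff smult_l_minus)
    show "c \<oplus>\<^bsub>M\<^esub> d \<in> C" if "c \<in> C" "d \<in> C" for c d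
      using that S.submoduleE(5)[OF CLs] by (simp add: C_iff add)
  qed (rule smc)
qed

text \<open>Both sides of the first equation lie in \<open>M_f\<close>, where
  \<open>to_section\<close> is injective; their images are \<open>CL (D f)\<close> and the sections
  of the sheaf of \<open>C\<close>.\<close>

lemma localized_closure_eq_iff:
  assumes f: "f \<in> carrier R"
  shows "localized_closure R cl (D f) R (to_sections R (D f)) f M L = localized_submodule R (powers R f) M C
    \<longleftrightarrow> CL (D f) = tilde_sub R M C (D f)"
proof -
  interpret iso: module_iso R M R M id id f
    by (intro module_iso.intro module_axioms R.is_cring module_iso_axioms.intro f)
      (auto simp: ring_hom_def semilinear_iso_def)
  let ?N = "localization R (powers R f) M" and ?LC = "localized_closure R cl (D f) R (to_sections R (D f)) f M L"
  have LC: "x \<in> ?LC \<longleftrightarrow> x \<in> carrier ?N \<and> iso.to_section x \<in> CL (D f)" for x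
    using iso.localized_closure_iff[of "to_sections R (D f)" L x cl] L by (simp add: CL_def)
  have bij: "bij_betw iso.to_section (carrier ?N) (carrier (T (D f)))" using iso.to_section_bij by simp
  have "iso.to_section ` ?LC = CL (D f)"
  proof (intro subset_antisym subsetI)
    show "s \<in> CL (D f)" if "s \<in> iso.to_section ` ?LC" for s using that LC by auto
    fix s assume s: "s \<in> CL (D f)"
    then have "s \<in> iso.to_section ` carrier ?N" using CL_subset bij by (auto simp: bij_betw_def)
    then obtain x where "x \<in> carrier ?N" "s = iso.to_section x" by blast
    then show "s \<in> iso.to_section ` ?LC" using s LC by auto
  qed
  moreover have "iso.to_section ` localized_submodule R (powers R f) M C = tilde_sub R M C (D f)"
    using iso.to_section_image_submodule[OF C_submodule] C_submodule by simp
  moreover have "inj_on iso.to_section (carrier ?N)" using bij by (simp add: bij_betw_def)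
  moreover have "?LC \<subseteq> carrier ?N" using LC by auto
  moreover have "localized_submodule R (powers R f) M C \<subseteq> carrier ?N"
    using C_iff by (auto simp: localized_submodule_def)
  ultimately show ?thesis using inj_on_image_eq_iff by metis
qed

text \<open>One inclusion of (a) holds in any case: elements of \<open>C\<close> restrict into the
  closure over D(f) by \<open>CL_restrict\<close>, and division by f^n does not leave this
  submodule.\<close>

lemma tilde_C_subset_CL:
  assumes f: "f \<in> carrier R"
  shows "tilde_sub R M C (D f) \<subseteq> CL (D f)"
proof
  fix s assume "s \<in> tilde_sub R M C (D f)"
  then obtain c and n :: nat where c: "c \<in> C" and s: "s = fraction_section R M (D f) c (f [^] n)"
    using tilde_sub_basic_openE[OF C_submodule f] by metis
  note fo = R.openin_basic_open[OF f]
  interpret T: module "\<O> R (D f)" "T (D f)" by (rule module_tilde[OF fo])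
  have "restrict (global_section c) (D f) \<in> CL (D f)"
    using CL_restrict[OF R.affine_spec f R.basic_open_subset_spec] c C_iff by blast
  then have "fraction_section R M (D f) c \<one> \<in> CL (D f)"
    by (simp add: restrict_fraction_section[OF R.basic_open_subset_spec])
  moreover have "fraction_section R (regular_module R) (D f) \<one> (f [^] n) \<in> carrier (\<O> R (D f))"
    using R.structure_fraction_closed[OF fo R.basic_open_pow_subset[OF f]] f by simp
  ultimately have "fraction_section R (regular_module R) (D f) \<one> (f [^] n) \<odot>\<^bsub>T (D f)\<^esub> fraction_section R M (D f) c \<one> \<in> CL (D f)"
    using T.submoduleE(4)[OF CL_submodule_basic[OF f]] by blast
  then show "s \<in> CL (D f)" unfolding s using pow_fraction(2)[OF f fo order_refl] c C_iff by simp
qed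

text \<open>On a chart U = Spec A where the sheaf comes from \<open>P\<close>, let \<open>a\<close>
  and \<open>b\<close> in \<open>A\<close> correspond to \<open>h\<close> and \<open>f\<close>. A
  section over D(h f) is c/(a b)^n with \<open>c\<close> in \<open>P\<close>. Multiplied by f^n it
  becomes c/a^n, which is defined on all of D(h). The chart is given as an isomorphism of ringed
  spaces only, so that it matches D(a) with D(h) has to be derived.\<close>

lemma quasi_coherent_extend_local:
  assumes qc: "quasi_coherent R SC" and p: "p \<in> spec R"
  obtains h where "h \<in> carrier R" "p \<in> D h"
    "\<And>f s. f \<in> carrier R \<Longrightarrow> s \<in> carrier (SC (D (h \<otimes> f))) \<Longrightarrow>
      \<exists>n::nat. \<exists>t\<in>carrier (SC (D h)). restrict t (D (h \<otimes> f)) = to_sections R (D (h \<otimes> f)) (f [^] n) \<odot>\<^bsub>T (D (h \<otimes> f))\<^esub> s"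
proof -
  obtain U and A :: "('r, 'r) sections ring" and \<psi> \<theta> and P :: "(('r, 'r) sections, 'r set \<Rightarrow> ('u \<times> 'r) set) module" and \<eta>
    where pU: "p \<in> U" and U: "openin (zariski R) U" and A: "cring A" and ri: "ringed_iso R U A \<psi> \<theta>" and P: "module A P"
      and e1: "\<forall>W. openin (zariski A) W \<longrightarrow>
          semilinear_iso (\<O> A W) (\<theta> W) (tilde A P W) (SC (U \<inter> \<psi> -` W)) (\<eta> W)"
      and e2: "\<forall>W W'. openin (zariski A) W \<longrightarrow> openin (zariski A) W' \<longrightarrow> W' \<subseteq> W \<longrightarrow>
          (\<forall>s\<in>carrier (tilde A P W). \<eta> W' (restrict s W') = restrict (\<eta> W s) (U \<inter> \<psi> -` W'))"
    using conjunct2[OF qc[unfolded quasi_coherent_def], THEN bspec, OF p]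
    by (elim exE conjE) (rule that; assumption)
  have eta: "\<And>W. openin (zariski A) W \<Longrightarrow> semilinear_iso (\<O> A W) (\<theta> W) (tilde A P W) (SC (U \<inter> \<psi> -` W)) (\<eta> W)"
    and eta_restrict: "\<And>W W' s. openin (zariski A) W \<Longrightarrow> openin (zariski A) W' \<Longrightarrow> W' \<subseteq> W \<Longrightarrow> s \<in> carrier (tilde A P W) \<Longrightarrow>
          \<eta> W' (restrict s W') = restrict (\<eta> W s) (U \<inter> \<psi> -` W')"
    using e1 e2 by blast+
  interpret P: module A P by (rule P)
  have homeo: "homeomorphic_map (subtopology (zariski R) U) (zariski A) \<psi>"
    and theta: "\<And>W. openin (zariski A) W \<Longrightarrow> \<theta> W \<in> ring_iso (\<O> A W) (\<O> R (U \<inter> \<psi> -` W))"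
    and theta_restrict: "\<And>W W' s. openin (zariski A) W \<Longrightarrow> openin (zariski A) W' \<Longrightarrow> W' \<subseteq> W \<Longrightarrow> s \<in> carrier (\<O> A W) \<Longrightarrow>
       \<theta> W' (restrict s W') = restrict (\<theta> W s) (U \<inter> \<psi> -` W')"
    using ri by (auto simp: ringed_iso_def)
  have topU: "topspace (subtopology (zariski R) U) = U"
    using openin_subset[OF U] by auto
  have psi_img: "\<psi> ` U = spec A" and psi_inj: "inj_on \<psi> U"
    using homeomorphic_imp_surjective_map[OF homeo] homeomorphic_imp_injective_map[OF homeo]
    unfolding topU P.R.topspace_zariski by simp_all
  have psi_open: "openin (zariski A) (\<psi> ` V)" if "openin (zariski R) V" "V \<subseteq> U" for V
    using homeomorphic_imp_open_map[OF homeo] that U by (auto simp: open_map_def openin_open_subtopology)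
  have psi_cont: "openin (zariski R) (U \<inter> \<psi> -` W)" if "openin (zariski A) W" for W
  proof -
    have "openin (subtopology (zariski R) U) {x \<in> U. \<psi> x \<in> W}"
      using homeomorphic_imp_continuous_map[OF homeo] that unfolding continuous_map topU by blast
    moreover have "{x \<in> U. \<psi> x \<in> W} = U \<inter> \<psi> -` W" by auto
    ultimately show ?thesis using openin_open_subtopology[OF U] by auto
  qed
  have spec_pre: "U \<inter> \<psi> -` spec A = U" using psi_img by auto
  have spec_o: "openin (zariski A) (spec A)" by (rule P.R.openin_spec)
  \<comment> \<open>The function \<open>r\<close> on \<open>U\<close> is a global section of the
    chart, and over Spec A these are the elements of \<open>A\<close>.\<close>
  have coord: "\<exists>a\<in>carrier A. \<theta> (spec A) (to_sections A (spec A) a) = to_sections R U r" if r: "r \<in> carrier R" for r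
  proof -
    have "to_sections R U r \<in> carrier (\<O> R U)" by (rule R.to_sections_closed[OF U r])
    then have "to_sections R U r \<in> \<theta> (spec A) ` carrier (\<O> A (spec A))"
      using theta[OF spec_o] unfolding spec_pre ring_iso_def bij_betw_def by simp
    then obtain x where x: "x \<in> carrier (\<O> A (spec A))" "\<theta> (spec A) x = to_sections R U r" by auto
    have "x \<in> to_sections A (spec A) ` carrier A" using x(1) P.R.to_sections_spec_bij by (simp add: bij_betw_def)
    then obtain a where "a \<in> carrier A" "x = to_sections A (spec A) a" by blast
    then show ?thesis using x(2) by blast
  qed
  have theta_sec: "\<theta> W (to_sections A W a) = to_sections R (U \<inter> \<psi> -` W) r"
    if W: "openin (zariski A) W" and a: "a \<in> carrier A" and eq: "\<theta> (spec A) (to_sections A (spec A) a) = to_sections R U r" for W a r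
  proof -
    have sub: "W \<subseteq> spec A" by (rule P.R.openin_zariski_subset[OF W])
    have "\<theta> W (restrict (to_sections A (spec A) a) W) = restrict (to_sections R U r) (U \<inter> \<psi> -` W)"
      using theta_restrict[OF spec_o W sub P.R.to_sections_closed[OF spec_o a]] eq by simp
    then show ?thesis by (simp add: P.R.restrict_to_sections[OF sub] R.restrict_to_sections)
  qed
  \<comment> \<open>On either side, the locus is the largest open subset on which the function is invertible.\<close>
  have locus: "U \<inter> \<psi> -` basic_open A a = U \<inter> D r"
    if r: "r \<in> carrier R" and a: "a \<in> carrier A" and eq: "\<theta> (spec A) (to_sections A (spec A) a) = to_sections R U r" for a r
  proof (intro subset_antisym subsetI)
    let ?W = "basic_open A a"
    have W: "openin (zariski A) ?W" by (rule P.R.openin_basic_open[OF a])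
    note V = psi_cont[OF W]
    have "to_sections A ?W a \<in> Units (\<O> A ?W)" by (rule P.R.structure_unit[OF W order_refl a])
    then obtain y where y: "y \<in> carrier (\<O> A ?W)" "y \<otimes>\<^bsub>\<O> A ?W\<^esub> to_sections A ?W a = \<one>\<^bsub>\<O> A ?W\<^esub>"
      "to_sections A ?W a \<otimes>\<^bsub>\<O> A ?W\<^esub> y = \<one>\<^bsub>\<O> A ?W\<^esub>" by (auto simp: Units_def)
    have h: "\<theta> ?W \<in> ring_hom (\<O> A ?W) (\<O> R (U \<inter> \<psi> -` ?W))" using theta[OF W] by (simp add: ring_iso_def)
    note ta = P.R.to_sections_closed[OF W a]
    have "\<theta> ?W y \<otimes>\<^bsub>\<O> R (U \<inter> \<psi> -` ?W)\<^esub> to_sections R (U \<inter> \<psi> -` ?W) r = \<one>\<^bsub>\<O> R (U \<inter> \<psi> -` ?W)\<^esub>"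
      "to_sections R (U \<inter> \<psi> -` ?W) r \<otimes>\<^bsub>\<O> R (U \<inter> \<psi> -` ?W)\<^esub> \<theta> ?W y = \<one>\<^bsub>\<O> R (U \<inter> \<psi> -` ?W)\<^esub>"
      using ring_hom_mult[OF h y(1) ta] ring_hom_mult[OF h ta y(1)] y ring_hom_one[OF h] theta_sec[OF W a eq] by simp_all
    then have "to_sections R (U \<inter> \<psi> -` ?W) r \<in> Units (\<O> R (U \<inter> \<psi> -` ?W))"
      using ring_hom_closed[OF h y(1)] R.to_sections_closed[OF V r] unfolding Units_def by blast
    then have "U \<inter> \<psi> -` ?W \<subseteq> D r" by (rule R.unit_imp_subset_basic_open[OF V r])
    then show "q \<in> U \<inter> D r" if "q \<in> U \<inter> \<psi> -` ?W" for q using that by auto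
  next
    fix q assume q: "q \<in> U \<inter> D r"
    let ?V = "U \<inter> D r"
    let ?W = "\<psi> ` ?V"
    have V: "openin (zariski R) ?V" using U R.openin_basic_open[OF r] by blast
    have W: "openin (zariski A) ?W" using psi_open[OF V] by blast
    have VW: "U \<inter> \<psi> -` ?W = ?V" using psi_inj by (auto simp: inj_on_def)
    have iso: "\<theta> ?W \<in> ring_iso (\<O> A ?W) (\<O> R ?V)" using theta[OF W] unfolding VW .
    have h: "\<theta> ?W \<in> ring_hom (\<O> A ?W) (\<O> R ?V)" and bij: "bij_betw (\<theta> ?W) (carrier (\<O> A ?W)) (carrier (\<O> R ?V))"
      using iso by (auto simp: ring_iso_def)
    interpret OA: cring "\<O> A ?W" by (rule P.R.cring_structure_sheaf[OF W])
    interpret OR: cring "\<O> R ?V" by (rule R.cring_structure_sheaf[OF V])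
    note ta = P.R.to_sections_closed[OF W a]
    have "to_sections R ?V r \<in> Units (\<O> R ?V)" by (rule R.structure_unit[OF V _ r]) auto
    then obtain z where z: "z \<in> carrier (\<O> R ?V)" "z \<otimes>\<^bsub>\<O> R ?V\<^esub> to_sections R ?V r = \<one>\<^bsub>\<O> R ?V\<^esub>" by (auto simp: Units_def)
    have "z \<in> \<theta> ?W ` carrier (\<O> A ?W)" using bij z(1) by (simp add: bij_betw_def)
    then obtain y where y: "y \<in> carrier (\<O> A ?W)" "\<theta> ?W y = z" by blast
    have "\<theta> ?W (y \<otimes>\<^bsub>\<O> A ?W\<^esub> to_sections A ?W a) = \<theta> ?W \<one>\<^bsub>\<O> A ?W\<^esub>"
      using ring_hom_mult[OF h y(1) ta] z(2) y(2) theta_sec[OF W a eq] ring_hom_one[OF h] unfolding VW by simp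
    then have yt: "y \<otimes>\<^bsub>\<O> A ?W\<^esub> to_sections A ?W a = \<one>\<^bsub>\<O> A ?W\<^esub>"
      using bij y(1) ta by (intro inj_onD[of "\<theta> ?W" "carrier (\<O> A ?W)"]) (auto simp: bij_betw_def)
    then have "to_sections A ?W a \<otimes>\<^bsub>\<O> A ?W\<^esub> y = \<one>\<^bsub>\<O> A ?W\<^esub>" using y(1) ta OA.m_comm by simp
    then have "to_sections A ?W a \<in> Units (\<O> A ?W)" using yt y(1) ta unfolding Units_def by blast
    then have "?W \<subseteq> basic_open A a" by (rule P.R.unit_imp_subset_basic_open[OF W a])
    then show "q \<in> U \<inter> \<psi> -` basic_open A a" using q by auto
  qed
  obtain h where h: "h \<in> carrier R" "p \<in> D h" "D h \<subseteq> U" using R.basic_open_basis[OF U pU] by blast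
  obtain a where a: "a \<in> carrier A" "\<theta> (spec A) (to_sections A (spec A) a) = to_sections R U h" using coord[OF h(1)] by blast
  have "\<exists>n::nat. \<exists>t\<in>carrier (SC (D h)). restrict t (D (h \<otimes> f)) = to_sections R (D (h \<otimes> f)) (f [^] n) \<odot>\<^bsub>T (D (h \<otimes> f))\<^esub> s"
    if f: "f \<in> carrier R" and s: "s \<in> carrier (SC (D (h \<otimes> f)))" for f s
  proof -
    obtain b where b: "b \<in> carrier A" "\<theta> (spec A) (to_sections A (spec A) b) = to_sections R U f" using coord[OF f] by blast
    let ?W = "basic_open A a" and ?W' = "basic_open A (a \<otimes>\<^bsub>A\<^esub> b)"
    have W: "openin (zariski A) ?W" "openin (zariski A) ?W'" using a b by (auto simp: P.R.openin_basic_open)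
    have sub: "?W' \<subseteq> ?W" using a b by (auto simp: P.R.basic_open_mult)
    have preW: "U \<inter> \<psi> -` ?W = D h" using locus[OF h(1) a] h(3) by auto
    have "U \<inter> \<psi> -` ?W' = (U \<inter> \<psi> -` ?W) \<inter> (U \<inter> \<psi> -` basic_open A b)" using a b by (auto simp: P.R.basic_open_mult)
    also have "\<dots> = D (h \<otimes> f)" unfolding preW locus[OF f b] using h f by (auto simp: R.basic_open_mult)
    finally have preW': "U \<inter> \<psi> -` ?W' = D (h \<otimes> f)" .
    have "s \<in> \<eta> ?W' ` carrier (tilde A P ?W')"
      using eta[OF W(2)] s unfolding preW' semilinear_iso_def bij_betw_def by simp
    then obtain s' where s': "s' \<in> carrier (tilde A P ?W')" "\<eta> ?W' s' = s" by blast
    obtain c and n :: nat where c: "c \<in> carrier P" "s' = fraction_section A P ?W' c ((a \<otimes>\<^bsub>A\<^esub> b) [^]\<^bsub>A\<^esub> n)"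
      using P.tilde_basic_openE[OF _ s'(1)] a b by auto
    define t' where "t' = fraction_section A P ?W c (a [^]\<^bsub>A\<^esub> n)"
    have t': "t' \<in> carrier (tilde A P ?W)"
      unfolding t'_def using P.fraction_section_in_tilde[OF W(1) P.R.basic_open_pow_subset[OF a(1)] c(1)] a by simp
    have one: "?W' \<subseteq> basic_open A \<one>\<^bsub>A\<^esub>" using P.R.openin_zariski_subset[OF W(2)] by (simp add: P.R.basic_open_one)
    have pow: "?W' \<subseteq> basic_open A ((a \<otimes>\<^bsub>A\<^esub> b) [^]\<^bsub>A\<^esub> n)" using P.R.basic_open_pow_subset[of "a \<otimes>\<^bsub>A\<^esub> b" n] a b by simp
    have apow: "?W' \<subseteq> basic_open A (a [^]\<^bsub>A\<^esub> n)" using sub P.R.basic_open_pow_subset[OF a(1), of n] by blast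
    \<comment> \<open>b^n cancels against the factor b^n of (a b)^n and leaves a^n, which is
      invertible on the larger set \<open>?W\<close>.\<close>
    have "to_sections A ?W' (b [^]\<^bsub>A\<^esub> n) \<odot>\<^bsub>tilde A P ?W'\<^esub> s' = fraction_section A P ?W' (b [^]\<^bsub>A\<^esub> n \<odot>\<^bsub>P\<^esub> c) ((a \<otimes>\<^bsub>A\<^esub> b) [^]\<^bsub>A\<^esub> n)"
      unfolding c(2) to_sections_eq_fraction_section
      using P.fraction_section_smult[OF one pow _ _ _ c(1), of "b [^]\<^bsub>A\<^esub> n"] a b by simp
    also have "\<dots> = fraction_section A P ?W' c (a [^]\<^bsub>A\<^esub> n)"
      by (rule P.fraction_section_eqI[OF pow apow one])
        (use a b c in \<open>auto simp: P.smult_assoc1[symmetric] P.R.nat_pow_distrib\<close>)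
    also have "\<dots> = restrict t' ?W'" unfolding t'_def by (rule restrict_fraction_section[OF sub, symmetric])
    finally have r: "restrict t' ?W' = to_sections A ?W' (b [^]\<^bsub>A\<^esub> n) \<odot>\<^bsub>tilde A P ?W'\<^esub> s'" by simp
    have hom: "\<theta> ?W' \<in> ring_hom (\<O> A ?W') (\<O> R (D (h \<otimes> f)))"
      using theta[OF W(2)] unfolding preW' by (simp add: ring_iso_def)
    have hfo: "openin (zariski R) (D (h \<otimes> f))" using h f by (simp add: R.openin_basic_open)
    interpret OA: cring "\<O> A ?W'" by (rule P.R.cring_structure_sheaf[OF W(2)])
    interpret OR: cring "\<O> R (D (h \<otimes> f))" by (rule R.cring_structure_sheaf[OF hfo])
    interpret th: ring_hom_ring "\<O> A ?W'" "\<O> R (D (h \<otimes> f))" "\<theta> ?W'"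
      by (intro ring_hom_ringI2 OA.ring_axioms OR.ring_axioms hom)
    have theta_pow: "\<theta> ?W' (to_sections A ?W' (b [^]\<^bsub>A\<^esub> n)) = to_sections R (D (h \<otimes> f)) (f [^] n)"
      unfolding P.R.to_sections_pow[OF W(2) b(1)] R.to_sections_pow[OF hfo f]
      using th.hom_nat_pow[OF P.R.to_sections_closed[OF W(2) b(1)]] theta_sec[OF W(2) b] unfolding preW' by simp
    have "restrict (\<eta> ?W t') (D (h \<otimes> f)) = \<eta> ?W' (restrict t' ?W')"
      using eta_restrict[OF W sub t'] unfolding preW' by simp
    also have "\<dots> = \<theta> ?W' (to_sections A ?W' (b [^]\<^bsub>A\<^esub> n)) \<odot>\<^bsub>SC (D (h \<otimes> f))\<^esub> \<eta> ?W' s'"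
      unfolding r using eta[OF W(2)] s'(1) P.R.to_sections_closed[OF W(2), of "b [^]\<^bsub>A\<^esub> n"] b(1)
      unfolding preW' semilinear_iso_def by simp
    also have "\<dots> = to_sections R (D (h \<otimes> f)) (f [^] n) \<odot>\<^bsub>T (D (h \<otimes> f))\<^esub> s"
      unfolding theta_pow s'(2) SC_ops ..
    finally have "restrict (\<eta> ?W t') (D (h \<otimes> f)) = to_sections R (D (h \<otimes> f)) (f [^] n) \<odot>\<^bsub>T (D (h \<otimes> f))\<^esub> s" .
    moreover have "\<eta> ?W t' \<in> carrier (SC (D h))"
      using eta[OF W(1)] t' unfolding preW semilinear_iso_def bij_betw_def by auto
    ultimately show ?thesis by blast
  qed
  then show thesis by (rule that[OF h(1,2)])
qed

lemma quasi_coherent_extend: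
  assumes qc: "quasi_coherent R SC" and f: "f \<in> carrier R" and s: "s \<in> carrier (SC (D f))"
  obtains n :: nat and t where "t \<in> carrier (SC (spec R))" "restrict t (D f) = to_sections R (D f) (f [^] n) \<odot>\<^bsub>T (D f)\<^esub> s"
proof -
  note fo = R.openin_basic_open[OF f]
  have sT: "s \<in> carrier (T (D f))" using s SC_subset by blast
  \<comment> \<open>The extension property is stated through values at points, so that sections over
    different open sets can be compared directly.\<close>
  define E where "E = (\<lambda>h (n::nat). \<exists>t\<in>carrier (SC (D h)). \<forall>p\<in>D h \<inter> D f. t p = (to_sections R (D f) (f [^] n) \<odot>\<^bsub>T (D f)\<^esub> s) p)"
  define H where "H = {h \<in> carrier R. \<exists>n. E h n}"
  have HR: "H \<subseteq> carrier R" by (auto simp: H_def)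
  have "\<exists>h\<in>H. p \<in> D h" if p: "p \<in> spec R" for p
  proof -
    obtain h where h: "h \<in> carrier R" "p \<in> D h"
      and ext: "\<And>f s. f \<in> carrier R \<Longrightarrow> s \<in> carrier (SC (D (h \<otimes> f))) \<Longrightarrow>
        \<exists>n::nat. \<exists>t\<in>carrier (SC (D h)). restrict t (D (h \<otimes> f)) = to_sections R (D (h \<otimes> f)) (f [^] n) \<odot>\<^bsub>T (D (h \<otimes> f))\<^esub> s"
      using quasi_coherent_extend_local[OF qc p] by blast
    have Dhf: "D (h \<otimes> f) = D h \<inter> D f" using h f by (simp add: R.basic_open_mult)
    have "openin (zariski R) (D (h \<otimes> f))" using h f by (simp add: R.openin_basic_open)
    then have "restrict s (D (h \<otimes> f)) \<in> carrier (SC (D (h \<otimes> f)))" using restrict_SC[OF fo _ _ s] Dhf by blast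
    from ext[OF f this] obtain n :: nat and t where t: "t \<in> carrier (SC (D h))"
      "restrict t (D (h \<otimes> f)) = to_sections R (D (h \<otimes> f)) (f [^] n) \<odot>\<^bsub>T (D (h \<otimes> f))\<^esub> restrict s (D (h \<otimes> f))"
      by blast
    have "t p = (to_sections R (D f) (f [^] n) \<odot>\<^bsub>T (D f)\<^esub> s) p" if "p \<in> D h \<inter> D f" for p
      using fun_cong[OF t(2), of p] that Dhf by (simp add: tilde_smult to_sections_def)
    then have "E h n" using t(1) unfolding E_def by blast
    then show ?thesis using h by (auto simp: H_def)
  qed
  then obtain F where F: "finite F" "F \<subseteq> H" "spec R \<subseteq> (\<Union>h\<in>F. D h)"
    using R.affine_open_compact[OF R.affine_spec, of H] HR by blast
  have FR: "h \<in> carrier R" if "h \<in> F" for h using that F(2) HR by auto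
  have shift: "a \<odot>\<^bsub>T U\<^esub> t \<in> carrier (SC U)" if "openin (zariski R) U" "a \<in> carrier (\<O> R U)" "t \<in> carrier (SC U)" for U a t
    using module.submoduleE(4)[OF module_tilde[OF that(1)] SC_submodule[OF that(1)] that(2,3)] .
  have pow_closed: "to_sections R U (f [^] (n::nat)) \<in> carrier (\<O> R U)" if "openin (zariski R) U" for U n
    using R.to_sections_closed[OF that] f by simp
  have pow_add: "to_sections R U (f [^] (k + n :: nat)) \<odot>\<^bsub>T U\<^esub> t = to_sections R U (f [^] k) \<odot>\<^bsub>T U\<^esub> (to_sections R U (f [^] n) \<odot>\<^bsub>T U\<^esub> t)"
    if U: "openin (zariski R) U" and t: "t \<in> carrier (T U)" for U k n t
  proof -
    have "to_sections R U (f [^] (k + n)) = to_sections R U (f [^] k) \<otimes>\<^bsub>\<O> R U\<^esub> to_sections R U (f [^] n)"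
      using ring_hom_mult[OF R.to_sections_hom[OF U], of "f [^] k" "f [^] n"] f by (simp add: R.nat_pow_mult)
    then show ?thesis using module.smult_assoc1[OF module_tilde[OF U] pow_closed[OF U] pow_closed[OF U] t] by simp
  qed
  \<comment> \<open>Multiplication by an element of \<open>R\<close> acts on each germ separately,
    whatever the open set.\<close>
  have pointwise: "(to_sections R U r \<odot>\<^bsub>T U\<^esub> t) p = (to_sections R V r \<odot>\<^bsub>T V\<^esub> t') p"
    if "p \<in> U" "p \<in> V" "t p = t' p" for U V r t t' p
    using that by (simp add: tilde_smult to_sections_def)
  have "\<exists>N. \<forall>h\<in>F. E h N"
  proof (rule finite_common_bound[OF F(1)])
    show "\<exists>n. E h n" if "h \<in> F" for h using that F(2) by (auto simp: H_def)
    show "E h (n + k)" if hF: "h \<in> F" and "E h n" for h n k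
    proof -
      note ho = R.openin_basic_open[OF FR[OF hF]]
      obtain t where t: "t \<in> carrier (SC (D h))" "\<forall>p\<in>D h \<inter> D f. t p = (to_sections R (D f) (f [^] n) \<odot>\<^bsub>T (D f)\<^esub> s) p"
        using \<open>E h n\<close> by (auto simp: E_def)
      have "(to_sections R (D h) (f [^] k) \<odot>\<^bsub>T (D h)\<^esub> t) p = (to_sections R (D f) (f [^] (n + k)) \<odot>\<^bsub>T (D f)\<^esub> s) p"
        if p: "p \<in> D h \<inter> D f" for p
        using pointwise[of p "D h" "D f" t "to_sections R (D f) (f [^] n) \<odot>\<^bsub>T (D f)\<^esub> s" "f [^] k"] t(2) p
          pow_add[OF fo sT, of k n] by (simp add: add.commute)
      then show ?thesis using shift[OF ho pow_closed[OF ho] t(1)] unfolding E_def by blast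
    qed
  qed
  then obtain N where N: "\<And>h. h \<in> F \<Longrightarrow> E h N" by blast
  then have "\<forall>h\<in>F. \<exists>t. t \<in> carrier (SC (D h)) \<and> (\<forall>p\<in>D h \<inter> D f. t p = (to_sections R (D f) (f [^] N) \<odot>\<^bsub>T (D f)\<^esub> s) p)"
    unfolding E_def by blast
  from bchoice[OF this] obtain \<tau> where
    \<tau>0: "\<forall>h\<in>F. \<tau> h \<in> carrier (SC (D h)) \<and> (\<forall>p\<in>D h \<inter> D f. \<tau> h p = (to_sections R (D f) (f [^] N) \<odot>\<^bsub>T (D f)\<^esub> s) p)" ..
  have \<tau>: "\<tau> h \<in> carrier (SC (D h))" if "h \<in> F" for h using \<tau>0 that by blast
  have \<tau>p: "\<tau> h p = (to_sections R (D f) (f [^] N) \<odot>\<^bsub>T (D f)\<^esub> s) p" if "h \<in> F" "p \<in> D h" "p \<in> D f" for h p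
    using \<tau>0 that by blast
  define Q where "Q = (\<lambda>x (k::nat). \<forall>p\<in>D (fst x) \<inter> D (snd x).
    (to_sections R (D (fst x)) (f [^] k) \<odot>\<^bsub>T (D (fst x))\<^esub> \<tau> (fst x)) p = (to_sections R (D (snd x)) (f [^] k) \<odot>\<^bsub>T (D (snd x))\<^esub> \<tau> (snd x)) p)"
  have "\<exists>K. \<forall>x\<in>F \<times> F. Q x K"
  proof (rule finite_common_bound)
    show "finite (F \<times> F)" using F by simp
    fix x assume "x \<in> F \<times> F"
    then obtain g h where x: "x = (g, h)" "g \<in> F" "h \<in> F" by auto
    let ?V = "D (g \<otimes> h)"
    have ghR: "g \<otimes> h \<in> carrier R" using x FR by simp
    have V: "?V = D g \<inter> D h" using x FR by (simp add: R.basic_open_mult)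
    note Vo = R.openin_basic_open[OF ghR]
    interpret TV: module "\<O> R ?V" "T ?V" by (rule module_tilde[OF Vo])
    have r: "restrict (\<tau> g) ?V \<in> carrier (T ?V)" "restrict (\<tau> h) ?V \<in> carrier (T ?V)"
      using restrict_in_tilde[OF R.openin_basic_open[OF FR[OF x(2)]] Vo] restrict_in_tilde[OF R.openin_basic_open[OF FR[OF x(3)]] Vo]
        \<tau>[OF x(2)] \<tau>[OF x(3)] SC_subset V by blast+
    \<comment> \<open>On D(f) both extensions have the values of f^N s, so \<open>?d\<close>
      vanishes on D(g h) \<inter> D(f), and some power of \<open>f\<close> kills it on all of D(g
      h).\<close>
    let ?d = "restrict (\<tau> g) ?V \<ominus>\<^bsub>T ?V\<^esub> restrict (\<tau> h) ?V"
    have d: "?d \<in> carrier (T ?V)" using r by simp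
    have dh: "restrict (\<tau> g) ?V = ?d \<oplus>\<^bsub>T ?V\<^esub> restrict (\<tau> h) ?V"
      using r by (simp add: TV.M.minus_eq TV.M.a_assoc TV.M.l_neg)
    have "?d p = \<zero>\<^bsub>localization R (carrier R - p) M\<^esub>" if p: "p \<in> ?V \<inter> D f" for p
    proof -
      have ps: "p \<in> spec R" using p by (auto simp: basic_open_def)
      interpret loc: abelian_group "localization R (carrier R - p) M"
        by (rule module_denominators.abelian_group_localization[OF prime_denominators[OF ps]])
      have c: "?d p \<in> carrier (localization R (carrier R - p) M)" "\<tau> h p \<in> carrier (localization R (carrier R - p) M)"
        using tilde_in_stalk[OF d] tilde_in_stalk[OF r(2), of p] p by auto
      have "\<tau> g p = \<tau> h p" using \<tau>p[OF x(2), of p] \<tau>p[OF x(3), of p] p V by auto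
      moreover have "\<tau> g p = ?d p \<oplus>\<^bsub>localization R (carrier R - p) M\<^esub> \<tau> h p"
        using fun_cong[OF dh, of p] p by (simp add: tilde_add)
      ultimately show ?thesis using c loc.add.r_cancel_one' by metis
    qed
    then obtain k :: nat where k: "to_sections R ?V (f [^] k) \<odot>\<^bsub>T ?V\<^esub> ?d = \<zero>\<^bsub>T ?V\<^esub>"
      using vanishing_section_torsion[OF R.affine_basic_open[OF ghR] f d] by metis
    have eq: "to_sections R ?V (f [^] k) \<odot>\<^bsub>T ?V\<^esub> restrict (\<tau> g) ?V = to_sections R ?V (f [^] k) \<odot>\<^bsub>T ?V\<^esub> restrict (\<tau> h) ?V"
      by (subst dh) (simp add: TV.smult_r_distr pow_closed[OF Vo] d r k)
    have "Q x k"
      unfolding Q_def x fst_conv snd_conv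
    proof
      fix p assume p: "p \<in> D g \<inter> D h"
      then have pV: "p \<in> ?V" using V by simp
      show "(to_sections R (D g) (f [^] k) \<odot>\<^bsub>T (D g)\<^esub> \<tau> g) p = (to_sections R (D h) (f [^] k) \<odot>\<^bsub>T (D h)\<^esub> \<tau> h) p"
        using fun_cong[OF eq, of p] p pV by (simp add: tilde_smult to_sections_def)
    qed
    then show "\<exists>k. Q x k" ..
  next
    fix x and n k :: nat assume "x \<in> F \<times> F" and Q: "Q x n"
    then obtain g h where x: "x = (g, h)" "g \<in> F" "h \<in> F" by auto
    note go = R.openin_basic_open[OF FR[OF x(2)]] and ho = R.openin_basic_open[OF FR[OF x(3)]]
    have T: "\<tau> g \<in> carrier (T (D g))" "\<tau> h \<in> carrier (T (D h))" using \<tau>[OF x(2)] \<tau>[OF x(3)] SC_subset by blast+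
    show "Q x (n + k)"
      unfolding Q_def x fst_conv snd_conv
    proof
      fix p assume p: "p \<in> D g \<inter> D h"
      have "(to_sections R (D g) (f [^] n) \<odot>\<^bsub>T (D g)\<^esub> \<tau> g) p = (to_sections R (D h) (f [^] n) \<odot>\<^bsub>T (D h)\<^esub> \<tau> h) p"
        using Q p by (simp add: Q_def x)
      then show "(to_sections R (D g) (f [^] (n + k)) \<odot>\<^bsub>T (D g)\<^esub> \<tau> g) p = (to_sections R (D h) (f [^] (n + k)) \<odot>\<^bsub>T (D h)\<^esub> \<tau> h) p"
        using pow_add[OF go T(1), of k n] pow_add[OF ho T(2), of k n] p
          pointwise[of p "D g" "D h" "to_sections R (D g) (f [^] n) \<odot>\<^bsub>T (D g)\<^esub> \<tau> g"
            "to_sections R (D h) (f [^] n) \<odot>\<^bsub>T (D h)\<^esub> \<tau> h" "f [^] k"] by (simp add: add.commute)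
    qed
  qed
  then obtain K where K: "\<And>x. x \<in> F \<times> F \<Longrightarrow> Q x K" by blast
  define u where "u = (\<lambda>h. to_sections R (D h) (f [^] K) \<odot>\<^bsub>T (D h)\<^esub> \<tau> h)"
  have u: "u h \<in> carrier (SC (D h))" if "h \<in> F" for h
    unfolding u_def using that FR R.openin_basic_open \<tau> pow_closed by (intro shift) auto
  have agree: "u g p = u h p" if "g \<in> F" "h \<in> F" "p \<in> D g" "p \<in> D h" for g h p
    using K[of "(g, h)"] that by (auto simp: Q_def u_def)
  \<comment> \<open>By \<open>agree\<close>, the value does not depend on the chosen member of the
    cover.\<close>
  define t where "t = (\<lambda>p\<in>spec R. u (SOME h. h \<in> F \<and> p \<in> D h) p)"
  have tu: "t p = u h p" if h: "h \<in> F" "p \<in> D h" for h p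
  proof -
    define g where "g = (SOME h. h \<in> F \<and> p \<in> D h)"
    have g: "g \<in> F \<and> p \<in> D g"
      unfolding g_def by (rule someI[of "\<lambda>h. h \<in> F \<and> p \<in> D h" h]) (use h in simp)
    have "p \<in> spec R" using h(2) by (simp add: basic_open_def)
    then have "t p = u g p" by (simp add: t_def g_def)
    also have "\<dots> = u h p" using agree[of g h p] g h by simp
    finally show ?thesis .
  qed
  have un: "\<Union>(D ` F) = spec R" using F(3) R.basic_open_subset_spec by blast
  have tSC: "t \<in> carrier (SC (\<Union>(D ` F)))"
  proof (rule SC_glue)
    show "openin (zariski R) U" if "U \<in> D ` F" for U using that FR R.openin_basic_open by auto
    show "t \<in> extensional (\<Union>(D ` F))" unfolding un by (simp add: t_def)
    show "restrict t U \<in> carrier (SC U)" if "U \<in> D ` F" for U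
    proof -
      obtain h where h: "h \<in> F" "U = D h" using \<open>U \<in> D ` F\<close> by blast
      have ext: "u h \<in> extensional (D h)" using u[OF h(1)] SC_subset tilde_extensional by blast
      have "restrict t (D h) = u h"
        by (rule extensionalityI[OF _ ext]) (use tu h in auto)
      then show ?thesis using u[OF h(1)] h(2) by simp
    qed
  qed
  \<comment> \<open>\<open>N\<close> is the exponent for extending to the members of the cover,
    \<open>K\<close> the one for making the extensions agree.\<close>
  have "restrict t (D f) = to_sections R (D f) (f [^] (K + N)) \<odot>\<^bsub>T (D f)\<^esub> s"
  proof (rule extensionalityI[where A = "D f"])
    fix p assume p: "p \<in> D f"
    then obtain h where h: "h \<in> F" "p \<in> D h" using F(3) R.basic_open_subset_spec[of f] by blast
    have "u h p = (to_sections R (D f) (f [^] K) \<odot>\<^bsub>T (D f)\<^esub> (to_sections R (D f) (f [^] N) \<odot>\<^bsub>T (D f)\<^esub> s)) p"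
      unfolding u_def using \<tau>p[OF h p] h(2) p by (intro pointwise) auto
    then show "restrict t (D f) p = (to_sections R (D f) (f [^] (K + N)) \<odot>\<^bsub>T (D f)\<^esub> s) p"
      unfolding pow_add[OF fo sT] using tu[OF h] p by simp
  qed (simp_all add: tilde_smult)
  with tSC show thesis unfolding un by (rule that)
qed

text \<open>If f^n s extends to a global section of the closure sheaf, that section is given by some
  \<open>c\<close> in \<open>C\<close>, and s = c/f^n.\<close>

lemma localization_if_quasi_coherent:
  assumes qc: "quasi_coherent R SC" and f: "f \<in> carrier R"
  shows "CL (D f) = tilde_sub R M C (D f)"
proof (intro subset_antisym tilde_C_subset_CL[OF f] subsetI)
  note fo = R.openin_basic_open[OF f]
  fix s assume s: "s \<in> CL (D f)"
  then have sT: "s \<in> carrier (T (D f))" and sSC: "s \<in> carrier (SC (D f))" using CL_subset SC_basic[OF f] by auto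
  obtain n :: nat and t where t: "t \<in> carrier (SC (spec R))" "restrict t (D f) = to_sections R (D f) (f [^] n) \<odot>\<^bsub>T (D f)\<^esub> s"
    using quasi_coherent_extend[OF qc f sSC] by blast
  obtain c where c: "c \<in> carrier M" "t = global_section c" using global_section_onto t(1) SC_subset by blast
  have "t \<in> CL (spec R)" using t(1) SC_basic[OF R.one_closed] by (simp add: spec_one)
  then have cC: "c \<in> C" using c by (simp add: C_iff)
  have fn: "f [^] n \<in> carrier R" using f by simp
  note pow = R.basic_open_pow_subset[OF f, of n]
  have ic: "fraction_section R (regular_module R) (D f) \<one> (f [^] n) \<in> carrier (\<O> R (D f))"
    by (rule R.structure_fraction_closed[OF fo pow fn R.one_closed])
  have "fraction_section R (regular_module R) (D f) \<one> (f [^] n) \<otimes>\<^bsub>\<O> R (D f)\<^esub> to_sections R (D f) (f [^] n) = \<one>\<^bsub>\<O> R (D f)\<^esub>"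
    using R.structure_fraction_cancel[OF fo pow fn R.one_closed] by (simp add: R.structure_one to_sections_eq_fraction_section)
  then have "s = fraction_section R (regular_module R) (D f) \<one> (f [^] n) \<odot>\<^bsub>T (D f)\<^esub> restrict t (D f)"
    unfolding t(2)
    using module.smult_assoc1[OF module_tilde[OF fo] ic R.to_sections_closed[OF fo fn] sT] module.smult_one[OF module_tilde[OF fo] sT]
    by simp
  also have "\<dots> = fraction_section R M (D f) c (f [^] n)"
    unfolding c(2) restrict_fraction_section[OF R.basic_open_subset_spec] by (rule pow_fraction(2)[OF f fo order_refl c(1)])
  finally show "s \<in> tilde_sub R M C (D f)"
    using fraction_section_in_local_fractions[OF C_submodule fo pow cC fn] tilde_sub_eq[OF C_submodule fo] by simp
qed

end

text \<open>The map from the sheaf of \<open>L\<close> onto its image in that of \<open>M\<close> is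
  injective because a germ over \<open>L\<close> is recovered from its image by keeping the pairs
  with numerator in \<open>L\<close>.\<close>

lemma (in module) tilde_sub_iso:
  assumes L: "submodule L R M" and U: "openin (zariski R) U"
  shows "semilinear_iso (\<O> R U) id (tilde R (M\<lparr>carrier := L\<rparr>) U) ((tilde R M U)\<lparr>carrier := tilde_sub R M L U\<rparr>)
    (\<lambda>t. \<lambda>p\<in>U. \<Union>(l, f)\<in>t p. frac R (carrier R - p) M l f)"
proof -
  interpret LM: module R "M\<lparr>carrier := L\<rparr>" by (rule submodule.submodule_is_module[OF L module_axioms])
  interpret reg: module R "regular_module R" by (rule module_regular_module)
  let ?N = "M\<lparr>carrier := L\<rparr>"
  define i where "i = (\<lambda>p x. \<Union>(l, f)\<in>x. frac R (carrier R - p) M l f)"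
  let ?J = "\<lambda>t. \<lambda>p\<in>U. i p (t p)"
  note sub = submodule_subset[OF L]
  have spec: "p \<in> spec R" if "p \<in> U" for p using that R.openin_zariski_subset[OF U] by auto
  note denL = LM.prime_denominators[OF spec] and den = prime_denominators[OF spec]
  have i: "i p (frac R (carrier R - p) ?N m s) = frac R (carrier R - p) M m s"
    if p: "p \<in> U" and m: "m \<in> L" "s \<in> carrier R - p" for p m s
  proof -
    interpret locL: module_denominators R ?N "carrier R - p" by (rule denL[OF p])
    interpret loc: module_denominators R M "carrier R - p" by (rule den[OF p])
    have mM: "m \<in> carrier M" using m sub by auto
    show ?thesis
      unfolding i_def
    proof (rule locL.union_frac_eq)
      fix m' s' assume "(m', s') \<in> frac R (carrier R - p) ?N m s"
      then have "(m', s') \<in> frac R (carrier R - p) M m s" unfolding carrier_updated_frac[OF m(1) sub] by blast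
      then show "frac R (carrier R - p) M m' s' = frac R (carrier R - p) M m s"
        by (rule loc.frac_mem_eq(3)[OF _ mM m(2)])
    qed (use m in simp_all)
  qed
  have inj: "x = y" if p: "p \<in> U" and x: "x \<in> carrier (localization R (carrier R - p) ?N)"
    and y: "y \<in> carrier (localization R (carrier R - p) ?N)" and eq: "i p x = i p y" for p x y
  proof -
    have "z = i p z \<inter> (L \<times> UNIV)" if z: "z \<in> carrier (localization R (carrier R - p) ?N)" for z
    proof -
      obtain m s where "m \<in> L" "s \<in> carrier R - p" "z = frac R (carrier R - p) ?N m s"
        using module_denominators.localizationE[OF denL[OF p] z] by auto
      then show ?thesis using i[OF p] carrier_updated_frac[OF _ sub] by metis
    qed
    then show ?thesis using x y eq by metis
  qed
  have add: "i p (x \<oplus>\<^bsub>localization R (carrier R - p) ?N\<^esub> y) = i p x \<oplus>\<^bsub>localization R (carrier R - p) M\<^esub> i p y"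
    if p: "p \<in> U" and x: "x \<in> carrier (localization R (carrier R - p) ?N)"
      "y \<in> carrier (localization R (carrier R - p) ?N)" for p x y
  proof -
    interpret locL: module_denominators R ?N "carrier R - p" by (rule denL[OF p])
    interpret loc: module_denominators R M "carrier R - p" by (rule den[OF p])
    obtain m n s where m: "m \<in> L" "n \<in> L" and s: "s \<in> carrier R - p"
      and xy: "x = frac R (carrier R - p) ?N m s" "y = frac R (carrier R - p) ?N n s"
      using locL.common_denominator[OF x] by auto
    have mn: "m \<oplus>\<^bsub>M\<^esub> n \<in> L" by (rule submoduleE(5)[OF L m])
    have "x \<oplus>\<^bsub>localization R (carrier R - p) ?N\<^esub> y = frac R (carrier R - p) ?N (m \<oplus>\<^bsub>M\<^esub> n) s"
      unfolding xy using locL.add_frac_same[of m n s] m s by simp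
    moreover have "frac R (carrier R - p) M m s \<oplus>\<^bsub>localization R (carrier R - p) M\<^esub> frac R (carrier R - p) M n s
        = frac R (carrier R - p) M (m \<oplus>\<^bsub>M\<^esub> n) s"
      using m sub by (intro loc.add_frac_same s) auto
    ultimately show ?thesis using i[OF p m(1) s] i[OF p m(2) s] i[OF p mn s] xy by simp
  qed
  have smult: "i p (a \<odot>\<^bsub>localization R (carrier R - p) ?N\<^esub> x) = a \<odot>\<^bsub>localization R (carrier R - p) M\<^esub> i p x"
    if p: "p \<in> U" and a: "a \<in> carrier (localization R (carrier R - p) (regular_module R))"
      and x: "x \<in> carrier (localization R (carrier R - p) ?N)" for p a x
  proof -
    interpret locL: module_denominators R ?N "carrier R - p" by (rule denL[OF p])
    interpret loc: module_denominators R M "carrier R - p" by (rule den[OF p])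
    interpret locR: module_denominators R "regular_module R" "carrier R - p" by (rule reg.prime_denominators[OF spec[OF p]])
    obtain b t where b: "b \<in> carrier R" "t \<in> carrier R - p" "a = frac R (carrier R - p) (regular_module R) b t"
      using locR.localizationE[OF a] by auto
    obtain m s where m: "m \<in> L" "s \<in> carrier R - p" "x = frac R (carrier R - p) ?N m s"
      using locL.localizationE[OF x] by auto
    have bm: "b \<odot>\<^bsub>M\<^esub> m \<in> L" by (rule submoduleE(4)[OF L b(1) m(1)])
    have "a \<odot>\<^bsub>localization R (carrier R - p) ?N\<^esub> x = frac R (carrier R - p) ?N (b \<odot>\<^bsub>M\<^esub> m) (t \<otimes> s)"
      unfolding b(3) m(3) using locL.smult_frac[of b m t s] b m by simp
    moreover have "a \<odot>\<^bsub>localization R (carrier R - p) M\<^esub> frac R (carrier R - p) M m s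
        = frac R (carrier R - p) M (b \<odot>\<^bsub>M\<^esub> m) (t \<otimes> s)"
      unfolding b(3) using m sub b by (intro loc.smult_frac) auto
    ultimately show ?thesis using i[OF p m(1,2)] i[OF p bm loc.denom_mult[OF b(2) m(2)]] m(3) by simp
  qed
  have J: "?J ` carrier (tilde R ?N U) = tilde_sub R M L U" by (simp add: tilde_sub_def i_def)
  have "semilinear_iso (\<O> R U) id (tilde R ?N U) ((tilde R M U)\<lparr>carrier := tilde_sub R M L U\<rparr>) ?J"
    unfolding semilinear_iso_def
  proof (intro conjI ballI)
    have "inj_on ?J (carrier (tilde R ?N U))"
    proof (rule inj_onI)
      fix s t assume s: "s \<in> carrier (tilde R ?N U)" and t: "t \<in> carrier (tilde R ?N U)" and eq: "?J s = ?J t"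
      show "s = t"
      proof (rule extensionalityI[where A = U])
        show "s \<in> extensional U" "t \<in> extensional U" using s t LM.tilde_extensional by auto
        show "s p = t p" if p: "p \<in> U" for p
          using inj[OF p LM.tilde_in_stalk[OF s p] LM.tilde_in_stalk[OF t p]] fun_cong[OF eq, of p] p by simp
      qed
    qed
    then show "bij_betw ?J (carrier (tilde R ?N U)) (carrier ((tilde R M U)\<lparr>carrier := tilde_sub R M L U\<rparr>))"
      using J by (simp add: bij_betw_def)
    show "?J (s \<oplus>\<^bsub>tilde R ?N U\<^esub> t) = ?J s \<oplus>\<^bsub>(tilde R M U)\<lparr>carrier := tilde_sub R M L U\<rparr>\<^esub> ?J t"
      if s: "s \<in> carrier (tilde R ?N U)" and t: "t \<in> carrier (tilde R ?N U)" for s t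
      using add LM.tilde_in_stalk[OF s] LM.tilde_in_stalk[OF t]
      by (simp add: tilde_add cong: restrict_cong)
    show "?J (a \<odot>\<^bsub>tilde R ?N U\<^esub> s) = id a \<odot>\<^bsub>(tilde R M U)\<lparr>carrier := tilde_sub R M L U\<rparr>\<^esub> ?J s"
      if a: "a \<in> carrier (\<O> R U)" and s: "s \<in> carrier (tilde R ?N U)" for a s
      using smult LM.tilde_in_stalk[OF s] reg.tilde_in_stalk[of a U] a
      by (simp add: tilde_smult structure_sheaf_def cong: restrict_cong)
  qed
  then show ?thesis by (simp add: i_def)
qed

section \<open>From localization to quasi-coherence\<close>

context glueable_closure
begin

text \<open>Both sides are determined by restrictions to the D(h) inside \<open>U\<close>, where the
  assumption identifies them.\<close>

lemma SC_eq_tilde_C: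
  assumes a: "\<And>f. f \<in> carrier R \<Longrightarrow> CL (D f) = tilde_sub R M C (D f)" and U: "openin (zariski R) U"
  shows "carrier (SC U) = tilde_sub R M C U"
proof (intro subset_antisym subsetI)
  have CD: "CL (D h) = local_fractions R M C (D h)" if "h \<in> carrier R" for h
    using a[OF that] tilde_sub_eq[OF C_submodule R.openin_basic_open[OF that]] by simp
  note sub = tilde_sub_eq[OF C_submodule U]
  show "s \<in> tilde_sub R M C U" if s: "s \<in> carrier (SC U)" for s
    unfolding sub
  proof (rule local_fractionsI)
    show "s \<in> extensional U" using s SC_subset tilde_extensional by blast
    fix p assume p: "p \<in> U"
    obtain h where h: "h \<in> carrier R" "p \<in> D h" "D h \<subseteq> U" "restrict s (D h) \<in> CL (D h)"
      using s p unfolding mem_SC_iff[OF U] by blast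
    then have "restrict s (D h) \<in> local_fractions R M C (D h)" using CD by simp
    then obtain k m where k: "k \<in> carrier R" "m \<in> C" "p \<in> D k" "D k \<subseteq> D h"
      "\<And>q. q \<in> D k \<Longrightarrow> restrict s (D h) q = frac R (carrier R - q) M m k"
      using local_fractionsE[OF _ h(2)] by metis
    then have "\<And>q. q \<in> D k \<Longrightarrow> s q = frac R (carrier R - q) M m k" by (metis restrict_apply' subsetD)
    then show "\<exists>h\<in>carrier R. \<exists>m\<in>C. p \<in> D h \<and> D h \<subseteq> U \<and> (\<forall>q\<in>D h. s q = frac R (carrier R - q) M m h)"
      using k h(3) by blast
  qed
  show "s \<in> carrier (SC U)" if s: "s \<in> tilde_sub R M C U" for s
    unfolding mem_SC_iff[OF U]
  proof (intro conjI ballI)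
    show "s \<in> carrier (T U)"
      using s local_fractions_mono[OF submodule_subset[OF C_submodule]] unfolding sub carrier_tilde[OF U] by blast
    fix p assume "p \<in> U"
    then obtain h where h: "h \<in> carrier R" "p \<in> D h" "D h \<subseteq> U" using R.basic_open_basis[OF U] by blast
    have "restrict s (D h) \<in> CL (D h)"
      using restrict_local_fractions[OF C_submodule R.openin_basic_open[OF h(1)] h(3)] s unfolding sub CD[OF h(1)] by blast
    then show "\<exists>h\<in>carrier R. p \<in> D h \<and> D h \<subseteq> U \<and> restrict s (D h) \<in> CL (D h)" using h by blast
  qed
qed

text \<open>A single chart, all of Spec R, suffices. As \<open>quasi_coherent\<close> prescribes the
  types of the coordinate ring and its module, \<open>R\<close> and \<open>C\<close> are replaced by
  \<open>\<O> R (spec R)\<close> and \<open>SC (spec R)\<close>. The passage between the two pairs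
  is a localization at 1, so the pullback of sections applies.\<close>

lemma quasi_coherent_if_localization:
  assumes a: "\<And>f. f \<in> carrier R \<Longrightarrow> CL (D f) = tilde_sub R M C (D f)"
  shows "quasi_coherent R SC"
proof -
  let ?A = "plain_ring (\<O> R (spec R))" and ?P = "SC (spec R)" and ?MC = "M\<lparr>carrier := C\<rparr>"
  have gs: "global_section c \<in> carrier ?P" if "c \<in> C" for c
    using that SC_basic[OF R.one_closed] by (simp add: C_iff spec_one)
  have gs_onto: "\<exists>c\<in>C. s = global_section c" if s: "s \<in> carrier ?P" for s
  proof -
    obtain c where c: "c \<in> carrier M" "s = global_section c" using global_section_onto s SC_subset by blast
    then show ?thesis using s SC_basic[OF R.one_closed] by (auto simp: C_iff spec_one)
  qed
  have CM: "c \<in> carrier M" if "c \<in> C" for c using that C_iff by blast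
  have lr: "localized_ring R ?A \<one> (to_sections R (spec R))"
    using R.localized_structure_sheaf[OF R.one_closed] by (simp add: spec_one)
  have mA: "module ?A ?P" by (rule module_plain_ring[OF SC_module[OF R.openin_spec]])
  have mC: "module R ?MC" by (rule submodule.submodule_is_module[OF C_submodule module_axioms])
  interpret lr: localized_ring R ?A \<one> "to_sections R (spec R)" by (rule lr)
  interpret P: module ?A ?P by (rule mA)
  \<comment> \<open>At the element 1 the localization conditions amount to bijectivity of
    \<open>global_section\<close> from \<open>C\<close> onto the global sections of
    \<open>SC\<close>.\<close>
  interpret lm: localized_module R ?A \<one> "to_sections R (spec R)" ?MC ?P global_section
  proof (intro localized_module.intro lr mA mC localized_module_axioms.intro)
    show "global_section m \<in> carrier ?P" if "m \<in> carrier ?MC" for m using that gs by simp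
    show "global_section (m \<oplus>\<^bsub>?MC\<^esub> n) = global_section m \<oplus>\<^bsub>?P\<^esub> global_section n"
      if "m \<in> carrier ?MC" "n \<in> carrier ?MC" for m n
      using that CM global_section_iso unfolding SC_ops by (simp add: semilinear_iso_def)
    show "global_section (r \<odot>\<^bsub>?MC\<^esub> m) = to_sections R (spec R) r \<odot>\<^bsub>?P\<^esub> global_section m"
      if "r \<in> carrier R" "m \<in> carrier ?MC" for r m
      using that CM global_section_iso unfolding SC_ops by (simp add: semilinear_iso_def)
    show "\<exists>m\<in>carrier ?MC. \<exists>n::nat. to_sections R (spec R) \<one> [^]\<^bsub>?A\<^esub> n \<odot>\<^bsub>?P\<^esub> c = global_section m"
      if c: "c \<in> carrier ?P" for c
    proof -
      obtain m where m: "m \<in> C" "c = global_section m" using gs_onto[OF c] by blast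
      have "to_sections R (spec R) \<one> [^]\<^bsub>?A\<^esub> (0::nat) \<odot>\<^bsub>?P\<^esub> c = c" using P.smult_one[OF c] by simp
      then show ?thesis using m by (intro bexI[of _ m] exI[of _ 0]) auto
    qed
    show "\<exists>k::nat. \<one> [^] k \<odot>\<^bsub>?MC\<^esub> m = \<one> [^] k \<odot>\<^bsub>?MC\<^esub> n"
      if "m \<in> carrier ?MC" "n \<in> carrier ?MC" "global_section m = global_section n" for m n
      using that CM global_section_inj[of m n] by simp
  qed
  define J where "J = (\<lambda>U t. \<lambda>p\<in>U. \<Union>(l, f)\<in>t p. frac R (carrier R - p) M l f)"
  define \<theta> where "\<theta> = (\<lambda>W. pullback_section R (regular_module R) (to_sections R (spec R)) (to_sections R (spec R)) lr.\<psi> (spec R \<inter> lr.\<psi> -` W))"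
  \<comment> \<open>The pullback leads from the sheaf of \<open>SC (spec R)\<close> on the spectrum
    of the global ring to the sheaf of \<open>C\<close> on Spec R; \<open>J\<close> then embeds it
    into the sheaf of \<open>M\<close>, where its image is \<open>SC\<close>.\<close>
  define \<eta> where "\<eta> = (\<lambda>W. J (spec R \<inter> lr.\<psi> -` W) \<circ>
    pullback_section R ?MC (to_sections R (spec R)) global_section lr.\<psi> (spec R \<inter> lr.\<psi> -` W))"
  have inv: "lm.inverse_image W = spec R \<inter> lr.\<psi> -` W" for W by (simp add: lm.inverse_image_def spec_one)
  have ri: "ringed_iso R (spec R) ?A lr.\<psi> \<theta>"
    using lr.ringed_iso_pullback unfolding \<theta>_def by (simp add: spec_one)
  have eta: "semilinear_iso (\<O> ?A W) (\<theta> W) (tilde ?A ?P W) (SC (spec R \<inter> lr.\<psi> -` W)) (\<eta> W)"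
    if W: "openin (zariski ?A) W" for W
  proof -
    let ?U = "spec R \<inter> lr.\<psi> -` W"
    have U: "openin (zariski R) ?U" using lm.inverse_image_open[OF W] unfolding inv .
    have s1: "semilinear_iso (\<O> ?A W) (\<theta> W) (tilde ?A ?P W) (tilde R ?MC ?U)
        (pullback_section R ?MC (to_sections R (spec R)) global_section lr.\<psi> ?U)"
      using lm.semilinear_iso_pull[OF W] unfolding inv \<theta>_def .
    \<comment> \<open>Here the assumption on the \<open>CL (D f)\<close> enters.\<close>
    have "SC ?U = (T ?U)\<lparr>carrier := tilde_sub R M C ?U\<rparr>"
      using SC_eq[of ?U] SC_eq_tilde_C[OF a U] by simp
    then have s2: "semilinear_iso (\<O> R ?U) id (tilde R ?MC ?U) (SC ?U) (J ?U)"
      using tilde_sub_iso[OF C_submodule U] unfolding J_def by simp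
    have "\<theta> W ` carrier (\<O> ?A W) \<subseteq> carrier (\<O> R ?U)"
      using ri W unfolding ringed_iso_def ring_iso_def bij_betw_def by blast
    from semilinear_iso_trans[OF s1 s2 this] show ?thesis by (simp add: \<eta>_def)
  qed
  have eta_restrict: "\<eta> W' (restrict s W') = restrict (\<eta> W s) (spec R \<inter> lr.\<psi> -` W')" if "W' \<subseteq> W" for W W' s
    using that by (intro ext) (auto simp: \<eta>_def J_def pullback_section_def)
  show ?thesis
    unfolding quasi_coherent_def
  proof (intro conjI SC_sheaf ballI)
    fix p assume "p \<in> spec R"
    then show "\<exists>U (A :: ('r, 'r) sections ring) \<psi> \<theta> (P :: (('r, 'r) sections, 'r set \<Rightarrow> ('u \<times> 'r) set) module) \<eta>.
       p \<in> U \<and> openin (zariski R) U \<and> cring A \<and> ringed_iso R U A \<psi> \<theta> \<and> module A P \<and>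
       (\<forall>W. openin (zariski A) W \<longrightarrow>
          semilinear_iso (\<O> A W) (\<theta> W) (tilde A P W) (SC (U \<inter> \<psi> -` W)) (\<eta> W)) \<and>
       (\<forall>W W'. openin (zariski A) W \<longrightarrow> openin (zariski A) W' \<longrightarrow> W' \<subseteq> W \<longrightarrow>
          (\<forall>s\<in>carrier (tilde A P W). \<eta> W' (restrict s W') = restrict (\<eta> W s) (U \<inter> \<psi> -` W')))"
      using R.openin_spec lr.A.is_cring ri mA eta eta_restrict
      by (intro exI[of _ "spec R"] exI[of _ ?A] exI[of _ lr.\<psi>] exI[of _ \<theta>] exI[of _ ?P] exI[of _ \<eta>]) simp
  qed
qed

end

theorem theorem3p1:
  fixes R :: "'r ring" and M :: "('r, 'u) module" and L :: "'u set"
    and cl :: "('r, 'u) operation"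
  assumes "infinite (UNIV :: 'u set)" and "carrier R \<lesssim> (UNIV :: 'u set)"
    and "cring R" and "module R M" and "submodule L R M"
    and "preclosure_operation R cl" and "glueable R cl"
  shows "(\<forall>f\<in>carrier R.
            localized_closure R cl (basic_open R f) R (to_sections R (basic_open R f)) f M L
            = localized_submodule R (powers R f) M
                (closure_in R cl (spec R) R (to_sections R (spec R)) M L))
         \<longleftrightarrow> quasi_coherent R (sheaf_closure R cl (tilde R M) (tilde_sub R M L))"
proof -
  interpret glueable_closure R M L cl
    by (intro glueable_closure.intro glueable_closure_axioms.intro assms)
  have "(\<forall>f\<in>carrier R. CL (D f) = tilde_sub R M C (D f)) \<longleftrightarrow> quasi_coherent R SC"
    using quasi_coherent_if_localization localization_if_quasi_coherent by blast
  then show ?thesis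
    unfolding SC_def C_def[symmetric] using localized_closure_eq_iff by simp
qed

end
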